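(* Let $1\leq k\leq n$, $1<p<\infty$, let $\Omega\subset\mathbb{R}^{n}$ be a bounded smooth open set and let $f:\Lambda^{k}(\mathbb{R}^n)\rightarrow\mathbb{R}$ be ext. quasiconvex and satisfy, for every $\xi\in\Lambda^{k}(\mathbb{R}^n)$, \[ c_{1}\left(|\xi|^{p}-1\right)\leq f(\xi)\leq c_{2}\left(|\xi|^{p}+1\right) \] for some $c_{1},c_{2}>0$. If \[ \alpha_{s}\rightharpoonup\alpha\quad\text{weakly in }W^{1,p}\left(\Omega;\Lambda^{k-1}(\mathbb{R}^n)\right), \] then \[ \liminf_{s\rightarrow\infty}\int_{\Omega}f(d\alpha_{s})\geq\int_{\Omega}f(d\alpha). \]
   Context: $\Lambda^k=\Lambda^k(\mathbb{R}^n)$ is the space of alternating $k$-linear forms on $\mathbb{R}^n$ ($\Lambda^0=\mathbb{R}$), with its Euclidean norm $|\cdot|$ for which $e^{i_1}\wedge\dots\wedge e^{i_k}$, $i_1<\dots<i_k$, is orthonormal. $W^{1,p}(\Omega;\Lambda^{k-1})$ is the usual Sobolev space of $(k-1)$-forms on $\Omega$, and $d$ is the exterior derivative, which maps $W^{1,p}(\Omega;\Lambda^{k-1})$ to $L^p(\Omega;\Lambda^k)$. A function $f:\Lambda^k\to\mathbb{R}$ is ext. quasiconvex if it is Borel measurable and locally bounded and \[ \int_{U}f(\xi+d\omega)\ge f(\xi)\operatorname{meas}U \] for every bounded open set $U\subset\mathbb{R}^n$, every $\xi\in\Lambda^k$ and every $\omega\in W_0^{1,\infty}(U;\Lambda^{k-1})$.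 *)

theory Defs
  imports "HOL-Analysis.Analysis"
begin

section \<open>Alternating forms\<close>

text \<open>
  A \<open>k\<close>-form is a function on lists of vectors; only lists of length \<open>k\<close> matter, and a form is
  \<open>0\<close> on all other lists, so that equality of forms is equality of functions.
  For \<open>k = 0\<close> the only relevant list is \<open>[]\<close>, and \<open>alt_forms 0\<close> is a copy of the reals.
\<close>

type_synonym 'a form = "'a list \<Rightarrow> real"

type_synonym 'n rvec = "(real, 'n) vec"

type_synonym 'n form_field = "'n rvec \<Rightarrow> 'n rvec form"

definition alt_forms :: "nat \<Rightarrow> 'a::real_vector form set" where
  "alt_forms k = {\<xi>.
     (\<forall>vs. length vs \<noteq> k \<longrightarrow> \<xi> vs = 0) \<and>
     (\<forall>vs i. length vs = k \<and> i < k \<longrightarrow> linear (\<lambda>v. \<xi> (vs[i := v]))) \<and>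
     (\<forall>vs i j. length vs = k \<and> i < j \<and> j < k \<and> vs ! i = vs ! j \<longrightarrow> \<xi> vs = 0)}"

definition form_add :: "'a form \<Rightarrow> 'a form \<Rightarrow> 'a form" where
  "form_add \<xi> \<eta> = (\<lambda>vs. \<xi> vs + \<eta> vs)"

definition form_diff :: "'a form \<Rightarrow> 'a form \<Rightarrow> 'a form" where
  "form_diff \<xi> \<eta> = (\<lambda>vs. \<xi> vs - \<eta> vs)"

text \<open>
  The index type \<open>'n\<close> is linearly ordered, like \<open>{1, \<dots>, n}\<close>. With the convention
  \<open>(e\<^sup>i\<^sup>1 \<and> \<dots> \<and> e\<^sup>i\<^sup>k) (e\<^sub>j\<^sub>1, \<dots>, e\<^sub>j\<^sub>k) = 1\<close> if \<open>i = j\<close> and \<open>0\<close> otherwise, for increasing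
  multi-indices \<open>i\<close> and \<open>j\<close>, the coefficients of \<open>\<xi>\<close> with respect to the basis of the
  \<open>e\<^sup>i\<^sup>1 \<and> \<dots> \<and> e\<^sup>i\<^sup>k\<close> are the values \<open>\<xi> (e\<^sub>i\<^sub>1, \<dots>, e\<^sub>i\<^sub>k)\<close>. The Euclidean norm is the one
  for which this basis is orthonormal.
\<close>

definition multi_indices :: "nat \<Rightarrow> 'n::{finite,linorder} list set" where
  "multi_indices k = {js. length js = k \<and> sorted_wrt (<) js}"

definition form_norm :: "nat \<Rightarrow> 'n::{finite,linorder} rvec form \<Rightarrow> real" where
  "form_norm k \<xi> = sqrt (\<Sum>js\<in>multi_indices k. (\<xi> (map (\<lambda>j. axis j 1) js))\<^sup>2)"

text \<open>The Borel sets of \<open>\<Lambda>\<^sup>k\<close>, generated by the open sets of the norm topology.\<close>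

definition form_borel :: "nat \<Rightarrow> 'n::{finite,linorder} rvec form measure" where
  "form_borel k = sigma (alt_forms k)
     {S. openin (Metric_space.mtopology (alt_forms k) (\<lambda>\<xi> \<eta>. form_norm k (form_diff \<xi> \<eta>))) S}"

section \<open>Smooth functions and smooth domains\<close>

text \<open>To be used for open sets \<open>S\<close> only.\<close>

primrec Cm_on ::
  "nat \<Rightarrow> ('a::real_normed_vector \<Rightarrow> 'b::real_normed_vector) \<Rightarrow> 'a set \<Rightarrow> bool" where
  "Cm_on 0 f S = continuous_on S f"
| "Cm_on (Suc m) f S =
     ((\<forall>x\<in>S. f differentiable (at x)) \<and>
      (\<forall>v. Cm_on m (\<lambda>x. frechet_derivative f (at x) v) S))"

definition smooth_on :: "('a::real_normed_vector \<Rightarrow> 'b::real_normed_vector) \<Rightarrow> 'a set \<Rightarrow> bool" where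
  "smooth_on f S \<longleftrightarrow> (\<forall>m. Cm_on m f S)"

text \<open>Near each boundary point, the set is a half ball up to a smooth diffeomorphism.\<close>

definition smooth_open_set :: "'n::finite rvec set \<Rightarrow> bool" where
  "smooth_open_set \<Omega> \<longleftrightarrow> open \<Omega> \<and>
     (\<forall>x\<in>frontier \<Omega>. \<exists>U. \<exists>H G :: 'n rvec \<Rightarrow> 'n rvec. \<exists>i.
        open U \<and> x \<in> U \<and> homeomorphism (ball 0 1) U H G \<and>
        smooth_on H (ball 0 1) \<and> smooth_on G U \<and>
        H ` {y \<in> ball 0 1. y $ i > 0} = U \<inter> \<Omega> \<and>
        H ` {y \<in> ball 0 1. y $ i = 0} = U \<inter> frontier \<Omega>)"

section \<open>Weak derivatives and Sobolev spaces of forms\<close>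

text \<open>
  Scalar functions and form-valued functions are defined on the whole space; only their values on
  the open set \<open>\<Omega>\<close> matter.
\<close>

definition test_functions :: "'a::euclidean_space set \<Rightarrow> ('a \<Rightarrow> real) set" where
  "test_functions \<Omega> = {\<phi>. smooth_on \<phi> UNIV \<and>
     compact (closure {x. \<phi> x \<noteq> 0}) \<and> closure {x. \<phi> x \<noteq> 0} \<subseteq> \<Omega>}"

definition has_weak_deriv ::
  "'a::euclidean_space set \<Rightarrow> 'a \<Rightarrow> ('a \<Rightarrow> real) \<Rightarrow> ('a \<Rightarrow> real) \<Rightarrow> bool" where
  "has_weak_deriv \<Omega> v u g \<longleftrightarrow>
     (\<forall>K. compact K \<and> K \<subseteq> \<Omega> \<longrightarrow> u absolutely_integrable_on K \<and> g absolutely_integrable_on K) \<and>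
     (\<forall>\<phi>\<in>test_functions \<Omega>.
        (LINT x|lebesgue_on \<Omega>. u x * frechet_derivative \<phi> (at x) v) =
        - (LINT x|lebesgue_on \<Omega>. g x * \<phi> x))"

text \<open>
  Evaluating a form-valued function at fixed vectors is a linear combination of its
  coefficients, so a weak derivative of all evaluations is the same as a weak derivative of all
  coefficients.
\<close>

definition has_weak_deriv_form ::
  "'a::euclidean_space set \<Rightarrow> nat \<Rightarrow> 'a \<Rightarrow> ('a \<Rightarrow> 'a form) \<Rightarrow> ('a \<Rightarrow> 'a form) \<Rightarrow> bool" where
  "has_weak_deriv_form \<Omega> k v \<alpha> \<beta> \<longleftrightarrow>
     (\<forall>x\<in>\<Omega>. \<beta> x \<in> alt_forms k) \<and>
     (\<forall>vs. has_weak_deriv \<Omega> v (\<lambda>x. \<alpha> x vs) (\<lambda>x. \<beta> x vs))"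

text \<open>
  A representative of the weak derivative, which is unique almost everywhere on \<open>\<Omega>\<close>; meaningful
  only if the weak derivative exists.
\<close>

definition weak_deriv ::
  "'a::euclidean_space set \<Rightarrow> nat \<Rightarrow> 'a \<Rightarrow> ('a \<Rightarrow> 'a form) \<Rightarrow> 'a \<Rightarrow> 'a form" where
  "weak_deriv \<Omega> k v \<alpha> = (SOME \<beta>. has_weak_deriv_form \<Omega> k v \<alpha> \<beta>)"

text \<open>
  The exterior derivative of a \<open>k\<close>-form, \<open>d\<alpha> = (\<Sum>j. e\<^sup>j \<and> \<partial>\<^sub>j\<alpha>)\<close>, evaluated at
  \<open>v\<^sub>0, \<dots>, v\<^sub>k\<close>: the \<open>i\<close>-th summand differentiates in direction \<open>v\<^sub>i\<close> and omits \<open>v\<^sub>i\<close> from the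
  arguments.
\<close>

definition ext_deriv ::
  "'n::finite rvec set \<Rightarrow> nat \<Rightarrow> 'n form_field \<Rightarrow> 'n form_field" where
  "ext_deriv \<Omega> k \<alpha> x = (\<lambda>vs.
     if length vs = Suc k
     then \<Sum>i<Suc k. (- 1) ^ i *
            (\<Sum>j\<in>UNIV. vs ! i $ j * weak_deriv \<Omega> k (axis j 1) \<alpha> x (take i vs @ drop (Suc i) vs))
     else 0)"

definition Lp :: "real \<Rightarrow> 'a::euclidean_space set \<Rightarrow> ('a \<Rightarrow> real) set" where
  "Lp p \<Omega> = {u. u \<in> borel_measurable (lebesgue_on \<Omega>) \<and>
                integrable (lebesgue_on \<Omega>) (\<lambda>x. \<bar>u x\<bar> powr p)}"

definition Linfty :: "'a::euclidean_space set \<Rightarrow> ('a \<Rightarrow> real) set" where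
  "Linfty \<Omega> = {u. u \<in> borel_measurable (lebesgue_on \<Omega>) \<and> (\<exists>C. AE x in lebesgue_on \<Omega>. \<bar>u x\<bar> \<le> C)}"

text \<open>
  First order Sobolev space of \<open>k\<close>-forms, the coefficients and their weak partial derivatives
  lying in the function space \<open>X\<close>, which will be \<open>Lp p \<Omega>\<close> or \<open>Linfty \<Omega>\<close>.
\<close>

definition sobolev_forms ::
  "('n::finite rvec \<Rightarrow> real) set \<Rightarrow> 'n rvec set \<Rightarrow> nat \<Rightarrow> 'n form_field set" where
  "sobolev_forms X \<Omega> k = {\<alpha>.
     (\<forall>x\<in>\<Omega>. \<alpha> x \<in> alt_forms k) \<and> (\<forall>vs. (\<lambda>x. \<alpha> x vs) \<in> X) \<and>
     (\<forall>j. \<exists>\<beta>. has_weak_deriv_form \<Omega> k (axis j 1) \<alpha> \<beta> \<and> (\<forall>vs. (\<lambda>x. \<beta> x vs) \<in> X))}"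

definition W1p :: "real \<Rightarrow> 'n::finite rvec set \<Rightarrow> nat \<Rightarrow> 'n form_field set" where
  "W1p p \<Omega> k = sobolev_forms (Lp p \<Omega>) \<Omega> k"

definition W1infty :: "'n::finite rvec set \<Rightarrow> nat \<Rightarrow> 'n form_field set" where
  "W1infty \<Omega> k = sobolev_forms (Linfty \<Omega>) \<Omega> k"

definition W1p_norm ::
  "real \<Rightarrow> 'n::{finite,linorder} rvec set \<Rightarrow> nat \<Rightarrow> 'n form_field \<Rightarrow> real" where
  "W1p_norm p \<Omega> k \<alpha> =
     ((LINT x|lebesgue_on \<Omega>. form_norm k (\<alpha> x) powr p) +
      (\<Sum>j\<in>UNIV. LINT x|lebesgue_on \<Omega>. form_norm k (weak_deriv \<Omega> k (axis j 1) \<alpha> x) powr p))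
     powr (1 / p)"

definition test_forms :: "'n::finite rvec set \<Rightarrow> nat \<Rightarrow> 'n form_field set" where
  "test_forms \<Omega> k = {\<phi>. (\<forall>x. \<phi> x \<in> alt_forms k) \<and> (\<forall>vs. (\<lambda>x. \<phi> x vs) \<in> test_functions \<Omega>)}"

text \<open>The closure of the test forms in \<open>W\<^sup>1\<^sup>,\<^sup>1\<close>.\<close>

definition W11_zero ::
  "'n::{finite,linorder} rvec set \<Rightarrow> nat \<Rightarrow> 'n form_field set" where
  "W11_zero \<Omega> k = {\<omega> \<in> W1p 1 \<Omega> k. \<exists>\<phi>. (\<forall>m::nat. \<phi> m \<in> test_forms \<Omega> k) \<and>
     (\<lambda>m. W1p_norm 1 \<Omega> k (\<lambda>x. form_diff (\<omega> x) (\<phi> m x))) \<longlonglongrightarrow> 0}"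

text \<open>
  As usual in the calculus of variations, the zero boundary values of a \<open>W\<^sup>1\<^sup>,\<^sup>\<infinity>\<close> form are
  understood in the sense of \<open>W\<^sup>1\<^sup>,\<^sup>1\<close>; the closure of the test forms in the \<open>W\<^sup>1\<^sup>,\<^sup>\<infinity>\<close> norm
  would contain only continuously differentiable forms.
\<close>

definition W1infty_zero ::
  "'n::{finite,linorder} rvec set \<Rightarrow> nat \<Rightarrow> 'n form_field set" where
  "W1infty_zero \<Omega> k = W1infty \<Omega> k \<inter> W11_zero \<Omega> k"

text \<open>
  The dual space of \<open>W\<^sup>1\<^sup>,\<^sup>p\<close>. Boundedness makes a functional take the same value on forms that
  agree almost everywhere on \<open>\<Omega>\<close>.
\<close>

definition W1p_dual ::
  "real \<Rightarrow> 'n::{finite,linorder} rvec set \<Rightarrow> nat \<Rightarrow> ('n form_field \<Rightarrow> real) set" where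
  "W1p_dual p \<Omega> k = {L.
     (\<forall>\<alpha>\<in>W1p p \<Omega> k. \<forall>\<beta>\<in>W1p p \<Omega> k. \<forall>a b.
        L (\<lambda>x vs. a * \<alpha> x vs + b * \<beta> x vs) = a * L \<alpha> + b * L \<beta>) \<and>
     (\<exists>C. \<forall>\<alpha>\<in>W1p p \<Omega> k. \<bar>L \<alpha>\<bar> \<le> C * W1p_norm p \<Omega> k \<alpha>)}"

definition weakly_converges_W1p ::
  "real \<Rightarrow> 'n::{finite,linorder} rvec set \<Rightarrow> nat \<Rightarrow>
   (nat \<Rightarrow> 'n form_field) \<Rightarrow> 'n form_field \<Rightarrow> bool" where
  "weakly_converges_W1p p \<Omega> k \<alpha>s \<alpha> \<longleftrightarrow>
     (\<forall>s. \<alpha>s s \<in> W1p p \<Omega> k) \<and> \<alpha> \<in> W1p p \<Omega> k \<and>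
     (\<forall>L\<in>W1p_dual p \<Omega> k. (\<lambda>s. L (\<alpha>s s)) \<longlonglongrightarrow> L \<alpha>)"

section \<open>Ext. quasiconvexity\<close>

text \<open>\<open>f\<close> is a function on \<open>\<Lambda>\<^sup>k\<close>; its values outside \<open>alt_forms k\<close> are irrelevant.\<close>

definition locally_bounded_on_forms ::
  "nat \<Rightarrow> ('n::{finite,linorder} rvec form \<Rightarrow> real) \<Rightarrow> bool" where
  "locally_bounded_on_forms k f \<longleftrightarrow>
     (\<forall>\<xi>\<in>alt_forms k. \<exists>r>0. \<exists>C. \<forall>\<eta>\<in>alt_forms k. form_norm k (form_diff \<eta> \<xi>) < r \<longrightarrow> \<bar>f \<eta>\<bar> \<le> C)"

text \<open>Here \<open>k \<ge> 1\<close> is assumed.\<close>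

definition ext_quasiconvex ::
  "nat \<Rightarrow> ('n::{finite,linorder} rvec form \<Rightarrow> real) \<Rightarrow> bool" where
  "ext_quasiconvex k f \<longleftrightarrow>
     f \<in> borel_measurable (form_borel k) \<and> locally_bounded_on_forms k f \<and>
     (\<forall>U. open U \<and> bounded U \<longrightarrow>
        (\<forall>\<xi>\<in>alt_forms k. \<forall>\<omega>\<in>W1infty_zero U (k - 1).
           (LINT x|lebesgue_on U. f (form_add \<xi> (ext_deriv U (k - 1) \<omega> x)))
             \<ge> f \<xi> * measure lebesgue U))"

end

theory Submission
  imports Defs
begin

text \<open>
  If \<open>d\<alpha>\<close> were a constant form \<open>\<xi>\<close> on a bounded open set \<open>U\<close>, and \<open>\<alpha>\<^sub>s - \<alpha>\<close> were zero near the
  boundary of \<open>U\<close>, then \<open>\<integral> f(d\<alpha>\<^sub>s) \<ge> f(\<xi>) meas U\<close> would be quasiconvexity itself. The proof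
  localizes to small sets on which \<open>d\<alpha>\<close> is almost constant, and then cuts \<open>\<alpha>\<^sub>s - \<alpha>\<close> off near the
  boundary of each of them.

  Almost constant. Up to a small remainder, \<open>\<Omega>\<close> is a finite disjoint union of open sets \<open>U i\<close> with
  compact closure in \<open>\<Omega>\<close> on which \<open>d\<alpha>\<close> is \<open>L\<^sup>p\<close>-close to one of its values
  (\<open>piecewise_constant_approximation\<close>). Replacing \<open>d\<alpha>\<close> by that value, and \<open>d\<alpha>\<^sub>s\<close> by that value plus
  \<open>d(\<alpha>\<^sub>s - \<alpha>)\<close>, is possible because a quasiconvex function of \<open>p\<close>-growth is continuous in a
  quantitative way (\<open>quasiconvex_estimate\<close>): \<open>f(\<xi>) \<le> f(\<eta>) + \<delta> (1 + |\<xi>|\<^sup>p) + C\<^sub>\<delta> |\<xi> - \<eta>|\<^sup>p\<close>. To see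
  this, test quasiconvexity at \<open>\<xi>\<close> with a cutoff times a linear primitive of the constant form
  \<open>\<eta> - \<xi>\<close>; the perturbed form is \<open>\<eta>\<close> except on a set of small measure, where growth bounds it.

  Boundary values. For a cutoff \<open>\<phi>\<close> and \<open>w = \<alpha>\<^sub>s - \<alpha>\<close> the Leibniz rule gives
  \<open>d(\<phi> w) = \<phi> dw + d\<phi> \<and> w\<close>. The second term is harmless, as \<open>w \<rightarrow> 0\<close> in \<open>L\<^sup>p\<close> away from the boundary
  of \<open>\<Omega>\<close>, by a Rellich argument (\<open>local_compactness\<close>). The first one is not small on the layer
  where \<open>0 < \<phi> < 1\<close>, since \<open>dw\<close> is only bounded in \<open>L\<^sup>p\<close>. De Giorgi's slicing repairs this
  (\<open>slicing_estimate\<close>): for \<open>l\<close> cutoffs whose layers are disjoint, the sum of the integrals of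
  \<open>|dw|\<^sup>p\<close> over the layers is at most the whole integral, so averaging over the cutoffs gains a
  factor \<open>1 / l\<close>.

  Quasiconvexity is tested with smooth forms, so \<open>\<alpha>\<^sub>s - \<alpha>\<close> is replaced by a mollification whose
  radius is chosen for each \<open>s\<close> so small that the errors tend to zero (\<open>smooth_approximation\<close>).
  Boundedness of the weakly convergent sequence comes from a gliding hump argument
  (\<open>gliding_hump\<close>), in which a series of functionals is unbounded along an unbounded sequence. The
  pieces are assembled in \<open>local_estimate\<close> and \<open>eventually_integral_le\<close>.

  All \<open>L\<^sup>p\<close> estimates are about the integral of \<open>|.|\<^sup>p\<close> and not about its \<open>p\<close>-th root: in place of
  Minkowski's inequality they use \<open>|a + b|\<^sup>p \<le> 2\<^sup>p (|a|\<^sup>p + |b|\<^sup>p)\<close>. Constants that depend on \<open>p\<close>,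
  \<open>n\<close> and \<open>k\<close> only are not optimized.
\<close>

section \<open>Smooth functions\<close>

text \<open>
  A function of class \<open>C\<^sup>m\<^sup>+\<^sup>1\<close> is usually recognized by a formula for its derivative; this rule
  makes the inductions on \<open>m\<close> below independent of \<open>frechet_derivative\<close>.
\<close>
lemma Cm_on_SucI:
  assumes "\<And>x. (f has_derivative f' x) (at x)" and "\<And>v. Cm_on m (\<lambda>x. f' x v) UNIV"
  shows "Cm_on (Suc m) f UNIV"
proof -
  have "frechet_derivative f (at x) = f' x" for x
    using assms(1) frechet_derivative_at by metis
  then show ?thesis using assms by (auto simp: differentiable_def)
qed

lemma Cm_on_SucD: "Cm_on (Suc m) f UNIV \<Longrightarrow> Cm_on m f UNIV"
proof (induction m arbitrary: f)
  case 0
  then show ?case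
    by (auto intro!: continuous_at_imp_continuous_on differentiable_imp_continuous_within)
qed simp

lemma Cm_on_const: "Cm_on m (\<lambda>x. c) UNIV"
proof (induction m arbitrary: c)
  case (Suc m)
  show ?case by (rule Cm_on_SucI[where f'="\<lambda>x v. 0"]) (use Suc in auto)
qed simp

lemma Cm_on_bounded_linear:
  assumes "bounded_linear f" shows "Cm_on m f UNIV"
proof (cases m)
  case 0 then show ?thesis using assms by (simp add: linear_continuous_on)
next
  case (Suc l)
  show ?thesis unfolding Suc
    by (rule Cm_on_SucI[where f'="\<lambda>x. f"]) (use assms in \<open>auto intro: bounded_linear_imp_has_derivative Cm_on_const\<close>)
qed

lemma Cm_on_has_derivative:
  "Cm_on (Suc m) f UNIV \<Longrightarrow> (f has_derivative frechet_derivative f (at x)) (at x)"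
  by (simp add: frechet_derivative_works[symmetric])

lemma Cm_on_frechet:
  "Cm_on (Suc m) f UNIV \<Longrightarrow> Cm_on m (\<lambda>x. frechet_derivative f (at x) v) UNIV"
  by simp

lemma Cm_on_add:
  "Cm_on m f UNIV \<Longrightarrow> Cm_on m g UNIV \<Longrightarrow> Cm_on m (\<lambda>x. f x + g x) UNIV"
proof (induction m arbitrary: f g)
  case 0 then show ?case by (simp add: continuous_on_add)
next
  case (Suc m)
  show ?case
    by (rule Cm_on_SucI[OF has_derivative_add[OF Cm_on_has_derivative[OF Suc.prems(1)] Cm_on_has_derivative[OF Suc.prems(2)]]])
      (intro Suc.IH Cm_on_frechet Suc.prems)
qed

lemma Cm_on_mult:
  fixes f g :: "'a::real_normed_vector \<Rightarrow> real"
  shows "Cm_on m f UNIV \<Longrightarrow> Cm_on m g UNIV \<Longrightarrow> Cm_on m (\<lambda>x. f x * g x) UNIV"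
proof (induction m arbitrary: f g)
  case 0 then show ?case by (simp add: continuous_on_mult)
next
  case (Suc m)
  show ?case
    by (rule Cm_on_SucI[OF has_derivative_mult[OF Cm_on_has_derivative[OF Suc.prems(1)] Cm_on_has_derivative[OF Suc.prems(2)]]])
      (intro Suc.IH Cm_on_frechet Suc.prems Cm_on_add Cm_on_SucD)
qed

text \<open>
  The chain rule expresses the derivative as a product of a composite and a derivative, both of one
  order less. Taking \<open>h\<close> on the real line makes its derivative a single function, so that the
  induction hypothesis applies to it.
\<close>
lemma Cm_on_compose:
  fixes h :: "real \<Rightarrow> real" and f :: "'a::real_normed_vector \<Rightarrow> real"
  shows "Cm_on m h UNIV \<Longrightarrow> Cm_on m f UNIV \<Longrightarrow> Cm_on m (\<lambda>x. h (f x)) UNIV"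
proof (induction m arbitrary: h f)
  case 0 then show ?case by (simp add: continuous_on_compose2[of UNIV h])
next
  case (Suc m)
  let ?h = "\<lambda>t. frechet_derivative h (at t) 1"
  have lin: "frechet_derivative h (at t) s = ?h t * s" for t s
  proof -
    have "linear (frechet_derivative h (at t))"
      using Suc.prems(1) by (simp add: linear_frechet_derivative)
    from linear_cmul[OF this, of s 1] show ?thesis by (simp add: mult.commute)
  qed
  have d: "((\<lambda>x. h (f x)) has_derivative (\<lambda>v. ?h (f x) * frechet_derivative f (at x) v)) (at x)" for x
    using has_derivative_compose[OF Cm_on_has_derivative[OF Suc.prems(2), of x] Cm_on_has_derivative[OF Suc.prems(1), of "f x"]]
    by (subst (asm) lin[of "f x" "frechet_derivative f (at x) _"])
  show ?case
    by (rule Cm_on_SucI[OF d])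
      (intro Cm_on_mult Suc.IH[of ?h f] Cm_on_frechet Suc.prems Cm_on_SucD)
qed

lemma smooth_has_derivative:
  "smooth_on f UNIV \<Longrightarrow> (f has_derivative frechet_derivative f (at x)) (at x)"
  using Cm_on_has_derivative[of 0 f x] unfolding smooth_on_def by blast

lemma smooth_frechet: "smooth_on f UNIV \<Longrightarrow> smooth_on (\<lambda>x. frechet_derivative f (at x) v) UNIV"
  using Cm_on_frechet unfolding smooth_on_def by blast

lemma smooth_continuous: "smooth_on f UNIV \<Longrightarrow> continuous_on UNIV f"
  unfolding smooth_on_def by (metis Cm_on.simps(1))

lemma smooth_continuous_frechet:
  "smooth_on f UNIV \<Longrightarrow> continuous_on UNIV (\<lambda>x. frechet_derivative f (at x) v)"
  by (intro smooth_continuous smooth_frechet)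

lemma smooth_linear_frechet: "smooth_on f UNIV \<Longrightarrow> linear (frechet_derivative f (at x))"
  using smooth_has_derivative has_derivative_linear by blast

lemma smooth_const: "smooth_on (\<lambda>x. c) UNIV"
  by (simp add: smooth_on_def Cm_on_const)

lemma smooth_bounded_linear: "bounded_linear f \<Longrightarrow> smooth_on f UNIV"
  by (simp add: smooth_on_def Cm_on_bounded_linear)

lemma smooth_add: "smooth_on f UNIV \<Longrightarrow> smooth_on g UNIV \<Longrightarrow> smooth_on (\<lambda>x. f x + g x) UNIV"
  by (simp add: smooth_on_def Cm_on_add)

lemma smooth_mult:
  fixes f g :: "'a::real_normed_vector \<Rightarrow> real"
  shows "smooth_on f UNIV \<Longrightarrow> smooth_on g UNIV \<Longrightarrow> smooth_on (\<lambda>x. f x * g x) UNIV"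
  by (simp add: smooth_on_def Cm_on_mult)

lemma smooth_compose:
  fixes h :: "real \<Rightarrow> real" and f :: "'a::real_normed_vector \<Rightarrow> real"
  shows "smooth_on h UNIV \<Longrightarrow> smooth_on f UNIV \<Longrightarrow> smooth_on (\<lambda>x. h (f x)) UNIV"
  by (simp add: smooth_on_def Cm_on_compose)

lemma smooth_sum:
  "(\<And>i. i \<in> I \<Longrightarrow> smooth_on (f i) UNIV) \<Longrightarrow> smooth_on (\<lambda>x. \<Sum>i\<in>I. f i x) UNIV"
  by (induction I rule: infinite_finite_induct) (auto intro: smooth_const smooth_add)

lemma frechet_mult:
  fixes f g :: "'a::real_normed_vector \<Rightarrow> real"
  assumes "smooth_on f UNIV" "smooth_on g UNIV"
  shows "frechet_derivative (\<lambda>x. f x * g x) (at x) v =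
    f x * frechet_derivative g (at x) v + frechet_derivative f (at x) v * g x"
  using frechet_derivative_at[OF has_derivative_mult[OF smooth_has_derivative[OF assms(1)] smooth_has_derivative[OF assms(2)]]]
  by (metis (no_types, lifting))

section \<open>Test functions and mollifiers\<close>

text \<open>
  \<open>exp_flat 0\<close> is the classical smooth function that is flat at \<open>0\<close>. The divisions by powers of \<open>t\<close>
  make the derivative of each member of the family a linear combination of members.
\<close>
definition exp_flat :: "nat \<Rightarrow> real \<Rightarrow> real" where
  "exp_flat m t = (if t > 0 then exp (- (1 / t)) / t ^ m else 0)"

lemma exp_flat_tendsto_0: "(exp_flat m \<longlongrightarrow> 0) (at_right 0)"
proof -
  have "((\<lambda>s. s ^ m / exp s) \<longlongrightarrow> (0::real)) at_top"
    by (rule tendsto_power_div_exp_0)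
  then have "((\<lambda>t. inverse t ^ m / exp (inverse t)) \<longlongrightarrow> (0::real)) (at_right 0)"
    by (rule filterlim_compose[OF _ filterlim_inverse_at_top_right])
  moreover have "eventually (\<lambda>t. inverse t ^ m / exp (inverse t) = exp_flat m t) (at_right 0)"
    by (auto simp: eventually_at_right[of 0 1] exp_flat_def exp_minus field_simps power_divide inverse_eq_divide intro!: exI[of _ 1])
  ultimately show ?thesis by (rule Lim_transform_eventually)
qed

lemma exp_flat_has_derivative:
  "(exp_flat m has_real_derivative exp_flat (m + 2) t - m * exp_flat (m + 1) t) (at t)"
proof -
  consider "t > 0" | "t < 0" | "t = 0" by linarith
  then show ?thesis
  proof cases
    case 1
    have *: "((\<lambda>t. exp (- (1 / t)) / t ^ m) has_real_derivative exp_flat (m + 2) t - m * exp_flat (m + 1) t) (at t)"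
      using 1 by (auto intro!: derivative_eq_intros simp: exp_flat_def field_simps power2_eq_square)
        (cases m; simp add: field_simps)
    show ?thesis
      by (rule has_field_derivative_transform_within_open[OF *, of "{0<..}"]) (use 1 in \<open>auto simp: exp_flat_def\<close>)
  next
    case 2
    have *: "((\<lambda>t. 0) has_real_derivative exp_flat (m + 2) t - m * exp_flat (m + 1) t) (at t)"
      using 2 by (simp add: exp_flat_def)
    show ?thesis
      by (rule has_field_derivative_transform_within_open[OF *, of "{..<0}"]) (use 2 in \<open>auto simp: exp_flat_def\<close>)
  next
    case 3
    have "((\<lambda>h. (exp_flat m h - exp_flat m 0) / (h - 0)) \<longlongrightarrow> 0) (at 0)"
    proof (rule filterlim_split_at)
      show "((\<lambda>h. (exp_flat m h - exp_flat m 0) / (h - 0)) \<longlongrightarrow> 0) (at_left 0)"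
        by (rule tendsto_eventually) (auto simp: exp_flat_def eventually_at_filter)
      have "eventually (\<lambda>t. exp_flat (m + 1) t = (exp_flat m t - exp_flat m 0) / (t - 0)) (at_right 0)"
        by (auto simp: exp_flat_def eventually_at_filter)
      with exp_flat_tendsto_0[of "m+1"]
      show "((\<lambda>h. (exp_flat m h - exp_flat m 0) / (h - 0)) \<longlongrightarrow> 0) (at_right 0)"
        by (rule Lim_transform_eventually)
    qed
    then show ?thesis using 3 by (simp add: has_field_derivative_iff exp_flat_def)
  qed
qed

lemma smooth_exp_flat: "smooth_on (exp_flat m) UNIV"
  unfolding smooth_on_def
proof
  fix l show "Cm_on l (exp_flat m) UNIV"
  proof (induction l arbitrary: m)
    case 0
    show ?case by (auto intro!: DERIV_continuous_on exp_flat_has_derivative)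
  next
    case (Suc l)
    have "Cm_on l (\<lambda>t. (exp_flat (m + 2) t + (- real m) * exp_flat (m + 1) t) * v) UNIV" for v
      by (intro Cm_on_mult Cm_on_add Cm_on_const Suc)
    moreover have "(exp_flat m has_derivative (\<lambda>v. (exp_flat (m + 2) t + (- real m) * exp_flat (m + 1) t) * v)) (at t)" for t
      using exp_flat_has_derivative[of m t] unfolding has_field_derivative_def by simp
    ultimately show ?case by (rule Cm_on_SucI[rotated])
  qed
qed

lemma test_functions_smooth: "\<phi> \<in> test_functions U \<Longrightarrow> smooth_on \<phi> UNIV"
  by (simp add: test_functions_def)

lemma test_functionsI:
  assumes "smooth_on \<phi> UNIV" "compact K" "K \<subseteq> U" "\<And>x. x \<notin> K \<Longrightarrow> \<phi> x = 0"
  shows "\<phi> \<in> test_functions U"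
proof -
  have "closure {x. \<phi> x \<noteq> 0} \<subseteq> K"
    by (rule closure_minimal) (use assms compact_imp_closed in auto)
  then show ?thesis using assms compact_Int_closed[of K "closure {x. \<phi> x \<noteq> 0}"]
    unfolding test_functions_def by (auto simp: Int_absorb1 compact_imp_closed)
qed

lemma frechet_derivative_zero_outside:
  assumes "closed K" "\<And>x. x \<notin> K \<Longrightarrow> \<phi> x = 0" "x \<notin> K"
  shows "frechet_derivative \<phi> (at x) v = 0"
proof -
  have "((\<lambda>x. 0) has_derivative (\<lambda>v. 0)) (at x)" by simp
  then have "(\<phi> has_derivative (\<lambda>v. 0)) (at x)"
    by (rule has_derivative_transform_within_open[of _ _ _ _ "- K"]) (use assms in auto)
  then show ?thesis using frechet_derivative_at by metis
qed

lemma test_functions_support: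
  assumes "\<phi> \<in> test_functions U"
  shows "\<exists>K. compact K \<and> K \<subseteq> U \<and> (\<forall>x. x \<notin> K \<longrightarrow> \<phi> x = 0) \<and>
    (\<forall>x v. x \<notin> K \<longrightarrow> frechet_derivative \<phi> (at x) v = 0)"
proof -
  define K where "K = closure {x. \<phi> x \<noteq> 0}"
  have K: "compact K" "K \<subseteq> U" using assms by (auto simp: test_functions_def K_def)
  have z: "x \<notin> K \<Longrightarrow> \<phi> x = 0" for x
    using closure_subset[of "{x. \<phi> x \<noteq> 0}"] unfolding K_def by blast
  show ?thesis
    by (intro exI[of _ K] conjI allI impI K z frechet_derivative_zero_outside[OF compact_imp_closed[OF K(1)]])
qed

lemma test_functions_mult:
  assumes "\<phi> \<in> test_functions U" "smooth_on g UNIV"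
  shows "(\<lambda>x. \<phi> x * g x) \<in> test_functions U"
proof -
  obtain K where "compact K" "K \<subseteq> U" "\<And>x. x \<notin> K \<Longrightarrow> \<phi> x = 0" using test_functions_support[OF assms(1)] by auto
  then show ?thesis by (intro test_functionsI[of _ K] smooth_mult test_functions_smooth[OF assms(1)] assms(2)) auto
qed

lemma test_functions_frechet:
  assumes "\<phi> \<in> test_functions U"
  shows "(\<lambda>x. frechet_derivative \<phi> (at x) v) \<in> test_functions U"
proof -
  obtain K where "compact K" "K \<subseteq> U" "\<And>x. x \<notin> K \<Longrightarrow> frechet_derivative \<phi> (at x) v = 0" using test_functions_support[OF assms(1)] by auto
  then show ?thesis by (intro test_functionsI[of _ K] smooth_frechet test_functions_smooth[OF assms(1)]) auto
qed

lemma test_functions_continuous: "\<phi> \<in> test_functions U \<Longrightarrow> continuous_on UNIV \<phi>"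
  by (simp add: smooth_continuous test_functions_smooth)

lemma continuous_compact_support_bounded:
  fixes g :: "'a::euclidean_space \<Rightarrow> real"
  assumes "continuous_on UNIV g" "compact K" "\<And>x. x \<notin> K \<Longrightarrow> g x = 0"
  obtains B where "B \<ge> 0" "\<And>x. \<bar>g x\<bar> \<le> B"
proof -
  have "compact (g ` K)"
    using assms by (meson compact_continuous_image continuous_on_subset subset_UNIV)
  then obtain B where B: "\<forall>y\<in>g ` K. norm y \<le> B" using compact_imp_bounded bounded_iff by metis
  show ?thesis
    by (rule that[of "max B 0"]) (use B assms(3) in \<open>auto simp: le_max_iff_disj\<close>)
qed

lemma test_functions_bounded:
  fixes \<phi> :: "'a::euclidean_space \<Rightarrow> real"
  assumes "\<phi> \<in> test_functions U"
  obtains B where "B \<ge> 0" "\<And>x. \<bar>\<phi> x\<bar> \<le> B"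
proof -
  obtain K where "compact K" "\<And>x. x \<notin> K \<Longrightarrow> \<phi> x = 0" using test_functions_support[OF assms(1)] by auto
  from continuous_compact_support_bounded[OF test_functions_continuous[OF assms] this] that show ?thesis by blast
qed

lemma test_functions_derivative_bounded:
  fixes \<phi> :: "'a::euclidean_space \<Rightarrow> real"
  assumes "\<phi> \<in> test_functions U"
  obtains B where "B \<ge> 0" "\<And>x v. \<bar>frechet_derivative \<phi> (at x) v\<bar> \<le> B * norm v"
proof -
  have "\<exists>B\<ge>0. \<forall>x. \<bar>frechet_derivative \<phi> (at x) b\<bar> \<le> B" for b
    using test_functions_bounded[OF test_functions_frechet[OF assms, of b]] by blast
  then obtain B where B: "\<And>b. B b \<ge> 0" "\<And>b x. \<bar>frechet_derivative \<phi> (at x) b\<bar> \<le> B b" by metis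
  have "\<bar>frechet_derivative \<phi> (at x) v\<bar> \<le> (\<Sum>b\<in>Basis. B b) * norm v" for x v
  proof -
    have lin: "linear (frechet_derivative \<phi> (at x))"
      using assms smooth_linear_frechet test_functions_smooth by blast
    have "frechet_derivative \<phi> (at x) v = frechet_derivative \<phi> (at x) (\<Sum>b\<in>Basis. (v \<bullet> b) *\<^sub>R b)"
      by (simp add: euclidean_representation)
    also have "\<dots> = (\<Sum>b\<in>Basis. (v \<bullet> b) * frechet_derivative \<phi> (at x) b)"
      using lin by (simp add: linear_sum linear_cmul)
    finally have "\<bar>frechet_derivative \<phi> (at x) v\<bar> \<le> (\<Sum>b\<in>Basis. \<bar>(v \<bullet> b) * frechet_derivative \<phi> (at x) b\<bar>)"
      by simp
    also have "\<dots> \<le> (\<Sum>b\<in>Basis. norm v * B b)"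
      by (intro sum_mono) (auto simp: abs_mult Basis_le_norm B intro!: mult_mono)
    finally show ?thesis by (simp add: sum_distrib_left mult.commute)
  qed
  then show ?thesis by (intro that[of "\<Sum>b\<in>Basis. B b"]) (auto intro: sum_nonneg B)
qed

lemma integrable_continuous_compact_support:
  fixes g :: "'a::euclidean_space \<Rightarrow> real"
  assumes "continuous_on UNIV g" "compact K" "\<And>x. x \<notin> K \<Longrightarrow> g x = 0"
  shows "integrable lborel g"
proof -
  have "set_integrable lborel K g"
    using assms borel_integrable_compact[of K g] continuous_on_subset
    unfolding set_integrable_def by (simp add: indicator_scaleR_eq_if continuous_on_subset)
  moreover have "(\<lambda>x. indicator K x *\<^sub>R g x) = g"
    by (rule ext) (use assms(3) in \<open>auto simp: indicator_def\<close>)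
  ultimately show ?thesis by (simp add: set_integrable_def)
qed

lemma test_functions_integrable:
  fixes \<phi> :: "'a::euclidean_space \<Rightarrow> real"
  assumes "\<phi> \<in> test_functions U" shows "integrable lborel \<phi>"
proof -
  obtain K where "compact K" "\<And>x. x \<notin> K \<Longrightarrow> \<phi> x = 0" using test_functions_support[OF assms(1)] by auto
  from integrable_continuous_compact_support[OF test_functions_continuous[OF assms] this] show ?thesis .
qed

definition mollifier :: "real \<Rightarrow> ('a::euclidean_space \<Rightarrow> real) \<Rightarrow> bool" where
  "mollifier \<epsilon> \<rho> \<longleftrightarrow> \<rho> \<in> test_functions (UNIV :: 'a set) \<and> (\<forall>x. \<rho> x \<ge> 0) \<and>
     (\<forall>x. norm x > \<epsilon> \<longrightarrow> \<rho> x = 0) \<and> (LINT x|lborel. \<rho> x) = 1"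

text \<open>
  A smooth bump is \<open>exp_flat 0\<close> composed with the polynomial \<open>\<epsilon>\<^sup>2 - |x|\<^sup>2\<close>. Its integral is
  positive, because it does not vanish on the ball, so it can be normalized.
\<close>
lemma mollifier_exists:
  assumes "\<epsilon> > 0" obtains \<rho> :: "'a::euclidean_space \<Rightarrow> real" where "mollifier \<epsilon> \<rho>"
proof -
  \<comment> \<open>The sum over the basis is \<open>|x|\<^sup>2\<close>, written as a visibly smooth expression.\<close>
  define b :: "'a \<Rightarrow> real" where "b x = exp_flat 0 (\<epsilon>\<^sup>2 + (- 1) * (\<Sum>i\<in>Basis. (x \<bullet> i) * (x \<bullet> i)))" for x
  have b: "b x = exp_flat 0 (\<epsilon>\<^sup>2 - (norm x)\<^sup>2)" for x
    unfolding b_def power2_norm_eq_inner by (subst euclidean_inner) simp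
  have sm: "smooth_on b UNIV"
    unfolding b_def
    by (rule smooth_compose[OF smooth_exp_flat])
      (intro smooth_add smooth_mult smooth_const smooth_sum smooth_bounded_linear bounded_linear_inner_left)
  have z: "b x = 0" if "norm x > \<epsilon>" for x
    using that assms power_strict_mono[of \<epsilon> "norm x" 2] by (simp add: b exp_flat_def)
  have pos: "b x \<ge> 0" for x by (simp add: b exp_flat_def)
  have t: "b \<in> test_functions UNIV"
    by (rule test_functionsI[OF sm compact_cball[of 0 \<epsilon>]]) (auto intro: z)
  have int: "integrable lborel b" by (rule test_functions_integrable[OF t])
  have cont: "continuous_on UNIV b" by (rule smooth_continuous[OF sm])
  have "(LINT x|lborel. b x) \<noteq> 0"
  proof
    assume "(LINT x|lborel. b x) = 0"
    then have "AE x in lborel. b x = 0"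
      using integral_nonneg_eq_0_iff_AE[OF int] pos by auto
    then have "emeasure lborel {x. b x \<noteq> 0} = 0"
      using cont by (subst (asm) AE_iff_measurable[where N="{x. b x \<noteq> 0}"])
         (auto intro!: borel_open open_Collect_neq continuous_intros)
    moreover have "ball 0 \<epsilon> \<subseteq> {x. b x \<noteq> 0}"
      using assms by (auto simp: b exp_flat_def power_strict_mono)
    moreover have "{x. b x \<noteq> 0} \<in> sets lborel"
      using cont by (auto intro!: borel_open open_Collect_neq continuous_intros)
    ultimately have "emeasure lborel (ball (0::'a) \<epsilon>) = 0"
      by (metis emeasure_mono le_zero_eq)
    then have "emeasure lebesgue (ball (0::'a) \<epsilon>) = 0" by simp
    then have "negligible (ball (0::'a) \<epsilon>)" by (simp add: negligible_iff_emeasure0 lmeasurable_ball fmeasurableD)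
    then show False using assms open_not_negligible[of "ball 0 \<epsilon>"] by auto
  qed
  then have I: "(LINT x|lborel. b x) > 0" using integral_nonneg_AE[of b lborel] pos by (metis AE_I2 less_eq_real_def)
  define \<rho> where "\<rho> = (\<lambda>x. b x * (1 / (LINT x|lborel. b x)))"
  have "mollifier \<epsilon> \<rho>"
    unfolding mollifier_def
  proof (intro conjI allI impI)
    show "\<rho> \<in> test_functions UNIV" unfolding \<rho>_def by (rule test_functions_mult[OF t smooth_const])
    show "\<rho> x \<ge> 0" for x using I pos by (simp add: \<rho>_def)
    show "norm x > \<epsilon> \<Longrightarrow> \<rho> x = 0" for x by (simp add: \<rho>_def z)
    show "(LINT x|lborel. \<rho> x) = 1" using I by (simp add: \<rho>_def)
  qed
  then show ?thesis by (rule that)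
qed

section \<open>Powers and convexity\<close>

text \<open>
  The substitute for the triangle inequality when \<open>|.|\<^sup>p\<close> is used instead of the \<open>L\<^sup>p\<close> norm.
\<close>
lemma powr_add_le:
  fixes a b p :: real assumes "0 \<le> p"
  shows "\<bar>a + b\<bar> powr p \<le> 2 powr p * (\<bar>a\<bar> powr p + \<bar>b\<bar> powr p)"
proof -
  have "\<bar>a + b\<bar> powr p \<le> (2 * max \<bar>a\<bar> \<bar>b\<bar>) powr p"
    using assms by (intro powr_mono2) auto
  also have "\<dots> = 2 powr p * max \<bar>a\<bar> \<bar>b\<bar> powr p" by (simp add: powr_mult)
  also have "\<dots> \<le> 2 powr p * (\<bar>a\<bar> powr p + \<bar>b\<bar> powr p)"
    by (intro mult_left_mono) (auto simp: max_def)
  finally show ?thesis .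
qed

text \<open>
  The convex function \<open>a \<mapsto> a\<^sup>p\<close> lies above its tangent at \<open>t\<close>; this is Young's inequality for \<open>a\<close>
  and \<open>t\<^sup>p\<^sup>-\<^sup>1\<close>.
\<close>
lemma powr_tangent:
  fixes a t p :: real assumes "1 \<le> p" "0 \<le> a" "0 \<le> t"
  shows "t powr p + p * t powr (p - 1) * (a - t) \<le> a powr p"
proof (cases "t = 0 \<or> p = 1")
  case False
  then have t: "t > 0" and p: "1 < p" using assms by auto
  \<comment> \<open>The conjugate exponent of \<open>p\<close> is \<open>p / (p - 1)\<close>.\<close>
  have "a * t powr (p - 1) \<le> a powr p / p + (t powr (p - 1)) powr (p / (p - 1)) / (p / (p - 1))"
    using assms p by (intro Youngs_inequality) (auto simp: field_simps)
  also have "(t powr (p - 1)) powr (p / (p - 1)) = t powr p"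
    using p by (simp add: powr_powr)
  finally have "p * (a * t powr (p - 1)) \<le> p * (a powr p / p + t powr p / (p / (p - 1)))"
    using assms by (intro mult_left_mono) auto
  also have "\<dots> = a powr p + (p - 1) * t powr p" using p by (simp add: field_simps)
  finally have "p * (a * t powr (p - 1)) \<le> a powr p + (p - 1) * t powr p" .
  moreover have "t powr (p - 1) * t = t powr p" using t by (simp add: powr_diff)
  ultimately show ?thesis by (simp add: algebra_simps)
qed (use assms in auto)

text \<open>
  Integrate the tangent inequality at \<open>t = \<integral> \<rho> g\<close> with weight \<open>\<rho>\<close>: the linear term integrates to
  zero.
\<close>
lemma weighted_jensen:
  fixes \<rho> g :: "'a \<Rightarrow> real"
  assumes "1 \<le> p" "\<And>x. 0 \<le> \<rho> x" "\<And>x. 0 \<le> g x" "integrable M \<rho>" "(LINT x|M. \<rho> x) = 1"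
    "integrable M (\<lambda>x. \<rho> x * g x)" "integrable M (\<lambda>x. \<rho> x * g x powr p)"
  shows "(LINT x|M. \<rho> x * g x) powr p \<le> (LINT x|M. \<rho> x * g x powr p)"
proof -
  define t where "t = (LINT x|M. \<rho> x * g x)"
  have t: "t \<ge> 0" unfolding t_def using assms by (intro integral_nonneg_AE) auto
  have "(LINT x|M. (t powr p - p * t powr (p - 1) * t) * \<rho> x + p * t powr (p - 1) * (\<rho> x * g x)) \<le> (LINT x|M. \<rho> x * g x powr p)"
  proof (rule integral_mono)
    fix x
    have "\<rho> x * (t powr p + p * t powr (p - 1) * (g x - t)) \<le> \<rho> x * g x powr p"
      using assms t by (intro mult_left_mono powr_tangent) auto
    then show "(t powr p - p * t powr (p - 1) * t) * \<rho> x + p * t powr (p - 1) * (\<rho> x * g x) \<le> \<rho> x * g x powr p"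
      by (simp add: algebra_simps)
  qed (use assms in auto)
  also have "(LINT x|M. (t powr p - p * t powr (p - 1) * t) * \<rho> x + p * t powr (p - 1) * (\<rho> x * g x)) = t powr p"
    using assms by (simp add: t_def[symmetric])
  finally show ?thesis unfolding t_def .
qed

lemma abs_integral_le:
  fixes f g :: "'a \<Rightarrow> real"
  assumes "integrable M f" "integrable M g" "\<And>x. \<bar>f x\<bar> \<le> g x"
  shows "\<bar>integral\<^sup>L M f\<bar> \<le> integral\<^sup>L M g"
proof -
  have "\<bar>integral\<^sup>L M f\<bar> \<le> (LINT x|M. \<bar>f x\<bar>)" using integral_norm_bound[of M f] by simp
  also have "\<dots> \<le> integral\<^sup>L M g" using assms by (intro integral_mono) auto
  finally show ?thesis .
qed

section \<open>Translation invariance\<close>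

lemma nn_integral_lborel_translate:
  fixes f :: "'a::euclidean_space \<Rightarrow> ennreal"
  assumes [measurable]: "f \<in> borel_measurable borel"
  shows "(\<integral>\<^sup>+x. f (c + x) \<partial>lborel) = (\<integral>\<^sup>+x. f x \<partial>lborel)"
proof -
  have "(\<integral>\<^sup>+x. f x \<partial>lborel) = (\<integral>\<^sup>+x. f x \<partial>distr lborel borel ((+) c))" by (simp add: lborel_distr_plus)
  also have "\<dots> = (\<integral>\<^sup>+x. f (c + x) \<partial>lborel)" by (subst nn_integral_distr) auto
  finally show ?thesis by simp
qed

lemma lborel_distr_reflect: "distr lborel borel (\<lambda>x. c - x) = (lborel :: 'a::euclidean_space measure)"
  using lborel_affine[of "-1" c] by (simp add: density_1)

lemma nn_integral_lborel_reflect: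
  fixes f :: "'a::euclidean_space \<Rightarrow> ennreal"
  assumes [measurable]: "f \<in> borel_measurable borel"
  shows "(\<integral>\<^sup>+x. f (c - x) \<partial>lborel) = (\<integral>\<^sup>+x. f x \<partial>lborel)"
proof -
  have "(\<integral>\<^sup>+x. f x \<partial>lborel) = (\<integral>\<^sup>+x. f x \<partial>distr lborel borel (\<lambda>x. c - x))" by (simp add: lborel_distr_reflect)
  also have "\<dots> = (\<integral>\<^sup>+x. f (c - x) \<partial>lborel)" by (subst nn_integral_distr) auto
  finally show ?thesis by simp
qed

lemma integral_lborel_reflect:
  fixes f :: "'a::euclidean_space \<Rightarrow> real"
  assumes [measurable]: "f \<in> borel_measurable borel"
  shows "(LINT x|lborel. f (c - x)) = (LINT x|lborel. f x)"
proof -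
  have "(LINT x|lborel. f x) = (LINT x|distr lborel borel (\<lambda>x. c - x). f x)" by (simp add: lborel_distr_reflect)
  also have "\<dots> = (LINT x|lborel. f (c - x))" by (subst integral_distr) auto
  finally show ?thesis by simp
qed

lemma integral_lborel_translate:
  fixes f :: "'a::euclidean_space \<Rightarrow> real"
  assumes [measurable]: "f \<in> borel_measurable borel"
  shows "(LINT x|lborel. f (c + x)) = (LINT x|lborel. f x)"
proof -
  have "(LINT x|lborel. f x) = (LINT x|distr lborel borel ((+) c). f x)" by (simp add: lborel_distr_plus)
  also have "\<dots> = (LINT x|lborel. f (c + x))" by (subst integral_distr) auto
  finally show ?thesis by simp
qed

lemma integrable_lborel_translate:
  fixes f :: "'a::euclidean_space \<Rightarrow> real"
  assumes "integrable lborel f"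
  shows "integrable lborel (\<lambda>x. f (c + x))"
proof -
  have "integrable (distr lborel borel ((+) c)) f" using assms by (simp add: lborel_distr_plus)
  then show ?thesis by (subst (asm) integrable_distr_eq) (use assms in auto)
qed

section \<open>Convolution\<close>

definition conv :: "('a::euclidean_space \<Rightarrow> real) \<Rightarrow> ('a \<Rightarrow> real) \<Rightarrow> 'a \<Rightarrow> real" where
  "conv \<phi> g x = (LINT y|lborel. \<phi> (x - y) * g y)"

lemma test_functions_measurable [measurable_dest]:
  "\<phi> \<in> test_functions U \<Longrightarrow> \<phi> \<in> borel_measurable borel"
  by (simp add: borel_measurable_continuous_onI test_functions_continuous)

lemma conv_integrable:
  fixes \<phi> :: "'a::euclidean_space \<Rightarrow> real"
  assumes \<phi>: "\<phi> \<in> test_functions U" and g: "integrable lborel g"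
  shows "integrable lborel (\<lambda>y. \<phi> (x - y) * g y)"
proof -
  obtain B where B: "\<And>x. \<bar>\<phi> x\<bar> \<le> B" using test_functions_bounded[OF \<phi>] by blast
  note [measurable] = test_functions_measurable[OF \<phi>] borel_measurable_integrable[OF g, simplified]
  show ?thesis
    by (rule Bochner_Integration.integrable_bound[of _ "\<lambda>y. B * g y"])
      (use g in \<open>auto simp: abs_mult intro!: AE_I2 mult_mono order_trans[OF B]\<close>)
qed

text \<open>
  Differentiation under the integral sign: the difference quotients of \<open>\<phi>\<close> are bounded by a
  Lipschitz constant, so dominated convergence with a multiple of \<open>|g|\<close> applies. The derivative is
  again a convolution of \<open>g\<close> with a test function, which gives smoothness by iteration.
\<close>
lemma conv_has_derivative:
  fixes \<phi> :: "'a::euclidean_space \<Rightarrow> real"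
  assumes \<phi>: "\<phi> \<in> test_functions U" and g: "integrable lborel g"
  shows "(conv \<phi> g has_derivative (\<lambda>v. conv (\<lambda>x. frechet_derivative \<phi> (at x) v) g x)) (at x)"
proof -
  let ?D = "\<lambda>x. frechet_derivative \<phi> (at x)"
  note Dt = test_functions_frechet[OF \<phi>]
  note Dint = conv_integrable[OF Dt g]
  note lin = smooth_linear_frechet[OF test_functions_smooth[OF \<phi>]]
  obtain B where B: "B \<ge> 0" "\<And>x v. \<bar>?D x v\<bar> \<le> B * norm v" using test_functions_derivative_bounded[OF \<phi>] by blast
  note [measurable] = test_functions_measurable[OF \<phi>] test_functions_measurable[OF Dt]
    borel_measurable_integrable[OF g, simplified]
  have lip: "\<bar>\<phi> y - \<phi> z\<bar> \<le> B * norm (y - z)" for y z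
  proof -
    have "norm (\<phi> y - \<phi> z) \<le> B * norm (y - z)"
    proof (rule differentiable_bound[of UNIV \<phi> ?D B y z])
      show "onorm (?D x) \<le> B" for x by (rule onorm_le) (use B in auto)
      show "(\<phi> has_derivative ?D x) (at x within UNIV)" for x
        using smooth_has_derivative[OF test_functions_smooth[OF \<phi>]] by simp
    qed auto
    then show ?thesis by simp
  qed
  have blin: "bounded_linear (\<lambda>v. conv (\<lambda>x. ?D x v) g x)"
  proof (rule bounded_linear_intro[where K="B * (LINT y|lborel. \<bar>g y\<bar>)"])
    show "conv (\<lambda>x. ?D x (v + w)) g x = conv (\<lambda>x. ?D x v) g x + conv (\<lambda>x. ?D x w) g x" for v w
      unfolding conv_def by (simp add: linear_add[OF lin] distrib_right Bochner_Integration.integral_add[OF Dint Dint])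
    show "conv (\<lambda>x. ?D x (r *\<^sub>R v)) g x = r *\<^sub>R conv (\<lambda>x. ?D x v) g x" for r v
      unfolding conv_def by (simp add: linear_cmul[OF lin] mult.assoc)
    show "norm (conv (\<lambda>x. ?D x v) g x) \<le> norm v * (B * (LINT y|lborel. \<bar>g y\<bar>))" for v
    proof -
      have "norm (conv (\<lambda>x. ?D x v) g x) \<le> (LINT y|lborel. B * norm v * \<bar>g y\<bar>)"
        unfolding conv_def
        by (rule Bochner_Integration.integral_norm_bound_integral[OF Dint])
          (use g B in \<open>auto simp: abs_mult intro!: mult_right_mono\<close>)
      then show ?thesis by (simp add: mult_ac)
    qed
  qed
  have "((\<lambda>h. norm (conv \<phi> g (x + h) - conv \<phi> g x - conv (\<lambda>x. ?D x h) g x) / norm h) \<longlongrightarrow> 0) (at 0)"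
    unfolding tendsto_at_iff_sequentially comp_def
  proof (intro allI impI)
    fix h :: "nat \<Rightarrow> 'a"
    assume h: "\<forall>i. h i \<in> UNIV - {0}" "h \<longlonglongrightarrow> 0"
    \<comment> \<open>The error of the difference quotient; it is bounded by twice the Lipschitz constant of \<open>\<phi>\<close>.\<close>
    define q where "q i y = (\<phi> (x + h i - y) - \<phi> (x - y) - ?D (x - y) (h i)) / norm (h i)" for i y
    have qb: "\<bar>q i y\<bar> \<le> 2 * B" for i y
    proof -
      have "\<bar>\<phi> (x + h i - y) - \<phi> (x - y) - ?D (x - y) (h i)\<bar> \<le> B * norm (h i) + B * norm (h i)"
        using lip[of "x + h i - y" "x - y"] B(2)[of "x - y" "h i"] by (simp add: algebra_simps)
      then show ?thesis using h(1) by (simp add: q_def divide_le_eq)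
    qed
    have q0: "(\<lambda>i. q i y) \<longlonglongrightarrow> 0" for y
    proof -
      have "((\<lambda>h. norm (\<phi> (x - y + h) - \<phi> (x - y) - ?D (x - y) h) / norm h) \<longlongrightarrow> 0) (at 0)"
        using smooth_has_derivative[OF test_functions_smooth[OF \<phi>], of "x - y"] unfolding has_derivative_at by blast
      then have "(\<lambda>i. norm (\<phi> (x - y + h i) - \<phi> (x - y) - ?D (x - y) (h i)) / norm (h i)) \<longlonglongrightarrow> 0"
        using h unfolding tendsto_at_iff_sequentially comp_def by blast
      then have "(\<lambda>i. \<bar>q i y\<bar>) \<longlonglongrightarrow> 0" by (simp add: q_def algebra_simps)
      then show ?thesis by (rule tendsto_rabs_zero_cancel)
    qed
    have "(\<lambda>i. LINT y|lborel. q i y * g y) \<longlonglongrightarrow> (LINT y|lborel. 0 * g y)"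
    proof (rule integral_dominated_convergence[where w="\<lambda>y. 2 * B * \<bar>g y\<bar>"])
      show "(\<lambda>y. q i y * g y) \<in> borel_measurable lborel" for i unfolding q_def by measurable
      show "AE y in lborel. (\<lambda>i. q i y * g y) \<longlonglongrightarrow> 0 * g y" by (intro AE_I2 tendsto_mult q0) auto
      show "AE y in lborel. norm (q i y * g y) \<le> 2 * B * \<bar>g y\<bar>" for i
        by (auto simp: abs_mult intro!: mult_right_mono qb)
    qed (use g in auto)
    moreover have "norm (conv \<phi> g (x + h i) - conv \<phi> g x - conv (\<lambda>x. ?D x (h i)) g x) / norm (h i) = \<bar>LINT y|lborel. q i y * g y\<bar>" for i
    proof -
      have "conv \<phi> g (x + h i) - conv \<phi> g x - conv (\<lambda>x. ?D x (h i)) g x =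
        (LINT y|lborel. (\<phi> (x + h i - y) * g y - \<phi> (x - y) * g y) - ?D (x - y) (h i) * g y)"
        unfolding conv_def using conv_integrable[OF \<phi> g] Dint by simp
      also have "\<dots> = (LINT y|lborel. norm (h i) * (q i y * g y))"
        using h(1) by (intro Bochner_Integration.integral_cong) (auto simp: q_def left_diff_distrib)
      finally show ?thesis using h(1) by (simp add: abs_mult)
    qed
    ultimately show "(\<lambda>i. norm (conv \<phi> g (x + h i) - conv \<phi> g x - conv (\<lambda>x. ?D x (h i)) g x) / norm (h i)) \<longlonglongrightarrow> 0"
      using tendsto_rabs_zero by simp
  qed
  with blin show ?thesis unfolding has_derivative_at by blast
qed

lemma frechet_conv:
  assumes "\<phi> \<in> test_functions U" "integrable lborel g"
  shows "frechet_derivative (conv \<phi> g) (at x) v = conv (\<lambda>x. frechet_derivative \<phi> (at x) v) g x"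
  using frechet_derivative_at[OF conv_has_derivative[OF assms]] by metis

lemma smooth_conv:
  assumes "\<phi> \<in> test_functions U" "integrable lborel g"
  shows "smooth_on (conv \<phi> g) UNIV"
  unfolding smooth_on_def
proof
  fix m show "Cm_on m (conv \<phi> g) UNIV" using assms(1)
  proof (induction m arbitrary: \<phi>)
    case 0
    then show ?case using conv_has_derivative[OF _ assms(2)]
      by (auto intro!: continuous_at_imp_continuous_on has_derivative_continuous)
  next
    case (Suc m)
    show ?case by (rule Cm_on_SucI[OF conv_has_derivative[OF Suc.prems assms(2)]])
        (intro Suc.IH test_functions_frechet Suc.prems)
  qed
qed

lemma conv_measurable:
  assumes "\<phi> \<in> test_functions U" "integrable lborel g"
  shows "conv \<phi> g \<in> borel_measurable borel"
  by (rule borel_measurable_continuous_onI[OF smooth_continuous[OF smooth_conv[OF assms]]])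

lemma conv_diff:
  assumes "\<phi> \<in> test_functions U" "integrable lborel g" "integrable lborel h"
  shows "conv \<phi> (\<lambda>y. g y - h y) x = conv \<phi> g x - conv \<phi> h x"
  unfolding conv_def
  by (simp add: right_diff_distrib Bochner_Integration.integral_diff[OF conv_integrable[OF assms(1,2)] conv_integrable[OF assms(1,3)]])

lemma mollifierD:
  assumes "mollifier \<epsilon> \<rho>"
  shows "\<rho> \<in> test_functions UNIV" "\<rho> x \<ge> 0" "norm x > \<epsilon> \<Longrightarrow> \<rho> x = 0" "(LINT x|lborel. \<rho> x) = 1"
    "integrable lborel \<rho>"
  using assms test_functions_integrable unfolding mollifier_def by auto

lemma mollifier_reflect:
  fixes \<rho> :: "'a::euclidean_space \<Rightarrow> real"
  assumes "mollifier \<epsilon> \<rho>"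
  shows "integrable lborel (\<lambda>y. \<rho> (x - y))" "(LINT y|lborel. \<rho> (x - y)) = 1"
proof -
  note [measurable] = test_functions_measurable[OF mollifierD(1)[OF assms]]
  have "integrable (distr lborel borel (\<lambda>y. x - y)) \<rho>"
    using mollifierD(5)[OF assms] by (simp add: lborel_distr_reflect)
  then show "integrable lborel (\<lambda>y. \<rho> (x - y))" by (subst (asm) integrable_distr_eq) auto
  show "(LINT y|lborel. \<rho> (x - y)) = 1"
    using mollifierD(4)[OF assms] by (subst integral_lborel_reflect) auto
qed

section \<open>Mollification in \<open>L\<^sup>p\<close>\<close>

text \<open>
  Convolutions are taken over the whole space and with Borel functions; bounded support makes such
  a function integrable for every \<open>p \<ge> 1\<close>.
\<close>
definition Lp_bounded_support :: "real \<Rightarrow> ('a::euclidean_space \<Rightarrow> real) \<Rightarrow> bool" where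
  "Lp_bounded_support p g \<longleftrightarrow> g \<in> borel_measurable borel \<and> bounded {x. g x \<noteq> 0} \<and>
     integrable lborel (\<lambda>x. \<bar>g x\<bar> powr p)"

lemma Lp_bounded_supportD:
  assumes "Lp_bounded_support p g" "1 \<le> p"
  shows "g \<in> borel_measurable borel" "integrable lborel (\<lambda>x. \<bar>g x\<bar> powr p)" "integrable lborel g"
proof -
  show [measurable]: "g \<in> borel_measurable borel" and i: "integrable lborel (\<lambda>x. \<bar>g x\<bar> powr p)"
    using assms by (auto simp: Lp_bounded_support_def)
  obtain R where R: "\<And>x. g x \<noteq> 0 \<Longrightarrow> norm x \<le> R" using assms by (auto simp: Lp_bounded_support_def bounded_iff)
  have le: "\<bar>g x\<bar> \<le> \<bar>g x\<bar> powr p + indicator (cball 0 R) x" for x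
  proof (cases "\<bar>g x\<bar> \<le> 1")
    case True then show ?thesis using R[of x] by (cases "g x = 0") (auto simp: indicator_def add_increasing)
  next
    case False
    then have "\<bar>g x\<bar> powr 1 \<le> \<bar>g x\<bar> powr p" using assms by (intro powr_mono) auto
    then show ?thesis using False by (auto simp: indicator_def)
  qed
  have "integrable lborel (\<lambda>x. \<bar>g x\<bar> powr p + indicator (cball 0 R) x)"
    using i finite_measure.emeasure_finite by (intro Bochner_Integration.integrable_add integrable_real_indicator emeasure_lborel_cball_finite) auto
  then show "integrable lborel g"
    by (rule Bochner_Integration.integrable_bound) (use le in \<open>auto intro!: AE_I2 order_trans[OF le]\<close>)
qed

lemma integrable_powr_add:
  fixes f g :: "'a \<Rightarrow> real"
  assumes [measurable]: "f \<in> borel_measurable M" "g \<in> borel_measurable M"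
    and f: "integrable M (\<lambda>x. \<bar>f x\<bar> powr p)" and g: "integrable M (\<lambda>x. \<bar>g x\<bar> powr p)" and "0 \<le> p"
  shows "integrable M (\<lambda>x. \<bar>f x + g x\<bar> powr p)"
    "(LINT x|M. \<bar>f x + g x\<bar> powr p) \<le> 2 powr p * ((LINT x|M. \<bar>f x\<bar> powr p) + (LINT x|M. \<bar>g x\<bar> powr p))"
proof -
  have i: "integrable M (\<lambda>x. 2 powr p * (\<bar>f x\<bar> powr p + \<bar>g x\<bar> powr p))" using f g by simp
  show j: "integrable M (\<lambda>x. \<bar>f x + g x\<bar> powr p)"
    by (rule Bochner_Integration.integrable_bound[OF i]) (auto simp: powr_add_le[OF \<open>0 \<le> p\<close>])
  have "(LINT x|M. \<bar>f x + g x\<bar> powr p) \<le> (LINT x|M. 2 powr p * (\<bar>f x\<bar> powr p + \<bar>g x\<bar> powr p))"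
    by (intro integral_mono i j powr_add_le \<open>0 \<le> p\<close>)
  then show "(LINT x|M. \<bar>f x + g x\<bar> powr p) \<le> 2 powr p * ((LINT x|M. \<bar>f x\<bar> powr p) + (LINT x|M. \<bar>g x\<bar> powr p))"
    using f g by simp
qed

lemma Lp_bounded_support_lin:
  assumes "Lp_bounded_support p g" "Lp_bounded_support p h" "1 \<le> p"
  shows "Lp_bounded_support p (\<lambda>x. a * g x + b * h x)"
  unfolding Lp_bounded_support_def
proof (intro conjI)
  note g = Lp_bounded_supportD[OF assms(1,3)] and h = Lp_bounded_supportD[OF assms(2,3)]
  note [measurable] = g(1) h(1)
  show "(\<lambda>x. a * g x + b * h x) \<in> borel_measurable borel" by measurable
  have "bounded ({x. g x \<noteq> 0} \<union> {x. h x \<noteq> 0})" using assms by (auto simp: Lp_bounded_support_def)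
  then show "bounded {x. a * g x + b * h x \<noteq> 0}" by (rule bounded_subset) auto
  show "integrable lborel (\<lambda>x. \<bar>a * g x + b * h x\<bar> powr p)"
    by (rule integrable_powr_add) (use g(2) h(2) assms(3) in \<open>auto simp: abs_mult powr_mult\<close>)
qed

lemma Lp_bounded_support_diff:
  assumes "Lp_bounded_support p g" "Lp_bounded_support p h" "1 \<le> p"
  shows "Lp_bounded_support p (\<lambda>x. g x - h x)"
  using Lp_bounded_support_lin[OF assms, of 1 "-1"] by simp

lemma Lp_bounded_support_continuous:
  fixes g :: "'a::euclidean_space \<Rightarrow> real"
  assumes "continuous_on UNIV g" "compact K" "\<And>x. x \<notin> K \<Longrightarrow> g x = 0" "0 < p"
  shows "Lp_bounded_support p g"
  unfolding Lp_bounded_support_def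
proof (intro conjI)
  show "g \<in> borel_measurable borel" by (rule borel_measurable_continuous_onI[OF assms(1)])
  show "bounded {x. g x \<noteq> 0}" by (rule bounded_subset[OF compact_imp_bounded[OF assms(2)]]) (use assms(3) in auto)
  have "continuous_on UNIV (\<lambda>x. \<bar>g x\<bar> powr p)" using assms by (intro continuous_on_powr' continuous_intros) auto
  then show "integrable lborel (\<lambda>x. \<bar>g x\<bar> powr p)"
    by (rule integrable_continuous_compact_support[OF _ assms(2)]) (use assms(3) in auto)
qed

text \<open>
  Jensen's inequality for the probability density \<open>y \<mapsto> \<rho> (x - y)\<close>, then Tonelli's theorem.
\<close>
lemma conv_Lp_bound_nn:
  fixes g :: "'a::euclidean_space \<Rightarrow> real"
  assumes m: "mollifier \<epsilon> \<rho>" and g: "Lp_bounded_support p g" and p: "1 \<le> p"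
  shows "(\<integral>\<^sup>+x. ennreal (\<bar>conv \<rho> g x\<bar> powr p) \<partial>lborel) \<le> ennreal (LINT x|lborel. \<bar>g x\<bar> powr p)"
proof -
  note G = Lp_bounded_supportD[OF g p]
  note \<rho> = mollifierD[OF m]
  note [measurable] = G(1) test_functions_measurable[OF \<rho>(1)]
  have pt: "ennreal (\<bar>conv \<rho> g x\<bar> powr p) \<le> (\<integral>\<^sup>+y. ennreal (\<rho> (x - y) * \<bar>g y\<bar> powr p) \<partial>lborel)" for x
  proof -
    have i1: "integrable lborel (\<lambda>y. \<rho> (x - y) * \<bar>g y\<bar>)" and i2: "integrable lborel (\<lambda>y. \<rho> (x - y) * \<bar>g y\<bar> powr p)"
      using G by (auto intro!: conv_integrable[OF \<rho>(1)])
    have "\<bar>conv \<rho> g x\<bar> \<le> (LINT y|lborel. \<rho> (x - y) * \<bar>g y\<bar>)"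
      unfolding conv_def using integral_norm_bound[of lborel "\<lambda>y. \<rho> (x - y) * g y"] \<rho>(2) by (simp add: abs_mult)
    then have "\<bar>conv \<rho> g x\<bar> powr p \<le> (LINT y|lborel. \<rho> (x - y) * \<bar>g y\<bar>) powr p"
      using p by (intro powr_mono2) auto
    also have "\<dots> \<le> (LINT y|lborel. \<rho> (x - y) * \<bar>g y\<bar> powr p)"
      using mollifier_reflect[OF m] i1 i2 \<rho>(2) p by (intro weighted_jensen) auto
    finally show ?thesis
      using \<rho>(2) by (subst nn_integral_eq_integral[OF i2]) (auto intro: ennreal_leI)
  qed
  have "(\<integral>\<^sup>+x. ennreal (\<bar>conv \<rho> g x\<bar> powr p) \<partial>lborel) \<le> (\<integral>\<^sup>+x. \<integral>\<^sup>+y. ennreal (\<rho> (x - y) * \<bar>g y\<bar> powr p) \<partial>lborel \<partial>lborel)"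
    by (rule nn_integral_mono) (rule pt)
  also have "\<dots> = (\<integral>\<^sup>+y. \<integral>\<^sup>+x. ennreal (\<rho> (x - y) * \<bar>g y\<bar> powr p) \<partial>lborel \<partial>lborel)"
    by (rule lborel_pair.Fubini'[symmetric]) measurable
  also have "\<dots> = (\<integral>\<^sup>+y. ennreal (\<bar>g y\<bar> powr p) \<partial>lborel)"
  proof (rule nn_integral_cong)
    fix y :: 'a
    have "(\<integral>\<^sup>+x. ennreal (\<rho> (x - y) * \<bar>g y\<bar> powr p) \<partial>lborel) = (\<integral>\<^sup>+x. ennreal (\<rho> (- y + x)) * ennreal (\<bar>g y\<bar> powr p) \<partial>lborel)"
      by (intro nn_integral_cong) (simp add: ennreal_mult \<rho>(2) algebra_simps)
    also have "\<dots> = (\<integral>\<^sup>+x. ennreal (\<rho> (- y + x)) \<partial>lborel) * ennreal (\<bar>g y\<bar> powr p)"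
      by (rule nn_integral_multc) measurable
    also have "(\<integral>\<^sup>+x. ennreal (\<rho> (- y + x)) \<partial>lborel) = (\<integral>\<^sup>+x. ennreal (\<rho> x) \<partial>lborel)"
      by (rule nn_integral_lborel_translate) measurable
    also have "\<dots> = 1" using nn_integral_eq_integral[OF \<rho>(5)] \<rho>(2,4) by simp
    finally show "(\<integral>\<^sup>+x. ennreal (\<rho> (x - y) * \<bar>g y\<bar> powr p) \<partial>lborel) = ennreal (\<bar>g y\<bar> powr p)" by simp
  qed
  also have "\<dots> = ennreal (LINT x|lborel. \<bar>g x\<bar> powr p)" by (rule nn_integral_eq_integral[OF G(2)]) simp
  finally show ?thesis .
qed

lemma conv_outside:
  assumes "mollifier \<epsilon> \<rho>" "\<And>y. norm y > R \<Longrightarrow> g y = 0" "norm x > R + \<epsilon>"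
  shows "conv \<rho> g x = 0"
proof -
  have "\<rho> (x - y) * g y = 0" for y
  proof (cases "norm y > R")
    case False
    then have "norm (x - y) > \<epsilon>" using assms(3) norm_triangle_sub[of x y] by linarith
    then show ?thesis using mollifierD(3)[OF assms(1)] by simp
  qed (use assms in auto)
  then have "(\<lambda>y. \<rho> (x - y) * g y) = (\<lambda>y. 0)" by blast
  then show ?thesis by (simp add: conv_def)
qed

lemma conv_Lp_bound:
  fixes g :: "'a::euclidean_space \<Rightarrow> real"
  assumes m: "mollifier \<epsilon> \<rho>" and g: "Lp_bounded_support p g" and p: "1 \<le> p"
  shows "Lp_bounded_support p (conv \<rho> g)"
    "(LINT x|lborel. \<bar>conv \<rho> g x\<bar> powr p) \<le> (LINT x|lborel. \<bar>g x\<bar> powr p)"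
proof -
  note G = Lp_bounded_supportD[OF g p]
  have [measurable]: "conv \<rho> g \<in> borel_measurable borel"
    by (rule conv_measurable[OF mollifierD(1)[OF m] G(3)])
  have fin: "(\<integral>\<^sup>+x. ennreal (\<bar>conv \<rho> g x\<bar> powr p) \<partial>lborel) < \<infinity>"
    using conv_Lp_bound_nn[OF assms] by (rule order.strict_trans1) simp
  have i: "integrable lborel (\<lambda>x. \<bar>conv \<rho> g x\<bar> powr p)"
    using fin by (intro integrableI_nonneg) auto
  obtain R where R: "\<And>x. g x \<noteq> 0 \<Longrightarrow> norm x \<le> R" using g by (auto simp: Lp_bounded_support_def bounded_iff)
  have "bounded {x. conv \<rho> g x \<noteq> 0}"
    unfolding bounded_iff using conv_outside[OF m, of R g] R by (metis (mono_tags, lifting) linorder_not_less mem_Collect_eq)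
  with i show "Lp_bounded_support p (conv \<rho> g)" by (simp add: Lp_bounded_support_def)
  show "(LINT x|lborel. \<bar>conv \<rho> g x\<bar> powr p) \<le> (LINT x|lborel. \<bar>g x\<bar> powr p)"
    using conv_Lp_bound_nn[OF assms] by (subst (asm) nn_integral_eq_integral[OF i]) (auto intro: integral_nonneg_AE)
qed

lemma conv_minus_const:
  assumes "mollifier \<epsilon> \<rho>" "integrable lborel h"
  shows "conv \<rho> h x - c = (LINT y|lborel. \<rho> (x - y) * (h y - c))"
proof -
  have "(LINT y|lborel. \<rho> (x - y) * (h y - c)) = (LINT y|lborel. \<rho> (x - y) * h y - \<rho> (x - y) * c)"
    by (simp add: algebra_simps)
  also have "\<dots> = conv \<rho> h x - c"
    using conv_integrable[OF mollifierD(1)[OF assms(1)] assms(2)] mollifier_reflect[OF assms(1)] by (simp add: conv_def)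
  finally show ?thesis by simp
qed

text \<open>
  The convolution is an average of values of \<open>h\<close> at distance at most \<open>\<epsilon>\<close>, and \<open>h\<close> is uniformly
  continuous.
\<close>
lemma conv_uniform_approx:
  fixes h :: "'a::euclidean_space \<Rightarrow> real"
  assumes h: "continuous_on UNIV h" "\<And>x. norm x > R \<Longrightarrow> h x = 0" and \<eta>: "\<eta> > 0"
  shows "\<exists>\<epsilon>0>0. \<forall>\<epsilon> \<rho> x. \<epsilon> < \<epsilon>0 \<longrightarrow> mollifier \<epsilon> \<rho> \<longrightarrow> \<bar>conv \<rho> h x - h x\<bar> \<le> \<eta>"
proof -
  have int: "integrable lborel h"
    by (rule integrable_continuous_compact_support[OF h(1) compact_cball[of 0 R]]) (use h(2) in auto)
  have "uniformly_continuous_on (cball 0 (R + 2)) h"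
    by (rule compact_uniformly_continuous) (use h(1) continuous_on_subset in auto)
  then obtain d where d: "d > 0" "\<And>x y. norm x \<le> R + 2 \<Longrightarrow> norm y \<le> R + 2 \<Longrightarrow> dist y x < d \<Longrightarrow> dist (h y) (h x) < \<eta>"
    unfolding uniformly_continuous_on_def using \<eta> by (metis mem_cball_0)
  show ?thesis
  proof (intro exI[of _ "min d 1"] conjI allI impI)
    fix \<epsilon> :: real and \<rho> :: "'a \<Rightarrow> real" and x :: 'a
    assume e: "\<epsilon> < min d 1" and m: "mollifier \<epsilon> \<rho>"
    note \<rho> = mollifierD[OF m]
    have osc: "\<bar>h y - h x\<bar> \<le> \<eta>" if "norm (x - y) \<le> \<epsilon>" for y
    proof (cases "norm x \<le> R + 1")
      case True
      then have "norm y \<le> R + 2" using that e norm_triangle_ineq4[of x "x - y"] by simp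
      moreover have "dist y x < d" using that e by (simp add: dist_norm norm_minus_commute)
      ultimately show ?thesis using d(2)[of x y] True by (simp add: dist_real_def)
    next
      case False
      then have "norm y > R" using that e norm_triangle_sub[of x y] by simp
      then show ?thesis using False h(2) \<eta> by simp
    qed
    have "\<bar>conv \<rho> h x - h x\<bar> = \<bar>LINT y|lborel. \<rho> (x - y) * (h y - h x)\<bar>"
      by (simp add: conv_minus_const[OF m int])
    also have "\<dots> \<le> (LINT y|lborel. \<eta> * \<rho> (x - y))"
    proof (rule abs_integral_le)
      have "integrable lborel (\<lambda>y. \<rho> (x - y) * h y - \<rho> (x - y) * h x)"
        using conv_integrable[OF \<rho>(1) int] mollifier_reflect[OF m] by simp
      then show "integrable lborel (\<lambda>y. \<rho> (x - y) * (h y - h x))" by (simp add: algebra_simps)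
      show "integrable lborel (\<lambda>y. \<eta> * \<rho> (x - y))" using mollifier_reflect[OF m] by simp
      show "\<bar>\<rho> (x - y) * (h y - h x)\<bar> \<le> \<eta> * \<rho> (x - y)" for y
      proof (cases "norm (x - y) \<le> \<epsilon>")
        case True
        then show ?thesis using mult_left_mono[OF osc[OF True] \<rho>(2)[of "x - y"]] \<rho>(2) by (simp add: abs_mult mult.commute)
      next
        case False then show ?thesis using \<rho>(3)[of "x - y"] by simp
      qed
    qed
    also have "\<dots> = \<eta>" using mollifier_reflect[OF m] by simp
    finally show "\<bar>conv \<rho> h x - h x\<bar> \<le> \<eta>" .
  qed (use d in auto)
qed

lemma Lp_truncation:
  fixes g :: "'a::euclidean_space \<Rightarrow> real"
  assumes g: "Lp_bounded_support p g" and p: "1 \<le> p" and \<eta>: "\<eta> > 0"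
  shows "\<exists>m>0. (LINT x|lborel. \<bar>g x - max (- m) (min m (g x))\<bar> powr p) < \<eta>"
proof -
  note G = Lp_bounded_supportD[OF g p]
  note [measurable] = G(1)
  have "(\<lambda>m. LINT x|lborel. \<bar>g x - max (- real m) (min (real m) (g x))\<bar> powr p) \<longlonglongrightarrow> (LINT x::'a|lborel. 0)"
  proof (rule integral_dominated_convergence[where w="\<lambda>x. \<bar>g x\<bar> powr p" and M="lborel"])
    show "AE x in lborel. (\<lambda>m. \<bar>g x - max (- real m) (min (real m) (g x))\<bar> powr p) \<longlonglongrightarrow> 0"
    proof (rule AE_I2)
      fix x
      show "(\<lambda>m. \<bar>g x - max (- real m) (min (real m) (g x))\<bar> powr p) \<longlonglongrightarrow> 0"
      proof (rule tendsto_eventually)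
        have "eventually (\<lambda>m. \<bar>g x\<bar> \<le> real m) sequentially"
          using eventually_ge_at_top[of "nat \<lceil>\<bar>g x\<bar>\<rceil>"] by eventually_elim linarith
        then show "\<forall>\<^sub>F m in sequentially. \<bar>g x - max (- real m) (min (real m) (g x))\<bar> powr p = 0"
          by eventually_elim (simp add: min_def max_def abs_if split: if_splits)
      qed
    qed
    show "AE x in lborel. norm (\<bar>g x - max (- real m) (min (real m) (g x))\<bar> powr p) \<le> \<bar>g x\<bar> powr p" for m
      using p by (intro AE_I2) (auto intro!: powr_mono2 simp: min_def max_def abs_if split: if_splits)
  qed (use G in auto)
  then have "eventually (\<lambda>m. (LINT x|lborel. \<bar>g x - max (- real m) (min (real m) (g x))\<bar> powr p) < \<eta>) sequentially"
    using \<eta> by (intro order_tendstoD(2)[where a=\<eta>]) auto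
  then have "eventually (\<lambda>m. 0 < real m \<and> (LINT x|lborel. \<bar>g x - max (- real m) (min (real m) (g x))\<bar> powr p) < \<eta>) sequentially"
    using eventually_gt_at_top[of 0] by eventually_elim auto
  then obtain m where "0 < real m \<and> (LINT x|lborel. \<bar>g x - max (- real m) (min (real m) (g x))\<bar> powr p) < \<eta>"
    by (auto dest!: eventually_happens simp del: of_nat_0_less_iff)
  then show ?thesis by blast
qed

text \<open>
  A measurable function is an almost everywhere limit of continuous functions. After truncation of
  \<open>g\<close> and of these functions to \<open>[-m, m]\<close>, and multiplication by a continuous cutoff, dominated
  convergence turns the pointwise limit into one in \<open>L\<^sup>p\<close>.
\<close>
lemma Lp_dense_continuous:
  fixes g :: "'a::euclidean_space \<Rightarrow> real"
  assumes g: "Lp_bounded_support p g" and p: "1 \<le> p" and \<eta>: "\<eta> > 0"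
  shows "\<exists>h R. continuous_on UNIV h \<and> (\<forall>x. norm x > R \<longrightarrow> h x = 0) \<and> (LINT x|lborel. \<bar>g x - h x\<bar> powr p) < \<eta>"
proof -
  note G = Lp_bounded_supportD[OF g p]
  note [measurable] = G(1)
  define \<eta>' where "\<eta>' = \<eta> / (2 powr p * 2)"
  have \<eta>': "\<eta>' > 0" using \<eta> by (simp add: \<eta>'_def)
  obtain R where R: "\<And>x. g x \<noteq> 0 \<Longrightarrow> norm x \<le> R" using g by (auto simp: Lp_bounded_support_def bounded_iff)
  obtain m where m: "m > 0" "(LINT x|lborel. \<bar>g x - max (- m) (min m (g x))\<bar> powr p) < \<eta>'"
    using Lp_truncation[OF g p \<eta>'] by blast
  define T where "T t = max (- m) (min m t)" for t :: real
  have Tb: "\<bar>T t\<bar> \<le> m" for t using m(1) by (auto simp: T_def)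
  have T0: "T 0 = 0" using m(1) by (simp add: T_def)
  define c where "c x = max 0 (min 1 (R + 1 - norm x))" for x :: 'a
  have c: "0 \<le> c x" "c x \<le> 1" "norm x \<le> R \<Longrightarrow> c x = 1" "norm x > R + 1 \<Longrightarrow> c x = 0" for x by (auto simp: c_def)
  have [measurable]: "T \<in> borel_measurable borel" "c \<in> borel_measurable borel"
    unfolding T_def c_def by measurable
  have "g \<in> borel_measurable lebesgue" using G(1) by (simp add: measurable_completion)
  then have "g measurable_on UNIV" by (simp add: lebesgue_measurable_imp_measurable_on)
  then obtain N F where N: "negligible N" and F: "\<And>n. continuous_on UNIV (F n)" "\<And>x. x \<notin> N \<Longrightarrow> (\<lambda>n. F n x) \<longlonglongrightarrow> g x"
    unfolding measurable_on_def by auto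
  have [measurable]: "F n \<in> borel_measurable borel" for n by (rule borel_measurable_continuous_onI[OF F(1)])
  have NAE: "AE x in lborel. x \<notin> N"
    using N AE_not_in[of N lebesgue] by (simp add: negligible_iff_null_sets AE_completion_iff)
  \<comment> \<open>\<open>c * T (F n x)\<close> is bounded by \<open>m\<close> and supported in a fixed ball, which provides the dominating
    function.\<close>
  define h where "h n x = c x * T (F n x)" for n x
  have hcont: "continuous_on UNIV (h n)" for n
    unfolding h_def c_def T_def using F(1)[of n] by (intro continuous_intros) auto
  have [measurable]: "h n \<in> borel_measurable borel" for n by (rule borel_measurable_continuous_onI[OF hcont])
  have Tg0: "c x * T (g x) = T (g x)" for x
    using R[of x] c(3)[of x] T0 by (cases "g x = 0") auto
  have "(\<lambda>n. LINT x|lborel. \<bar>T (g x) - h n x\<bar> powr p) \<longlonglongrightarrow> (LINT x::'a|lborel. 0)"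
  proof (rule integral_dominated_convergence[where w="\<lambda>x. indicator (cball 0 (R + 1)) x *\<^sub>R (2 * m) powr p" and M="lborel"])
    show "integrable lborel (\<lambda>x::'a. indicator (cball 0 (R + 1)) x *\<^sub>R (2 * m) powr p)"
      by (intro integrable_scaleR_left integrable_real_indicator emeasure_lborel_cball_finite) auto
    show "AE x in lborel. (\<lambda>n. \<bar>T (g x) - h n x\<bar> powr p) \<longlonglongrightarrow> 0"
      using NAE
    proof eventually_elim
      case (elim x)
      have "(\<lambda>n. h n x) \<longlonglongrightarrow> c x * T (g x)"
        unfolding h_def T_def by (intro tendsto_intros tendsto_max tendsto_min F(2) elim)
      then have "(\<lambda>n. \<bar>T (g x) - h n x\<bar>) \<longlonglongrightarrow> \<bar>T (g x) - T (g x)\<bar>"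
        unfolding Tg0 by (intro tendsto_intros)
      then have "(\<lambda>n. \<bar>T (g x) - h n x\<bar> powr p) \<longlonglongrightarrow> \<bar>T (g x) - T (g x)\<bar> powr p"
        using p by (intro tendsto_powr') auto
      then show ?case using p by simp
    qed
    show "AE x in lborel. norm (\<bar>T (g x) - h n x\<bar> powr p) \<le> indicator (cball 0 (R + 1)) x *\<^sub>R (2 * m) powr p" for n
    proof (rule AE_I2)
      fix x
      have e: "T (g x) - h n x = c x * (T (g x) - T (F n x))"
        using Tg0[of x] by (simp add: h_def algebra_simps)
      have "\<bar>T (g x) - h n x\<bar> \<le> 1 * (2 * m)"
        unfolding e abs_mult using c[of x] Tb[of "g x"] Tb[of "F n x"] by (intro mult_mono) auto
      then have "\<bar>T (g x) - h n x\<bar> powr p \<le> (2 * m) powr p" using p by (intro powr_mono2) auto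
      moreover have "T (g x) - h n x = 0" if "norm x > R + 1" unfolding e using c(4)[OF that] by simp
      ultimately show "norm (\<bar>T (g x) - h n x\<bar> powr p) \<le> indicator (cball 0 (R + 1)) x *\<^sub>R (2 * m) powr p"
        by (auto simp: indicator_def)
    qed
  qed auto
  then have "eventually (\<lambda>n. (LINT x|lborel. \<bar>T (g x) - h n x\<bar> powr p) < \<eta>') sequentially"
    using \<eta>' by (intro order_tendstoD(2)[where a=\<eta>']) auto
  then obtain n where n: "(LINT x|lborel. \<bar>T (g x) - h n x\<bar> powr p) < \<eta>'" by (auto dest!: eventually_happens)
  have hz: "h n x = 0" if "norm x > R + 1" for x using c(4)[OF that] by (simp add: h_def)
  have hL: "Lp_bounded_support p (h n)"
    by (rule Lp_bounded_support_continuous[OF hcont compact_cball[of 0 "R + 1"]]) (use hz p in auto)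
  have TL: "Lp_bounded_support p (\<lambda>x. T (g x))"
    unfolding Lp_bounded_support_def
  proof (intro conjI)
    show "bounded {x. T (g x) \<noteq> 0}" using R T0 unfolding bounded_iff by (metis (mono_tags, lifting) mem_Collect_eq)
    show "integrable lborel (\<lambda>x. \<bar>T (g x)\<bar> powr p)"
      by (rule Bochner_Integration.integrable_bound[OF G(2)])
        (use p m(1) in \<open>auto intro!: AE_I2 powr_mono2 simp: T_def min_def max_def abs_if\<close>)
  qed measurable
  note D1 = Lp_bounded_supportD[OF Lp_bounded_support_diff[OF g TL p] p]
  note D2 = Lp_bounded_supportD[OF Lp_bounded_support_diff[OF TL hL p] p]
  have "(LINT x|lborel. \<bar>(g x - T (g x)) + (T (g x) - h n x)\<bar> powr p) \<le> 2 powr p * ((LINT x|lborel. \<bar>g x - T (g x)\<bar> powr p) + (LINT x|lborel. \<bar>T (g x) - h n x\<bar> powr p))"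
    using D1(1,2) D2(1,2) p by (intro integrable_powr_add(2)) auto
  also have "\<dots> < 2 powr p * (\<eta>' + \<eta>')" using n m(2) unfolding T_def by (intro mult_strict_left_mono add_strict_mono) auto
  also have "\<dots> = \<eta>" by (simp add: \<eta>'_def)
  finally have "(LINT x|lborel. \<bar>g x - h n x\<bar> powr p) < \<eta>" by simp
  with hcont hz show ?thesis by blast
qed

text \<open>
  Split \<open>g = (g - h) + h\<close> with a continuous \<open>h\<close> close to \<open>g\<close> in \<open>L\<^sup>p\<close>: the first part is small
  before and after mollification, uniformly in the mollifier, and the second one converges
  uniformly.
\<close>
lemma conv_Lp_approx:
  fixes g :: "'a::euclidean_space \<Rightarrow> real"
  assumes g: "Lp_bounded_support p g" and p: "1 \<le> p" and \<eta>: "\<eta> > 0"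
  shows "\<exists>\<epsilon>0>0. \<forall>\<epsilon> \<rho>. \<epsilon> < \<epsilon>0 \<longrightarrow> mollifier \<epsilon> \<rho> \<longrightarrow> (LINT x|lborel. \<bar>conv \<rho> g x - g x\<bar> powr p) < \<eta>"
proof -
  define \<eta>' where "\<eta>' = \<eta> / (2 powr p * 2 powr p * 4)"
  have \<eta>': "\<eta>' > 0" using \<eta> by (simp add: \<eta>'_def)
  obtain h R where h: "continuous_on UNIV h" "\<And>x. norm x > R \<Longrightarrow> h x = 0" and gh: "(LINT x|lborel. \<bar>g x - h x\<bar> powr p) < \<eta>'"
    using Lp_dense_continuous[OF g p \<eta>'] by blast
  have hL: "Lp_bounded_support p h"
    by (rule Lp_bounded_support_continuous[OF h(1) compact_cball[of 0 R]]) (use h(2) p in auto)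
  define V where "V = measure lborel (cball (0::'a) (R + 1))"
  \<comment> \<open>A uniform error \<open>s\<close> costs at most \<open>s\<^sup>p V\<close> in the integral, as everything lives in a ball of
    volume \<open>V\<close>.\<close>
  define s where "s = (\<eta>' / (V + 1)) powr (1 / p)"
  have V: "V \<ge> 0" by (simp add: V_def)
  have s: "s > 0" "s powr p = \<eta>' / (V + 1)" using \<eta>' V p by (auto simp: s_def powr_powr)
  obtain \<epsilon>1 where \<epsilon>1: "\<epsilon>1 > 0" "\<And>\<epsilon> \<rho> x. \<epsilon> < \<epsilon>1 \<Longrightarrow> mollifier \<epsilon> \<rho> \<Longrightarrow> \<bar>conv \<rho> h x - h x\<bar> \<le> s"
    using conv_uniform_approx[OF h s(1)] by blast
  have main: "(LINT x|lborel. \<bar>conv \<rho> g x - g x\<bar> powr p) < \<eta>" if e: "\<epsilon> < min \<epsilon>1 1" and m: "mollifier \<epsilon> \<rho>" for \<epsilon> \<rho>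
  proof -
    note dL = Lp_bounded_support_diff[OF g hL p]
    note cL = conv_Lp_bound[OF m dL p]
    note G = Lp_bounded_supportD[OF g p] and H = Lp_bounded_supportD[OF hL p]
    note chL = conv_Lp_bound(1)[OF m hL p]
    note eL = Lp_bounded_support_diff[OF chL hL p]
    have "(LINT x|lborel. \<bar>conv \<rho> h x - h x\<bar> powr p) \<le> (LINT x|lborel. indicator (cball (0::'a) (R + 1)) x *\<^sub>R s powr p)"
    proof (rule integral_mono)
      show "integrable lborel (\<lambda>x. \<bar>conv \<rho> h x - h x\<bar> powr p)" using Lp_bounded_supportD(2)[OF eL p] .
      show "integrable lborel (\<lambda>x::'a. indicator (cball 0 (R + 1)) x *\<^sub>R s powr p)"
        by (intro integrable_scaleR_left integrable_real_indicator emeasure_lborel_cball_finite) auto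
      fix x :: 'a
      have "conv \<rho> h x - h x = 0" if "norm x > R + 1"
        using that e by (simp add: conv_outside[OF m h(2)] h(2))
      then show "\<bar>conv \<rho> h x - h x\<bar> powr p \<le> indicator (cball 0 (R + 1)) x *\<^sub>R s powr p"
        using \<epsilon>1(2)[OF _ m, of x] e p by (auto simp: indicator_def intro!: powr_mono2)
    qed
    also have "\<dots> = V * s powr p" unfolding V_def by simp
    also have "\<dots> < \<eta>'" using \<eta>' V by (simp add: s(2) field_simps)
    finally have c1: "(LINT x|lborel. \<bar>conv \<rho> h x - h x\<bar> powr p) < \<eta>'" .
    have c2: "(LINT x|lborel. \<bar>conv \<rho> (\<lambda>x. g x - h x) x\<bar> powr p) < \<eta>'" using cL(2) gh by linarith
    have c3: "(LINT x|lborel. \<bar>h x - g x\<bar> powr p) < \<eta>'" using gh by (simp add: abs_minus_commute)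
    note eD = Lp_bounded_supportD[OF eL p] and cD = Lp_bounded_supportD[OF cL(1) p]
      and hg = Lp_bounded_supportD[OF Lp_bounded_support_diff[OF hL g p] p]
    note A = integrable_powr_add[OF _ _ eD(2) hg(2)]
    have A1: "integrable lborel (\<lambda>x. \<bar>(conv \<rho> h x - h x) + (h x - g x)\<bar> powr p)"
      and A2: "(LINT x|lborel. \<bar>(conv \<rho> h x - h x) + (h x - g x)\<bar> powr p) \<le> 2 powr p * ((LINT x|lborel. \<bar>conv \<rho> h x - h x\<bar> powr p) + (LINT x|lborel. \<bar>h x - g x\<bar> powr p))"
      using A eD(1) hg(1) p by auto
    have eq: "conv \<rho> g x - g x = conv \<rho> (\<lambda>x. g x - h x) x + ((conv \<rho> h x - h x) + (h x - g x))" for x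
      using conv_diff[OF mollifierD(1)[OF m] G(3) H(3)] by simp
    have "(LINT x|lborel. \<bar>conv \<rho> g x - g x\<bar> powr p) \<le> 2 powr p * ((LINT x|lborel. \<bar>conv \<rho> (\<lambda>x. g x - h x) x\<bar> powr p)
        + (LINT x|lborel. \<bar>(conv \<rho> h x - h x) + (h x - g x)\<bar> powr p))"
      unfolding eq using cD(1,2) borel_measurable_add[OF eD(1) hg(1)] A1 p by (intro integrable_powr_add(2)) simp_all
    also have "\<dots> \<le> 2 powr p * (2 powr p * \<eta>' + 2 powr p * (\<eta>' + \<eta>'))"
    proof (intro mult_left_mono add_mono)
      show "(LINT x|lborel. \<bar>conv \<rho> (\<lambda>x. g x - h x) x\<bar> powr p) \<le> 2 powr p * \<eta>'"
        using c2 \<eta>' p ge_one_powr_ge_zero[of 2 p] mult_right_mono[of 1 "2 powr p" \<eta>'] by linarith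
      show "(LINT x|lborel. \<bar>(conv \<rho> h x - h x) + (h x - g x)\<bar> powr p) \<le> 2 powr p * (\<eta>' + \<eta>')"
        using c1 c3 by (intro order_trans[OF A2] mult_left_mono) auto
    qed auto
    also have "\<dots> < 2 powr p * 2 powr p * 4 * \<eta>'" using \<eta>' by (simp add: algebra_simps)
    also have "\<dots> = \<eta>" by (simp add: \<eta>'_def)
    finally show ?thesis .
  qed
  show ?thesis by (rule exI[of _ "min \<epsilon>1 1"]) (use \<epsilon>1(1) main in auto)
qed

section \<open>Cutoff functions\<close>

lemma Cm_on_reflect:
  fixes f :: "'a::real_normed_vector \<Rightarrow> real"
  shows "Cm_on m f UNIV \<Longrightarrow> Cm_on m (\<lambda>y. f (c - y)) UNIV"
proof (induction m arbitrary: f)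
  case 0 then show ?case
    by (auto intro!: continuous_on_compose2[of UNIV f] continuous_intros)
next
  case (Suc m)
  have "((\<lambda>y. f (c - y)) has_derivative (\<lambda>v. frechet_derivative f (at (c - y)) (- v))) (at y)" for y
    by (rule has_derivative_compose[OF _ Cm_on_has_derivative[OF Suc.prems]]) (auto intro!: derivative_eq_intros)
  then show ?case by (rule Cm_on_SucI) (intro Suc.IH[OF Cm_on_frechet[OF Suc.prems]])
qed

lemma smooth_reflect:
  fixes f :: "'a::real_normed_vector \<Rightarrow> real"
  shows "smooth_on f UNIV \<Longrightarrow> smooth_on (\<lambda>y. f (c - y)) UNIV"
  by (simp add: smooth_on_def Cm_on_reflect)

lemma frechet_reflect:
  fixes f :: "'a::real_normed_vector \<Rightarrow> real"
  assumes "smooth_on f UNIV"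
  shows "frechet_derivative (\<lambda>y. f (c - y)) (at y) v = - frechet_derivative f (at (c - y)) v"
proof -
  have "((\<lambda>y. f (c - y)) has_derivative (\<lambda>v. frechet_derivative f (at (c - y)) (- v))) (at y)"
    by (rule has_derivative_compose[OF _ smooth_has_derivative[OF assms]]) (auto intro!: derivative_eq_intros)
  from frechet_derivative_at[OF this] show ?thesis
    using linear_neg[OF smooth_linear_frechet[OF assms]] by (metis (no_types, lifting))
qed

text \<open>Mollify the indicator of a closed neighbourhood of \<open>K\<close>.\<close>
lemma cutoff_exists:
  fixes K U :: "'a::euclidean_space set"
  assumes K: "compact K" "K \<subseteq> U" and U: "open U"
  shows "\<exists>\<phi>\<in>test_functions U. (\<forall>x. 0 \<le> \<phi> x \<and> \<phi> x \<le> 1) \<and> (\<forall>x\<in>K. \<phi> x = 1)"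
proof -
  obtain e where e: "e > 0" "(\<Union>x\<in>K. cball x e) \<subseteq> U"
    using compact_subset_open_imp_cball_epsilon_subset[OF K(1) U K(2)] by blast
  define A where "A = (\<Union>x\<in>K. cball x (e / 2))"
  have A: "compact A" unfolding A_def by (rule compact_minkowski_sum_cball[OF K(1)])
  have [measurable]: "A \<in> sets borel" by (rule borel_compact[OF A])
  have int: "integrable lborel (indicator A :: 'a \<Rightarrow> real)"
    by (rule integrable_real_indicator) (use emeasure_compact_finite[OF A] in auto)
  obtain \<rho> :: "'a \<Rightarrow> real" where m: "mollifier (e / 2) \<rho>" using mollifier_exists[of "e / 2"] e by auto
  note \<rho> = mollifierD[OF m]
  note r = mollifier_reflect[OF m]
  define \<phi> where "\<phi> = conv \<rho> (indicator A)"
  have ci: "integrable lborel (\<lambda>y. \<rho> (x - y) * indicator A y)" for x by (rule conv_integrable[OF \<rho>(1) int])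
  have ge: "0 \<le> \<phi> x" for x unfolding \<phi>_def conv_def by (intro integral_nonneg_AE AE_I2) (auto simp: \<rho>(2))
  have le: "\<phi> x \<le> 1" for x
  proof -
    have "\<phi> x \<le> (LINT y|lborel. \<rho> (x - y))" unfolding \<phi>_def conv_def
      by (rule integral_mono[OF ci r(1)]) (auto simp: indicator_def \<rho>(2))
    then show ?thesis using r(2) by simp
  qed
  have one: "\<phi> x = 1" if "x \<in> K" for x
  proof -
    have "\<rho> (x - y) * indicator A y = \<rho> (x - y)" for y
    proof (cases "norm (x - y) > e / 2")
      case False
      then have "y \<in> A" using that unfolding A_def by (auto simp: dist_norm intro!: bexI[of _ x])
      then show ?thesis by simp
    qed (simp add: \<rho>(3))
    then have "\<phi> x = (LINT y|lborel. \<rho> (x - y))" unfolding \<phi>_def conv_def by (simp only:)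
    then show ?thesis using r(2) by simp
  qed
  have "\<phi> \<in> test_functions U"
  proof (rule test_functionsI[OF _ compact_minkowski_sum_cball[OF K(1)] e(2)])
    show "smooth_on \<phi> UNIV" unfolding \<phi>_def by (rule smooth_conv[OF \<rho>(1) int])
    fix x assume x: "x \<notin> (\<Union>x\<in>K. cball x e)"
    have "\<rho> (x - y) * indicator A y = 0" for y
    proof (cases "y \<in> A")
      case True
      then obtain z where z: "z \<in> K" "dist z y \<le> e / 2" by (auto simp: A_def)
      have "dist z x > e" using x z(1) by auto
      then have "norm (x - y) > e / 2" using z(2) dist_triangle[of z x y] by (simp add: dist_norm norm_minus_commute)
      then show ?thesis by (simp add: \<rho>(3))
    qed simp
    then show "\<phi> x = 0" unfolding \<phi>_def conv_def by (simp only: integral_zero)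
  qed
  then show ?thesis using ge le one by blast
qed

section \<open>Borel representatives\<close>

text \<open>
  Functions in the Sobolev spaces are Lebesgue measurable on \<open>\<Omega>\<close> and arbitrary outside, while
  convolution asks for Borel functions on the whole space. A Borel version that vanishes outside
  \<open>\<Omega>\<close> connects the two.
\<close>
definition borel_rep :: "'a::euclidean_space set \<Rightarrow> ('a \<Rightarrow> real) \<Rightarrow> 'a \<Rightarrow> real" where
  "borel_rep \<Omega> u = (SOME g. g \<in> borel_measurable borel \<and> (\<forall>x. x \<notin> \<Omega> \<longrightarrow> g x = 0) \<and>
     (AE x in lebesgue_on \<Omega>. u x = g x))"

lemma borel_rep:
  fixes u :: "'a::euclidean_space \<Rightarrow> real"
  assumes \<Omega>: "open \<Omega>" and u: "u \<in> borel_measurable (lebesgue_on \<Omega>)"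
  shows "borel_rep \<Omega> u \<in> borel_measurable borel" "x \<notin> \<Omega> \<Longrightarrow> borel_rep \<Omega> u x = 0"
    "AE x in lebesgue_on \<Omega>. u x = borel_rep \<Omega> u x"
proof -
  have [measurable]: "\<Omega> \<in> sets borel" using \<Omega> by simp
  have \<Omega>l: "\<Omega> \<in> sets lebesgue" using \<Omega> by simp
  have "(\<lambda>x. if x \<in> \<Omega> then u x else 0) \<in> borel_measurable lebesgue"
    using u \<Omega>l by (simp add: borel_measurable_if)
  then obtain g where g: "g \<in> borel_measurable lborel" "AE x in lborel. (if x \<in> \<Omega> then u x else 0) = g x"
    using completion_ex_borel_measurable_real by blast
  have [measurable]: "g \<in> borel_measurable borel" using g(1) by simp
  have "AE x in lebesgue. (if x \<in> \<Omega> then u x else 0) = g x" using g(2) by (rule AE_completion)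
  then have "AE x in lebesgue_on \<Omega>. u x = indicator \<Omega> x * g x"
    by (subst AE_restrict_space_iff) (use \<Omega>l in \<open>auto elim!: eventually_mono simp: indicator_def split: if_splits\<close>)
  then have "\<exists>g. g \<in> borel_measurable borel \<and> (\<forall>x. x \<notin> \<Omega> \<longrightarrow> g x = 0) \<and> (AE x in lebesgue_on \<Omega>. u x = g x)"
    by (intro exI[of _ "\<lambda>x. indicator \<Omega> x * g x"]) auto
  from someI_ex[OF this] show "borel_rep \<Omega> u \<in> borel_measurable borel" "x \<notin> \<Omega> \<Longrightarrow> borel_rep \<Omega> u x = 0"
    "AE x in lebesgue_on \<Omega>. u x = borel_rep \<Omega> u x" unfolding borel_rep_def by auto
qed

lemma lebesgue_on_lborel:
  fixes f F :: "'a::euclidean_space \<Rightarrow> real"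
  assumes \<Omega>: "open \<Omega>" and f: "f \<in> borel_measurable (lebesgue_on \<Omega>)" and F: "F \<in> borel_measurable borel"
    and F0: "\<And>x. x \<notin> \<Omega> \<Longrightarrow> F x = 0" and eq: "AE x in lebesgue_on \<Omega>. f x = F x"
  shows "integrable (lebesgue_on \<Omega>) f \<longleftrightarrow> integrable lborel F" "(LINT x|lebesgue_on \<Omega>. f x) = (LINT x|lborel. F x)"
proof -
  have \<Omega>l: "\<Omega> \<in> sets lebesgue" using \<Omega> by simp
  have Fl: "F \<in> borel_measurable (lebesgue_on \<Omega>)"
    using F \<Omega>l by (intro measurable_restrict_space1) (simp add: measurable_completion)
  have ind: "(\<lambda>x. indicator \<Omega> x *\<^sub>R F x) = F" using F0 by (auto simp: indicator_def fun_eq_iff)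
  have "integrable (lebesgue_on \<Omega>) f \<longleftrightarrow> integrable (lebesgue_on \<Omega>) F"
    by (rule integrable_cong_AE[OF f Fl eq])
  also have "\<dots> \<longleftrightarrow> integrable lborel F"
    using \<Omega>l F by (simp add: integrable_restrict_space ind integrable_completion del: real_scaleR_def)
  finally show "integrable (lebesgue_on \<Omega>) f \<longleftrightarrow> integrable lborel F" .
  have "(LINT x|lebesgue_on \<Omega>. f x) = (LINT x|lebesgue_on \<Omega>. F x)"
    by (rule integral_cong_AE[OF f Fl eq])
  also have "\<dots> = (LINT x|lborel. F x)"
    using \<Omega>l F by (simp add: integral_restrict_space ind integral_completion del: real_scaleR_def)
  finally show "(LINT x|lebesgue_on \<Omega>. f x) = (LINT x|lborel. F x)" .
qed

lemma borel_measurable_lebesgue_on: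
  "f \<in> borel_measurable borel \<Longrightarrow> f \<in> borel_measurable (lebesgue_on \<Omega>)"
  by (intro measurable_restrict_space1) (simp add: measurable_completion)

lemma borel_rep_Lp:
  fixes u :: "'a::euclidean_space \<Rightarrow> real"
  assumes \<Omega>: "open \<Omega>" "bounded \<Omega>" and u: "u \<in> Lp p \<Omega>"
  shows "Lp_bounded_support p (borel_rep \<Omega> u)"
    "(LINT x|lebesgue_on \<Omega>. \<bar>u x\<bar> powr p) = (LINT x|lborel. \<bar>borel_rep \<Omega> u x\<bar> powr p)"
proof -
  have um: "u \<in> borel_measurable (lebesgue_on \<Omega>)" and ui: "integrable (lebesgue_on \<Omega>) (\<lambda>x. \<bar>u x\<bar> powr p)"
    using u by (auto simp: Lp_def)
  note r = borel_rep[OF \<Omega>(1) um]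
  note [measurable] = r(1) um
  have eq: "AE x in lebesgue_on \<Omega>. \<bar>u x\<bar> powr p = \<bar>borel_rep \<Omega> u x\<bar> powr p" using r(3) by eventually_elim simp
  have conv: "integrable (lebesgue_on \<Omega>) (\<lambda>x. \<bar>u x\<bar> powr p) \<longleftrightarrow> integrable lborel (\<lambda>x. \<bar>borel_rep \<Omega> u x\<bar> powr p)"
    "(LINT x|lebesgue_on \<Omega>. \<bar>u x\<bar> powr p) = (LINT x|lborel. \<bar>borel_rep \<Omega> u x\<bar> powr p)"
    by (rule lebesgue_on_lborel[OF \<Omega>(1) _ _ _ eq]; use r(2) in simp)+
  show "Lp_bounded_support p (borel_rep \<Omega> u)"
    unfolding Lp_bounded_support_def
    using r conv ui by (auto intro: bounded_subset[OF \<Omega>(2)])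
  show "(LINT x|lebesgue_on \<Omega>. \<bar>u x\<bar> powr p) = (LINT x|lborel. \<bar>borel_rep \<Omega> u x\<bar> powr p)" by (rule conv)
qed

text \<open>Turns pairings with test functions on \<open>\<Omega>\<close> into convolutions.\<close>
lemma borel_rep_integral:
  fixes u :: "'a::euclidean_space \<Rightarrow> real"
  assumes \<Omega>: "open \<Omega>" and u: "u \<in> borel_measurable (lebesgue_on \<Omega>)" and h: "h \<in> borel_measurable borel"
  shows "(LINT x|lebesgue_on \<Omega>. u x * h x) = (LINT x|lborel. borel_rep \<Omega> u x * h x)"
proof -
  note r = borel_rep[OF \<Omega>(1) u]
  note [measurable] = r(1) u h borel_measurable_lebesgue_on[OF h]
  have eq: "AE x in lebesgue_on \<Omega>. u x * h x = borel_rep \<Omega> u x * h x" using r(3) by eventually_elim simp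
  show ?thesis by (rule lebesgue_on_lborel(2)[OF \<Omega>(1) _ _ _ eq]) (use r(2) in simp_all)
qed

section \<open>Uniqueness of weak derivatives\<close>

text \<open>All mollifications of \<open>g\<close> vanish, and they converge to \<open>g\<close> in \<open>L\<^sup>1\<close>.\<close>
lemma fundamental_lemma_lborel:
  fixes g :: "'a::euclidean_space \<Rightarrow> real"
  assumes g: "Lp_bounded_support 1 g"
    and z: "\<And>\<epsilon> \<rho> x. \<epsilon> > 0 \<Longrightarrow> mollifier \<epsilon> \<rho> \<Longrightarrow> (LINT y|lborel. g y * \<rho> (x - y)) = 0"
  shows "AE x in lborel. g x = 0"
proof -
  have G: "integrable lborel g" using Lp_bounded_supportD(3)[OF g] by simp
  have "(LINT x|lborel. \<bar>g x\<bar>) \<le> 0 + \<eta>" if \<eta>: "\<eta> > 0" for \<eta>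
  proof -
    obtain \<epsilon>0 where \<epsilon>0: "\<epsilon>0 > 0" "\<And>\<epsilon> \<rho>. \<epsilon> < \<epsilon>0 \<Longrightarrow> mollifier \<epsilon> \<rho> \<Longrightarrow> (LINT x|lborel. \<bar>conv \<rho> g x - g x\<bar> powr 1) < \<eta>"
      using conv_Lp_approx[OF g _ \<eta>] by auto
    obtain \<rho> :: "'a \<Rightarrow> real" where m: "mollifier (\<epsilon>0 / 2) \<rho>" using mollifier_exists[of "\<epsilon>0 / 2"] \<epsilon>0(1) by auto
    have "conv \<rho> g x = 0" for x unfolding conv_def using z[OF _ m, of x] \<epsilon>0(1) by (simp add: mult.commute)
    then show ?thesis using \<epsilon>0(2)[OF _ m] \<epsilon>0(1) by simp
  qed
  then have "(LINT x|lborel. \<bar>g x\<bar>) \<le> 0" by (rule field_le_epsilon)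
  moreover have "(LINT x|lborel. \<bar>g x\<bar>) \<ge> 0" by (rule integral_nonneg_AE) simp
  ultimately have "(LINT x|lborel. \<bar>g x\<bar>) = 0" by simp
  then have "AE x in lborel. \<bar>g x\<bar> = 0" using integral_nonneg_eq_0_iff_AE[of lborel "\<lambda>x. \<bar>g x\<bar>"] G by simp
  then show ?thesis by simp
qed

text \<open>The integrability clause in the definition of \<open>has_weak_deriv\<close>.\<close>
definition loc_integrable :: "'a::euclidean_space set \<Rightarrow> ('a \<Rightarrow> real) \<Rightarrow> bool" where
  "loc_integrable \<Omega> u \<longleftrightarrow> (\<forall>K. compact K \<and> K \<subseteq> \<Omega> \<longrightarrow> u absolutely_integrable_on K)"

lemma loc_integrable_mult_test:
  fixes u :: "'a::euclidean_space \<Rightarrow> real"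
  assumes \<Omega>: "open \<Omega>" and u: "loc_integrable \<Omega> u" and \<phi>: "\<phi> \<in> test_functions \<Omega>"
  shows "integrable lebesgue (\<lambda>x. u x * \<phi> x)" "integrable (lebesgue_on \<Omega>) (\<lambda>x. u x * \<phi> x)"
    "(LINT x|lebesgue_on \<Omega>. u x * \<phi> x) = (LINT x|lebesgue. u x * \<phi> x)"
proof -
  obtain K where K: "compact K" "K \<subseteq> \<Omega>" "\<And>x. x \<notin> K \<Longrightarrow> \<phi> x = 0" using test_functions_support[OF \<phi>] by auto
  obtain B where B: "\<And>x. \<bar>\<phi> x\<bar> \<le> B" using test_functions_bounded[OF \<phi>] by blast
  have i: "integrable lebesgue (\<lambda>x. indicator K x *\<^sub>R u x)"
    using u K unfolding loc_integrable_def set_integrable_def by blast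
  have [measurable]: "\<phi> \<in> borel_measurable lebesgue" using test_functions_measurable[OF \<phi>] by (simp add: measurable_completion)
  have "integrable lebesgue (\<lambda>x. (indicator K x *\<^sub>R u x) * \<phi> x)"
    by (rule Bochner_Integration.integrable_bound[of _ "\<lambda>x. (indicator K x *\<^sub>R u x) * B"])
      (use i in \<open>auto intro!: AE_I2 mult_left_mono order_trans[OF B] simp: abs_mult\<close>)
  moreover have e: "(indicator K x *\<^sub>R u x) * \<phi> x = u x * \<phi> x" for x using K(3)[of x] by (auto simp: indicator_def)
  ultimately show i: "integrable lebesgue (\<lambda>x. u x * \<phi> x)" by (simp only: e)
  have "indicator \<Omega> x *\<^sub>R (u x * \<phi> x) = u x * \<phi> x" for x using K(2) K(3)[of x] by (auto simp: indicator_def)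
  then show "integrable (lebesgue_on \<Omega>) (\<lambda>x. u x * \<phi> x)" "(LINT x|lebesgue_on \<Omega>. u x * \<phi> x) = (LINT x|lebesgue. u x * \<phi> x)"
    using \<Omega> i by (simp_all add: integrable_restrict_space integral_restrict_space del: real_scaleR_def)
qed

text \<open>
  Multiplication by a cutoff that is \<open>1\<close> on a compact set \<open>K\<close> makes \<open>u\<close> a function with compact
  support in \<open>\<Omega>\<close>, of which all mollifications vanish; \<open>\<Omega>\<close> is a countable union of such \<open>K\<close>.
\<close>
lemma fundamental_lemma:
  fixes u :: "'a::euclidean_space \<Rightarrow> real"
  assumes \<Omega>: "open \<Omega>" and u: "loc_integrable \<Omega> u"
    and z: "\<And>\<phi>. \<phi> \<in> test_functions \<Omega> \<Longrightarrow> (LINT x|lebesgue_on \<Omega>. u x * \<phi> x) = 0"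
  shows "AE x in lebesgue_on \<Omega>. u x = 0"
proof -
  have K0: "AE x in lebesgue. x \<in> K \<longrightarrow> u x = 0" if K: "compact K" "K \<subseteq> \<Omega>" for K
  proof -
    obtain \<theta> where \<theta>: "\<theta> \<in> test_functions \<Omega>" "\<And>x. x \<in> K \<Longrightarrow> \<theta> x = 1" using cutoff_exists[OF K \<Omega>] by blast
    obtain L where L: "compact L" "L \<subseteq> \<Omega>" "\<And>x. x \<notin> L \<Longrightarrow> \<theta> x = 0" using test_functions_support[OF \<theta>(1)] by auto
    note i = loc_integrable_mult_test[OF \<Omega> u \<theta>(1)]
    obtain g0 where g0: "g0 \<in> borel_measurable lborel" "AE x in lborel. u x * \<theta> x = g0 x"
      using completion_ex_borel_measurable_real borel_measurable_integrable[OF i(1)] by blast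
    define g where "g x = indicator L x * g0 x" for x
    have [measurable]: "g0 \<in> borel_measurable borel" "L \<in> sets borel" using g0(1) borel_compact[OF L(1)] by auto
    have [measurable]: "g \<in> borel_measurable borel" unfolding g_def by measurable
    have gL: "AE x in lebesgue. u x * \<theta> x = g x"
      using AE_completion[OF g0(2)] by eventually_elim (use L(3) in \<open>auto simp: g_def indicator_def\<close>)
    have gi: "integrable lborel g"
      using i(1) integrable_cong_AE[OF _ _ gL] borel_measurable_integrable[OF i(1)]
      by (simp add: measurable_completion integrable_completion)
    have "Lp_bounded_support 1 g"
      unfolding Lp_bounded_support_def
    proof (intro conjI)
      show "bounded {x. g x \<noteq> 0}"
        by (rule bounded_subset[OF compact_imp_bounded[OF L(1)]]) (auto simp: g_def indicator_def)
    qed (use gi in auto)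
    then have "AE x in lborel. g x = 0"
    proof (rule fundamental_lemma_lborel)
      fix \<epsilon> :: real and \<rho> :: "'a \<Rightarrow> real" and x
      assume m: "mollifier \<epsilon> \<rho>"
      note [measurable] = test_functions_measurable[OF mollifierD(1)[OF m]]
      have t: "(\<lambda>y. \<theta> y * \<rho> (x - y)) \<in> test_functions \<Omega>"
        by (intro test_functions_mult[OF \<theta>(1)] smooth_reflect test_functions_smooth[OF mollifierD(1)[OF m]])
      have "(LINT y|lborel. g y * \<rho> (x - y)) = (LINT y|lebesgue. g y * \<rho> (x - y))"
        by (rule integral_completion[symmetric]) measurable
      also have "\<dots> = (LINT y|lebesgue. u y * (\<theta> y * \<rho> (x - y)))"
      proof (rule integral_cong_AE)
        show "AE y in lebesgue. g y * \<rho> (x - y) = u y * (\<theta> y * \<rho> (x - y))"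
          using gL by eventually_elim simp
      qed (use borel_measurable_integrable[OF loc_integrable_mult_test(1)[OF \<Omega> u t]] in \<open>auto intro!: measurable_completion\<close>)
      also have "\<dots> = 0" using z[OF t] loc_integrable_mult_test(3)[OF \<Omega> u t] by simp
      finally show "(LINT y|lborel. g y * \<rho> (x - y)) = 0" .
    qed
    then have "AE x in lebesgue. g x = 0" by (rule AE_completion)
    then show ?thesis using gL by eventually_elim (use \<theta>(2) in auto)
  qed
  obtain C where C: "\<And>n::nat. compact (C n)" "\<And>n. C n \<subseteq> \<Omega>" "\<Union> (range C) = \<Omega>"
    using open_Union_compact_subsets[OF \<Omega>] by metis
  have "AE x in lebesgue. \<forall>n. x \<in> C n \<longrightarrow> u x = 0" unfolding AE_all_countable by (intro allI K0 C(1,2))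
  then have "AE x in lebesgue. x \<in> \<Omega> \<longrightarrow> u x = 0" by eventually_elim (use C(3) in blast)
  then show ?thesis using \<Omega> by (subst AE_restrict_space_iff) auto
qed

lemma has_weak_derivD:
  assumes "has_weak_deriv \<Omega> v u g"
  shows "loc_integrable \<Omega> u" "loc_integrable \<Omega> g"
    "\<phi> \<in> test_functions \<Omega> \<Longrightarrow> (LINT x|lebesgue_on \<Omega>. u x * frechet_derivative \<phi> (at x) v) = - (LINT x|lebesgue_on \<Omega>. g x * \<phi> x)"
  using assms unfolding has_weak_deriv_def loc_integrable_def by auto

lemma loc_integrable_lin:
  assumes "loc_integrable \<Omega> u" "loc_integrable \<Omega> w"
  shows "loc_integrable \<Omega> (\<lambda>x. a * u x + b * w x)"
  using assms unfolding loc_integrable_def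
  by (auto intro!: set_integral_add set_integrable_mult_right)

lemma has_weak_deriv_lin:
  fixes u w :: "'a::euclidean_space \<Rightarrow> real"
  assumes \<Omega>: "open \<Omega>" and u: "has_weak_deriv \<Omega> v u g" and w: "has_weak_deriv \<Omega> v w h"
  shows "has_weak_deriv \<Omega> v (\<lambda>x. a * u x + b * w x) (\<lambda>x. a * g x + b * h x)"
proof -
  note U = has_weak_derivD[OF u] and W = has_weak_derivD[OF w]
  have lin: "(LINT x|lebesgue_on \<Omega>. (a * u x + b * w x) * \<phi> x) = a * (LINT x|lebesgue_on \<Omega>. u x * \<phi> x) + b * (LINT x|lebesgue_on \<Omega>. w x * \<phi> x)"
    if "loc_integrable \<Omega> u" "loc_integrable \<Omega> w" "\<phi> \<in> test_functions \<Omega>" for \<phi> u w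
    using loc_integrable_mult_test(2)[OF \<Omega> that(1,3)] loc_integrable_mult_test(2)[OF \<Omega> that(2,3)]
    by (simp add: distrib_right mult.assoc)
  show ?thesis
    using loc_integrable_lin[OF U(1) W(1), of a b] loc_integrable_lin[OF U(2) W(2), of a b]
    unfolding has_weak_deriv_def
    by (auto simp: loc_integrable_def lin[OF U(1) W(1) test_functions_frechet] lin[OF U(2) W(2)] U(3) W(3))
qed

lemma has_weak_deriv_unique:
  fixes u :: "'a::euclidean_space \<Rightarrow> real"
  assumes \<Omega>: "open \<Omega>" and g: "has_weak_deriv \<Omega> v u g" and h: "has_weak_deriv \<Omega> v u h"
  shows "AE x in lebesgue_on \<Omega>. g x = h x"
proof -
  have d: "has_weak_deriv \<Omega> v (\<lambda>x. 1 * u x + - 1 * u x) (\<lambda>x. 1 * g x + - 1 * h x)"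
    by (rule has_weak_deriv_lin[OF \<Omega> g h])
  have "AE x in lebesgue_on \<Omega>. 1 * g x + - 1 * h x = 0"
    by (rule fundamental_lemma[OF \<Omega> has_weak_derivD(2)[OF d]]) (use has_weak_derivD(3)[OF d] in auto)
  then show ?thesis by simp
qed

section \<open>Classical derivatives are weak derivatives\<close>

text \<open>
  The integral of a difference quotient vanishes by translation invariance, and the difference
  quotients converge to the derivative boundedly and with supports in a fixed compact set.
\<close>
lemma integral_frechet_test:
  fixes \<psi> :: "'a::euclidean_space \<Rightarrow> real"
  assumes \<psi>: "\<psi> \<in> test_functions U"
  shows "(LINT x|lborel. frechet_derivative \<psi> (at x) v) = 0"
proof -
  let ?D = "\<lambda>x. frechet_derivative \<psi> (at x)"
  note sm = test_functions_smooth[OF \<psi>]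
  note int = test_functions_integrable[OF \<psi>]
  note [measurable] = test_functions_measurable[OF \<psi>] test_functions_measurable[OF test_functions_frechet[OF \<psi>]]
  obtain K where K: "compact K" "\<And>x. x \<notin> K \<Longrightarrow> \<psi> x = 0" using test_functions_support[OF \<psi>] by auto
  obtain B where B: "B \<ge> 0" "\<And>x v. \<bar>?D x v\<bar> \<le> B * norm v" using test_functions_derivative_bounded[OF \<psi>] by blast
  have lip: "\<bar>\<psi> y - \<psi> z\<bar> \<le> B * norm (y - z)" for y z
  proof -
    have "norm (\<psi> y - \<psi> z) \<le> B * norm (y - z)"
    proof (rule differentiable_bound[of UNIV \<psi> ?D B y z])
      show "onorm (?D x) \<le> B" for x by (rule onorm_le) (use B in auto)
      show "(\<psi> has_derivative ?D x) (at x within UNIV)" for x using smooth_has_derivative[OF sm] by simp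
    qed auto
    then show ?thesis by simp
  qed
  define L where "L = (\<Union>x\<in>K. cball x (norm v))"
  have L: "compact L" unfolding L_def by (rule compact_minkowski_sum_cball[OF K(1)])
  have [measurable]: "L \<in> sets borel" by (rule borel_compact[OF L])
  define q where "q n x = (\<psi> ((1 / Suc n) *\<^sub>R v + x) - \<psi> x) * Suc n" for n x
  have "(\<lambda>n. LINT x|lborel. q n x) \<longlonglongrightarrow> (LINT x|lborel. ?D x v)"
  proof (rule integral_dominated_convergence[where w="\<lambda>x. indicator L x *\<^sub>R (B * norm v)"])
    show "integrable lborel (\<lambda>x::'a. indicator L x *\<^sub>R (B * norm v))"
      by (intro integrable_scaleR_left integrable_real_indicator) (use emeasure_compact_finite[OF L] in auto)
    show "q n \<in> borel_measurable lborel" for n unfolding q_def by measurable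
    show "AE x in lborel. norm (q n x) \<le> indicator L x *\<^sub>R (B * norm v)" for n
    proof (rule AE_I2)
      fix x
      show "norm (q n x) \<le> indicator L x *\<^sub>R (B * norm v)"
      proof (cases "x \<in> L")
        case True
        have "\<bar>\<psi> ((1 / Suc n) *\<^sub>R v + x) - \<psi> x\<bar> * Suc n \<le> B * norm ((1 / Suc n) *\<^sub>R v) * Suc n"
          using lip[of "(1 / Suc n) *\<^sub>R v + x" x] by (intro mult_right_mono) auto
        also have "\<dots> = B * norm v" by (simp add: field_simps)
        finally show ?thesis using True by (simp add: q_def abs_mult)
      next
        case False
        have n: "norm ((1 / Suc n) *\<^sub>R v) \<le> norm v" by (simp add: field_simps mult_left_le_one_le)
        have "x \<notin> K" using False by (auto simp: L_def)
        moreover have "(1 / Suc n) *\<^sub>R v + x \<notin> K"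
        proof
          assume "(1 / Suc n) *\<^sub>R v + x \<in> K"
          moreover have "x \<in> cball ((1 / Suc n) *\<^sub>R v + x) (norm v)" using n by (simp add: dist_norm)
          ultimately show False using False unfolding L_def by blast
        qed
        ultimately show ?thesis using False by (simp add: q_def K(2))
      qed
    qed
    show "AE x in lborel. (\<lambda>n. q n x) \<longlonglongrightarrow> ?D x v"
    proof (rule AE_I2)
      fix x
      have lin: "linear (?D x)" by (rule smooth_linear_frechet[OF sm])
      have "((\<lambda>t. \<psi> (t *\<^sub>R v + x)) has_derivative (\<lambda>t. ?D x (t *\<^sub>R v))) (at 0)"
        by (rule has_derivative_compose[of "\<lambda>t. t *\<^sub>R v + x" "\<lambda>t. t *\<^sub>R v" 0 UNIV \<psi>])
          (use smooth_has_derivative[OF sm] in \<open>auto intro!: derivative_eq_intros\<close>)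
      then have "((\<lambda>t. \<psi> (t *\<^sub>R v + x)) has_real_derivative ?D x v) (at 0)"
        unfolding has_field_derivative_def linear_cmul[OF lin] real_scaleR_def by (simp only: mult.commute[of _ "?D x v"])
      then have "((\<lambda>t. (\<psi> (t *\<^sub>R v + x) - \<psi> x) / t) \<longlongrightarrow> ?D x v) (at 0)"
        by (simp add: has_field_derivative_iff)
      then have "(\<lambda>n. (\<psi> ((1 / Suc n) *\<^sub>R v + x) - \<psi> x) / (1 / Suc n)) \<longlonglongrightarrow> ?D x v"
        unfolding tendsto_at_iff_sequentially comp_def
        by (elim allE[of _ "\<lambda>n. 1 / Suc n"]) (use LIMSEQ_Suc[OF lim_1_over_n] in auto)
      then show "(\<lambda>n. q n x) \<longlonglongrightarrow> ?D x v" by (simp add: q_def)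
    qed
  qed simp
  moreover have "(LINT x|lborel. q n x) = 0" for n
    unfolding q_def using integrable_lborel_translate[OF int] int by (simp add: integral_lborel_translate)
  ultimately show ?thesis by (simp add: LIMSEQ_const_iff)
qed

text \<open>
  For a test function \<open>\<phi>\<close> the product \<open>u \<phi>\<close> is a test function, so its derivative has integral
  zero.
\<close>
lemma smooth_has_weak_deriv:
  fixes u :: "'a::euclidean_space \<Rightarrow> real"
  assumes \<Omega>: "open \<Omega>" and u: "smooth_on u UNIV"
  shows "has_weak_deriv \<Omega> v u (\<lambda>x. frechet_derivative u (at x) v)"
proof -
  have ai: "g absolutely_integrable_on K" if "continuous_on UNIV g" "compact K" for K and g :: "'a \<Rightarrow> real"
  proof -
    note [measurable] = borel_measurable_continuous_onI[OF that(1)] borel_compact[OF that(2)]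
    have "integrable lborel (\<lambda>x. indicator K x *\<^sub>R g x)"
      using that by (intro borel_integrable_compact continuous_on_subset[OF that(1)]) auto
    then show ?thesis unfolding set_integrable_def by (subst integrable_completion) measurable
  qed
  have loc: "loc_integrable \<Omega> u" "loc_integrable \<Omega> (\<lambda>x. frechet_derivative u (at x) v)"
    unfolding loc_integrable_def using ai smooth_continuous[OF u] smooth_continuous_frechet[OF u] by auto
  show ?thesis
    unfolding has_weak_deriv_def
  proof (intro conjI ballI)
    show "\<forall>K. compact K \<and> K \<subseteq> \<Omega> \<longrightarrow> u absolutely_integrable_on K \<and> (\<lambda>x. frechet_derivative u (at x) v) absolutely_integrable_on K"
      using loc by (auto simp: loc_integrable_def)
    fix \<phi> :: "'a \<Rightarrow> real" assume \<phi>: "\<phi> \<in> test_functions \<Omega>"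
    note \<psi> = test_functions_mult[OF \<phi> u]
    note i1 = loc_integrable_mult_test[OF \<Omega> loc(1) test_functions_frechet[OF \<phi>]]
    note i2 = loc_integrable_mult_test[OF \<Omega> loc(2) \<phi>]
    have "(LINT x|lebesgue. u x * frechet_derivative \<phi> (at x) v + frechet_derivative u (at x) v * \<phi> x) = (LINT x|lebesgue. frechet_derivative (\<lambda>x. \<phi> x * u x) (at x) v)"
      by (simp add: frechet_mult[OF test_functions_smooth[OF \<phi>] u] algebra_simps)
    also have "\<dots> = 0"
      using integral_frechet_test[OF \<psi>] test_functions_measurable[OF test_functions_frechet[OF \<psi>]] by (simp add: integral_completion)
    finally show "(LINT x|lebesgue_on \<Omega>. u x * frechet_derivative \<phi> (at x) v) = - (LINT x|lebesgue_on \<Omega>. frechet_derivative u (at x) v * \<phi> x)"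
      using i1 i2 by simp
  qed
qed

text \<open>
  Mollification commutes with weak differentiation at points whose \<open>\<epsilon>\<close>-ball lies in \<open>\<Omega>\<close>: for those
  \<open>x\<close> the function \<open>y \<mapsto> \<rho> (x - y)\<close> is a test function on \<open>\<Omega>\<close>, and the definition of the weak
  derivative moves the derivative from \<open>\<rho>\<close> to \<open>u\<close>.
\<close>
lemma frechet_conv_weak_deriv:
  fixes u g :: "'a::euclidean_space \<Rightarrow> real"
  assumes \<Omega>: "open \<Omega>" "bounded \<Omega>" and p: "1 \<le> p" and u: "u \<in> Lp p \<Omega>" and g: "g \<in> Lp p \<Omega>"
    and w: "has_weak_deriv \<Omega> v u g" and m: "mollifier \<epsilon> \<rho>" and x: "cball x \<epsilon> \<subseteq> \<Omega>"
  shows "frechet_derivative (conv \<rho> (borel_rep \<Omega> u)) (at x) v = conv \<rho> (borel_rep \<Omega> g) x"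
proof -
  note \<rho> = mollifierD[OF m]
  have um: "u \<in> borel_measurable (lebesgue_on \<Omega>)" and gm: "g \<in> borel_measurable (lebesgue_on \<Omega>)"
    using u g by (auto simp: Lp_def)
  have ui: "integrable lborel (borel_rep \<Omega> u)" using Lp_bounded_supportD(3)[OF borel_rep_Lp(1)[OF \<Omega> u] p] .
  note sm = test_functions_smooth[OF \<rho>(1)]
  note [measurable] = test_functions_measurable[OF \<rho>(1)] test_functions_measurable[OF test_functions_frechet[OF \<rho>(1)]]
  have t: "(\<lambda>y. \<rho> (x - y)) \<in> test_functions \<Omega>"
    by (rule test_functionsI[OF smooth_reflect[OF sm] compact_cball x]) (simp add: \<rho>(3) dist_norm)
  have "frechet_derivative (conv \<rho> (borel_rep \<Omega> u)) (at x) v = (LINT y|lborel. frechet_derivative \<rho> (at (x - y)) v * borel_rep \<Omega> u y)"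
    by (simp add: frechet_conv[OF \<rho>(1) ui] conv_def)
  also have "\<dots> = (LINT y|lborel. borel_rep \<Omega> u y * frechet_derivative \<rho> (at (x - y)) v)" by (simp add: mult.commute)
  also have "\<dots> = (LINT y|lebesgue_on \<Omega>. u y * frechet_derivative \<rho> (at (x - y)) v)"
    by (rule borel_rep_integral[symmetric, OF \<Omega>(1) um]) measurable
  also have "\<dots> = - (LINT y|lebesgue_on \<Omega>. u y * frechet_derivative (\<lambda>y. \<rho> (x - y)) (at y) v)"
    by (simp add: frechet_reflect[OF sm])
  also have "\<dots> = (LINT y|lebesgue_on \<Omega>. g y * \<rho> (x - y))" using has_weak_derivD(3)[OF w t] by simp
  also have "\<dots> = (LINT y|lborel. borel_rep \<Omega> g y * \<rho> (x - y))"
    by (rule borel_rep_integral[OF \<Omega>(1) gm]) measurable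
  also have "\<dots> = conv \<rho> (borel_rep \<Omega> g) x" by (simp add: conv_def mult.commute)
  finally show ?thesis .
qed

section \<open>Alternating forms\<close>

lemma alt_forms_length: "\<xi> \<in> alt_forms k \<Longrightarrow> length vs \<noteq> k \<Longrightarrow> \<xi> vs = 0"
  by (simp add: alt_forms_def)

lemma alt_forms_linear: "\<xi> \<in> alt_forms k \<Longrightarrow> length vs = k \<Longrightarrow> i < k \<Longrightarrow> linear (\<lambda>v. \<xi> (vs[i := v]))"
  by (simp add: alt_forms_def)

lemma alt_forms_eq: "\<xi> \<in> alt_forms k \<Longrightarrow> length vs = k \<Longrightarrow> i < j \<Longrightarrow> j < k \<Longrightarrow> vs ! i = vs ! j \<Longrightarrow> \<xi> vs = 0"
  unfolding alt_forms_def by blast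

lemma alt_formsI:
  assumes "\<And>vs. length vs \<noteq> k \<Longrightarrow> \<xi> vs = 0"
    and "\<And>vs i. length vs = k \<Longrightarrow> i < k \<Longrightarrow> linear (\<lambda>v. \<xi> (vs[i := v]))"
    and "\<And>vs i j. length vs = k \<Longrightarrow> i < j \<Longrightarrow> j < k \<Longrightarrow> vs ! i = vs ! j \<Longrightarrow> \<xi> vs = 0"
  shows "\<xi> \<in> alt_forms k"
  unfolding alt_forms_def using assms by blast

lemma alt_forms_lin:
  fixes \<xi> \<eta> :: "'a::real_vector form"
  assumes "\<xi> \<in> alt_forms k" "\<eta> \<in> alt_forms k"
  shows "(\<lambda>vs. a * \<xi> vs + b * \<eta> vs) \<in> alt_forms k"
proof (rule alt_formsI)
  fix vs :: "'a list" and i assume "length vs = k" "i < k"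
  then have "linear (\<lambda>v. \<xi> (vs[i := v]))" "linear (\<lambda>v. \<eta> (vs[i := v]))" using assms by (auto intro: alt_forms_linear)
  then show "linear (\<lambda>v. a * \<xi> (vs[i := v]) + b * \<eta> (vs[i := v]))"
    unfolding linear_iff by (simp add: algebra_simps)
next
  show "a * \<xi> vs + b * \<eta> vs = 0" if "length vs \<noteq> k" for vs
    using that assms by (simp add: alt_forms_length)
  show "a * \<xi> vs + b * \<eta> vs = 0" if "length vs = k" "i < j" "j < k" "vs ! i = vs ! j" for vs :: "'a list" and i j
    using alt_forms_eq[OF assms(1) that] alt_forms_eq[OF assms(2) that] by simp
qed

lemma alt_forms_zero: "(\<lambda>vs. 0) \<in> alt_forms k"
  by (rule alt_formsI) (auto simp: linear_iff)

lemma alt_forms_scale: "\<xi> \<in> alt_forms k \<Longrightarrow> (\<lambda>vs. a * \<xi> vs) \<in> alt_forms k"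
  using alt_forms_lin[of \<xi> k \<xi> a 0] by simp

lemma alt_forms_add: "\<xi> \<in> alt_forms k \<Longrightarrow> \<eta> \<in> alt_forms k \<Longrightarrow> form_add \<xi> \<eta> \<in> alt_forms k"
  using alt_forms_lin[of \<xi> k \<eta> 1 1] by (simp add: form_add_def)

lemma alt_forms_diff: "\<xi> \<in> alt_forms k \<Longrightarrow> \<eta> \<in> alt_forms k \<Longrightarrow> form_diff \<xi> \<eta> \<in> alt_forms k"
  using alt_forms_lin[of \<xi> k \<eta> 1 "-1"] by (simp add: form_diff_def)

lemma alt_forms_sum:
  "(\<And>j. j \<in> J \<Longrightarrow> \<xi> j \<in> alt_forms k) \<Longrightarrow> (\<lambda>vs. \<Sum>j\<in>J. c j * \<xi> j vs) \<in> alt_forms k"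
proof (induction J rule: infinite_finite_induct)
  case (insert j J)
  then show ?case using alt_forms_lin[of "\<xi> j" k "\<lambda>vs. \<Sum>j\<in>J. c j * \<xi> j vs" "c j" 1] by simp
qed (auto intro: alt_forms_zero)

lemma alt_forms_slot_add:
  assumes "\<xi> \<in> alt_forms k" "length as + length bs + 1 = k"
  shows "\<xi> (as @ (v + w) # bs) = \<xi> (as @ v # bs) + \<xi> (as @ w # bs)"
  using linear_add[OF alt_forms_linear[OF assms(1), of "as @ v # bs" "length as"], of v w] assms(2) by simp

text \<open>Polarization: expand \<open>\<xi> (\<dots>, v + w, v + w, \<dots>) = 0\<close>.\<close>
lemma alt_forms_swap:
  assumes \<xi>: "\<xi> \<in> alt_forms k" and l: "length as + length bs + 2 = k"
  shows "\<xi> (as @ v # w # bs) = - \<xi> (as @ w # v # bs)"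
proof -
  have z: "\<xi> (as @ u # u # bs) = 0" for u
    by (rule alt_forms_eq[OF \<xi>, of _ "length as" "Suc (length as)"]) (use l in \<open>auto simp: nth_append\<close>)
  have a1: "\<xi> (as @ (v + w) # c # bs) = \<xi> (as @ v # c # bs) + \<xi> (as @ w # c # bs)" for c
    using l by (intro alt_forms_slot_add[OF \<xi>]) simp
  have a2: "\<xi> (as @ c # (v + w) # bs) = \<xi> (as @ c # v # bs) + \<xi> (as @ c # w # bs)" for c
    using alt_forms_slot_add[OF \<xi>, of "as @ [c]" bs v w] l by simp
  show ?thesis using z[of "v + w"] z[of v] z[of w] by (simp add: a1 a2)
qed

lemma alt_forms_move:
  assumes \<xi>: "\<xi> \<in> alt_forms k" and l: "length as + length bs + 1 = k"
  shows "\<xi> (as @ v # bs) = (- 1) ^ length as * \<xi> (v # as @ bs)"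
  using l
proof (induction as arbitrary: bs rule: rev_induct)
  case (snoc a as)
  have "\<xi> (as @ a # v # bs) = - \<xi> (as @ v # a # bs)" using snoc.prems by (intro alt_forms_swap[OF \<xi>]) simp
  also have "\<dots> = - ((- 1) ^ length as * \<xi> (v # as @ a # bs))" using snoc.prems by (subst snoc.IH) auto
  finally show ?case by simp
qed simp

text \<open>
  The alternating sum in the definition of the exterior derivative, for an arbitrary form \<open>D v\<close>
  depending on a direction \<open>v\<close>. With weak derivatives for \<open>D\<close> it is \<open>ext_deriv\<close> (see
  \<open>ext_deriv_eq\<close>), with classical ones the classical exterior derivative, and with \<open>D v = l v * \<omega>\<close>
  the wedge product of the linear form \<open>l\<close> with \<open>\<omega>\<close>.
\<close>
definition ext_comb :: "nat \<Rightarrow> ('a \<Rightarrow> 'a form) \<Rightarrow> 'a form" where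
  "ext_comb k D vs = (if length vs = Suc k
     then \<Sum>i<Suc k. (- 1) ^ i * D (vs ! i) (take i vs @ drop (Suc i) vs) else 0)"

lemma omit_update:
  assumes "i \<noteq> l" "i < length vs" "l < length vs"
  shows "take l (vs[i := v]) @ drop (Suc l) (vs[i := v]) = (take l vs @ drop (Suc l) vs)[(if i < l then i else i - 1) := v]"
  using assms by (auto simp: list_eq_iff_nth_eq nth_append nth_list_update min_def)

lemma nth_omit:
  assumes "l < length vs" "i < length vs" "i \<noteq> l"
  shows "(take l vs @ drop (Suc l) vs) ! (if i < l then i else i - 1) = vs ! i"
  using assms by (auto simp: nth_append min_def)

text \<open>
  If two arguments are equal, then a summand that omits neither of them vanishes. The two remaining
  summands differ by the position of one argument, and moving it to the front shows that they have
  opposite signs.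
\<close>
lemma ext_comb_alt:
  fixes D :: "'a::real_vector \<Rightarrow> 'a form"
  assumes D: "\<And>v. D v \<in> alt_forms k" and lin: "\<And>vs. linear (\<lambda>v. D v vs)"
  shows "ext_comb k D \<in> alt_forms (Suc k)"
proof (rule alt_formsI)
  show "length vs \<noteq> Suc k \<Longrightarrow> ext_comb k D vs = 0" for vs by (simp add: ext_comb_def)
next
  fix vs :: "'a list" and i assume l: "length vs = Suc k" and i: "i < Suc k"
  have "linear (\<lambda>v. (- 1) ^ l * D (vs[i := v] ! l) (take l (vs[i := v]) @ drop (Suc l) (vs[i := v])))" if "l < Suc k" for l
  proof -
    have "linear (\<lambda>v. D (vs[i := v] ! l) (take l (vs[i := v]) @ drop (Suc l) (vs[i := v])))"
    proof (cases "l = i")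
      case True
      then show ?thesis using lin[of "take i vs @ drop (Suc i) vs"] i l by simp
    next
      case False
      have "linear (\<lambda>v. D (vs ! l) ((take l vs @ drop (Suc l) vs)[(if i < l then i else i - 1) := v]))"
        using D[of "vs ! l"] that l i False by (intro alt_forms_linear) auto
      then show ?thesis using False i l that by (simp add: omit_update)
    qed
    then show ?thesis by (simp add: linear_iff algebra_simps)
  qed
  then have "linear (\<lambda>v. \<Sum>l<Suc k. (- 1) ^ l * D (vs[i := v] ! l) (take l (vs[i := v]) @ drop (Suc l) (vs[i := v])))"
    by (intro linear_compose_sum) auto
  then show "linear (\<lambda>v. ext_comb k D (vs[i := v]))" using l by (simp add: ext_comb_def del: sum.lessThan_Suc)
next
  fix vs :: "'a list" and i j assume l: "length vs = Suc k" and ij: "i < j" "j < Suc k" and eq: "vs ! i = vs ! j"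
  define F where "F l = (- 1) ^ l * D (vs ! l) (take l vs @ drop (Suc l) vs)" for l
  define as where "as = take i vs"
  define bs where "bs = take (j - i - 1) (drop (Suc i) vs)"
  define cs where "cs = drop (Suc j) vs"
  define v where "v = vs ! i"
  have la: "length as = i" and lb: "length bs = j - i - 1" and lc: "length cs = k - j" using l ij by (auto simp: as_def bs_def cs_def)
  have "drop (Suc i) vs = bs @ drop j vs"
    using ij by (metis Suc_leI add_Suc_right add_diff_inverse_nat append_take_drop_id bs_def diff_diff_left drop_drop not_less plus_1_eq_Suc add.commute)
  also have "drop j vs = v # cs" using ij l eq by (simp add: v_def cs_def Cons_nth_drop_Suc)
  finally have d: "drop (Suc i) vs = bs @ v # cs" .
  have vs: "vs = as @ v # bs @ v # cs"
    using ij l d unfolding as_def v_def by (metis Cons_nth_drop_Suc append_take_drop_id less_trans)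
  have "F l = 0" if "l < Suc k" "l \<noteq> i" "l \<noteq> j" for l
  proof -
    let ?r = "\<lambda>i. if i < l then i else i - 1"
    have "D (vs ! l) (take l vs @ drop (Suc l) vs) = 0"
    proof (rule alt_forms_eq[OF D, of _ "?r i" "?r j"])
      show "(take l vs @ drop (Suc l) vs) ! ?r i = (take l vs @ drop (Suc l) vs) ! ?r j"
        using nth_omit[of l vs i] nth_omit[of l vs j] that ij l eq by simp
    qed (use that ij l in auto)
    then show ?thesis by (simp add: F_def)
  qed
  then have "(\<Sum>l<Suc k. F l) = (\<Sum>l\<in>{i, j}. F l)"
    using ij by (intro sum.mono_neutral_right) auto
  moreover have "ext_comb k D vs = (\<Sum>l<Suc k. F l)"
    unfolding ext_comb_def F_def using l by (simp only: if_True refl)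
  ultimately have "ext_comb k D vs = (\<Sum>l\<in>{i, j}. F l)" by simp
  also have "\<dots> = F i + F j" using ij by simp
  also have "F i = (- 1) ^ i * D v (as @ bs @ v # cs)"
    using d by (simp add: F_def v_def as_def)
  also have "D v (as @ bs @ v # cs) = (- 1) ^ (length (as @ bs)) * D v (v # as @ bs @ cs)"
    using alt_forms_move[OF D, of "as @ bs" cs v v] la lb lc ij by simp
  also have "F j = (- 1) ^ j * D v (as @ v # bs @ cs)"
  proof -
    have ji: "j = length (as @ v # bs)" using la lb ij by simp
    have "take (length (as @ v # bs)) ((as @ v # bs) @ (v # cs)) = as @ v # bs" by (subst take_append) simp
    then have "take j vs = as @ v # bs" using vs ji by simp
    then show ?thesis using eq by (simp add: F_def v_def cs_def)
  qed
  also have "D v (as @ v # bs @ cs) = (- 1) ^ length as * D v (v # as @ bs @ cs)"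
    using alt_forms_move[OF D, of as "bs @ cs" v v] la lb lc ij by simp
  also have "(- 1) ^ i * ((- 1) ^ length (as @ bs) * D v (v # as @ bs @ cs)) + (- 1) ^ j * ((- 1) ^ length as * D v (v # as @ bs @ cs)) = 0"
  proof -
    have "j = Suc (i + length bs)" using lb ij by simp
    then show ?thesis by (simp add: la power_add)
  qed
  finally show "ext_comb k D vs = 0" .
qed

section \<open>Coordinates of forms\<close>

abbreviation basis_list :: "'n::finite list \<Rightarrow> 'n rvec list" where
  "basis_list js \<equiv> map (\<lambda>j. axis j 1) js"

text \<open>
  The coordinates of a form, as a vector whose type does not depend on the degree: increasing
  multi-indices are the sorted enumerations of subsets of the index type, and subsets of the wrong
  cardinality get the coordinate \<open>0\<close>. In this way analysis of form-valued functions becomes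
  analysis in a Euclidean space.
\<close>
definition form_vec :: "nat \<Rightarrow> 'n::{finite,linorder} rvec form \<Rightarrow> (real, 'n set) vec" where
  "form_vec k \<xi> = (\<chi> A. if card A = k then \<xi> (basis_list (sorted_list_of_set A)) else 0)"

lemma multi_indices_bij:
  "bij_betw sorted_list_of_set {A :: 'n::{finite,linorder} set. card A = k} (multi_indices k)"
proof (rule bij_betwI[where g=set])
  show "sorted_list_of_set \<in> {A :: 'n set. card A = k} \<rightarrow> multi_indices k"
    by (auto simp: multi_indices_def)
  show "set \<in> multi_indices k \<rightarrow> {A :: 'n set. card A = k}"
    by (auto simp: multi_indices_def strict_sorted_iff distinct_card)
  show "sorted_list_of_set (set js) = js" if "js \<in> multi_indices k" for js :: "'n list"
    using that by (auto simp: multi_indices_def strict_sorted_iff sorted_list_of_set.idem_if_sorted_distinct)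
qed simp

lemma finite_multi_indices [simp]: "finite (multi_indices k :: 'n::{finite,linorder} list set)"
  using bij_betw_finite[OF multi_indices_bij[of k, where 'n='n]] by simp

lemma form_norm_eq: "form_norm k \<xi> = norm (form_vec k \<xi>)"
proof -
  have "(\<Sum>js\<in>multi_indices k. (\<xi> (basis_list js))\<^sup>2) = (\<Sum>A | card A = k. (\<xi> (basis_list (sorted_list_of_set A)))\<^sup>2)"
    by (rule sum.reindex_bij_betw[OF multi_indices_bij, symmetric])
  also have "\<dots> = (\<Sum>A\<in>UNIV. (form_vec k \<xi> $ A)\<^sup>2)"
    by (rule sum.mono_neutral_cong_left) (auto simp: form_vec_def)
  finally show ?thesis by (simp add: form_norm_def norm_vec_def L2_set_def)
qed

lemma form_vec_add: "form_vec k (form_add \<xi> \<eta>) = form_vec k \<xi> + form_vec k \<eta>"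
  by (simp add: form_vec_def vec_eq_iff form_add_def)

lemma form_vec_diff: "form_vec k (form_diff \<xi> \<eta>) = form_vec k \<xi> - form_vec k \<eta>"
  by (simp add: form_vec_def vec_eq_iff form_diff_def)

lemma form_vec_cong:
  "(\<And>js. js \<in> multi_indices k \<Longrightarrow> \<xi> (basis_list js) = \<eta> (basis_list js)) \<Longrightarrow> form_vec k \<xi> = form_vec k \<eta>"
  using bij_betwE[OF multi_indices_bij[of k]] by (auto simp: form_vec_def vec_eq_iff)

lemma component_le_form_norm:
  assumes "js \<in> multi_indices k" shows "\<bar>\<xi> (basis_list js)\<bar> \<le> norm (form_vec k \<xi>)"
proof -
  obtain A where A: "card A = k" "js = sorted_list_of_set A"
    using assms multi_indices_bij[of k, where 'n='a] by (auto simp: bij_betw_def)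
  then have "\<xi> (basis_list js) = form_vec k \<xi> $ A" by (simp add: form_vec_def)
  then show ?thesis by (simp add: component_le_norm_cart)
qed

text \<open>
  Either \<open>j\<close> occurs in \<open>js\<close> and the value is zero, or sorting \<open>j\<close> into \<open>js\<close> gives a coordinate of
  \<open>\<xi>\<close> up to sign.
\<close>
lemma alt_forms_basis_cons_le:
  fixes \<xi> :: "'n::{finite,linorder} rvec form"
  assumes \<xi>: "\<xi> \<in> alt_forms (Suc m)" and js: "js \<in> multi_indices m"
  shows "\<bar>\<xi> (axis j 1 # basis_list js)\<bar> \<le> norm (form_vec (Suc m) \<xi>)"
proof (cases "j \<in> set js")
  case True
  then obtain i where i: "i < length js" "js ! i = j" by (auto simp: in_set_conv_nth)
  have "\<xi> (axis j 1 # basis_list js) = 0"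
    by (rule alt_forms_eq[OF \<xi>, of _ 0 "Suc i"]) (use i js in \<open>auto simp: multi_indices_def\<close>)
  then show ?thesis by simp
next
  case False
  define as bs where "as = takeWhile (\<lambda>i. i < j) js" and "bs = dropWhile (\<lambda>i. i < j) js"
  have ab: "js = as @ bs" by (simp add: as_def bs_def)
  have s: "sorted_wrt (<) js" and l: "length js = m" using js by (auto simp: multi_indices_def)
  have as: "\<forall>i\<in>set as. i < j" unfolding as_def using set_takeWhileD by fast
  have bs: "\<forall>i\<in>set bs. j < i"
  proof (cases bs)
    case (Cons b cs)
    then have "\<not> b < j" unfolding bs_def by (metis dropWhile_eq_Cons_conv)
    moreover have "b \<noteq> j" using False ab Cons by auto
    moreover have "\<forall>i\<in>set cs. b < i" using s ab Cons by (auto simp: sorted_wrt_append)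
    ultimately show ?thesis using Cons by auto
  qed simp
  have "sorted_wrt (<) (as @ j # bs)" using s ab as bs by (auto simp: sorted_wrt_append)
  then have mi: "as @ j # bs \<in> multi_indices (Suc m)" using l ab by (simp add: multi_indices_def)
  have "\<xi> (basis_list as @ axis j 1 # basis_list bs) = (- 1) ^ length as * \<xi> (axis j 1 # basis_list as @ basis_list bs)"
    using alt_forms_move[OF \<xi>, of "basis_list as" "basis_list bs"] l ab by simp
  then have "\<bar>\<xi> (axis j 1 # basis_list js)\<bar> = \<bar>\<xi> (basis_list (as @ j # bs))\<bar>"
    by (simp add: ab abs_mult power_abs)
  then show ?thesis using component_le_form_norm[OF mi] by metis
qed

lemma powr_sum_le:
  fixes a :: "'i \<Rightarrow> real"
  assumes "finite I" "\<And>i. i \<in> I \<Longrightarrow> 0 \<le> a i" "0 \<le> p"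
  shows "(\<Sum>i\<in>I. a i) powr p \<le> real (card I) powr p * (\<Sum>i\<in>I. a i powr p)"
proof (cases "I = {}")
  case False
  define m where "m = Max (a ` I)"
  have m: "m \<in> a ` I" "\<And>i. i \<in> I \<Longrightarrow> a i \<le> m" using assms(1) False by (auto simp: m_def)
  then obtain k where k: "k \<in> I" "m = a k" by auto
  have "(\<Sum>i\<in>I. a i) \<le> real (card I) * m" using sum_bounded_above[of I a m] m(2) by simp
  then have "(\<Sum>i\<in>I. a i) powr p \<le> (real (card I) * m) powr p"
    using assms by (intro powr_mono2 sum_nonneg) auto
  also have "\<dots> = real (card I) powr p * a k powr p" using k assms by (simp add: powr_mult)
  also have "\<dots> \<le> real (card I) powr p * (\<Sum>i\<in>I. a i powr p)"
    using k(1) assms(1) by (intro mult_left_mono member_le_sum) auto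
  finally show ?thesis .
qed simp

lemma omit_multi_indices:
  assumes "js \<in> multi_indices (Suc m)" "i < Suc m"
  shows "take i js @ drop (Suc i) js \<in> multi_indices m"
proof -
  have "sorted_wrt (<) (take i js @ drop i js)" using assms by (simp add: multi_indices_def)
  moreover have "drop i js = js ! i # drop (Suc i) js" using assms by (simp add: multi_indices_def Cons_nth_drop_Suc)
  ultimately show ?thesis using assms by (auto simp: multi_indices_def sorted_wrt_append)
qed

lemma ext_comb_basis:
  assumes "js \<in> multi_indices (Suc m)"
  shows "ext_comb m D (basis_list js) = (\<Sum>i<Suc m. (- 1) ^ i * D (axis (js ! i) 1) (basis_list (take i js @ drop (Suc i) js)))"
  using assms by (auto simp: ext_comb_def multi_indices_def take_map drop_map simp del: sum.lessThan_Suc intro!: sum.cong)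

text \<open>
  Each of the finitely many coordinates is a signed sum of values of \<open>D\<close> on basis vectors.
\<close>
lemma ext_comb_bound:
  fixes D :: "'n::{finite,linorder} rvec \<Rightarrow> 'n rvec form"
  shows "norm (form_vec (Suc m) (ext_comb m D)) \<le>
    real (CARD('n set) * Suc m) * (\<Sum>j\<in>UNIV. \<Sum>ks\<in>multi_indices m. \<bar>D (axis j 1) (basis_list ks)\<bar>)"
proof -
  define S where "S = (\<Sum>j\<in>UNIV. \<Sum>ks\<in>multi_indices m. \<bar>D (axis j 1) (basis_list ks)\<bar>)"
  have S0: "S \<ge> 0" unfolding S_def by (intro sum_nonneg) auto
  have mem: "\<bar>D (axis j 1) (basis_list ks)\<bar> \<le> S" if "ks \<in> multi_indices m" for j ks
  proof -
    have "\<bar>D (axis j 1) (basis_list ks)\<bar> \<le> (\<Sum>ks\<in>multi_indices m. \<bar>D (axis j 1) (basis_list ks)\<bar>)"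
      using that by (intro member_le_sum) auto
    also have "\<dots> \<le> S" unfolding S_def by (rule member_le_sum[of j UNIV]) (auto intro: sum_nonneg)
    finally show ?thesis .
  qed
  have comp: "\<bar>form_vec (Suc m) (ext_comb m D) $ A\<bar> \<le> real (Suc m) * S" for A
  proof (cases "card A = Suc m")
    case True
    define js where "js = sorted_list_of_set A"
    have js: "js \<in> multi_indices (Suc m)" using True bij_betwE[OF multi_indices_bij] by (auto simp: js_def)
    have "\<bar>form_vec (Suc m) (ext_comb m D) $ A\<bar> = \<bar>\<Sum>i<Suc m. (- 1) ^ i * D (axis (js ! i) 1) (basis_list (take i js @ drop (Suc i) js))\<bar>"
      using True by (simp add: form_vec_def ext_comb_basis[OF js] js_def[symmetric] del: sum.lessThan_Suc)
    also have "\<dots> \<le> (\<Sum>i<Suc m. \<bar>(- 1) ^ i * D (axis (js ! i) 1) (basis_list (take i js @ drop (Suc i) js))\<bar>)" by (rule sum_abs)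
    also have "\<dots> \<le> (\<Sum>i<Suc m. S)"
      by (rule sum_mono) (use mem[OF omit_multi_indices[OF js]] in \<open>auto simp: abs_mult power_abs\<close>)
    finally show ?thesis by simp
  qed (simp add: form_vec_def S0)
  have "norm (form_vec (Suc m) (ext_comb m D)) \<le> (\<Sum>A\<in>UNIV. \<bar>form_vec (Suc m) (ext_comb m D) $ A\<bar>)" by (rule norm_le_l1_cart)
  also have "\<dots> \<le> (\<Sum>A\<in>(UNIV :: 'n set set). real (Suc m) * S)" by (rule sum_mono) (rule comp)
  also have "\<dots> = real (CARD('n set) * Suc m) * S" by (simp add: algebra_simps)
  finally show ?thesis unfolding S_def .
qed

section \<open>Measurability on the space of forms\<close>

text \<open>
  Move the first element of \<open>as\<close> to the front of \<open>bs\<close>, which changes at most the sign. The prefix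
  \<open>pre\<close> collects the elements that are in place already.
\<close>
lemma alt_forms_abs_mset:
  assumes \<xi>: "\<xi> \<in> alt_forms k"
  shows "mset as = mset bs \<Longrightarrow> length pre + length as = k \<Longrightarrow> \<bar>\<xi> (pre @ as)\<bar> = \<bar>\<xi> (pre @ bs)\<bar>"
proof (induction as arbitrary: pre bs)
  case (Cons a as)
  have "a \<in> set bs" using Cons.prems(1) by (metis list.set_intros(1) mset_eq_setD)
  then obtain b1 b2 where bs: "bs = b1 @ a # b2" by (meson split_list)
  have m: "mset as = mset (b1 @ b2)" using Cons.prems(1) bs by simp
  then have l: "length as = length b1 + length b2" using mset_eq_length by fastforce
  have "\<bar>\<xi> ((pre @ b1) @ a # b2)\<bar> = \<bar>\<xi> (a # (pre @ b1) @ b2)\<bar>"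
    using alt_forms_move[OF \<xi>, of "pre @ b1" b2 a] l Cons.prems(2) by (simp add: abs_mult power_abs)
  also have "\<dots> = \<bar>\<xi> (pre @ a # (b1 @ b2))\<bar>"
    using alt_forms_move[OF \<xi>, of pre "b1 @ b2" a] l Cons.prems(2) by (simp add: abs_mult power_abs)
  also have "\<dots> = \<bar>\<xi> ((pre @ [a]) @ as)\<bar>"
    using Cons.IH[OF m, of "pre @ [a]"] Cons.prems(2) by simp
  finally show ?case using bs by simp
qed simp

lemma alt_forms_basis_zero:
  fixes \<xi> :: "'n::{finite,linorder} rvec form"
  assumes \<xi>: "\<xi> \<in> alt_forms k" and z: "form_vec k \<xi> = 0" and l: "length js = k"
  shows "\<xi> (basis_list js) = 0"
proof (cases "distinct js")
  case True
  have "\<bar>\<xi> (basis_list js)\<bar> = \<bar>\<xi> (basis_list (sort js))\<bar>"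
    using alt_forms_abs_mset[OF \<xi>, of "basis_list js" "basis_list (sort js)" "[]"] l by simp
  moreover have "sort js \<in> multi_indices k" using True l by (simp add: multi_indices_def strict_sorted_iff)
  ultimately show ?thesis using component_le_form_norm[of "sort js" k \<xi>] z by simp
next
  case False
  then obtain i j where ij: "i < length js" "j < length js" "i \<noteq> j" "js ! i = js ! j" by (auto simp: distinct_conv_nth)
  show ?thesis
    by (rule alt_forms_eq[OF \<xi>, of _ "min i j" "max i j"]) (use ij l in \<open>auto simp: min_def max_def\<close>)
qed

text \<open>
  Expand the arguments one after the other, from the last to the first, in the standard basis.
\<close>
lemma alt_forms_zero_if_coordinates_zero:
  fixes \<xi> :: "'n::{finite,linorder} rvec form"
  assumes \<xi>: "\<xi> \<in> alt_forms k" and z: "form_vec k \<xi> = 0"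
  shows "\<xi> vs = 0"
proof (cases "length vs = k")
  case True
  have "length vs + length js = k \<Longrightarrow> \<xi> (vs @ basis_list js) = 0" for js
  proof (induction vs arbitrary: js rule: rev_induct)
    case Nil then show ?case using alt_forms_basis_zero[OF \<xi> z] by simp
  next
    case (snoc v vs)
    have "linear (\<lambda>u. \<xi> ((vs @ v # basis_list js)[length vs := u]))"
      using snoc.prems by (intro alt_forms_linear[OF \<xi>]) auto
    then have "linear (\<lambda>u. \<xi> (vs @ u # basis_list js))"
      by (simp add: list_update_append)
    from linear_sum[OF this, of "\<lambda>j. v $ j *\<^sub>R axis j 1" UNIV] linear_cmul[OF this]
    have "\<xi> (vs @ (\<Sum>j\<in>UNIV. v $ j *\<^sub>R axis j 1) # basis_list js) = (\<Sum>j\<in>UNIV. v $ j * \<xi> (vs @ axis j 1 # basis_list js))" by simp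
    also have "(\<Sum>j\<in>UNIV. v $ j *\<^sub>R axis j 1) = v"
      using basis_expansion[of v] by (simp add: scalar_mult_eq_scaleR)
    also have "(\<Sum>j\<in>UNIV. v $ j * \<xi> (vs @ axis j 1 # basis_list js)) = 0"
      using snoc.IH[of "_ # js"] snoc.prems by (intro sum.neutral) simp
    finally show ?case by simp
  qed
  from this[of "[]"] True show ?thesis by simp
qed (use \<xi> alt_forms_length in auto)

lemma form_vec_inj:
  fixes \<xi> \<eta> :: "'n::{finite,linorder} rvec form"
  assumes "\<xi> \<in> alt_forms k" "\<eta> \<in> alt_forms k" "form_vec k \<xi> = form_vec k \<eta>"
  shows "\<xi> = \<eta>"
proof
  fix vs
  have "form_diff \<xi> \<eta> vs = 0"
    using assms by (intro alt_forms_zero_if_coordinates_zero[of _ k] alt_forms_diff) (simp_all add: form_vec_diff)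
  then show "\<xi> vs = \<eta> vs" by (simp add: form_diff_def)
qed

text \<open>
  The coordinate map is isometric, so openness of a set of forms can be read off from coordinates.
\<close>
lemma form_topology:
  fixes S :: "'n::{finite,linorder} rvec form set"
  shows "openin (Metric_space.mtopology (alt_forms k) (\<lambda>\<xi> \<eta>. form_norm k (form_diff \<xi> \<eta>))) S \<longleftrightarrow>
    S \<subseteq> alt_forms k \<and> (\<forall>\<xi>\<in>S. \<exists>r>0. \<forall>\<eta>\<in>alt_forms k. norm (form_vec k \<xi> - form_vec k \<eta>) < r \<longrightarrow> \<eta> \<in> S)"
proof -
  let ?d = "\<lambda>\<xi> \<eta> :: 'n rvec form. form_norm k (form_diff \<xi> \<eta>)"
  interpret Metric_space "alt_forms k" ?d
  proof
    fix \<xi> \<eta> \<zeta> :: "'n rvec form"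
    show "0 \<le> ?d \<xi> \<eta>" by (simp add: form_norm_eq)
    show "?d \<xi> \<eta> = ?d \<eta> \<xi>" by (simp add: form_norm_eq form_vec_diff norm_minus_commute)
    show "?d \<xi> \<eta> = 0 \<longleftrightarrow> \<xi> = \<eta>" if "\<xi> \<in> alt_forms k" "\<eta> \<in> alt_forms k"
      using form_vec_inj[OF that] by (auto simp: form_norm_eq form_vec_diff)
    show "?d \<xi> \<zeta> \<le> ?d \<xi> \<eta> + ?d \<eta> \<zeta>" 
      using norm_triangle_ineq[of "form_vec k \<xi> - form_vec k \<eta>" "form_vec k \<eta> - form_vec k \<zeta>"]
      by (simp add: form_norm_eq form_vec_diff)
  qed
  have ball: "mball \<xi> r \<subseteq> S \<longleftrightarrow>
      (\<forall>\<eta>\<in>alt_forms k. norm (form_vec k \<xi> - form_vec k \<eta>) < r \<longrightarrow> \<eta> \<in> S)" if "\<xi> \<in> alt_forms k" for \<xi> r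
    unfolding mball_def unfolding form_norm_eq form_vec_diff using that by auto
  show ?thesis
    unfolding openin_mtopology
  proof (rule conj_cong[OF refl])
    assume "S \<subseteq> alt_forms k"
    then have "(\<exists>r>0. mball \<xi> r \<subseteq> S) \<longleftrightarrow>
      (\<exists>r>0. \<forall>\<eta>\<in>alt_forms k. norm (form_vec k \<xi> - form_vec k \<eta>) < r \<longrightarrow> \<eta> \<in> S)" if "\<xi> \<in> S" for \<xi>
      using ball[of \<xi>] that by (simp only: subsetD)
    then show "(\<forall>\<xi>. \<xi> \<in> S \<longrightarrow> (\<exists>r>0. mball \<xi> r \<subseteq> S)) \<longleftrightarrow>
      (\<forall>\<xi>\<in>S. \<exists>r>0. \<forall>\<eta>\<in>alt_forms k. norm (form_vec k \<xi> - form_vec k \<eta>) < r \<longrightarrow> \<eta> \<in> S)"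
      unfolding Ball_def by (simp only: cong: imp_cong)
  qed
qed

text \<open>
  Sets of this shape form a sigma algebra, and it contains the open sets: an open set is the
  preimage of a union of balls in coordinate space.
\<close>
lemma sets_form_borel:
  assumes "B \<in> sets (form_borel k)"
  shows "\<exists>Q\<in>sets borel. B = {\<xi> \<in> alt_forms k. form_vec k \<xi> \<in> Q}"
proof -
  let ?G = "{S. openin (Metric_space.mtopology (alt_forms k) (\<lambda>\<xi> \<eta>. form_norm k (form_diff \<xi> \<eta>))) S}"
  have "?G \<subseteq> Pow (alt_forms k)" by (auto simp: form_topology)
  then have "B \<in> sigma_sets (alt_forms k) ?G" using assms unfolding form_borel_def by (subst (asm) sets_measure_of) auto
  then show ?thesis
  proof induction
    case (Basic S)
    then have S: "S \<subseteq> alt_forms k" "\<forall>\<xi>\<in>S. \<exists>r>0. \<forall>\<eta>\<in>alt_forms k. norm (form_vec k \<xi> - form_vec k \<eta>) < r \<longrightarrow> \<eta> \<in> S"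
      by (auto simp: form_topology)
    from bchoice[OF S(2)] obtain r where r: "\<forall>\<xi>\<in>S. 0 < r \<xi> \<and> (\<forall>\<eta>\<in>alt_forms k. norm (form_vec k \<xi> - form_vec k \<eta>) < r \<xi> \<longrightarrow> \<eta> \<in> S)" ..
    show ?case
    proof (intro bexI[of _ "\<Union>\<xi>\<in>S. ball (form_vec k \<xi>) (r \<xi>)"])
      show "S = {\<xi> \<in> alt_forms k. form_vec k \<xi> \<in> (\<Union>\<xi>\<in>S. ball (form_vec k \<xi>) (r \<xi>))}"
      proof (intro equalityI subsetI)
        fix \<xi> assume "\<xi> \<in> S"
        then show "\<xi> \<in> {\<xi> \<in> alt_forms k. form_vec k \<xi> \<in> (\<Union>\<xi>\<in>S. ball (form_vec k \<xi>) (r \<xi>))}" using S(1) r by (auto intro!: bexI[of _ \<xi>])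
      next
        fix \<eta> assume "\<eta> \<in> {\<xi> \<in> alt_forms k. form_vec k \<xi> \<in> (\<Union>\<xi>\<in>S. ball (form_vec k \<xi>) (r \<xi>))}"
        then obtain \<xi> where "\<eta> \<in> alt_forms k" "\<xi> \<in> S" "norm (form_vec k \<xi> - form_vec k \<eta>) < r \<xi>" by (auto simp: dist_norm)
        then show "\<eta> \<in> S" using r by blast
      qed
    qed (intro borel_open open_UN ballI open_ball)
  next
    case Empty show ?case by (intro bexI[of _ "{}"]) auto
  next
    case (Compl B)
    then obtain Q where "Q \<in> sets borel" "B = {\<xi> \<in> alt_forms k. form_vec k \<xi> \<in> Q}" by blast
    then show ?case by (intro bexI[of _ "- Q"]) auto
  next
    case (Union B)
    then have "\<forall>i. \<exists>Q. Q \<in> sets borel \<and> B i = {\<xi> \<in> alt_forms k. form_vec k \<xi> \<in> Q}" by blast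
    from choice[OF this] obtain Q where Q: "\<forall>i. Q i \<in> sets borel \<and> B i = {\<xi> \<in> alt_forms k. form_vec k \<xi> \<in> Q i}" ..
    have "(\<Union>i. Q i) \<in> sets borel" using Q by blast
    then show ?case using Q by (intro bexI[of _ "\<Union>i. Q i"]) auto
  qed
qed

lemma space_form_borel [simp]: "space (form_borel k) = alt_forms k"
  by (simp add: form_borel_def space_measure_of_conv)

text \<open>
  Makes the composition of a Borel function on forms with a field of forms measurable.
\<close>
lemma measurable_form_borel:
  fixes F :: "'a \<Rightarrow> 'n::{finite,linorder} rvec form"
  assumes "\<And>x. x \<in> space M \<Longrightarrow> F x \<in> alt_forms k" and F: "(\<lambda>x. form_vec k (F x)) \<in> borel_measurable M"
  shows "F \<in> measurable M (form_borel k)"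
proof (rule measurableI)
  fix B :: "'n rvec form set" assume "B \<in> sets (form_borel k)"
  then obtain Q where Q: "Q \<in> sets borel" "B = {\<xi> \<in> alt_forms k. form_vec k \<xi> \<in> Q}" using sets_form_borel by blast
  have "F -` B \<inter> space M = (\<lambda>x. form_vec k (F x)) -` Q \<inter> space M" using Q(2) assms(1) by auto
  then show "F -` B \<inter> space M \<in> sets M" using measurable_sets[OF F Q(1)] by simp
qed (simp add: assms(1))

lemma borel_measurable_form_vec:
  fixes F :: "'a \<Rightarrow> 'n::{finite,linorder} rvec form"
  assumes "\<And>js. js \<in> multi_indices k \<Longrightarrow> (\<lambda>x. F x (basis_list js)) \<in> borel_measurable M"
  shows "(\<lambda>x. form_vec k (F x)) \<in> borel_measurable M"
proof (rule borel_measurable_euclidean_space[THEN iffD2], rule ballI)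
  fix b :: "(real, 'n set) vec" assume "b \<in> Basis"
  then obtain A where A: "b = axis A 1" by (auto simp: Basis_vec_def)
  have "(\<lambda>x. if card A = k then F x (basis_list (sorted_list_of_set A)) else 0) \<in> borel_measurable M"
  proof (cases "card A = k")
    case True
    then show ?thesis using assms[of "sorted_list_of_set A"] bij_betwE[OF multi_indices_bij[of k]] by auto
  qed simp
  then show "(\<lambda>x. form_vec k (F x) \<bullet> b) \<in> borel_measurable M"
    by (simp add: A inner_axis form_vec_def)
qed

section \<open>Classical exterior derivative\<close>

lemma frechet_lin:
  fixes f g :: "'a::real_normed_vector \<Rightarrow> real"
  assumes "smooth_on f UNIV" "smooth_on g UNIV"
  shows "frechet_derivative (\<lambda>x. a * f x + b * g x) (at x) v =
    a * frechet_derivative f (at x) v + b * frechet_derivative g (at x) v"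
proof -
  have "((\<lambda>x. a * f x + b * g x) has_derivative (\<lambda>v. a * frechet_derivative f (at x) v + b * frechet_derivative g (at x) v)) (at x)"
    by (intro has_derivative_add has_derivative_mult_right smooth_has_derivative assms)
  from frechet_derivative_at[OF this] show ?thesis by metis
qed

definition smooth_form :: "nat \<Rightarrow> 'n::finite form_field \<Rightarrow> bool" where
  "smooth_form m w \<longleftrightarrow> (\<forall>x. w x \<in> alt_forms m) \<and> (\<forall>vs. smooth_on (\<lambda>x. w x vs) UNIV)"

lemma smooth_formD:
  assumes "smooth_form m w" shows "w x \<in> alt_forms m" "smooth_on (\<lambda>x. w x vs) UNIV"
  using assms by (auto simp: smooth_form_def)

lemma smooth_form_frechet:
  assumes w: "smooth_form m w"
  shows "(\<lambda>vs. frechet_derivative (\<lambda>y. w y vs) (at x) v) \<in> alt_forms m"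
proof (rule alt_formsI)
  note W = smooth_formD[OF w]
  fix vs
  show "frechet_derivative (\<lambda>y. w y vs) (at x) v = 0" if "length vs \<noteq> m"
    using alt_forms_length[OF W(1) that] by simp
  show "frechet_derivative (\<lambda>y. w y vs) (at x) v = 0" if "length vs = m" "i < j" "j < m" "vs ! i = vs ! j" for i j
    using alt_forms_eq[OF W(1) that] by simp
  show "linear (\<lambda>u. frechet_derivative (\<lambda>y. w y (vs[i := u])) (at x) v)" if "length vs = m" "i < m" for i
  proof -
    have lin: "linear (\<lambda>u. w y (vs[i := u]))" for y by (rule alt_forms_linear[OF W(1) that])
    have e: "w y (vs[i := a + b]) = 1 * w y (vs[i := a]) + 1 * w y (vs[i := b])"
      "w y (vs[i := c *\<^sub>R a]) = c * w y (vs[i := a]) + 0 * w y (vs[i := a])" for y a b c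
      using linear_add[OF lin[of y]] linear_cmul[OF lin[of y]] by simp_all
    show ?thesis
      by (rule linearI) (simp_all only: e frechet_lin[OF W(2) W(2)], simp_all)
  qed
qed

text \<open>The classical exterior derivative.\<close>
definition cext :: "nat \<Rightarrow> 'n::finite form_field \<Rightarrow> 'n form_field" where
  "cext m w x = ext_comb m (\<lambda>v vs. frechet_derivative (\<lambda>y. w y vs) (at x) v)"

lemma cext_alt: "smooth_form m w \<Longrightarrow> cext m w x \<in> alt_forms (Suc m)"
  unfolding cext_def
  by (intro ext_comb_alt smooth_form_frechet smooth_linear_frechet smooth_formD(2))

lemma smooth_form_mult:
  assumes "smooth_form m w" "smooth_on \<phi> UNIV"
  shows "smooth_form m (\<lambda>x vs. \<phi> x * w x vs)"
  using assms by (auto simp: smooth_form_def intro!: smooth_mult alt_forms_scale)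

text \<open>The Leibniz rule \<open>d(\<phi> w) = \<phi> dw + d\<phi> \<and> w\<close>.\<close>
lemma cext_mult:
  assumes "smooth_form m w" "smooth_on \<phi> UNIV"
  shows "cext m (\<lambda>x vs. \<phi> x * w x vs) x vs =
    \<phi> x * cext m w x vs + ext_comb m (\<lambda>v vs. frechet_derivative \<phi> (at x) v * w x vs) vs"
  unfolding cext_def ext_comb_def
  by (simp add: frechet_mult[OF assms(2) smooth_formD(2)[OF assms(1)]] sum_distrib_left sum.distrib[symmetric] algebra_simps
      del: sum.lessThan_Suc)

lemma continuous_form_vec:
  fixes F :: "'a::topological_space \<Rightarrow> 'n::{finite,linorder} rvec form"
  assumes "\<And>js. js \<in> multi_indices k \<Longrightarrow> continuous_on S (\<lambda>x. F x (basis_list js))"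
  shows "continuous_on S (\<lambda>x. form_vec k (F x))"
  unfolding form_vec_def
proof (rule continuous_on_vec_lambda)
  fix A :: "'n set"
  show "continuous_on S (\<lambda>x. if card A = k then F x (basis_list (sorted_list_of_set A)) else 0)"
  proof (cases "card A = k")
    case True
    then show ?thesis using assms[of "sorted_list_of_set A"] bij_betwE[OF multi_indices_bij[of k]] by auto
  qed simp
qed

lemma continuous_cext:
  fixes w :: "'n::{finite,linorder} form_field"
  assumes "smooth_form m w"
  shows "continuous_on UNIV (\<lambda>x. form_vec (Suc m) (cext m w x))" "continuous_on UNIV (\<lambda>x. form_vec m (w x))"
proof -
  show "continuous_on UNIV (\<lambda>x. form_vec (Suc m) (cext m w x))"
    unfolding cext_def
    by (rule continuous_form_vec)
      (auto simp: ext_comb_basis simp del: sum.lessThan_Suc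
        intro!: continuous_intros smooth_continuous_frechet smooth_formD(2)[OF assms])
  show "continuous_on UNIV (\<lambda>x. form_vec m (w x))"
    by (intro continuous_form_vec smooth_continuous smooth_formD(2)[OF assms])
qed

section \<open>Integration over bounded open sets\<close>

lemma finite_measure_lebesgue_on:
  fixes U :: "'a::euclidean_space set"
  assumes "open U" "bounded U" shows "finite_measure (lebesgue_on U)"
proof (rule finite_measureI)
  have "emeasure (lebesgue_on U) U = emeasure lebesgue U"
    using assms by (intro emeasure_restrict_space) auto
  also have "\<dots> = emeasure lborel U" using assms by simp
  also have "\<dots> < \<infinity>" using emeasure_bounded_finite[OF assms(2)] .
  finally show "emeasure (lebesgue_on U) (space (lebesgue_on U)) \<noteq> \<infinity>" by (simp add: space_restrict_space)
qed

lemma integrable_lebesgue_on_bounded: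
  fixes g :: "'a::euclidean_space \<Rightarrow> real"
  assumes "open U" "bounded U" "g \<in> borel_measurable (lebesgue_on U)" "\<And>x. x \<in> U \<Longrightarrow> \<bar>g x\<bar> \<le> B"
  shows "integrable (lebesgue_on U) g"
proof -
  interpret finite_measure "lebesgue_on U" by (rule finite_measure_lebesgue_on[OF assms(1,2)])
  show ?thesis by (rule integrable_const_bound[of _ B]) (use assms in \<open>auto intro!: AE_I2 simp: space_restrict_space\<close>)
qed

lemma continuous_bounded_on:
  fixes g :: "'a::euclidean_space \<Rightarrow> 'b::real_normed_vector"
  assumes "bounded U" "continuous_on UNIV g"
  obtains B where "B \<ge> 0" "\<And>x. x \<in> U \<Longrightarrow> norm (g x) \<le> B"
proof -
  have "compact (g ` closure U)"
    using assms by (intro compact_continuous_image continuous_on_subset[OF assms(2)]) auto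
  then obtain B where B: "\<forall>y\<in>g ` closure U. norm y \<le> B" using compact_imp_bounded bounded_iff by metis
  show ?thesis by (rule that[of "max B 0"]) (use B closure_subset in \<open>fastforce simp: le_max_iff_disj\<close>)+
qed

lemma integrable_lebesgue_on_continuous:
  fixes g :: "'a::euclidean_space \<Rightarrow> real"
  assumes "open U" "bounded U" "continuous_on UNIV g"
  shows "integrable (lebesgue_on U) g"
proof -
  obtain B where "\<And>x. x \<in> U \<Longrightarrow> norm (g x) \<le> B" using continuous_bounded_on[OF assms(2,3)] by blast
  then show ?thesis
    using assms by (intro integrable_lebesgue_on_bounded borel_measurable_lebesgue_on borel_measurable_continuous_onI) auto
qed

lemma measurable_lebesgue_on_AE:
  fixes f g :: "'a::euclidean_space \<Rightarrow> real"
  assumes S: "S \<in> sets lebesgue" and f: "f \<in> borel_measurable (lebesgue_on S)" and eq: "AE x in lebesgue_on S. g x = f x"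
  shows "g \<in> borel_measurable (lebesgue_on S)"
proof -
  have "AE x in lebesgue. x \<in> S \<longrightarrow> g x = f x" using eq S by (subst (asm) AE_restrict_space_iff) auto
  then obtain N where N: "N \<in> null_sets lebesgue" "{x. \<not> (x \<in> S \<longrightarrow> g x = f x)} \<subseteq> N"
    by (auto simp: eventually_ae_filter)
  have "f measurable_on S" using f S by (simp add: measurable_on_iff_borel_measurable)
  then have "g measurable_on S"
    by (rule measurable_on_spike[of _ _ N]) (use N in \<open>auto simp: negligible_iff_null_sets\<close>)
  then show ?thesis using S by (simp add: measurable_on_iff_borel_measurable)
qed

section \<open>Weak exterior derivative\<close>

lemma weak_deriv_spec:
  assumes "has_weak_deriv_form \<Omega> m v \<alpha> \<beta>"
  shows "has_weak_deriv_form \<Omega> m v \<alpha> (weak_deriv \<Omega> m v \<alpha>)"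
  unfolding weak_deriv_def by (rule someI[of _ \<beta>]) (rule assms)

lemma weak_deriv_AE:
  assumes "open \<Omega>" "has_weak_deriv_form \<Omega> m v \<alpha> \<beta>"
  shows "AE x in lebesgue_on \<Omega>. weak_deriv \<Omega> m v \<alpha> x vs = \<beta> x vs"
  using has_weak_deriv_unique[OF assms(1), of v "\<lambda>x. \<alpha> x vs"] weak_deriv_spec[OF assms(2)] assms(2)
  unfolding has_weak_deriv_form_def by blast

lemma ext_deriv_eq:
  "ext_deriv \<Omega> m \<alpha> x = ext_comb m (\<lambda>v vs. \<Sum>j\<in>UNIV. v $ j * weak_deriv \<Omega> m (axis j 1) \<alpha> x vs)"
  unfolding ext_deriv_def ext_comb_def by (intro ext if_cong refl)

lemma ext_deriv_alt:
  assumes "\<And>j. has_weak_deriv_form \<Omega> m (axis j 1) \<alpha> (\<beta> j)" "x \<in> \<Omega>"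
  shows "ext_deriv \<Omega> m \<alpha> x \<in> alt_forms (Suc m)"
  unfolding ext_deriv_eq
proof (rule ext_comb_alt)
  have "weak_deriv \<Omega> m (axis j 1) \<alpha> x \<in> alt_forms m" for j
    using weak_deriv_spec[OF assms(1)] assms(2) by (simp add: has_weak_deriv_form_def)
  then show "(\<lambda>vs. \<Sum>j\<in>UNIV. v $ j * weak_deriv \<Omega> m (axis j 1) \<alpha> x vs) \<in> alt_forms m" for v
    by (intro alt_forms_sum) auto
  show "linear (\<lambda>v. \<Sum>j\<in>UNIV. v $ j * weak_deriv \<Omega> m (axis j 1) \<alpha> x vs)" for vs
    by (rule linearI) (simp_all add: sum.distrib sum_distrib_left algebra_simps)
qed

text \<open>
  The coordinates of \<open>ext_comb m D\<close> involve only the values of \<open>D\<close> in coordinate directions and on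
  increasing multi-indices: these are finitely many, so almost everywhere statements about each of
  them combine.
\<close>
lemma ext_comb_axis_cong:
  fixes D E :: "'n::{finite,linorder} rvec \<Rightarrow> 'n rvec form"
  assumes "\<And>j ks. ks \<in> multi_indices m \<Longrightarrow> D (axis j 1) (basis_list ks) = E (axis j 1) (basis_list ks)"
  shows "form_vec (Suc m) (ext_comb m D) = form_vec (Suc m) (ext_comb m E)"
  by (rule form_vec_cong) (simp add: ext_comb_basis assms omit_multi_indices del: sum.lessThan_Suc map_append)

lemma sum_axis: "(\<Sum>i\<in>UNIV. axis j (1::real) $ i * c i) = c (j :: 'n::finite)"
  by (simp add: axis_def if_distrib[of "\<lambda>a. a * _"] cong: if_cong)

lemma AE_weak_deriv_basis:
  fixes \<alpha> :: "'n::{finite,linorder} form_field"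
  assumes "open \<Omega>" "\<And>j. has_weak_deriv_form \<Omega> m (axis j 1) \<alpha> (\<beta> j)"
  shows "AE x in lebesgue_on \<Omega>. \<forall>j. \<forall>ks\<in>multi_indices m. weak_deriv \<Omega> m (axis j 1) \<alpha> x (basis_list ks) = \<beta> j x (basis_list ks)"
proof -
  have "AE x in lebesgue_on \<Omega>. \<forall>ks\<in>multi_indices m. weak_deriv \<Omega> m (axis j 1) \<alpha> x (basis_list ks) = \<beta> j x (basis_list ks)" for j
    by (rule AE_finite_allI) (auto intro: weak_deriv_AE assms)
  then have "AE x in lebesgue_on \<Omega>. \<forall>j\<in>UNIV. \<forall>ks\<in>multi_indices m. weak_deriv \<Omega> m (axis j 1) \<alpha> x (basis_list ks) = \<beta> j x (basis_list ks)"
    by (rule AE_finite_allI[OF finite])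
  then show ?thesis by simp
qed

text \<open>
  Weak derivatives are unique almost everywhere, so the choice of a representative in \<open>weak_deriv\<close>
  does not matter.
\<close>
lemma ext_deriv_AE:
  fixes \<alpha> :: "'n::{finite,linorder} form_field"
  assumes "open \<Omega>" "\<And>j. has_weak_deriv_form \<Omega> m (axis j 1) \<alpha> (\<beta> j)"
  shows "AE x in lebesgue_on \<Omega>. form_vec (Suc m) (ext_deriv \<Omega> m \<alpha> x) =
    form_vec (Suc m) (ext_comb m (\<lambda>v vs. \<Sum>j\<in>UNIV. v $ j * \<beta> j x vs))"
  using AE_weak_deriv_basis[OF assms]
  by eventually_elim (unfold ext_deriv_eq, rule ext_comb_axis_cong, simp add: sum_axis)

lemma smooth_form_weak_deriv:
  assumes "open U" "smooth_form m \<omega>"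
  shows "has_weak_deriv_form U m v \<omega> (\<lambda>x vs. frechet_derivative (\<lambda>y. \<omega> y vs) (at x) v)"
  unfolding has_weak_deriv_form_def
  using smooth_form_frechet[OF assms(2)] smooth_has_weak_deriv[OF assms(1) smooth_formD(2)[OF assms(2)]] by auto

lemma ext_deriv_smooth_AE:
  fixes \<omega> :: "'n::{finite,linorder} form_field"
  assumes U: "open U" and \<omega>: "smooth_form m \<omega>"
  shows "AE x in lebesgue_on U. ext_deriv U m \<omega> x = cext m \<omega> x"
proof -
  note h = smooth_form_weak_deriv[OF U \<omega>]
  have e: "form_vec (Suc m) (ext_comb m (\<lambda>v vs. \<Sum>j\<in>UNIV. v $ j * frechet_derivative (\<lambda>y. \<omega> y vs) (at x) (axis j 1))) = form_vec (Suc m) (cext m \<omega> x)" for x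
    unfolding cext_def by (rule ext_comb_axis_cong) (simp add: sum_axis)
  have "AE x in lebesgue_on U. x \<in> U" using AE_space[of "lebesgue_on U"] by (simp add: space_restrict_space)
  then show ?thesis
    using ext_deriv_AE[OF U h]
    by eventually_elim (use ext_deriv_alt[OF h] cext_alt[OF \<omega>] e in \<open>auto intro!: form_vec_inj[of _ "Suc m"]\<close>)
qed

lemma W1p_norm_zero_form:
  fixes U :: "'n::{finite,linorder} rvec set"
  assumes U: "open U"
  shows "W1p_norm 1 U m (\<lambda>x vs. 0) = 0"
proof -
  have h: "has_weak_deriv_form U m (axis j 1) (\<lambda>x vs. 0) (\<lambda>x vs. 0)" for j :: 'n
    using smooth_form_weak_deriv[OF U, of m "\<lambda>x vs. 0" "axis j 1"]
    by (simp add: smooth_form_def alt_forms_zero smooth_const)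
  have fn: "form_norm m (\<lambda>vs. 0 :: real) = 0" for m by (simp add: form_norm_def)
  have "(LINT x|lebesgue_on U. form_norm m (weak_deriv U m (axis j 1) (\<lambda>x vs. 0) x) powr 1) = 0" for j
  proof (rule integral_eq_zero_AE)
    show "AE x in lebesgue_on U. form_norm m (weak_deriv U m (axis j 1) (\<lambda>x vs. 0) x) powr 1 = 0"
      using AE_weak_deriv_basis[OF U h] by eventually_elim (simp add: form_norm_def)
  qed
  then show ?thesis by (simp add: W1p_norm_def fn)
qed

text \<open>A test form is approximated by the constant sequence of itself.\<close>
lemma test_forms_W1infty_zero:
  fixes \<omega> :: "'n::{finite,linorder} form_field"
  assumes U: "open U" "bounded U" and \<omega>: "\<omega> \<in> test_forms U m"
  shows "\<omega> \<in> W1infty_zero U m"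
proof -
  have sm: "smooth_form m \<omega>" using \<omega> test_functions_smooth by (auto simp: test_forms_def smooth_form_def)
  have t: "(\<lambda>x. \<omega> x vs) \<in> test_functions U" for vs using \<omega> by (simp add: test_forms_def)
  note h = smooth_form_weak_deriv[OF U(1) sm]
  have X: "\<omega> \<in> sobolev_forms X U m" if X: "\<And>\<phi>. \<phi> \<in> test_functions U \<Longrightarrow> \<phi> \<in> X" for X
    unfolding sobolev_forms_def using smooth_formD(1)[OF sm] X[OF t]
    by (auto intro!: exI[of _ "\<lambda>x vs. frechet_derivative (\<lambda>y. \<omega> y vs) (at x) (axis _ 1)"] h X[OF test_functions_frechet[OF t]])
  have m: "\<phi> \<in> borel_measurable (lebesgue_on U)" if "\<phi> \<in> test_functions U" for \<phi>
    by (rule borel_measurable_lebesgue_on[OF test_functions_measurable[OF that]])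
  have "\<omega> \<in> W1infty U m" unfolding W1infty_def
  proof (rule X)
    fix \<phi> :: "'n rvec \<Rightarrow> real" assume \<phi>: "\<phi> \<in> test_functions U"
    obtain B where "\<And>x. \<bar>\<phi> x\<bar> \<le> B" using test_functions_bounded[OF \<phi>] by blast
    then show "\<phi> \<in> Linfty U" unfolding Linfty_def using m[OF \<phi>] by auto
  qed
  moreover have "\<omega> \<in> W1p 1 U m" unfolding W1p_def
  proof (rule X)
    fix \<phi> :: "'n rvec \<Rightarrow> real" assume \<phi>: "\<phi> \<in> test_functions U"
    have "integrable (lebesgue_on U) (\<lambda>x. \<bar>\<phi> x\<bar> powr 1)"
      using integrable_lebesgue_on_continuous[OF U continuous_on_rabs[OF test_functions_continuous[OF \<phi>]]] by simp
    then show "\<phi> \<in> Lp 1 U" unfolding Lp_def using m[OF \<phi>] by simp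
  qed
  moreover have "\<exists>\<phi>. (\<forall>l::nat. \<phi> l \<in> test_forms U m) \<and> (\<lambda>l. W1p_norm 1 U m (\<lambda>x. form_diff (\<omega> x) (\<phi> l x))) \<longlonglongrightarrow> 0"
    by (rule exI[of _ "\<lambda>l. \<omega>"]) (simp add: \<omega> form_diff_def W1p_norm_zero_form[OF U(1)])
  ultimately show ?thesis unfolding W1infty_zero_def W11_zero_def by blast
qed

section \<open>Quasiconvexity with smooth test forms\<close>

lemma measurable_f_form:
  fixes f :: "'n::{finite,linorder} rvec form \<Rightarrow> real"
  assumes "ext_quasiconvex k f" "\<And>x. x \<in> U \<Longrightarrow> F x \<in> alt_forms k"
    "(\<lambda>x. form_vec k (F x)) \<in> borel_measurable (lebesgue_on U)"
  shows "(\<lambda>x. f (F x)) \<in> borel_measurable (lebesgue_on U)"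
  by (rule measurable_compose[OF measurable_form_borel])
    (use assms in \<open>auto simp: ext_quasiconvex_def space_restrict_space\<close>)

text \<open>
  A cutoff times a smooth form is a test form, and its weak exterior derivative is the classical
  one almost everywhere. This is the form in which quasiconvexity is used from here on.
\<close>
lemma quasiconvex_smooth:
  fixes f :: "'n::{finite,linorder} rvec form \<Rightarrow> real"
  assumes qc: "ext_quasiconvex (Suc m) f" and U: "open U" "bounded U" and \<xi>: "\<xi> \<in> alt_forms (Suc m)"
    and w: "smooth_form m w" and \<phi>: "\<phi> \<in> test_functions U"
  shows "f \<xi> * measure lebesgue U \<le> (LINT x|lebesgue_on U. f (form_add \<xi> (cext m (\<lambda>x vs. \<phi> x * w x vs) x)))"
proof -
  define \<omega> where "\<omega> = (\<lambda>x vs. \<phi> x * w x vs)"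
  have sm: "smooth_form m \<omega>" unfolding \<omega>_def by (rule smooth_form_mult[OF w test_functions_smooth[OF \<phi>]])
  have "\<omega> \<in> test_forms U m"
    using sm test_functions_mult[OF \<phi> smooth_formD(2)[OF w]] by (auto simp: test_forms_def smooth_form_def \<omega>_def)
  then have "\<omega> \<in> W1infty_zero U m" by (rule test_forms_W1infty_zero[OF U])
  then have q: "f \<xi> * measure lebesgue U \<le> (LINT x|lebesgue_on U. f (form_add \<xi> (ext_deriv U m \<omega> x)))"
    using qc U \<xi> unfolding ext_quasiconvex_def by auto
  have eq: "AE x in lebesgue_on U. f (form_add \<xi> (ext_deriv U m \<omega> x)) = f (form_add \<xi> (cext m \<omega> x))"
    using ext_deriv_smooth_AE[OF U(1) sm] by eventually_elim simp
  have meas: "(\<lambda>x. f (form_add \<xi> (cext m \<omega> x))) \<in> borel_measurable (lebesgue_on U)"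
  proof (rule measurable_f_form[OF qc])
    show "form_add \<xi> (cext m \<omega> x) \<in> alt_forms (Suc m)" for x by (intro alt_forms_add \<xi> cext_alt sm)
    show "(\<lambda>x. form_vec (Suc m) (form_add \<xi> (cext m \<omega> x))) \<in> borel_measurable (lebesgue_on U)"
      unfolding form_vec_add
      by (intro borel_measurable_lebesgue_on borel_measurable_continuous_onI continuous_intros continuous_cext(1) sm)
  qed
  have "(LINT x|lebesgue_on U. f (form_add \<xi> (ext_deriv U m \<omega> x))) = (LINT x|lebesgue_on U. f (form_add \<xi> (cext m \<omega> x)))"
    by (rule integral_cong_AE[OF measurable_lebesgue_on_AE[OF _ meas eq] meas eq]) (use U in auto)
  with q show ?thesis unfolding \<omega>_def by simp
qed

section \<open>Quantitative continuity of quasiconvex functions\<close>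

lemma integral_lebesgue_on_const_indicator:
  fixes U :: "'a::euclidean_space set"
  assumes U: "open U" "bounded U" and A: "A \<in> sets lebesgue" "A \<subseteq> U"
  shows "integrable (lebesgue_on U) (\<lambda>x. indicator A x * c :: real)"
    "(LINT x|lebesgue_on U. indicator A x * c) = measure lebesgue A * c"
proof -
  interpret finite_measure "lebesgue_on U" by (rule finite_measure_lebesgue_on[OF U])
  have Us: "U \<in> sets lebesgue" using U by simp
  have As: "A \<in> sets (lebesgue_on U)" using A Us by (auto simp: sets_restrict_space_iff)
  show "integrable (lebesgue_on U) (\<lambda>x. indicator A x * c :: real)"
    by (intro integrable_mult_left integrable_real_indicator As) (use emeasure_finite[of A] in \<open>simp only: top.not_eq_extremum infinity_ennreal_def\<close>)
  have "(LINT x|lebesgue_on U. indicator A x * c) = measure (lebesgue_on U) A * c"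
    using As A by (simp add: Int_absorb2 space_restrict_space)
  also have "measure (lebesgue_on U) A = measure lebesgue A"
    using A Us by (intro measure_restrict_space) auto
  finally show "(LINT x|lebesgue_on U. indicator A x * c) = measure lebesgue A * c" .
qed

lemma integral_lebesgue_on_const:
  fixes U :: "'a::euclidean_space set"
  assumes U: "open U" "bounded U"
  shows "integrable (lebesgue_on U) (\<lambda>x. c :: real)" "(LINT x|lebesgue_on U. c) = measure lebesgue U * c"
proof -
  show "integrable (lebesgue_on U) (\<lambda>x. c :: real)"
    using finite_measure.integrable_const[OF finite_measure_lebesgue_on[OF U]] .
  have "(LINT x|lebesgue_on U. c) = (LINT x|lebesgue_on U. indicator U x * c)"
    by (rule Bochner_Integration.integral_cong) (auto simp: space_restrict_space)
  then show "(LINT x|lebesgue_on U. c) = measure lebesgue U * c"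
    using integral_lebesgue_on_const_indicator(2)[OF U, of U c] U by simp
qed

text \<open>
  A cutoff function attains an extremum wherever its value is \<open>0\<close> or \<open>1\<close>. So \<open>d\<phi>\<close> vanishes there,
  also at boundary points of the sets where \<open>\<phi>\<close> is \<open>0\<close> or \<open>1\<close>.
\<close>
lemma frechet_zero_extremum:
  fixes \<phi> :: "'a::euclidean_space \<Rightarrow> real"
  assumes "smooth_on \<phi> UNIV" "\<And>x. 0 \<le> \<phi> x \<and> \<phi> x \<le> 1" "\<phi> x = 0 \<or> \<phi> x = 1"
  shows "frechet_derivative \<phi> (at x) v = 0"
proof -
  have "frechet_derivative \<phi> (at x) = (\<lambda>v. 0)"
    by (rule differential_zero_maxmin[of x UNIV \<phi>]) (use assms smooth_has_derivative in auto)
  then show ?thesis by simp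
qed

text \<open>The alternating sum is the wedge product \<open>l \<and> \<omega>\<close>.\<close>
lemma wedge_bound:
  fixes l :: "'n::{finite,linorder} rvec \<Rightarrow> real" and \<omega> :: "'n rvec form"
  assumes B: "0 \<le> B" "\<And>v. \<bar>l v\<bar> \<le> B * norm v"
  shows "norm (form_vec (Suc m) (ext_comb m (\<lambda>v vs. l v * \<omega> vs))) \<le>
    real (CARD('n set) * Suc m) * (real CARD('n) * real (card (multi_indices m :: 'n list set))) * (B * norm (form_vec m \<omega>))"
proof -
  have "norm (form_vec (Suc m) (ext_comb m (\<lambda>v vs. l v * \<omega> vs))) \<le>
    real (CARD('n set) * Suc m) * (\<Sum>j\<in>UNIV. \<Sum>ks\<in>multi_indices m. \<bar>l (axis j 1) * \<omega> (basis_list ks)\<bar>)"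
    by (rule ext_comb_bound)
  also have "\<dots> \<le> real (CARD('n set) * Suc m) * (\<Sum>j\<in>(UNIV::'n set). \<Sum>ks\<in>(multi_indices m :: 'n list set). B * norm (form_vec m \<omega>))"
  proof (intro mult_left_mono sum_mono)
    fix j :: 'n and ks :: "'n list" assume ks: "ks \<in> multi_indices m"
    have "\<bar>l (axis j 1)\<bar> * \<bar>\<omega> (basis_list ks)\<bar> \<le> B * norm (form_vec m \<omega>)"
      by (intro mult_mono component_le_form_norm ks) (use B(1) B(2)[of "axis j 1"] in auto)
    then show "\<bar>l (axis j 1) * \<omega> (basis_list ks)\<bar> \<le> B * norm (form_vec m \<omega>)" by (simp add: abs_mult)
  qed auto
  also have "\<dots> = real (CARD('n set) * Suc m) * (real CARD('n) * real (card (multi_indices m :: 'n list set))) * (B * norm (form_vec m \<omega>))"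
    by (simp add: mult_ac)
  finally show ?thesis .
qed

text \<open>
  The primitive that the Poincare homotopy formula gives for a constant form \<open>\<zeta>\<close> of degree \<open>m + 1\<close>:
  contraction of \<open>\<zeta>\<close> with the position vector, divided by the degree.
\<close>
definition linear_potential :: "nat \<Rightarrow> 'n::finite rvec form \<Rightarrow> 'n form_field" where
  "linear_potential m \<zeta> x vs = \<zeta> (x # vs) / real (Suc m)"

lemma linear_cons:
  assumes "\<zeta> \<in> alt_forms (Suc m)" shows "linear (\<lambda>x. \<zeta> (x # vs))"
proof (cases "length vs = m")
  case True
  have "linear (\<lambda>x. \<zeta> ((0 # vs)[0 := x]))" using True by (intro alt_forms_linear[OF assms]) auto
  then show ?thesis by simp
next
  case False
  then have "(\<lambda>x. \<zeta> (x # vs)) = (\<lambda>x. 0)" using alt_forms_length[OF assms] by auto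
  then show ?thesis by (simp add: linear_iff)
qed

lemma linear_potential_bounded_linear:
  fixes \<zeta> :: "'n::finite rvec form"
  assumes "\<zeta> \<in> alt_forms (Suc m)"
  shows "bounded_linear (\<lambda>x. linear_potential m \<zeta> x vs)"
proof -
  have "linear (\<lambda>x. linear_potential m \<zeta> x vs)"
    unfolding linear_potential_def using linear_cons[OF assms, of vs]
    by (simp add: linear_iff add_divide_distrib)
  then show ?thesis by (simp add: linear_conv_bounded_linear)
qed

lemma linear_potential_smooth:
  fixes \<zeta> :: "'n::finite rvec form"
  assumes \<zeta>: "\<zeta> \<in> alt_forms (Suc m)"
  shows "smooth_form m (linear_potential m \<zeta>)"
  unfolding smooth_form_def
proof (intro conjI allI)
  show "smooth_on (\<lambda>x. linear_potential m \<zeta> x vs) UNIV" for vs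
    by (intro smooth_bounded_linear linear_potential_bounded_linear \<zeta>)
  fix x
  have "(\<lambda>vs. \<zeta> (x # vs)) \<in> alt_forms m"
  proof (rule alt_formsI)
    fix vs :: "'n rvec list"
    show "length vs \<noteq> m \<Longrightarrow> \<zeta> (x # vs) = 0" using alt_forms_length[OF \<zeta>] by simp
    show "linear (\<lambda>v. \<zeta> (x # vs[i := v]))" if "length vs = m" "i < m" for i
      using alt_forms_linear[OF \<zeta>, of "x # vs" "Suc i"] that by simp
    show "\<zeta> (x # vs) = 0" if "length vs = m" "i < j" "j < m" "vs ! i = vs ! j" for i j
      using alt_forms_eq[OF \<zeta>, of "x # vs" "Suc i" "Suc j"] that by simp
  qed
  from alt_forms_scale[OF this, of "1 / real (Suc m)"] show "linear_potential m \<zeta> x \<in> alt_forms m"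
    by (simp add: linear_potential_def[abs_def])
qed

text \<open>
  Each of the \<open>m + 1\<close> summands equals \<open>\<zeta> vs / (m + 1)\<close>, since moving an argument of \<open>\<zeta>\<close> to the
  front costs exactly the sign of that summand.
\<close>
lemma cext_linear_potential:
  fixes \<zeta> :: "'n::finite rvec form"
  assumes \<zeta>: "\<zeta> \<in> alt_forms (Suc m)"
  shows "cext m (linear_potential m \<zeta>) x = \<zeta>"
proof
  fix vs :: "'n rvec list"
  show "cext m (linear_potential m \<zeta>) x vs = \<zeta> vs"
  proof (cases "length vs = Suc m")
    case True
    have fd: "frechet_derivative (\<lambda>y. linear_potential m \<zeta> y us) (at x) v = linear_potential m \<zeta> v us" for us v
      using frechet_derivative_at[OF bounded_linear_imp_has_derivative[OF linear_potential_bounded_linear[OF \<zeta>]]] by metis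
    have "(- 1) ^ i * linear_potential m \<zeta> (vs ! i) (take i vs @ drop (Suc i) vs) = \<zeta> vs / real (Suc m)" if "i < Suc m" for i
    proof -
      have "\<zeta> vs = \<zeta> (take i vs @ vs ! i # drop (Suc i) vs)" using that True by (simp add: id_take_nth_drop[symmetric])
      also have "\<dots> = (- 1) ^ i * \<zeta> (vs ! i # take i vs @ drop (Suc i) vs)"
        using alt_forms_move[OF \<zeta>, of "take i vs" "drop (Suc i) vs" "vs ! i"] that True by simp
      finally show ?thesis by (simp add: linear_potential_def)
    qed
    then have "cext m (linear_potential m \<zeta>) x vs = (\<Sum>i<Suc m. \<zeta> vs / real (Suc m))"
      unfolding cext_def ext_comb_def fd using True by (simp del: sum.lessThan_Suc)
    then show ?thesis by simp
  next
    case False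
    then show ?thesis using alt_forms_length[OF \<zeta> False] by (simp add: cext_def ext_comb_def)
  qed
qed

lemma linear_potential_bound:
  fixes \<zeta> :: "'n::{finite,linorder} rvec form"
  assumes \<zeta>: "\<zeta> \<in> alt_forms (Suc m)"
  shows "norm (form_vec m (linear_potential m \<zeta> x)) \<le> real CARD('n set) * real CARD('n) * norm x * norm (form_vec (Suc m) \<zeta>)"
proof -
  let ?N = "norm (form_vec (Suc m) \<zeta>)"
  have comp: "\<bar>form_vec m (linear_potential m \<zeta> x) $ A\<bar> \<le> real CARD('n) * norm x * ?N" for A
  proof (cases "card A = m")
    case True
    define ks where "ks = sorted_list_of_set A"
    have ks: "ks \<in> multi_indices m" using True bij_betwE[OF multi_indices_bij] by (auto simp: ks_def)
    note lin = linear_cons[OF \<zeta>, of "basis_list ks"]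
    have "\<zeta> (x # basis_list ks) = \<zeta> ((\<Sum>j\<in>UNIV. x $ j *\<^sub>R axis j 1) # basis_list ks)"
      using basis_expansion[of x] by (simp add: scalar_mult_eq_scaleR)
    also have "\<dots> = (\<Sum>j\<in>UNIV. x $ j * \<zeta> (axis j 1 # basis_list ks))"
      using linear_sum[OF lin, of "\<lambda>j. x $ j *\<^sub>R axis j 1" UNIV] linear_cmul[OF lin] by simp
    finally have "\<bar>\<zeta> (x # basis_list ks)\<bar> \<le> (\<Sum>j\<in>UNIV. \<bar>x $ j * \<zeta> (axis j 1 # basis_list ks)\<bar>)" by simp
    also have "\<dots> \<le> (\<Sum>j\<in>(UNIV::'n set). norm x * ?N)"
      by (intro sum_mono) (auto simp: abs_mult intro!: mult_mono component_le_norm_cart alt_forms_basis_cons_le[OF \<zeta> ks])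
    finally have "\<bar>\<zeta> (x # basis_list ks)\<bar> \<le> real CARD('n) * norm x * ?N" by (simp add: mult.assoc)
    moreover have "\<bar>\<zeta> (x # basis_list ks)\<bar> / real (Suc m) \<le> \<bar>\<zeta> (x # basis_list ks)\<bar>"
      by (simp add: divide_le_eq mult_le_cancel_left1)
    ultimately show ?thesis using True by (simp add: form_vec_def linear_potential_def ks_def[symmetric])
  qed (simp add: form_vec_def)
  have "norm (form_vec m (linear_potential m \<zeta> x)) \<le> (\<Sum>A\<in>UNIV. \<bar>form_vec m (linear_potential m \<zeta> x) $ A\<bar>)" by (rule norm_le_l1_cart)
  also have "\<dots> \<le> (\<Sum>A\<in>(UNIV::'n set set). real CARD('n) * norm x * ?N)" by (rule sum_mono) (rule comp)
  finally show ?thesis by (simp add: mult.assoc)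
qed

lemma compact_inner_approx:
  fixes U :: "'a::euclidean_space set"
  assumes U: "open U" "bounded U" and e: "e > 0"
  shows "\<exists>K. compact K \<and> K \<subseteq> U \<and> measure lebesgue (U - K) < e"
proof -
  have "U \<in> sets lebesgue" using U by simp
  from sets_lebesgue_inner_closed[OF this e] obtain K where K: "closed K" "K \<subseteq> U" "U - K \<in> lmeasurable" "emeasure lebesgue (U - K) < ennreal e" by metis
  have "measure lebesgue (U - K) < e"
    using K(3,4) e by (simp add: emeasure_eq_measure2 ennreal_less_iff)
  then show ?thesis using K U(2) bounded_subset compact_eq_bounded_closed by blast
qed

text \<open>
  The growth conditions in the form in which they enter the estimates: a constant lower bound and
  \<open>p\<close>-growth from above.
\<close>
locale quasiconvex_growth =
  fixes f :: "'n::{finite,linorder} rvec form \<Rightarrow> real" and m :: nat and p c1 c2 :: real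
  assumes qc: "ext_quasiconvex (Suc m) f" and p: "1 \<le> p" and c: "0 \<le> c1" "0 \<le> c2"
    and lower: "\<And>\<xi>. \<xi> \<in> alt_forms (Suc m) \<Longrightarrow> - c1 \<le> f \<xi>"
    and upper: "\<And>\<xi>. \<xi> \<in> alt_forms (Suc m) \<Longrightarrow> f \<xi> \<le> c2 * (norm (form_vec (Suc m) \<xi>) powr p + 1)"
begin

abbreviation nrm :: "'n rvec form \<Rightarrow> real" where "nrm \<xi> \<equiv> norm (form_vec (Suc m) \<xi>)"

lemma integrable_f_smooth:
  assumes U: "open U" "bounded U" and \<xi>: "\<xi> \<in> alt_forms (Suc m)" and w: "smooth_form m w"
  shows "integrable (lebesgue_on U) (\<lambda>x. f (form_add \<xi> (cext m w x)))"
proof -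
  have alt: "form_add \<xi> (cext m w x) \<in> alt_forms (Suc m)" for x by (intro alt_forms_add \<xi> cext_alt w)
  have cont: "continuous_on UNIV (\<lambda>x. form_vec (Suc m) (form_add \<xi> (cext m w x)))"
    unfolding form_vec_add by (intro continuous_intros continuous_cext(1) w)
  obtain B where B: "B \<ge> 0" "\<And>x. x \<in> U \<Longrightarrow> nrm (form_add \<xi> (cext m w x)) \<le> B"
    using continuous_bounded_on[OF U(2) cont] by blast
  show ?thesis
  proof (rule integrable_lebesgue_on_bounded[OF U, of _ "c1 + c2 * (B powr p + 1)"])
    show "(\<lambda>x. f (form_add \<xi> (cext m w x))) \<in> borel_measurable (lebesgue_on U)"
      by (intro measurable_f_form[OF qc] alt borel_measurable_lebesgue_on borel_measurable_continuous_onI cont)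
    fix x assume x: "x \<in> U"
    have "f (form_add \<xi> (cext m w x)) \<le> c2 * (nrm (form_add \<xi> (cext m w x)) powr p + 1)" by (rule upper[OF alt])
    also have "\<dots> \<le> c2 * (B powr p + 1)" using B(2)[OF x] c p by (intro mult_left_mono add_mono powr_mono2) auto
    finally have "f (form_add \<xi> (cext m w x)) \<le> c2 * (B powr p + 1)" .
    moreover have "0 \<le> c2 * (B powr p + 1)" using c by simp
    ultimately show "\<bar>f (form_add \<xi> (cext m w x))\<bar> \<le> c1 + c2 * (B powr p + 1)" using lower[OF alt[of x]] c by linarith
  qed
qed

text \<open>
  On the unit ball \<open>U\<close>, test quasiconvexity at \<open>\<xi>\<close> with \<open>\<phi>\<close> times a linear primitive of
  \<open>\<zeta> = \<eta> - \<xi>\<close>, where the cutoff \<open>\<phi>\<close> is \<open>1\<close> on a compact \<open>K\<close>. On \<open>K\<close> the argument of \<open>f\<close> is \<open>\<eta>\<close>; on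
  \<open>U - K\<close> the growth condition bounds its value by a combination of \<open>1 + |\<xi>|\<^sup>p\<close> and \<open>|\<zeta>|\<^sup>p\<close>. The
  measure of \<open>U - K\<close> is chosen in terms of \<open>\<delta>\<close>, which makes the coefficient of \<open>|\<xi>|\<^sup>p\<close> small; the
  price is a constant in front of \<open>|\<zeta>|\<^sup>p\<close>, because the derivative of \<open>\<phi>\<close> is large.
\<close>
lemma quasiconvex_estimate:
  assumes \<delta>: "\<delta> > 0"
  shows "\<exists>C\<ge>0. \<forall>\<xi>\<in>alt_forms (Suc m). \<forall>\<eta>\<in>alt_forms (Suc m).
    f \<xi> \<le> f \<eta> + \<delta> * (1 + nrm \<xi> powr p) + C * norm (form_vec (Suc m) \<xi> - form_vec (Suc m) \<eta>) powr p"
proof -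
  define U where "U = ball (0 :: 'n rvec) 1"
  have U: "open U" "bounded U" by (auto simp: U_def)
  define \<mu> where "\<mu> = measure lebesgue U"
  have \<mu>: "\<mu> > 0" unfolding \<mu>_def U_def by (simp add: content_ball_pos measure_completion)
  define C1 where "C1 = c1 + c2 + c2 * 2 powr p"
  have C1: "C1 \<ge> 0" using c by (simp add: C1_def)
  obtain K where K: "compact K" "K \<subseteq> U" "measure lebesgue (U - K) < \<mu> * (\<delta> / (C1 + 1))"
    using compact_inner_approx[OF U, of "\<mu> * (\<delta> / (C1 + 1))"] \<mu> \<delta> C1 by (auto simp: field_simps)
  obtain \<phi> where \<phi>: "\<phi> \<in> test_functions U" "\<And>x. 0 \<le> \<phi> x \<and> \<phi> x \<le> 1" "\<And>x. x \<in> K \<Longrightarrow> \<phi> x = 1"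
    using cutoff_exists[OF K(1,2) U(1)] by blast
  note sm = test_functions_smooth[OF \<phi>(1)]
  obtain B where B: "B \<ge> 0" "\<And>x v. \<bar>frechet_derivative \<phi> (at x) v\<bar> \<le> B * norm v"
    using test_functions_derivative_bounded[OF \<phi>(1)] by blast
  \<comment> \<open>A bound for the wedge product of \<open>d\<phi>\<close> with the primitive, relative to the size of \<open>\<zeta>\<close>.\<close>
  define W where "W = real (CARD('n set) * Suc m) * (real CARD('n) * real (card (multi_indices m :: 'n list set))) * (B * (real CARD('n set) * real CARD('n)))"
  have W: "W \<ge> 0" using B by (simp add: W_def)
  define C where "C = \<delta> * c2 * 2 powr p * (1 + W) powr p"
  have "f \<xi> \<le> f \<eta> + \<delta> * (1 + nrm \<xi> powr p) + C * norm (form_vec (Suc m) \<xi> - form_vec (Suc m) \<eta>) powr p"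
    if \<xi>: "\<xi> \<in> alt_forms (Suc m)" and \<eta>: "\<eta> \<in> alt_forms (Suc m)" for \<xi> \<eta>
  proof -
    define \<zeta> where "\<zeta> = form_diff \<eta> \<xi>"
    have \<zeta>: "\<zeta> \<in> alt_forms (Suc m)" unfolding \<zeta>_def by (intro alt_forms_diff \<xi> \<eta>)
    have n\<zeta>: "nrm \<zeta> = norm (form_vec (Suc m) \<xi> - form_vec (Suc m) \<eta>)" by (simp add: \<zeta>_def form_vec_diff norm_minus_commute)
    let ?L = "linear_potential m \<zeta>"
    let ?w = "\<lambda>x vs. \<phi> x * ?L x vs"
    note L = linear_potential_smooth[OF \<zeta>]
    have sw: "smooth_form m ?w" by (rule smooth_form_mult[OF L sm])
    have alt: "form_add \<xi> (cext m ?w x) \<in> alt_forms (Suc m)" for x by (intro alt_forms_add \<xi> cext_alt sw)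
    have cw: "cext m ?w x vs = \<phi> x * \<zeta> vs + ext_comb m (\<lambda>v vs. frechet_derivative \<phi> (at x) v * ?L x vs) vs" for x vs
      by (simp add: cext_mult[OF L sm] cext_linear_potential[OF \<zeta>])
    \<comment> \<open>An upper bound for \<open>f\<close> at the perturbed form minus the lower bound \<open>- c1\<close> of \<open>f\<close>.\<close>
    define M where "M = c2 * (2 powr p * (nrm \<xi> powr p + (1 + W) powr p * nrm \<zeta> powr p) + 1) + c1"
    have inK: "f (form_add \<xi> (cext m ?w x)) = f \<eta>" if "x \<in> K" for x
    proof -
      have "cext m ?w x = \<zeta>"
        using \<phi>(3)[OF that] frechet_zero_extremum[OF sm \<phi>(2), of x] by (auto simp: cw ext_comb_def)
      then have "form_add \<xi> (cext m ?w x) = \<eta>" by (simp add: form_add_def \<zeta>_def form_diff_def)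
      then show ?thesis by simp
    qed
    have all: "f (form_add \<xi> (cext m ?w x)) \<le> f \<eta> + M" if x: "x \<in> U" for x
    proof -
      have wb: "norm (form_vec (Suc m) (ext_comb m (\<lambda>v vs. frechet_derivative \<phi> (at x) v * ?L x vs))) \<le> W * nrm \<zeta>"
      proof -
        have "norm (form_vec m (?L x)) \<le> real CARD('n set) * real CARD('n) * norm x * nrm \<zeta>" by (rule linear_potential_bound[OF \<zeta>])
        also have "\<dots> \<le> real CARD('n set) * real CARD('n) * 1 * nrm \<zeta>"
          using x by (intro mult_right_mono mult_left_mono) (auto simp: U_def)
        finally have "norm (form_vec m (?L x)) \<le> real CARD('n set) * real CARD('n) * nrm \<zeta>" by simp
        then show ?thesis
          unfolding W_def mult.assoc
          by (intro order_trans[OF wedge_bound[OF B(1) B(2), unfolded mult.assoc]] mult_left_mono) (use B(1) in auto)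
      qed
      have "form_vec (Suc m) (cext m ?w x) = \<phi> x *\<^sub>R form_vec (Suc m) \<zeta> + form_vec (Suc m) (ext_comb m (\<lambda>v vs. frechet_derivative \<phi> (at x) v * ?L x vs))"
        by (simp add: form_vec_def vec_eq_iff cw)
      then have "nrm (cext m ?w x) \<le> \<bar>\<phi> x\<bar> * nrm \<zeta> + W * nrm \<zeta>"
        using norm_triangle_ineq[of "\<phi> x *\<^sub>R form_vec (Suc m) \<zeta>"] wb by (smt (verit) norm_scaleR)
      also have "\<dots> \<le> 1 * nrm \<zeta> + W * nrm \<zeta>" using \<phi>(2)[of x] by (intro add_mono mult_right_mono) auto
      finally have n1: "nrm (cext m ?w x) \<le> (1 + W) * nrm \<zeta>" by (simp add: algebra_simps)
      have "f (form_add \<xi> (cext m ?w x)) \<le> c2 * (nrm (form_add \<xi> (cext m ?w x)) powr p + 1)" by (rule upper[OF alt])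
      also have "\<dots> \<le> c2 * (\<bar>nrm \<xi> + (1 + W) * nrm \<zeta>\<bar> powr p + 1)"
      proof (intro mult_left_mono add_mono powr_mono2)
        have "nrm (form_add \<xi> (cext m ?w x)) \<le> nrm \<xi> + nrm (cext m ?w x)" unfolding form_vec_add by (rule norm_triangle_ineq)
        then show "nrm (form_add \<xi> (cext m ?w x)) \<le> \<bar>nrm \<xi> + (1 + W) * nrm \<zeta>\<bar>" using n1 by linarith
      qed (use c p in auto)
      also have "\<dots> \<le> c2 * (2 powr p * (\<bar>nrm \<xi>\<bar> powr p + \<bar>(1 + W) * nrm \<zeta>\<bar> powr p) + 1)"
        using c p by (intro mult_left_mono add_mono powr_add_le) auto
      also have "\<dots> = M - c1" using W by (simp add: M_def powr_mult abs_mult)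
      finally show ?thesis using lower[OF \<eta>] by linarith
    qed
    have UK: "U - K \<in> sets lebesgue" "U - K \<subseteq> U" using U K(1) by (auto intro!: sets.Diff borel_compact)
    note UKi = integral_lebesgue_on_const_indicator[OF U UK, of M]
    have M0: "M \<ge> 0" using c by (simp add: M_def)
    have "f \<xi> * \<mu> \<le> (LINT x|lebesgue_on U. f (form_add \<xi> (cext m ?w x)))"
      unfolding \<mu>_def by (rule quasiconvex_smooth[OF qc U \<xi> L \<phi>(1)])
    also have "\<dots> \<le> (LINT x|lebesgue_on U. f \<eta> + indicator (U - K) x * M)"
    proof (rule integral_mono)
      show "integrable (lebesgue_on U) (\<lambda>x. f \<eta> + indicator (U - K) x * M)"
        by (intro Bochner_Integration.integrable_add integral_lebesgue_on_const(1)[OF U] UKi)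
    next
      fix x assume "x \<in> space (lebesgue_on U)"
      then have "x \<in> U" by (simp add: space_restrict_space)
      then show "f (form_add \<xi> (cext m ?w x)) \<le> f \<eta> + indicator (U - K) x * M"
        using inK[of x] all[of x] M0 by (cases "x \<in> K") auto
    qed (rule integrable_f_smooth[OF U \<xi> sw])
    also have "\<dots> = \<mu> * f \<eta> + measure lebesgue (U - K) * M"
      unfolding \<mu>_def
      by (subst Bochner_Integration.integral_add[OF integral_lebesgue_on_const(1)[OF U] UKi(1)])
        (simp only: UKi(2) integral_lebesgue_on_const(2)[OF U])
    also have "\<dots> \<le> \<mu> * f \<eta> + (\<mu> * (\<delta> / (C1 + 1))) * M"
      using K(3) M0 by (intro add_left_mono mult_right_mono) auto
    finally have "\<mu> * f \<xi> \<le> \<mu> * (f \<eta> + \<delta> / (C1 + 1) * M)" by (simp add: algebra_simps)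
    then have 1: "f \<xi> \<le> f \<eta> + \<delta> / (C1 + 1) * M" using \<mu> by (rule mult_left_le_imp_le)
    have "M \<le> C1 * (1 + nrm \<xi> powr p) + c2 * 2 powr p * (1 + W) powr p * nrm \<zeta> powr p"
    proof -
      have "0 \<le> (c1 + c2) * nrm \<xi> powr p + c2 * 2 powr p" using c by simp
      then show ?thesis unfolding M_def C1_def by (simp add: algebra_simps)
    qed
    also have "\<dots> \<le> (C1 + 1) * (1 + nrm \<xi> powr p) + (C1 + 1) * (c2 * 2 powr p * (1 + W) powr p * nrm \<zeta> powr p)"
      using C1 c by (intro add_mono mult_right_mono) (auto simp: mult_le_cancel_right1 mult_less_0_iff)
    also have "\<dots> = (C1 + 1) * ((1 + nrm \<xi> powr p) + c2 * 2 powr p * (1 + W) powr p * nrm \<zeta> powr p)" by (simp add: algebra_simps)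
    finally have "\<delta> / (C1 + 1) * M \<le> \<delta> / (C1 + 1) * ((C1 + 1) * ((1 + nrm \<xi> powr p) + c2 * 2 powr p * (1 + W) powr p * nrm \<zeta> powr p))"
      using \<delta> C1 by (intro mult_left_mono) auto
    also have "\<dots> = \<delta> * (1 + nrm \<xi> powr p) + C * nrm \<zeta> powr p"
      using C1 by (simp add: C_def field_simps)
    finally show ?thesis using 1 by (simp add: n\<zeta>)
  qed
  moreover have "C \<ge> 0" using \<delta> c by (simp add: C_def)
  ultimately show ?thesis by blast
qed

text \<open>
  Quasiconvexity without zero boundary values, up to error terms. For each of \<open>l\<close> cutoffs, apply
  quasiconvexity to \<open>\<phi> j * w\<close> and compare with \<open>dw\<close> itself: nothing changes where \<open>\<phi> j = 1\<close>, and
  where \<open>\<phi> j = 0\<close> the value is \<open>f \<xi>\<close>, which costs a multiple of the measure of \<open>U - K\<close>. The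
  transition layer \<open>S j\<close> of \<open>\<phi> j\<close> costs, in addition, the integral of \<open>|dw|\<^sup>p\<close> over the layer and a
  multiple of the integral of \<open>|w|\<^sup>p\<close>. As the layers are disjoint, the average over \<open>j < l\<close>
  contains the integral of \<open>|dw|\<^sup>p\<close> with the factor \<open>1 / l\<close>. The constant \<open>C1\<close> does not depend on
  \<open>l\<close>, \<open>U\<close> or \<open>K\<close>, whereas the constant \<open>C\<close> in front of \<open>|w|\<^sup>p\<close> may, as \<open>w\<close> will tend to zero.
\<close>
lemma slicing_estimate:
  fixes U K :: "'n rvec set" and l :: nat
  assumes U: "open U" "bounded U" and K: "compact K" "K \<subseteq> U" and l: "l > 0"
  defines "C1 \<equiv> c1 + c2 * (1 + 3 powr p)"
  shows "\<exists>C\<ge>0. \<forall>\<xi>\<in>alt_forms (Suc m). \<forall>w. smooth_form m w \<longrightarrow>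
    f \<xi> * measure lebesgue U \<le> (LINT x|lebesgue_on U. f (form_add \<xi> (cext m w x)))
      + C1 * (1 + nrm \<xi> powr p) * measure lebesgue (U - K)
      + C1 / l * (LINT x|lebesgue_on U. nrm (cext m w x) powr p)
      + C * (LINT x|lebesgue_on U. norm (form_vec m (w x)) powr p)"
proof -
  \<comment> \<open>Each cutoff is \<open>1\<close> on the support of its predecessor; this makes the transition layers disjoint.\<close>
  let ?P = "\<lambda>n::nat. \<lambda>\<phi>. \<phi> \<in> test_functions U \<and> (\<forall>x. 0 \<le> \<phi> x \<and> \<phi> x \<le> 1) \<and> (\<forall>x\<in>K. \<phi> x = 1)"
  let ?Q = "\<lambda>n::nat. \<lambda>\<phi> \<psi> :: 'n rvec \<Rightarrow> real. \<forall>x. \<phi> x \<noteq> 0 \<longrightarrow> \<psi> x = 1"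
  have "\<exists>\<phi>. \<forall>n. ?P n (\<phi> n) \<and> ?Q n (\<phi> n) (\<phi> (Suc n))"
  proof (rule dependent_nat_choice)
    show "\<exists>\<phi>. ?P 0 \<phi>" using cutoff_exists[OF K U(1)] by blast
    fix \<phi> n assume \<phi>: "?P n \<phi>"
    then obtain L where L: "compact L" "L \<subseteq> U" "\<forall>x. x \<notin> L \<longrightarrow> \<phi> x = 0" using test_functions_support[of \<phi> U] by blast
    obtain \<psi> where \<psi>: "\<psi> \<in> test_functions U" "\<forall>x. 0 \<le> \<psi> x \<and> \<psi> x \<le> 1" "\<forall>x\<in>K \<union> L. \<psi> x = 1"
      using cutoff_exists[of "K \<union> L" U] K L U(1) by (auto simp: compact_Un)
    show "\<exists>\<psi>. ?P (Suc n) \<psi> \<and> ?Q n \<phi> \<psi>" using \<psi> L(3) by (intro exI[of _ \<psi>]) blast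
  qed
  then obtain \<phi> where \<phi>: "\<And>n. \<phi> n \<in> test_functions U" "\<And>n x. 0 \<le> \<phi> n x \<and> \<phi> n x \<le> 1" "\<And>n x. x \<in> K \<Longrightarrow> \<phi> n x = 1"
    and step: "\<And>n x. \<phi> n x \<noteq> 0 \<Longrightarrow> \<phi> (Suc n) x = 1" by blast
  have chain: "\<phi> j x = 1" if "i < j" "\<phi> i x \<noteq> 0" for i j x
    using that by (induction j) (auto simp: less_Suc_eq step)
  define S where "S j = {x. \<phi> j x \<noteq> 0 \<and> \<phi> j x \<noteq> 1}" for j
  have disj: "(\<Sum>j<l. indicator (S j) x) \<le> (1::real)" for x
  proof (cases "\<exists>j<l. x \<in> S j")
    case True
    then obtain j where j: "j < l" "x \<in> S j" by blast
    have "x \<notin> S i" if "i \<noteq> j" for i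
      using j(2) chain[of i j x] chain[of j i x] that by (cases "i < j") (auto simp: S_def)
    then have "(\<Sum>i<l. indicator (S i) x) = (\<Sum>i<l. if i = j then 1 else (0::real))"
      using j(2) by (intro sum.cong) (auto simp: indicator_def)
    then show ?thesis using j(1) by simp
  qed (auto intro!: order_trans[OF eq_refl[OF sum.neutral]])
  have "\<exists>B\<ge>0. \<forall>x v. \<bar>frechet_derivative (\<phi> j) (at x) v\<bar> \<le> B * norm v" for j
    using test_functions_derivative_bounded[OF \<phi>(1)[of j]] by metis
  then obtain B where B: "\<And>j. B j \<ge> 0" "\<And>j x v. \<bar>frechet_derivative (\<phi> j) (at x) v\<bar> \<le> B j * norm v" by metis
  define W where "W = real (CARD('n set) * Suc m) * (real CARD('n) * real (card (multi_indices m :: 'n list set)))"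
  have W0: "W \<ge> 0" by (simp add: W_def)
  define C where "C = (\<Sum>j<l. C1 * (W * B j) powr p) / l"
  have C1: "C1 \<ge> 0" unfolding C1_def using c by simp
  have c23: "c2 * 3 powr p \<le> C1" "c1 + c2 \<le> C1" using c unfolding C1_def by (auto simp: algebra_simps)
  have "f \<xi> * measure lebesgue U \<le> (LINT x|lebesgue_on U. f (form_add \<xi> (cext m w x)))
      + C1 * (1 + nrm \<xi> powr p) * measure lebesgue (U - K)
      + C1 / l * (LINT x|lebesgue_on U. nrm (cext m w x) powr p)
      + C * (LINT x|lebesgue_on U. norm (form_vec m (w x)) powr p)"
    if \<xi>: "\<xi> \<in> alt_forms (Suc m)" and w: "smooth_form m w" for \<xi> w
  proof -
    define F where "F j x = f (form_add \<xi> (cext m (\<lambda>x vs. \<phi> j x * w x vs) x))" for j x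
    define A where "A = C1 * (1 + nrm \<xi> powr p)"
    define g where "g x = nrm (cext m w x) powr p" for x
    define h where "h x = norm (form_vec m (w x)) powr p" for x
    define F0 where "F0 x = f (form_add \<xi> (cext m w x))" for x
    note sm = test_functions_smooth[OF \<phi>(1)]
    have alt0: "form_add \<xi> (cext m w x) \<in> alt_forms (Suc m)" for x by (intro alt_forms_add \<xi> cext_alt w)
    have altj: "form_add \<xi> (cext m (\<lambda>x vs. \<phi> j x * w x vs) x) \<in> alt_forms (Suc m)" for j x
      by (intro alt_forms_add \<xi> cext_alt smooth_form_mult w sm)
    have A0: "A \<ge> 0" using C1 by (simp add: A_def)
    \<comment> \<open>The pointwise comparison, separately where \<open>\<phi> j\<close> is \<open>1\<close>, where it is \<open>0\<close>, and on its transition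
      layer.\<close>
    have pt: "F j x \<le> F0 x + indicator (U - K) x * A + indicator (S j) x * (C1 * g x) + C1 * (W * B j) powr p * h x"
      if x: "x \<in> U" for j x
    proof -
      have g0: "0 \<le> g x" and h0: "0 \<le> h x" by (auto simp: g_def h_def)
      let ?e = "ext_comb m (\<lambda>v vs. frechet_derivative (\<phi> j) (at x) v * w x vs)"
      have cw: "cext m (\<lambda>x vs. \<phi> j x * w x vs) x vs = \<phi> j x * cext m w x vs + ?e vs" for vs
        by (rule cext_mult[OF w sm])
      consider "\<phi> j x = 1" | "\<phi> j x = 0" | "x \<in> S j" by (auto simp: S_def)
      then show ?thesis
      proof cases
        case 1
        then have "cext m (\<lambda>x vs. \<phi> j x * w x vs) x = cext m w x"
          using frechet_zero_extremum[OF sm \<phi>(2), of j x] by (auto simp: cw ext_comb_def)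
        then have "F j x = F0 x" by (simp add: F_def F0_def)
        moreover have "0 \<le> indicator (U - K) x * A + indicator (S j) x * (C1 * g x) + C1 * (W * B j) powr p * h x"
          using A0 C1 g0 h0 by simp
        ultimately show ?thesis by linarith
      next
        case 2
        then have "cext m (\<lambda>x vs. \<phi> j x * w x vs) x = (\<lambda>vs. 0)"
          using frechet_zero_extremum[OF sm \<phi>(2), of j x] by (auto simp: cw ext_comb_def)
        then have "F j x = f \<xi>" by (simp add: F_def form_add_def)
        also have "\<dots> \<le> c2 * (nrm \<xi> powr p + 1)" by (rule upper[OF \<xi>])
        also have "\<dots> \<le> A - c1"
        proof -
          have "c2 * (nrm \<xi> powr p + 1) + c1 \<le> (c1 + c2) * (1 + nrm \<xi> powr p)" using c by (simp add: algebra_simps)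
          also have "\<dots> \<le> A" unfolding A_def using c23 by (intro mult_right_mono) auto
          finally show ?thesis by simp
        qed
        also have "\<dots> \<le> A + F0 x" using lower[OF alt0[of x]] by (simp add: F0_def)
        finally have "F j x \<le> A + F0 x" .
        moreover have "x \<in> U - K" using x \<phi>(3)[of x j] 2 by auto
        moreover have "0 \<le> indicator (S j) x * (C1 * g x) + C1 * (W * B j) powr p * h x"
          using C1 g0 h0 by simp
        ultimately show ?thesis by simp
      next
        case 3
        have xK: "x \<in> U - K" using 3 x \<phi>(3)[of x j] by (auto simp: S_def)
        have e: "norm (form_vec (Suc m) ?e) \<le> W * B j * norm (form_vec m (w x))"
          using wedge_bound[OF B(1)[of j] B(2)[of j x], of m "w x"] by (simp add: W_def mult.assoc)
        have "form_vec (Suc m) (cext m (\<lambda>x vs. \<phi> j x * w x vs) x) = \<phi> j x *\<^sub>R form_vec (Suc m) (cext m w x) + form_vec (Suc m) ?e"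
          by (simp add: form_vec_def vec_eq_iff cw)
        then have "nrm (cext m (\<lambda>x vs. \<phi> j x * w x vs) x) \<le> \<bar>\<phi> j x\<bar> * nrm (cext m w x) + W * B j * norm (form_vec m (w x))"
          using norm_triangle_ineq[of "\<phi> j x *\<^sub>R form_vec (Suc m) (cext m w x)"] e by (smt (verit) norm_scaleR)
        also have "\<dots> \<le> 1 * nrm (cext m w x) + W * B j * norm (form_vec m (w x))"
          using \<phi>(2)[of j x] by (intro add_right_mono mult_right_mono) auto
        finally have n1: "nrm (cext m (\<lambda>x vs. \<phi> j x * w x vs) x) \<le> nrm (cext m w x) + W * B j * norm (form_vec m (w x))" by simp
        \<comment> \<open>The three contributions to the argument of \<open>f\<close>, so that the inequality for sums of three
          powers applies.\<close>
        define a where "a i = (if i = 0 then nrm \<xi> else if i = 1 then nrm (cext m w x) else W * B j * norm (form_vec m (w x)))" for i :: nat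
        have a0: "0 \<le> a i" for i using W0 B(1) by (simp add: a_def)
        have asum: "(\<Sum>i<3. a i) = nrm \<xi> + nrm (cext m w x) + W * B j * norm (form_vec m (w x))"
          by (simp add: a_def numeral_3_eq_3)
        have apsum: "(\<Sum>i<3. a i powr p) = nrm \<xi> powr p + g x + (W * B j) powr p * h x"
          using W0 B(1) by (simp add: a_def numeral_3_eq_3 g_def h_def powr_mult)
        have "F j x \<le> c2 * (nrm (form_add \<xi> (cext m (\<lambda>x vs. \<phi> j x * w x vs) x)) powr p + 1)"
          unfolding F_def by (rule upper[OF altj])
        also have "\<dots> \<le> c2 * ((\<Sum>i<3. a i) powr p + 1)"
        proof (intro mult_left_mono add_mono powr_mono2)
          have "nrm (form_add \<xi> (cext m (\<lambda>x vs. \<phi> j x * w x vs) x)) \<le> nrm \<xi> + nrm (cext m (\<lambda>x vs. \<phi> j x * w x vs) x)"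
            unfolding form_vec_add by (rule norm_triangle_ineq)
          then show "nrm (form_add \<xi> (cext m (\<lambda>x vs. \<phi> j x * w x vs) x)) \<le> (\<Sum>i<3. a i)" using n1 asum by linarith
        qed (use c p in auto)
        also have "\<dots> \<le> c2 * (3 powr p * (\<Sum>i<3. a i powr p) + 1)"
          using powr_sum_le[of "{..<3::nat}" a p] a0 c p by (intro mult_left_mono add_mono) auto
        also have "\<dots> = c2 * 3 powr p * nrm \<xi> powr p + c2 + c2 * 3 powr p * (g x) + c2 * 3 powr p * ((W * B j) powr p * h x)"
          unfolding apsum by (simp add: algebra_simps)
        also have "\<dots> \<le> c2 * 3 powr p * nrm \<xi> powr p + c2 + C1 * g x + C1 * ((W * B j) powr p * h x)"
          using c23(1) g0 h0 by (intro add_mono mult_right_mono) auto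
        also have "\<dots> \<le> (A - c1) + C1 * g x + C1 * ((W * B j) powr p * h x)"
        proof -
          have "0 \<le> (c1 + c2) * nrm \<xi> powr p + c2 * 3 powr p" using c by simp
          then show ?thesis unfolding A_def C1_def by (simp add: algebra_simps)
        qed
        also have "\<dots> \<le> (A + F0 x) + C1 * g x + C1 * ((W * B j) powr p * h x)"
          using lower[OF alt0[of x]] by (simp add: F0_def)
        finally show ?thesis using xK 3 by (simp add: mult.assoc)
      qed
    qed
    have gi: "integrable (lebesgue_on U) g" unfolding g_def using p
      by (intro integrable_lebesgue_on_continuous[OF U] continuous_on_powr' continuous_intros continuous_cext(1)[OF w]) auto
    have hi: "integrable (lebesgue_on U) h" unfolding h_def using p
      by (intro integrable_lebesgue_on_continuous[OF U] continuous_on_powr' continuous_intros continuous_cext(2)[OF w]) auto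
    have F0i: "integrable (lebesgue_on U) F0" unfolding F0_def by (rule integrable_f_smooth[OF U \<xi> w])
    have Fi: "integrable (lebesgue_on U) (F j)" for j unfolding F_def
      by (rule integrable_f_smooth[OF U \<xi> smooth_form_mult[OF w sm]])
    have UK: "U - K \<in> sets lebesgue" "U - K \<subseteq> U" using U K(1) by (auto intro!: sets.Diff borel_compact)
    note UKi = integral_lebesgue_on_const_indicator[OF U UK, of "real l * A"]
    have "real l * (f \<xi> * measure lebesgue U) = (\<Sum>j<l. f \<xi> * measure lebesgue U)" by simp
    also have "\<dots> \<le> (\<Sum>j<l. (LINT x|lebesgue_on U. F j x))"
      unfolding F_def by (intro sum_mono quasiconvex_smooth[OF qc U \<xi> w \<phi>(1)])
    also have "\<dots> = (LINT x|lebesgue_on U. (\<Sum>j<l. F j x))" by (rule Bochner_Integration.integral_sum[symmetric]) (rule Fi)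
    also have "\<dots> \<le> (LINT x|lebesgue_on U. l * F0 x + indicator (U - K) x * (l * A) + C1 * g x + (\<Sum>j<l. C1 * (W * B j) powr p) * h x)"
    proof (rule integral_mono)
      show "integrable (lebesgue_on U) (\<lambda>x. l * F0 x + indicator (U - K) x * (l * A) + C1 * g x + (\<Sum>j<l. C1 * (W * B j) powr p) * h x)"
        by (intro Bochner_Integration.integrable_add integrable_mult_right UKi gi hi F0i)
    next
      fix x assume "x \<in> space (lebesgue_on U)"
      then have x: "x \<in> U" by (simp add: space_restrict_space)
      have "(\<Sum>j<l. F j x) \<le> (\<Sum>j<l. F0 x + indicator (U - K) x * A + indicator (S j) x * (C1 * g x) + C1 * (W * B j) powr p * h x)"
        by (intro sum_mono pt x)
      also have "\<dots> = l * F0 x + indicator (U - K) x * (l * A) + (\<Sum>j<l. indicator (S j) x) * (C1 * g x) + (\<Sum>j<l. C1 * (W * B j) powr p) * h x"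
        by (simp add: sum.distrib sum_distrib_right distrib_left)
      also have "\<dots> \<le> l * F0 x + indicator (U - K) x * (l * A) + 1 * (C1 * g x) + (\<Sum>j<l. C1 * (W * B j) powr p) * h x"
        using C1 by (intro add_mono mult_right_mono disj order_refl) (auto simp: g_def)
      finally show "(\<Sum>j<l. F j x) \<le> l * F0 x + indicator (U - K) x * (l * A) + C1 * g x + (\<Sum>j<l. C1 * (W * B j) powr p) * h x" by simp
    qed (intro Bochner_Integration.integrable_sum Fi)
    also have "\<dots> = l * (LINT x|lebesgue_on U. F0 x) + measure lebesgue (U - K) * (l * A) + C1 * (LINT x|lebesgue_on U. g x) + (\<Sum>j<l. C1 * (W * B j) powr p) * (LINT x|lebesgue_on U. h x)"
    proof -
      note i1 = integrable_mult_right[OF F0i, of "real l"]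
      note i2 = Bochner_Integration.integrable_add[OF i1 UKi(1)]
      note i3 = Bochner_Integration.integrable_add[OF i2 integrable_mult_right[OF gi, of C1]]
      show ?thesis
        by (simp only: Bochner_Integration.integral_add[OF i3 integrable_mult_right[OF hi]] Bochner_Integration.integral_add[OF i2 integrable_mult_right[OF gi]]
            Bochner_Integration.integral_add[OF i1 UKi(1)] UKi(2) integral_mult_right_zero)
    qed
    also have "\<dots> = real l * ((LINT x|lebesgue_on U. F0 x) + A * measure lebesgue (U - K) + C1 / l * (LINT x|lebesgue_on U. g x) + C * (LINT x|lebesgue_on U. h x))"
      using l by (simp add: C_def field_simps)
    finally have "f \<xi> * measure lebesgue U \<le> (LINT x|lebesgue_on U. F0 x) + A * measure lebesgue (U - K) + C1 / l * (LINT x|lebesgue_on U. g x) + C * (LINT x|lebesgue_on U. h x)"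
      by (rule mult_left_le_imp_le) (use l in simp)
    then show ?thesis unfolding F0_def A_def g_def h_def .
  qed
  moreover have "C \<ge> 0" unfolding C_def using C1 by (intro divide_nonneg_nonneg sum_nonneg) auto
  ultimately show ?thesis by blast
qed

end

section \<open>Weak convergence: boundedness and tested limits\<close>

lemma powr_mult_powr_inverse:
  fixes a :: real assumes "a > 0" "1 < p" "1 / p + 1 / q = 1"
  shows "a / a powr (1 / q) = a powr (1 / p)"
proof -
  have "a / a powr (1 / q) = a powr (1 - 1 / q)" using assms by (simp add: powr_diff)
  also have "1 - 1 / q = 1 / p" using assms by simp
  finally show ?thesis .
qed

text \<open>Young's inequality for \<open>u\<close> and \<open>g\<close> divided by their norms, integrated.\<close>
lemma holder_inequality:
  fixes u g :: "'a \<Rightarrow> real"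
  assumes p: "1 < p" "1 < q" "1 / p + 1 / q = 1"
    and [measurable]: "u \<in> borel_measurable M" "g \<in> borel_measurable M"
    and u: "integrable M (\<lambda>x. \<bar>u x\<bar> powr p)" and g: "integrable M (\<lambda>x. \<bar>g x\<bar> powr q)"
  shows "integrable M (\<lambda>x. g x * u x)"
    "\<bar>LINT x|M. g x * u x\<bar> \<le> (LINT x|M. \<bar>g x\<bar> powr q) powr (1 / q) * (LINT x|M. \<bar>u x\<bar> powr p) powr (1 / p)"
proof -
  have young: "\<bar>g x * u x\<bar> \<le> \<bar>u x\<bar> powr p / p + \<bar>g x\<bar> powr q / q" for x
    using Youngs_inequality[of p q "\<bar>u x\<bar>" "\<bar>g x\<bar>"] p by (simp add: abs_mult mult.commute)
  have "integrable M (\<lambda>x. \<bar>u x\<bar> powr p / p + \<bar>g x\<bar> powr q / q)" using u g by simp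
  then show i: "integrable M (\<lambda>x. g x * u x)"
    by (rule Bochner_Integration.integrable_bound) (auto intro!: AE_I2 order_trans[OF young])
  define a where "a = (LINT x|M. \<bar>u x\<bar> powr p)"
  define b where "b = (LINT x|M. \<bar>g x\<bar> powr q)"
  have ab: "a \<ge> 0" "b \<ge> 0" unfolding a_def b_def by (auto intro: integral_nonneg_AE)
  show "\<bar>LINT x|M. g x * u x\<bar> \<le> (LINT x|M. \<bar>g x\<bar> powr q) powr (1 / q) * (LINT x|M. \<bar>u x\<bar> powr p) powr (1 / p)"
  proof (cases "a = 0 \<or> b = 0")
    case True
    have "AE x in M. g x * u x = 0"
    proof (cases "a = 0")
      case True
      then have "AE x in M. \<bar>u x\<bar> powr p = 0" unfolding a_def using integral_nonneg_eq_0_iff_AE[OF u] by simp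
      then show ?thesis by eventually_elim simp
    next
      case False
      then have "b = 0" using \<open>a = 0 \<or> b = 0\<close> by simp
      then have "AE x in M. \<bar>g x\<bar> powr q = 0" unfolding b_def using integral_nonneg_eq_0_iff_AE[OF g] by simp
      then show ?thesis by eventually_elim simp
    qed
    then have "(LINT x|M. g x * u x) = 0" by (rule integral_eq_zero_AE)
    then show ?thesis by simp
  next
    case False
    then have pos: "a > 0" "b > 0" using ab by auto
    \<comment> \<open>\<open>A\<close> and \<open>B\<close> are the norms by which the functions are divided.\<close>
    define A where "A = a powr (1 / p)"
    define B where "B = b powr (1 / q)"
    have AB: "A > 0" "B > 0" using pos by (auto simp: A_def B_def)
    have ApBq: "A powr p = a" "B powr q = b" using pos p by (auto simp: A_def B_def powr_powr)
    have "\<bar>LINT x|M. g x * u x\<bar> \<le> (LINT x|M. A * B * (\<bar>u x\<bar> powr p / (a * p) + \<bar>g x\<bar> powr q / (b * q)))"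
    proof (rule abs_integral_le[OF i])
      show "integrable M (\<lambda>x. A * B * (\<bar>u x\<bar> powr p / (a * p) + \<bar>g x\<bar> powr q / (b * q)))" using u g by simp
      fix x
      have "(\<bar>u x\<bar> / A) * (\<bar>g x\<bar> / B) \<le> (\<bar>u x\<bar> / A) powr p / p + (\<bar>g x\<bar> / B) powr q / q"
        using AB p by (intro Youngs_inequality) auto
      also have "\<dots> = \<bar>u x\<bar> powr p / (a * p) + \<bar>g x\<bar> powr q / (b * q)"
        using AB by (simp add: powr_divide ApBq)
      finally have "A * B * ((\<bar>u x\<bar> / A) * (\<bar>g x\<bar> / B)) \<le> A * B * (\<bar>u x\<bar> powr p / (a * p) + \<bar>g x\<bar> powr q / (b * q))"
        using AB by (intro mult_left_mono) auto
      then show "\<bar>g x * u x\<bar> \<le> A * B * (\<bar>u x\<bar> powr p / (a * p) + \<bar>g x\<bar> powr q / (b * q))"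
        using AB by (simp add: abs_mult field_simps)
    qed
    also have "\<dots> = A * B * (a / (a * p) + b / (b * q))" using u g by (simp add: a_def b_def)
    also have "\<dots> = B * A" using pos p by simp
    finally show ?thesis unfolding A_def B_def a_def b_def .
  qed
qed

text \<open>
  The uniform boundedness principle along a sequence. If \<open>N (x s)\<close> were unbounded, choose indices
  \<open>t j\<close> with \<open>N (x (t j))\<close> at least of order \<open>4 ^ j * j\<close> and add the functionals \<open>L (t j)\<close> with
  coefficients \<open>\<plusminus> 4\<^sup>-\<^sup>j\<close>. The sign of the \<open>j\<close>-th one is chosen so that at \<open>x (t j)\<close> it does not
  cancel the sum of the previous ones, and the later ones contribute at most a third of its size
  there. So this series is unbounded along \<open>x\<close>, contrary to \<open>bdd\<close>.
\<close>
lemma gliding_hump: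
  fixes L :: "nat \<Rightarrow> 'v \<Rightarrow> real" and N :: "'v \<Rightarrow> real" and x :: "nat \<Rightarrow> 'v"
  assumes le: "\<And>t s. \<bar>L t (x s)\<bar> \<le> N (x s)" and norming: "\<And>s. L s (x s) = N (x s)"
    and bdd: "\<And>c t. (\<And>j. \<bar>c j\<bar> \<le> (1 / 4) ^ j) \<Longrightarrow> \<exists>M. \<forall>s. \<bar>\<Sum>j. c j * L (t j) (x s)\<bar> \<le> M"
  shows "\<exists>M. \<forall>s. N (x s) \<le> M"
proof (rule ccontr)
  assume "\<nexists>M. \<forall>s. N (x s) \<le> M"
  then have "\<forall>j::nat. \<exists>s. 2 * 4 ^ j * real (Suc j) \<le> N (x s)" by (meson linorder_not_le less_imp_le)
  then obtain t where t: "\<And>j. 2 * 4 ^ j * real (Suc j) \<le> N (x (t j))" by metis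
  \<comment> \<open>The partial sums of the series, constructed together with the signs of its coefficients.\<close>
  define P where "P = rec_nat (\<lambda>v. 0) (\<lambda>j P v. P v + (if P (x (t j)) \<ge> 0 then 1 else -1) * (1 / 4) ^ j * L (t j) v)"
  define c where "c j = (if P j (x (t j)) \<ge> 0 then 1 else -1 :: real) * (1 / 4) ^ j" for j
  have P: "P n v = (\<Sum>j<n. c j * L (t j) v)" for n v by (induction n) (simp_all add: P_def c_def)
  have cb: "\<bar>c j\<bar> = (1 / 4) ^ j" for j by (simp add: c_def power_abs abs_mult)
  have geo: "(\<lambda>j. (1 / 4) ^ j * b) sums (4 / 3 * b)" for b :: real
    using sums_mult2[OF geometric_sums[of "1 / 4 :: real"], of b] by simp
  obtain M where M: "\<And>s. \<bar>\<Sum>j. c j * L (t j) (x s)\<bar> \<le> M" using bdd[of c t] cb by auto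
  have "real (Suc j) \<le> M" for j
  proof -
    let ?v = "x (t j)"
    let ?a = "\<lambda>i. c i * L (t i) ?v"
    have ab: "norm (?a i) \<le> (1 / 4) ^ i * N ?v" for i
      using le[of "t i" "t j"] by (auto simp: abs_mult cb intro!: mult_left_mono)
    have sm: "summable ?a" by (rule summable_comparison_test'[OF sums_summable[OF geo], of 0]) (rule ab)
    have tail: "\<bar>\<Sum>i. ?a (i + Suc j)\<bar> \<le> (1 / 4) ^ Suc j * (4 / 3 * N ?v)"
    proof -
      have s1: "(\<lambda>i. (1 / 4) ^ Suc j * ((1 / 4) ^ i * N ?v)) sums ((1 / 4) ^ Suc j * (4 / 3 * N ?v))"
        by (rule sums_mult[OF geo])
      have b: "norm (?a (i + Suc j)) \<le> (1 / 4) ^ Suc j * ((1 / 4) ^ i * N ?v)" for i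
        using ab[of "i + Suc j"] by (simp add: power_add mult_ac)
      have "norm (\<Sum>i. ?a (i + Suc j)) \<le> (\<Sum>i. (1 / 4) ^ Suc j * ((1 / 4) ^ i * N ?v))"
        by (rule norm_suminf_le[OF b sums_summable[OF s1]])
      then show ?thesis using sums_unique[OF s1] by simp
    qed
    have split: "(\<Sum>i. ?a i) = (\<Sum>i. ?a (i + Suc j)) + P (Suc j) ?v"
      unfolding P by (rule suminf_split_initial_segment[OF sm])
    have "P (Suc j) ?v = P j ?v + c j * N ?v" using norming[of "t j"] by (simp add: P)
    then have "(1 / 4) ^ j * N ?v \<le> \<bar>P (Suc j) ?v\<bar>"
      unfolding c_def by (cases "P j ?v \<ge> 0") auto
    then have "(1 / 4) ^ j * N ?v - (1 / 4) ^ Suc j * (4 / 3 * N ?v) \<le> \<bar>\<Sum>i. ?a i\<bar>"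
      using split tail by linarith
    then have "(1 / 4) ^ j * (2 / 3 * N ?v) \<le> M" using M[of "t j"] by (simp add: algebra_simps)
    moreover have "(1 / 4) ^ j * (2 / 3 * (2 * 4 ^ j * real (Suc j))) \<le> (1 / 4) ^ j * (2 / 3 * N ?v)"
      by (intro mult_left_mono t) auto
    ultimately show ?thesis by (simp add: power_divide)
  qed
  then show False using reals_Archimedean2[of M] by (metis Suc_n_not_le_n le_less_trans lessI less_le_not_le of_nat_less_iff)
qed

lemma form_norm_powr_le:
  fixes \<xi> :: "'n::{finite,linorder} rvec form"
  assumes "0 \<le> p"
  shows "norm (form_vec k \<xi>) powr p \<le> real (card (multi_indices k :: 'n list set)) powr p * (\<Sum>ks\<in>multi_indices k. \<bar>\<xi> (basis_list ks)\<bar> powr p)"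
proof -
  have "norm (form_vec k \<xi>) = L2_set (\<lambda>ks. \<xi> (basis_list ks)) (multi_indices k)"
    unfolding form_norm_eq[symmetric] form_norm_def L2_set_def by simp
  also have "\<dots> \<le> (\<Sum>ks\<in>multi_indices k. \<bar>\<xi> (basis_list ks)\<bar>)" by (rule L2_set_le_sum_abs)
  finally have "norm (form_vec k \<xi>) powr p \<le> (\<Sum>ks\<in>multi_indices k. \<bar>\<xi> (basis_list ks)\<bar>) powr p"
    using assms by (intro powr_mono2) auto
  also have "\<dots> \<le> real (card (multi_indices k :: 'n list set)) powr p * (\<Sum>ks\<in>multi_indices k. \<bar>\<xi> (basis_list ks)\<bar> powr p)"
    by (rule powr_sum_le) (use assms in auto)
  finally show ?thesis .
qed

lemma form_norm_powr_integrable: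
  fixes F :: "'a \<Rightarrow> 'n::{finite,linorder} rvec form"
  assumes p: "0 \<le> p" and m: "\<And>ks. ks \<in> multi_indices k \<Longrightarrow> (\<lambda>x. F x (basis_list ks)) \<in> borel_measurable M"
    and i: "\<And>ks. ks \<in> multi_indices k \<Longrightarrow> integrable M (\<lambda>x. \<bar>F x (basis_list ks)\<bar> powr p)"
  shows "integrable M (\<lambda>x. norm (form_vec k (F x)) powr p)"
    "(LINT x|M. norm (form_vec k (F x)) powr p) \<le>
      real (card (multi_indices k :: 'n list set)) powr p * (\<Sum>ks\<in>multi_indices k. (LINT x|M. \<bar>F x (basis_list ks)\<bar> powr p))"
proof -
  let ?C = "real (card (multi_indices k :: 'n list set)) powr p"
  have [measurable]: "(\<lambda>x. form_vec k (F x)) \<in> borel_measurable M" by (rule borel_measurable_form_vec) (rule m)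
  have j: "integrable M (\<lambda>x. ?C * (\<Sum>ks\<in>multi_indices k. \<bar>F x (basis_list ks)\<bar> powr p))" by (intro integrable_mult_right Bochner_Integration.integrable_sum i)
  show h: "integrable M (\<lambda>x. norm (form_vec k (F x)) powr p)"
  proof (rule Bochner_Integration.integrable_bound[OF j])
    show "AE x in M. norm (norm (form_vec k (F x)) powr p) \<le> norm (?C * (\<Sum>ks\<in>multi_indices k. \<bar>F x (basis_list ks)\<bar> powr p))"
      using form_norm_powr_le[OF p] by (intro AE_I2) (simp add: sum_nonneg)
  qed measurable
  have "(LINT x|M. norm (form_vec k (F x)) powr p) \<le> (LINT x|M. ?C * (\<Sum>ks\<in>multi_indices k. \<bar>F x (basis_list ks)\<bar> powr p))"
    by (intro integral_mono h j form_norm_powr_le p)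
  also have "\<dots> = ?C * (\<Sum>ks\<in>multi_indices k. (LINT x|M. \<bar>F x (basis_list ks)\<bar> powr p))"
    by (simp add: Bochner_Integration.integral_sum[OF i])
  finally show "(LINT x|M. norm (form_vec k (F x)) powr p) \<le> ?C * (\<Sum>ks\<in>multi_indices k. (LINT x|M. \<bar>F x (basis_list ks)\<bar> powr p))" .
qed

lemma W1pD:
  assumes "\<alpha> \<in> W1p p \<Omega> m"
  shows "x \<in> \<Omega> \<Longrightarrow> \<alpha> x \<in> alt_forms m" "(\<lambda>x. \<alpha> x vs) \<in> Lp p \<Omega>"
    "\<exists>\<beta>. has_weak_deriv_form \<Omega> m (axis j 1) \<alpha> \<beta> \<and> (\<forall>vs. (\<lambda>x. \<beta> x vs) \<in> Lp p \<Omega>)"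
  using assms unfolding W1p_def sobolev_forms_def by auto

lemma Lp_cong_AE:
  assumes "\<Omega> \<in> sets lebesgue" "g \<in> Lp p \<Omega>" "AE x in lebesgue_on \<Omega>. h x = g x"
  shows "h \<in> Lp p \<Omega>"
proof -
  have h: "h \<in> borel_measurable (lebesgue_on \<Omega>)" using assms by (auto simp: Lp_def intro: measurable_lebesgue_on_AE)
  moreover have "integrable (lebesgue_on \<Omega>) (\<lambda>x. \<bar>h x\<bar> powr p) \<longleftrightarrow> integrable (lebesgue_on \<Omega>) (\<lambda>x. \<bar>g x\<bar> powr p)"
    using h assms by (intro integrable_cong_AE) (auto simp: Lp_def)
  ultimately show ?thesis using assms by (simp add: Lp_def)
qed

lemma W1p_weak_deriv:
  assumes \<Omega>: "open \<Omega>" and \<alpha>: "\<alpha> \<in> W1p p \<Omega> m"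
  shows "has_weak_deriv_form \<Omega> m (axis j 1) \<alpha> (weak_deriv \<Omega> m (axis j 1) \<alpha>)"
    "(\<lambda>x. weak_deriv \<Omega> m (axis j 1) \<alpha> x vs) \<in> Lp p \<Omega>"
proof -
  obtain \<beta> where \<beta>: "has_weak_deriv_form \<Omega> m (axis j 1) \<alpha> \<beta>" "\<And>vs. (\<lambda>x. \<beta> x vs) \<in> Lp p \<Omega>" using W1pD(3)[OF \<alpha>] by blast
  show "has_weak_deriv_form \<Omega> m (axis j 1) \<alpha> (weak_deriv \<Omega> m (axis j 1) \<alpha>)" by (rule weak_deriv_spec[OF \<beta>(1)])
  show "(\<lambda>x. weak_deriv \<Omega> m (axis j 1) \<alpha> x vs) \<in> Lp p \<Omega>"
    by (rule Lp_cong_AE[OF _ \<beta>(2) weak_deriv_AE[OF \<Omega> \<beta>(1)]]) (use \<Omega> in simp)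
qed

lemma has_weak_deriv_form_lin:
  assumes \<Omega>: "open \<Omega>" and a: "has_weak_deriv_form \<Omega> m v \<alpha> \<alpha>'" and b: "has_weak_deriv_form \<Omega> m v \<beta> \<beta>'"
  shows "has_weak_deriv_form \<Omega> m v (\<lambda>x vs. a * \<alpha> x vs + b * \<beta> x vs) (\<lambda>x vs. a * \<alpha>' x vs + b * \<beta>' x vs)"
  using a b unfolding has_weak_deriv_form_def by (auto intro: alt_forms_lin has_weak_deriv_lin[OF \<Omega>])

text \<open>
  A coordinate of a form, or a coordinate of one of its weak partial derivatives, as an operator
  from \<open>W\<^sup>1\<^sup>,\<^sup>p\<close> to \<open>L\<^sup>p\<close> of norm at most \<open>1\<close>. Linearity is asked for almost everywhere only,
  because \<open>weak_deriv\<close> is a choice of a representative.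
\<close>
definition coordinate_op :: "real \<Rightarrow> 'n::{finite,linorder} rvec set \<Rightarrow> nat \<Rightarrow> ('n form_field \<Rightarrow> 'n rvec \<Rightarrow> real) \<Rightarrow> bool" where
  "coordinate_op p \<Omega> m T \<longleftrightarrow>
    (\<forall>\<alpha>\<in>W1p p \<Omega> m. T \<alpha> \<in> Lp p \<Omega> \<and> (LINT x|lebesgue_on \<Omega>. \<bar>T \<alpha> x\<bar> powr p) powr (1 / p) \<le> W1p_norm p \<Omega> m \<alpha>) \<and>
    (\<forall>\<alpha>\<in>W1p p \<Omega> m. \<forall>\<beta>\<in>W1p p \<Omega> m. \<forall>a b.
      AE x in lebesgue_on \<Omega>. T (\<lambda>x vs. a * \<alpha> x vs + b * \<beta> x vs) x = a * T \<alpha> x + b * T \<beta> x)"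

lemma W1p_norm_ge:
  fixes \<alpha> :: "'n::{finite,linorder} form_field"
  assumes \<Omega>: "open \<Omega>" and \<alpha>: "\<alpha> \<in> W1p p \<Omega> m" and p: "1 \<le> p" and ks: "ks \<in> multi_indices m"
  shows "(LINT x|lebesgue_on \<Omega>. \<bar>\<alpha> x (basis_list ks)\<bar> powr p) powr (1 / p) \<le> W1p_norm p \<Omega> m \<alpha>"
    "(LINT x|lebesgue_on \<Omega>. \<bar>weak_deriv \<Omega> m (axis j 1) \<alpha> x (basis_list ks)\<bar> powr p) powr (1 / p) \<le> W1p_norm p \<Omega> m \<alpha>"
proof -
  let ?I = "\<lambda>F. LINT x|lebesgue_on \<Omega>. form_norm m (F x) powr p"
  have le: "(LINT x|lebesgue_on \<Omega>. \<bar>F x (basis_list ks)\<bar> powr p) \<le> ?I F"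
    if F: "\<And>vs. (\<lambda>x. F x vs) \<in> Lp p \<Omega>" for F :: "'n form_field"
    unfolding form_norm_eq
  proof (rule integral_mono)
    show "integrable (lebesgue_on \<Omega>) (\<lambda>x. \<bar>F x (basis_list ks)\<bar> powr p)" using F by (simp add: Lp_def)
    show "integrable (lebesgue_on \<Omega>) (\<lambda>x. norm (form_vec m (F x)) powr p)"
      using F p by (intro form_norm_powr_integrable) (auto simp: Lp_def)
    show "\<bar>F x (basis_list ks)\<bar> powr p \<le> norm (form_vec m (F x)) powr p" for x
      using p by (intro powr_mono2 component_le_form_norm ks) auto
  qed
  have nn: "0 \<le> ?I F" for F :: "'n form_field" by (rule integral_nonneg_AE) simp
  have s: "?I (weak_deriv \<Omega> m (axis j 1) \<alpha>) \<le> (\<Sum>j\<in>UNIV. ?I (weak_deriv \<Omega> m (axis j 1) \<alpha>))" for j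
    by (rule member_le_sum[of j UNIV "\<lambda>j. ?I (weak_deriv \<Omega> m (axis j 1) \<alpha>)"]) (auto intro: nn)
  have s0: "0 \<le> (\<Sum>j\<in>UNIV. ?I (weak_deriv \<Omega> m (axis j 1) \<alpha>))" by (intro sum_nonneg nn)
  have n0: "0 \<le> (LINT x|lebesgue_on \<Omega>. \<bar>g x\<bar> powr p)" for g :: "'n rvec \<Rightarrow> real" by (rule integral_nonneg_AE) simp
  show "(LINT x|lebesgue_on \<Omega>. \<bar>\<alpha> x (basis_list ks)\<bar> powr p) powr (1 / p) \<le> W1p_norm p \<Omega> m \<alpha>"
    unfolding W1p_norm_def
    using le[of \<alpha>, OF W1pD(2)[OF \<alpha>]] s0 p n0 by (intro powr_mono2) auto
  show "(LINT x|lebesgue_on \<Omega>. \<bar>weak_deriv \<Omega> m (axis j 1) \<alpha> x (basis_list ks)\<bar> powr p) powr (1 / p) \<le> W1p_norm p \<Omega> m \<alpha>"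
    unfolding W1p_norm_def
    using le[of "weak_deriv \<Omega> m (axis j 1) \<alpha>", OF W1p_weak_deriv(2)[OF \<Omega> \<alpha>, of j]] s[of j] nn[of \<alpha>] p by (intro powr_mono2 n0) (linarith | simp)+
qed

lemma coordinate_op_value:
  fixes \<Omega> :: "'n::{finite,linorder} rvec set"
  assumes "open \<Omega>" "1 \<le> p" "ks \<in> multi_indices m"
  shows "coordinate_op p \<Omega> m (\<lambda>\<alpha> x. \<alpha> x (basis_list ks))"
  unfolding coordinate_op_def using W1pD(2) W1p_norm_ge(1)[OF assms(1) _ assms(2,3)] by auto

lemma coordinate_op_deriv:
  fixes \<Omega> :: "'n::{finite,linorder} rvec set"
  assumes \<Omega>: "open \<Omega>" and p: "1 \<le> p" and ks: "ks \<in> multi_indices m"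
  shows "coordinate_op p \<Omega> m (\<lambda>\<alpha> x. weak_deriv \<Omega> m (axis j 1) \<alpha> x (basis_list ks))"
  unfolding coordinate_op_def
proof (intro conjI ballI allI)
  fix \<alpha> assume \<alpha>: "\<alpha> \<in> W1p p \<Omega> m"
  show "(\<lambda>x. weak_deriv \<Omega> m (axis j 1) \<alpha> x (basis_list ks)) \<in> Lp p \<Omega>" by (rule W1p_weak_deriv(2)[OF \<Omega> \<alpha>])
  show "(LINT x|lebesgue_on \<Omega>. \<bar>weak_deriv \<Omega> m (axis j 1) \<alpha> x (basis_list ks)\<bar> powr p) powr (1 / p) \<le> W1p_norm p \<Omega> m \<alpha>"
    by (rule W1p_norm_ge(2)[OF \<Omega> \<alpha> p ks])
  fix \<beta> a b assume \<beta>: "\<beta> \<in> W1p p \<Omega> m"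
  show "AE x in lebesgue_on \<Omega>. weak_deriv \<Omega> m (axis j 1) (\<lambda>x vs. a * \<alpha> x vs + b * \<beta> x vs) x (basis_list ks) =
    a * weak_deriv \<Omega> m (axis j 1) \<alpha> x (basis_list ks) + b * weak_deriv \<Omega> m (axis j 1) \<beta> x (basis_list ks)"
    by (rule weak_deriv_AE[OF \<Omega> has_weak_deriv_form_lin[OF \<Omega> W1p_weak_deriv(1)[OF \<Omega> \<alpha>] W1p_weak_deriv(1)[OF \<Omega> \<beta>]]])
qed

text \<open>The closed unit ball of the dual of \<open>L\<^sup>p\<close>, where \<open>q\<close> is the conjugate exponent.\<close>
definition dual_ball :: "real \<Rightarrow> 'a::euclidean_space set \<Rightarrow> ('a \<Rightarrow> real) set" where
  "dual_ball q \<Omega> = {g. g \<in> borel_measurable (lebesgue_on \<Omega>) \<and> integrable (lebesgue_on \<Omega>) (\<lambda>x. \<bar>g x\<bar> powr q) \<and>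
     (LINT x|lebesgue_on \<Omega>. \<bar>g x\<bar> powr q) \<le> 1}"

context
  fixes p q :: real and \<Omega> :: "'n::{finite,linorder} rvec set" and m :: nat and T :: "'n form_field \<Rightarrow> 'n rvec \<Rightarrow> real"
  assumes \<Omega>: "\<Omega> \<in> sets lebesgue" and pq: "1 < p" "1 < q" "1 / p + 1 / q = 1" and T: "coordinate_op p \<Omega> m T"
begin

lemma dual_pairing:
  assumes g: "g \<in> dual_ball q \<Omega>" and \<alpha>: "\<alpha> \<in> W1p p \<Omega> m"
  shows "integrable (lebesgue_on \<Omega>) (\<lambda>x. g x * T \<alpha> x)"
    "\<bar>LINT x|lebesgue_on \<Omega>. g x * T \<alpha> x\<bar> \<le> (LINT x|lebesgue_on \<Omega>. \<bar>T \<alpha> x\<bar> powr p) powr (1 / p)"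
proof -
  have t: "T \<alpha> \<in> Lp p \<Omega>" using T \<alpha> by (simp add: coordinate_op_def)
  note h = holder_inequality[OF pq, of "T \<alpha>" "lebesgue_on \<Omega>" g]
  show "integrable (lebesgue_on \<Omega>) (\<lambda>x. g x * T \<alpha> x)" using g t by (intro h) (auto simp: dual_ball_def Lp_def)
  have "\<bar>LINT x|lebesgue_on \<Omega>. g x * T \<alpha> x\<bar> \<le> (LINT x|lebesgue_on \<Omega>. \<bar>g x\<bar> powr q) powr (1 / q) * (LINT x|lebesgue_on \<Omega>. \<bar>T \<alpha> x\<bar> powr p) powr (1 / p)"
    using g t by (intro h) (auto simp: dual_ball_def Lp_def)
  also have "\<dots> \<le> 1 powr (1 / q) * (LINT x|lebesgue_on \<Omega>. \<bar>T \<alpha> x\<bar> powr p) powr (1 / p)"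
    using g pq by (intro mult_right_mono powr_mono2) (auto simp: dual_ball_def intro: integral_nonneg_AE)
  finally show "\<bar>LINT x|lebesgue_on \<Omega>. g x * T \<alpha> x\<bar> \<le> (LINT x|lebesgue_on \<Omega>. \<bar>T \<alpha> x\<bar> powr p) powr (1 / p)" by simp
qed

lemma dual_pairing_lin:
  assumes g: "g \<in> dual_ball q \<Omega>" and \<alpha>: "\<alpha> \<in> W1p p \<Omega> m" and \<beta>: "\<beta> \<in> W1p p \<Omega> m"
  shows "(LINT x|lebesgue_on \<Omega>. g x * T (\<lambda>x vs. a * \<alpha> x vs + b * \<beta> x vs) x) =
    a * (LINT x|lebesgue_on \<Omega>. g x * T \<alpha> x) + b * (LINT x|lebesgue_on \<Omega>. g x * T \<beta> x)"
proof -
  have "AE x in lebesgue_on \<Omega>. T (\<lambda>x vs. a * \<alpha> x vs + b * \<beta> x vs) x = a * T \<alpha> x + b * T \<beta> x"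
    using T \<alpha> \<beta> by (simp add: coordinate_op_def)
  then have ae: "AE x in lebesgue_on \<Omega>. a * (g x * T \<alpha> x) + b * (g x * T \<beta> x) = g x * T (\<lambda>x vs. a * \<alpha> x vs + b * \<beta> x vs) x"
    by eventually_elim (simp add: algebra_simps)
  note i = dual_pairing(1)[OF g \<alpha>] dual_pairing(1)[OF g \<beta>]
  have j: "integrable (lebesgue_on \<Omega>) (\<lambda>x. a * (g x * T \<alpha> x) + b * (g x * T \<beta> x))" using i by simp
  have "(LINT x|lebesgue_on \<Omega>. g x * T (\<lambda>x vs. a * \<alpha> x vs + b * \<beta> x vs) x) = (LINT x|lebesgue_on \<Omega>. a * (g x * T \<alpha> x) + b * (g x * T \<beta> x))"
  proof -
    have ae': "AE x in lebesgue_on \<Omega>. g x * T (\<lambda>x vs. a * \<alpha> x vs + b * \<beta> x vs) x = a * (g x * T \<alpha> x) + b * (g x * T \<beta> x)"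
      using ae by eventually_elim simp
    show ?thesis
      by (rule integral_cong_AE[OF measurable_lebesgue_on_AE[OF \<Omega> borel_measurable_integrable[OF j] ae'] borel_measurable_integrable[OF j] ae'])
  qed
  then show ?thesis using i by simp
qed

text \<open>
  The series converges absolutely, and it is bounded by \<open>4 / 3\<close> times the norm, so it is an element
  of the dual.
\<close>
lemma dual_series:
  assumes g: "\<And>j. g j \<in> dual_ball q \<Omega>" and c: "\<And>j. \<bar>c j\<bar> \<le> (1 / 4) ^ j"
  shows "(\<lambda>\<alpha>. \<Sum>j. c j * (LINT x|lebesgue_on \<Omega>. g j x * T \<alpha> x)) \<in> W1p_dual p \<Omega> m"
proof -
  have geo: "(\<lambda>j. (1 / 4) ^ j * b) sums (4 / 3 * b)" for b :: real
    using sums_mult2[OF geometric_sums[of "1 / 4 :: real"], of b] by simp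
  have b: "norm (c j * (LINT x|lebesgue_on \<Omega>. g j x * T \<alpha> x)) \<le> (1 / 4) ^ j * (W1p_norm p \<Omega> m \<alpha>)" if \<alpha>: "\<alpha> \<in> W1p p \<Omega> m" for j \<alpha>
  proof -
    have "(LINT x|lebesgue_on \<Omega>. \<bar>T \<alpha> x\<bar> powr p) powr (1 / p) \<le> W1p_norm p \<Omega> m \<alpha>" using T \<alpha> by (simp add: coordinate_op_def)
    then show ?thesis using dual_pairing(2)[OF g \<alpha>, of j] c[of j] by (auto simp: abs_mult intro!: mult_mono)
  qed
  have sm: "summable (\<lambda>j. c j * (LINT x|lebesgue_on \<Omega>. g j x * T \<alpha> x))" if \<alpha>: "\<alpha> \<in> W1p p \<Omega> m" for \<alpha>
    by (rule summable_comparison_test'[OF sums_summable[OF geo], of 0]) (rule b[OF \<alpha>])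
  show ?thesis
    unfolding W1p_dual_def
  proof (intro CollectI conjI ballI allI exI[of _ "4 / 3"])
    fix \<alpha> assume \<alpha>: "\<alpha> \<in> W1p p \<Omega> m"
    show "\<bar>\<Sum>j. c j * (LINT x|lebesgue_on \<Omega>. g j x * T \<alpha> x)\<bar> \<le> 4 / 3 * W1p_norm p \<Omega> m \<alpha>"
      using norm_suminf_le[OF b[OF \<alpha>] sums_summable[OF geo]] sums_unique[OF geo] by simp
    fix \<beta> a b' assume \<beta>: "\<beta> \<in> W1p p \<Omega> m"
    have "(\<Sum>j. c j * (LINT x|lebesgue_on \<Omega>. g j x * T (\<lambda>x vs. a * \<alpha> x vs + b' * \<beta> x vs) x)) =
      (\<Sum>j. a * (c j * (LINT x|lebesgue_on \<Omega>. g j x * T \<alpha> x)) + b' * (c j * (LINT x|lebesgue_on \<Omega>. g j x * T \<beta> x)))"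
      by (simp add: dual_pairing_lin[OF g \<alpha> \<beta>] algebra_simps)
    also have "\<dots> = a * (\<Sum>j. c j * (LINT x|lebesgue_on \<Omega>. g j x * T \<alpha> x)) + b' * (\<Sum>j. c j * (LINT x|lebesgue_on \<Omega>. g j x * T \<beta> x))"
      using sm[OF \<alpha>] sm[OF \<beta>] by (simp add: suminf_add[symmetric] summable_mult suminf_mult)
    finally show "(\<Sum>j. c j * (LINT x|lebesgue_on \<Omega>. g j x * T (\<lambda>x vs. a * \<alpha> x vs + b' * \<beta> x vs) x)) =
      a * (\<Sum>j. c j * (LINT x|lebesgue_on \<Omega>. g j x * T \<alpha> x)) + b' * (\<Sum>j. c j * (LINT x|lebesgue_on \<Omega>. g j x * T \<beta> x))" .
  qed
qed

text \<open>
  The extremal case of Hoelder's inequality, \<open>g = sgn u |u|\<^sup>p\<^sup>-\<^sup>1\<close> divided by its \<open>L\<^sup>q\<close> norm.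
\<close>
lemma norming_functional:
  assumes \<alpha>: "\<alpha> \<in> W1p p \<Omega> m"
  shows "\<exists>g\<in>dual_ball q \<Omega>. (LINT x|lebesgue_on \<Omega>. g x * T \<alpha> x) = (LINT x|lebesgue_on \<Omega>. \<bar>T \<alpha> x\<bar> powr p) powr (1 / p)"
proof -
  define u where "u = T \<alpha>"
  have u: "u \<in> Lp p \<Omega>" using T \<alpha> by (simp add: coordinate_op_def u_def)
  then have [measurable]: "u \<in> borel_measurable (lebesgue_on \<Omega>)" and i: "integrable (lebesgue_on \<Omega>) (\<lambda>x. \<bar>u x\<bar> powr p)" by (auto simp: Lp_def)
  define a where "a = (LINT x|lebesgue_on \<Omega>. \<bar>u x\<bar> powr p)"
  have a0: "a \<ge> 0" unfolding a_def by (rule integral_nonneg_AE) simp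
  show ?thesis
  proof (cases "a = 0")
    case True
    then show ?thesis using pq by (intro bexI[of _ "\<lambda>x. 0"]) (auto simp: a_def u_def dual_ball_def)
  next
    case False
    then have a: "a > 0" using a0 by simp
    define A where "A = a powr (1 / q)"
    have A: "A > 0" "A powr q = a" using a pq by (auto simp: A_def powr_powr)
    define g where "g x = sgn (u x) * \<bar>u x\<bar> powr (p - 1) / A" for x
    have [measurable]: "g \<in> borel_measurable (lebesgue_on \<Omega>)" unfolding g_def by measurable
    \<comment> \<open>The identity that makes \<open>|g|\<^sup>q\<close> a multiple of \<open>|u|\<^sup>p\<close>.\<close>
    have pq': "(p - 1) * q = p" using pq by (simp add: field_simps)
    have gq: "\<bar>g x\<bar> powr q = \<bar>u x\<bar> powr p / a" for x
    proof (cases "u x = 0")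
      case False
      have "\<bar>g x\<bar> = \<bar>u x\<bar> powr (p - 1) / A" using A False by (simp add: g_def abs_mult abs_sgn_eq)
      then show ?thesis using A by (simp add: powr_divide powr_powr pq')
    qed (use pq in \<open>simp add: g_def\<close>)
    have "integrable (lebesgue_on \<Omega>) (\<lambda>x. \<bar>g x\<bar> powr q)" "(LINT x|lebesgue_on \<Omega>. \<bar>g x\<bar> powr q) = 1"
      unfolding gq using i a by (auto simp: a_def)
    then have g: "g \<in> dual_ball q \<Omega>" by (simp add: dual_ball_def)
    have gu: "g x * u x = \<bar>u x\<bar> powr p / A" for x
    proof (cases "u x = 0")
      case False
      have "g x * u x = \<bar>u x\<bar> powr (p - 1) * \<bar>u x\<bar> / A" by (simp add: g_def abs_sgn mult_ac)
      also have "\<bar>u x\<bar> powr (p - 1) * \<bar>u x\<bar> = \<bar>u x\<bar> powr p" using False by (simp add: powr_diff)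
      finally show ?thesis .
    qed (use pq in simp)
    have "(LINT x|lebesgue_on \<Omega>. g x * u x) = a / A" unfolding gu by (simp add: a_def)
    also have "\<dots> = a powr (1 / p)" unfolding A_def by (rule powr_mult_powr_inverse[OF a pq(1,3)])
    finally show ?thesis using g by (auto simp: a_def u_def)
  qed
qed

text \<open>
  Apply the gliding hump to the functionals that norm \<open>T (\<alpha>s s)\<close>: their series are in the dual, so
  they converge, and in particular are bounded, along the weakly convergent sequence.
\<close>
lemma weak_convergence_bounded:
  assumes w: "weakly_converges_W1p p \<Omega> m \<alpha>s \<alpha>"
  shows "\<exists>M. \<forall>s. (LINT x|lebesgue_on \<Omega>. \<bar>T (\<alpha>s s) x\<bar> powr p) \<le> M"
proof -
  have \<alpha>s: "\<alpha>s s \<in> W1p p \<Omega> m" for s using w by (simp add: weakly_converges_W1p_def)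
  let ?N = "\<lambda>\<alpha>. (LINT x|lebesgue_on \<Omega>. \<bar>T \<alpha> x\<bar> powr p) powr (1 / p)"
  have "\<forall>s. \<exists>g. g \<in> dual_ball q \<Omega> \<and> (LINT x|lebesgue_on \<Omega>. g x * T (\<alpha>s s) x) = ?N (\<alpha>s s)"
  proof
    fix s
    show "\<exists>g. g \<in> dual_ball q \<Omega> \<and> (LINT x|lebesgue_on \<Omega>. g x * T (\<alpha>s s) x) = ?N (\<alpha>s s)"
      using norming_functional[OF \<alpha>s[of s]] by (elim bexE) (intro exI conjI)
  qed
  from choice[OF this] obtain g where g': "\<forall>s. g s \<in> dual_ball q \<Omega> \<and> (LINT x|lebesgue_on \<Omega>. g s x * T (\<alpha>s s) x) = ?N (\<alpha>s s)" ..
  then have g: "\<And>s. g s \<in> dual_ball q \<Omega>" "\<And>s. (LINT x|lebesgue_on \<Omega>. g s x * T (\<alpha>s s) x) = ?N (\<alpha>s s)" by simp_all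
  have "\<exists>M. \<forall>s. ?N (\<alpha>s s) \<le> M"
  proof (rule gliding_hump[where L="\<lambda>t \<alpha>. LINT x|lebesgue_on \<Omega>. g t x * T \<alpha> x" and x=\<alpha>s and N="?N"])
    show "\<bar>LINT x|lebesgue_on \<Omega>. g t x * T (\<alpha>s s) x\<bar> \<le> ?N (\<alpha>s s)" for t s by (rule dual_pairing(2)[OF g(1) \<alpha>s])
    show "(LINT x|lebesgue_on \<Omega>. g s x * T (\<alpha>s s) x) = ?N (\<alpha>s s)" for s by (rule g(2))
    fix c :: "nat \<Rightarrow> real" and t :: "nat \<Rightarrow> nat" assume c: "\<And>j. \<bar>c j\<bar> \<le> (1 / 4) ^ j"
    have "(\<lambda>s. \<Sum>j. c j * (LINT x|lebesgue_on \<Omega>. g (t j) x * T (\<alpha>s s) x)) \<longlonglongrightarrow> (\<Sum>j. c j * (LINT x|lebesgue_on \<Omega>. g (t j) x * T \<alpha> x))"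
      by (rule bspec[OF _ dual_series[of "\<lambda>j. g (t j)" c, OF g(1) c]])
        (use w in \<open>unfold weakly_converges_W1p_def, blast\<close>)
    then have "Bseq (\<lambda>s. \<Sum>j. c j * (LINT x|lebesgue_on \<Omega>. g (t j) x * T (\<alpha>s s) x))" by (intro convergent_imp_Bseq convergentI)
    then show "\<exists>M. \<forall>s. \<bar>\<Sum>j. c j * (LINT x|lebesgue_on \<Omega>. g (t j) x * T (\<alpha>s s) x)\<bar> \<le> M"
      unfolding Bseq_def by auto
  qed
  then obtain M where M: "\<And>s. ?N (\<alpha>s s) \<le> M" by blast
  have "(LINT x|lebesgue_on \<Omega>. \<bar>T (\<alpha>s s) x\<bar> powr p) \<le> M powr p" for s
  proof -
    have nn: "0 \<le> (LINT x|lebesgue_on \<Omega>. \<bar>T (\<alpha>s s) x\<bar> powr p)" by (rule integral_nonneg_AE) simp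
    have "?N (\<alpha>s s) powr p \<le> M powr p" using M[of s] pq by (intro powr_mono2) auto
    then show ?thesis using nn pq by (simp add: powr_powr)
  qed
  then show ?thesis by blast
qed

text \<open>
  Integration against a multiple of \<open>g\<close> in the dual ball is a series with one nonzero coefficient.
\<close>
lemma weak_convergence_tested:
  assumes w: "weakly_converges_W1p p \<Omega> m \<alpha>s \<alpha>" and g: "g \<in> borel_measurable (lebesgue_on \<Omega>)" "integrable (lebesgue_on \<Omega>) (\<lambda>x. \<bar>g x\<bar> powr q)"
  shows "(\<lambda>s. LINT x|lebesgue_on \<Omega>. g x * T (\<alpha>s s) x) \<longlonglongrightarrow> (LINT x|lebesgue_on \<Omega>. g x * T \<alpha> x)"
proof -
  \<comment> \<open>The summand \<open>1\<close> keeps the scaling factor positive when \<open>g\<close> vanishes.\<close>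
  define a where "a = (LINT x|lebesgue_on \<Omega>. \<bar>g x\<bar> powr q) + 1"
  have a: "a \<ge> 1" unfolding a_def by (simp add: integral_nonneg_AE)
  define b where "b = a powr (1 / q)"
  have b: "b > 0" "b powr q = a" using a pq by (auto simp: b_def powr_powr)
  have "(\<lambda>x. g x / b) \<in> dual_ball q \<Omega>"
    unfolding dual_ball_def
  proof (intro CollectI conjI)
    have e: "\<bar>g x / b\<bar> powr q = \<bar>g x\<bar> powr q / a" for x using b by (simp add: powr_divide)
    show "integrable (lebesgue_on \<Omega>) (\<lambda>x. \<bar>g x / b\<bar> powr q)" unfolding e using g by simp
    have "(LINT x|lebesgue_on \<Omega>. \<bar>g x / b\<bar> powr q) = (a - 1) / a" unfolding e by (simp add: a_def)
    then show "(LINT x|lebesgue_on \<Omega>. \<bar>g x / b\<bar> powr q) \<le> 1" using a by simp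
  qed (use g in simp)
  then have "(\<lambda>\<alpha>. \<Sum>j. (if j = 0 then 1 else 0) * (LINT x|lebesgue_on \<Omega>. g x / b * T \<alpha> x)) \<in> W1p_dual p \<Omega> m"
    by (intro dual_series[of "\<lambda>j x. g x / b" "\<lambda>j. if j = 0 then 1 else 0"]) auto
  moreover have "(\<Sum>j::nat. (if j = 0 then 1 else 0) * (LINT x|lebesgue_on \<Omega>. g x / b * T \<alpha> x)) = (LINT x|lebesgue_on \<Omega>. g x * T \<alpha> x) / b" for \<alpha>
    by (subst suminf_finite[of "{0}"]) auto
  ultimately have "(\<lambda>s. (LINT x|lebesgue_on \<Omega>. g x * T (\<alpha>s s) x) / b) \<longlonglongrightarrow> (LINT x|lebesgue_on \<Omega>. g x * T \<alpha> x) / b"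
    using w unfolding weakly_converges_W1p_def by auto
  from tendsto_mult_right[OF this, of b] show ?thesis using b by simp
qed

end

section \<open>Local compactness\<close>

text \<open>The fundamental theorem of calculus along the segment from \<open>x\<close> to \<open>x - z\<close>.\<close>
lemma segment_bound:
  fixes w H :: "'a::euclidean_space \<Rightarrow> real"
  assumes w: "smooth_on w UNIV" and H: "continuous_on UNIV H"
    and le: "\<And>t. 0 \<le> t \<Longrightarrow> t \<le> 1 \<Longrightarrow> \<bar>frechet_derivative w (at (x - t *\<^sub>R z)) z\<bar> \<le> c * H (x - t *\<^sub>R z)"
  shows "\<bar>w (x - z) - w x\<bar> \<le> c * (LINT t|lborel. indicator {0..1} t * H (x - t *\<^sub>R z))"
proof -
  let ?D = "\<lambda>t. frechet_derivative w (at (x - t *\<^sub>R z)) z"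
  have cH: "continuous_on {0..1} (\<lambda>t. c * H (x - t *\<^sub>R z))"
    by (intro continuous_intros continuous_on_compose2[OF H]) auto
  have ftc: "((\<lambda>t. - ?D t) has_integral (w (x - 1 *\<^sub>R z) - w (x - 0 *\<^sub>R z))) {0..1}"
  proof (rule fundamental_theorem_of_calculus)
    fix t :: real
    have lin: "linear (frechet_derivative w (at (x - t *\<^sub>R z)))" by (rule smooth_linear_frechet[OF w])
    have "((\<lambda>t. w (x - t *\<^sub>R z)) has_derivative (\<lambda>h. frechet_derivative w (at (x - t *\<^sub>R z)) (- (h *\<^sub>R z)))) (at t within {0..1})"
      by (rule has_derivative_compose[OF _ smooth_has_derivative[OF w]]) (auto intro!: derivative_eq_intros)
    then show "((\<lambda>t. w (x - t *\<^sub>R z)) has_vector_derivative - ?D t) (at t within {0..1})"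
      unfolding has_vector_derivative_def by (simp add: linear_neg[OF lin] linear_cmul[OF lin])
  qed simp
  have "norm (integral {0..1} (\<lambda>t. - ?D t)) \<le> integral {0..1} (\<lambda>t. c * H (x - t *\<^sub>R z))"
    by (rule Henstock_Kurzweil_Integration.integral_norm_bound_integral)
      (use ftc le cH in \<open>auto intro: integrable_continuous_interval\<close>)
  moreover have "integral {0..1} (\<lambda>t. - ?D t) = w (x - z) - w x" using integral_unique[OF ftc] by simp
  moreover have "integral {0..1} (\<lambda>t. c * H (x - t *\<^sub>R z)) = (LINT t:{0..1}|lborel. c * H (x - t *\<^sub>R z))"
    by (rule set_borel_integral_eq_integral(2)[symmetric]) (rule borel_integrable_atLeastAtMost', rule cH)
  moreover have "(LINT t:{0..1}|lborel. c * H (x - t *\<^sub>R z)) = c * (LINT t|lborel. indicator {0..1} t * H (x - t *\<^sub>R z))"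
    unfolding set_lebesgue_integral_def by (simp add: mult.left_commute[of _ c] del: integral_mult_right_zero) simp
  ultimately show ?thesis by (simp only: real_norm_def)
qed

text \<open>
  The error is an average of differences \<open>w (x - z) - w x\<close>, and each is the integral of a
  derivative along a segment of length at most \<open>\<epsilon>\<close>. Jensen's inequality for both averages and
  Tonelli's theorem give the rate \<open>\<epsilon>\<close>, uniformly for all \<open>w\<close> whose derivative has a majorant \<open>H\<close>
  bounded in \<open>L\<^sup>p\<close>. The majorant is required only near \<open>U\<close>, since weak derivatives on \<open>\<Omega>\<close> control
  mollified functions only at a distance from the boundary.
\<close>
lemma mollification_error:
  fixes w H :: "'a::euclidean_space \<Rightarrow> real"
  assumes p: "1 \<le> p" and w: "smooth_on w UNIV" "Lp_bounded_support p w"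
    and H: "continuous_on UNIV H" "\<And>x. 0 \<le> H x" "integrable lborel (\<lambda>x. H x powr p)"
    and m: "mollifier \<epsilon> \<rho>" "0 \<le> \<epsilon>"
    and le: "\<And>x y v. x \<in> U \<Longrightarrow> dist x y \<le> \<epsilon> \<Longrightarrow> \<bar>frechet_derivative w (at y) v\<bar> \<le> norm v * H y"
    and U: "open U" "bounded U"
  shows "(LINT x|lebesgue_on U. \<bar>conv \<rho> w x - w x\<bar> powr p) \<le> \<epsilon> powr p * (LINT x|lborel. H x powr p)"
proof -
  note \<rho> = mollifierD[OF m(1)]
  note W = Lp_bounded_supportD[OF w(2) p]
  note wc = smooth_continuous[OF w(1)]
  have Hp: "continuous_on UNIV (\<lambda>x. H x powr p)" using H p by (intro continuous_on_powr' continuous_intros) auto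
  note [measurable] = borel_measurable_continuous_onI[OF wc] test_functions_measurable[OF \<rho>(1)]
    borel_measurable_continuous_onI[OF H(1)] borel_measurable_continuous_onI[OF Hp]
    conv_measurable[OF \<rho>(1) W(3)]
  have Us: "U \<in> sets lborel" using U by simp
  have inner: "\<bar>w (x - z) - w x\<bar> powr p \<le> \<epsilon> powr p * (LINT t|lborel. indicator {0..1} t * H (x - t *\<^sub>R z) powr p)"
    if x: "x \<in> U" and z: "norm z \<le> \<epsilon>" for x z
  proof -
    have i: "integrable lborel (\<lambda>t::real. indicator {0..1} t * g t)" if "continuous_on UNIV g" for g :: "real \<Rightarrow> real"
      using borel_integrable_compact[of "{0..1::real}" g] continuous_on_subset[OF that] by simp
    have c1: "continuous_on UNIV (\<lambda>t::real. H (x - t *\<^sub>R z))" by (intro continuous_on_compose2[OF H(1)] continuous_intros) auto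
    have c2: "continuous_on UNIV (\<lambda>t::real. H (x - t *\<^sub>R z) powr p)" by (intro continuous_on_compose2[OF Hp] continuous_intros) auto
    have "\<bar>w (x - z) - w x\<bar> \<le> \<epsilon> * (LINT t|lborel. indicator {0..1} t * H (x - t *\<^sub>R z))"
    proof (rule segment_bound[OF w(1) H(1)])
      fix t :: real assume t: "0 \<le> t" "t \<le> 1"
      have "dist x (x - t *\<^sub>R z) \<le> 1 * norm z" using t by (simp add: dist_norm mult_left_le_one_le)
      then have "\<bar>frechet_derivative w (at (x - t *\<^sub>R z)) z\<bar> \<le> norm z * H (x - t *\<^sub>R z)" using z by (intro le[OF x]) simp
      also have "\<dots> \<le> \<epsilon> * H (x - t *\<^sub>R z)" using z H(2) by (intro mult_right_mono) auto
      finally show "\<bar>frechet_derivative w (at (x - t *\<^sub>R z)) z\<bar> \<le> \<epsilon> * H (x - t *\<^sub>R z)" .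
    qed
    then have "\<bar>w (x - z) - w x\<bar> powr p \<le> (\<epsilon> * (LINT t|lborel. indicator {0..1} t * H (x - t *\<^sub>R z))) powr p"
      using p by (intro powr_mono2) auto
    also have "\<dots> = \<epsilon> powr p * (LINT t|lborel. indicator {0..1} t * H (x - t *\<^sub>R z)) powr p"
      using m(2) H(2) by (intro powr_mult)
    also have "\<dots> \<le> \<epsilon> powr p * (LINT t|lborel. indicator {0..1} t * H (x - t *\<^sub>R z) powr p)"
      by (intro mult_left_mono weighted_jensen) (use p H(2) i[OF c1] i[OF c2] i[of "\<lambda>t. 1"] in auto)
    finally show ?thesis .
  qed
  have pt: "ennreal (indicator U x * \<bar>conv \<rho> w x - w x\<bar> powr p) \<le>
      (\<integral>\<^sup>+z. ennreal (\<rho> z) * (ennreal (\<epsilon> powr p) * (\<integral>\<^sup>+t. indicator {0..1} t * ennreal (H (x - t *\<^sub>R z) powr p) \<partial>lborel)) \<partial>lborel)" for x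
  proof (cases "x \<in> U")
    case True
    have i0: "integrable lborel (\<lambda>y. \<rho> (x - y))" by (rule mollifier_reflect(1)[OF m(1)])
    obtain B where B: "\<And>x. \<bar>\<rho> x\<bar> \<le> B" using test_functions_bounded[OF \<rho>(1)] by blast
    obtain R where R: "\<And>y. w y \<noteq> 0 \<Longrightarrow> norm y \<le> R" using w(2) by (auto simp: Lp_bounded_support_def bounded_iff)
    have wb: "\<exists>M. \<forall>y. \<bar>w y\<bar> \<le> M"
      using continuous_compact_support_bounded[OF wc compact_cball[of 0 R]] R by (metis mem_cball_0)
    then obtain M where M: "\<And>y. \<bar>w y\<bar> \<le> M" by blast
    have d: "\<bar>w y - w x\<bar> \<le> 2 * M" for y using M[of y] M[of x] by linarith
    have i1: "integrable lborel (\<lambda>y. \<rho> (x - y) * \<bar>w y - w x\<bar>)"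
      by (rule Bochner_Integration.integrable_bound[OF integrable_mult_left[OF i0, of "2 * M"]])
        (use d \<rho>(2) in \<open>auto intro!: AE_I2 mult_left_mono order_trans[OF d] simp: abs_mult\<close>)
    have i2: "integrable lborel (\<lambda>y. \<rho> (x - y) * \<bar>w y - w x\<bar> powr p)"
    proof (rule Bochner_Integration.integrable_bound[OF integrable_mult_left[OF i0, of "(2 * M) powr p"]])
      have "\<bar>w y - w x\<bar> powr p \<le> (2 * M) powr p" for y using d p by (intro powr_mono2) auto
      then show "AE y in lborel. norm (\<rho> (x - y) * \<bar>w y - w x\<bar> powr p) \<le> norm (\<rho> (x - y) * (2 * M) powr p)"
        using \<rho>(2) by (intro AE_I2) (auto simp: abs_mult intro!: mult_left_mono)
    qed measurable
    have i3: "integrable lborel (\<lambda>y. \<rho> (x - y) * (w y - w x))"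
      by (rule Bochner_Integration.integrable_bound[OF i1]) (auto simp: abs_mult)
    have "\<bar>conv \<rho> w x - w x\<bar> \<le> (LINT y|lborel. \<rho> (x - y) * \<bar>w y - w x\<bar>)"
      unfolding conv_minus_const[OF m(1) W(3)] using \<rho>(2) by (intro abs_integral_le i3 i1) (simp add: abs_mult)
    then have "\<bar>conv \<rho> w x - w x\<bar> powr p \<le> (LINT y|lborel. \<rho> (x - y) * \<bar>w y - w x\<bar>) powr p" using p by (intro powr_mono2) auto
    also have "\<dots> \<le> (LINT y|lborel. \<rho> (x - y) * \<bar>w y - w x\<bar> powr p)"
      using p \<rho>(2) i0 i1 i2 mollifier_reflect(2)[OF m(1)] by (intro weighted_jensen) auto
    finally have "ennreal (\<bar>conv \<rho> w x - w x\<bar> powr p) \<le> (\<integral>\<^sup>+y. ennreal (\<rho> (x - y) * \<bar>w y - w x\<bar> powr p) \<partial>lborel)"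
      using \<rho>(2) by (subst nn_integral_eq_integral[OF i2]) (auto intro: ennreal_leI)
    also have "\<dots> = (\<integral>\<^sup>+y. ennreal (\<rho> (x - y) * \<bar>w (x - (x - y)) - w x\<bar> powr p) \<partial>lborel)" by simp
    also have "\<dots> = (\<integral>\<^sup>+z. ennreal (\<rho> z * \<bar>w (x - z) - w x\<bar> powr p) \<partial>lborel)"
      by (rule nn_integral_lborel_reflect[of "\<lambda>z. ennreal (\<rho> z * \<bar>w (x - z) - w x\<bar> powr p)" x]) measurable
    also have "\<dots> \<le> (\<integral>\<^sup>+z. ennreal (\<rho> z) * (ennreal (\<epsilon> powr p) * (\<integral>\<^sup>+t. indicator {0..1} t * ennreal (H (x - t *\<^sub>R z) powr p) \<partial>lborel)) \<partial>lborel)"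
    proof (rule nn_integral_mono)
      fix z
      show "ennreal (\<rho> z * \<bar>w (x - z) - w x\<bar> powr p) \<le> ennreal (\<rho> z) * (ennreal (\<epsilon> powr p) * (\<integral>\<^sup>+t. indicator {0..1} t * ennreal (H (x - t *\<^sub>R z) powr p) \<partial>lborel))"
      proof (cases "norm z \<le> \<epsilon>")
        case z: True
        have c2: "continuous_on UNIV (\<lambda>t::real. H (x - t *\<^sub>R z) powr p)" by (intro continuous_on_compose2[OF Hp] continuous_intros) auto
        have i: "integrable lborel (\<lambda>t::real. indicator {0..1} t * H (x - t *\<^sub>R z) powr p)"
          using borel_integrable_compact[of "{0..1::real}" "\<lambda>t. H (x - t *\<^sub>R z) powr p"] continuous_on_subset[OF c2] by simp
        have "(\<integral>\<^sup>+t. indicator {0..1} t * ennreal (H (x - t *\<^sub>R z) powr p) \<partial>lborel) = (\<integral>\<^sup>+t. ennreal (indicator {0..1} t * H (x - t *\<^sub>R z) powr p) \<partial>lborel)"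
          by (rule nn_integral_cong) (auto simp: indicator_def)
        also have "\<dots> = ennreal (LINT t|lborel. indicator {0..1} t * H (x - t *\<^sub>R z) powr p)"
          by (rule nn_integral_eq_integral[OF i]) auto
        finally show ?thesis
          using inner[OF True z] \<rho>(2)[of z]
          by (simp add: ennreal_mult[symmetric] integral_nonneg_AE ennreal_leI mult_left_mono)
      next
        case False
        then show ?thesis using \<rho>(3)[of z] by simp
      qed
    qed
    finally show ?thesis using True by simp
  qed simp
  have ci: "integrable (lebesgue_on U) (\<lambda>x. \<bar>conv \<rho> w x - w x\<bar> powr p)" using p
    by (intro integrable_lebesgue_on_continuous[OF U] continuous_on_powr' continuous_intros wc smooth_continuous[OF smooth_conv[OF \<rho>(1) W(3)]]) auto
  have "ennreal (LINT x|lebesgue_on U. \<bar>conv \<rho> w x - w x\<bar> powr p) = (\<integral>\<^sup>+x. ennreal (\<bar>conv \<rho> w x - w x\<bar> powr p) \<partial>lebesgue_on U)"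
    by (rule nn_integral_eq_integral[OF ci, symmetric]) simp
  also have "\<dots> = (\<integral>\<^sup>+x. ennreal (\<bar>conv \<rho> w x - w x\<bar> powr p) * indicator U x \<partial>lebesgue)"
    using U by (intro nn_integral_restrict_space) auto
  also have "\<dots> = (\<integral>\<^sup>+x. ennreal (indicator U x * \<bar>conv \<rho> w x - w x\<bar> powr p) \<partial>lborel)"
    unfolding nn_integral_completion by (rule nn_integral_cong) (auto simp: indicator_def)
  also have "\<dots> \<le> (\<integral>\<^sup>+x. \<integral>\<^sup>+z. ennreal (\<rho> z) * (ennreal (\<epsilon> powr p) * (\<integral>\<^sup>+t. indicator {0..1} t * ennreal (H (x - t *\<^sub>R z) powr p) \<partial>lborel)) \<partial>lborel \<partial>lborel)"
    by (rule nn_integral_mono) (rule pt)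
  also have "\<dots> = (\<integral>\<^sup>+z. \<integral>\<^sup>+x. ennreal (\<rho> z) * (ennreal (\<epsilon> powr p) * (\<integral>\<^sup>+t. indicator {0..1} t * ennreal (H (x - t *\<^sub>R z) powr p) \<partial>lborel)) \<partial>lborel \<partial>lborel)"
    by (rule lborel_pair.Fubini'[symmetric]) measurable
  also have "\<dots> = (\<integral>\<^sup>+z. ennreal (\<rho> z) * (ennreal (\<epsilon> powr p) * (\<integral>\<^sup>+t. indicator {0..1::real} t * (\<integral>\<^sup>+x. ennreal (H x powr p) \<partial>lborel) \<partial>lborel)) \<partial>lborel)"
  proof (rule nn_integral_cong)
    fix z :: 'a
    have "(\<integral>\<^sup>+x. ennreal (\<rho> z) * (ennreal (\<epsilon> powr p) * (\<integral>\<^sup>+t. indicator {0..1} t * ennreal (H (x - t *\<^sub>R z) powr p) \<partial>lborel)) \<partial>lborel)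
      = ennreal (\<rho> z) * (ennreal (\<epsilon> powr p) * (\<integral>\<^sup>+x. \<integral>\<^sup>+t. indicator {0..1} t * ennreal (H (x - t *\<^sub>R z) powr p) \<partial>lborel \<partial>lborel))"
      by (simp add: nn_integral_cmult)
    also have "(\<integral>\<^sup>+x. \<integral>\<^sup>+t. indicator {0..1} t * ennreal (H (x - t *\<^sub>R z) powr p) \<partial>lborel \<partial>lborel) =
        (\<integral>\<^sup>+t. \<integral>\<^sup>+x. indicator {0..1} t * ennreal (H (x - t *\<^sub>R z) powr p) \<partial>lborel \<partial>lborel)"
      by (rule lborel_pair.Fubini') measurable
    also have "\<dots> = (\<integral>\<^sup>+t. indicator {0..1::real} t * (\<integral>\<^sup>+x. ennreal (H x powr p) \<partial>lborel) \<partial>lborel)"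
    proof (rule nn_integral_cong)
      fix t :: real
      have "(\<integral>\<^sup>+x. ennreal (H (x - t *\<^sub>R z) powr p) \<partial>lborel) = (\<integral>\<^sup>+x. ennreal (H (- (t *\<^sub>R z) + x) powr p) \<partial>lborel)"
        by (simp add: algebra_simps)
      also have "\<dots> = (\<integral>\<^sup>+x. ennreal (H x powr p) \<partial>lborel)"
        by (rule nn_integral_lborel_translate[of "\<lambda>x. ennreal (H x powr p)"]) measurable
      finally show "(\<integral>\<^sup>+x. indicator {0..1} t * ennreal (H (x - t *\<^sub>R z) powr p) \<partial>lborel) = indicator {0..1} t * (\<integral>\<^sup>+x. ennreal (H x powr p) \<partial>lborel)"
        by (simp add: nn_integral_cmult)
    qed
    finally show "(\<integral>\<^sup>+x. ennreal (\<rho> z) * (ennreal (\<epsilon> powr p) * (\<integral>\<^sup>+t. indicator {0..1} t * ennreal (H (x - t *\<^sub>R z) powr p) \<partial>lborel)) \<partial>lborel) =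
      ennreal (\<rho> z) * (ennreal (\<epsilon> powr p) * (\<integral>\<^sup>+t. indicator {0..1::real} t * (\<integral>\<^sup>+x. ennreal (H x powr p) \<partial>lborel) \<partial>lborel))" .
  qed
  also have "\<dots> = (\<integral>\<^sup>+z. ennreal (\<rho> z) * (ennreal (\<epsilon> powr p) * (\<integral>\<^sup>+x. ennreal (H x powr p) \<partial>lborel)) \<partial>lborel)"
    by (simp add: nn_integral_multc)
  also have "\<dots> = (\<integral>\<^sup>+z. ennreal (\<rho> z) \<partial>lborel) * (ennreal (\<epsilon> powr p) * (\<integral>\<^sup>+x. ennreal (H x powr p) \<partial>lborel))"
    by (rule nn_integral_multc) measurable
  also have "(\<integral>\<^sup>+z. ennreal (\<rho> z) \<partial>lborel) = 1" using nn_integral_eq_integral[OF \<rho>(5)] \<rho>(2,4) by simp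
  also have "(\<integral>\<^sup>+x. ennreal (H x powr p) \<partial>lborel) = ennreal (LINT x|lborel. H x powr p)"
    by (rule nn_integral_eq_integral[OF H(3)]) simp
  finally have "ennreal (LINT x|lebesgue_on U. \<bar>conv \<rho> w x - w x\<bar> powr p) \<le> ennreal (\<epsilon> powr p * (LINT x|lborel. H x powr p))"
    by (simp add: ennreal_mult integral_nonneg_AE)
  then show ?thesis by (subst (asm) ennreal_le_iff) (auto intro: integral_nonneg_AE)
qed

lemma lebesgue_on_le_lborel:
  fixes F :: "'a::euclidean_space \<Rightarrow> real"
  assumes U: "open U" and F: "integrable lborel F" "\<And>x. 0 \<le> F x"
  shows "integrable (lebesgue_on U) F" "(LINT x|lebesgue_on U. F x) \<le> (LINT x|lborel. F x)"
proof -
  have [measurable]: "U \<in> sets borel" "F \<in> borel_measurable borel" using U F(1) by auto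
  have i: "integrable lborel (\<lambda>x. indicator U x * F x)"
    by (rule Bochner_Integration.integrable_bound[OF F(1)]) (auto simp: indicator_def)
  have il: "integrable lebesgue (\<lambda>x. indicator U x * F x)" using i by (subst integrable_completion) auto
  show "integrable (lebesgue_on U) F" using U il by (subst integrable_restrict_space) auto
  have "(LINT x|lebesgue_on U. F x) = (LINT x|lebesgue. indicator U x * F x)"
    using U by (subst integral_restrict_space) auto
  also have "\<dots> = (LINT x|lborel. indicator U x * F x)" by (rule integral_completion) measurable
  also have "\<dots> \<le> (LINT x|lborel. F x)" using F by (intro integral_mono i) (auto simp: indicator_def)
  finally show "(LINT x|lebesgue_on U. F x) \<le> (LINT x|lborel. F x)" .
qed

lemma frechet_axis_expansion:
  fixes w :: "'n::finite rvec \<Rightarrow> real"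
  assumes "smooth_on w UNIV"
  shows "frechet_derivative w (at y) v = (\<Sum>j\<in>UNIV. v $ j * frechet_derivative w (at y) (axis j 1))"
proof -
  note lin = smooth_linear_frechet[OF assms, of y]
  have "frechet_derivative w (at y) v = frechet_derivative w (at y) (\<Sum>j\<in>UNIV. v $ j *\<^sub>R axis j 1)"
    using basis_expansion[of v] by (simp add: scalar_mult_eq_scaleR)
  then show ?thesis using linear_sum[OF lin, of "\<lambda>j. v $ j *\<^sub>R axis j 1" UNIV] linear_cmul[OF lin] by simp
qed

lemma test_functions_reflect:
  fixes \<phi> :: "'a::euclidean_space \<Rightarrow> real"
  assumes "\<phi> \<in> test_functions UNIV" shows "(\<lambda>y. \<phi> (x - y)) \<in> test_functions UNIV"
proof -
  obtain K where K: "compact K" "\<And>x. x \<notin> K \<Longrightarrow> \<phi> x = 0" using test_functions_support[OF assms] by auto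
  show ?thesis
  proof (rule test_functionsI)
    show "smooth_on (\<lambda>y. \<phi> (x - y)) UNIV" by (rule smooth_reflect[OF test_functions_smooth[OF assms]])
    show "compact ((\<lambda>z. x - z) ` K)" by (intro compact_continuous_image continuous_intros K(1))
    show "\<phi> (x - y) = 0" if "y \<notin> (\<lambda>z. x - z) ` K" for y
    proof (rule K(2))
      show "x - y \<notin> K" using that by (metis diff_diff_eq2 add_diff_cancel_left' image_eqI)
    qed
  qed simp
qed

text \<open>From \<open>|u| \<le> 1 + |u|\<^sup>p\<close> on \<open>\<Omega>\<close>.\<close>
lemma integral_abs_le_powr:
  fixes u :: "'a::euclidean_space \<Rightarrow> real"
  assumes \<Omega>: "open \<Omega>" "bounded \<Omega>" and u: "u \<in> Lp p \<Omega>" and p: "1 \<le> p"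
  shows "(LINT x|lborel. \<bar>borel_rep \<Omega> u x\<bar>) \<le> measure lborel \<Omega> + (LINT x|lebesgue_on \<Omega>. \<bar>u x\<bar> powr p)"
proof -
  note L = borel_rep_Lp[OF \<Omega> u]
  note D = Lp_bounded_supportD[OF L(1) p]
  have um: "u \<in> borel_measurable (lebesgue_on \<Omega>)" using u by (simp add: Lp_def)
  have fin: "emeasure lborel \<Omega> < \<infinity>" by (rule emeasure_bounded_finite[OF \<Omega>(2)])
  have i: "integrable lborel (indicator \<Omega> :: 'a \<Rightarrow> real)" using \<Omega>(1) fin by (intro integrable_real_indicator) auto
  have "(LINT x|lborel. \<bar>borel_rep \<Omega> u x\<bar>) \<le> (LINT x|lborel. indicator \<Omega> x + \<bar>borel_rep \<Omega> u x\<bar> powr p)"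
  proof (rule integral_mono)
    fix x
    show "\<bar>borel_rep \<Omega> u x\<bar> \<le> indicator \<Omega> x + \<bar>borel_rep \<Omega> u x\<bar> powr p"
    proof (cases "x \<in> \<Omega>")
      case True
      show ?thesis
      proof (cases "\<bar>borel_rep \<Omega> u x\<bar> \<le> 1")
        case False
        then have "\<bar>borel_rep \<Omega> u x\<bar> powr 1 \<le> \<bar>borel_rep \<Omega> u x\<bar> powr p" using p by (intro powr_mono) auto
        then show ?thesis using True by simp
      qed (use True in \<open>simp add: add_increasing2\<close>)
    qed (use borel_rep(2)[OF \<Omega>(1) um] in simp)
  qed (use D i in auto)
  also have "\<dots> = measure lborel \<Omega> + (LINT x|lborel. \<bar>borel_rep \<Omega> u x\<bar> powr p)"
    using i D(2) by simp
  finally show ?thesis using L(2) by simp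
qed

text \<open>
  With a fixed mollifier the convolution at \<open>x\<close> is a pairing with a test function, so it tends to
  zero at every \<open>x\<close>, and it is uniformly bounded: dominated convergence applies.
\<close>
lemma conv_weakly_null:
  fixes u :: "nat \<Rightarrow> 'a::euclidean_space \<Rightarrow> real"
  assumes \<Omega>: "open \<Omega>" "bounded \<Omega>" and p: "1 \<le> p" and U: "open U" "bounded U"
    and u: "\<And>s. u s \<in> Lp p \<Omega>" "\<And>s. (LINT x|lebesgue_on \<Omega>. \<bar>u s x\<bar> powr p) \<le> M"
    and tested: "\<And>h. h \<in> test_functions UNIV \<Longrightarrow> (\<lambda>s. LINT x|lebesgue_on \<Omega>. u s x * h x) \<longlonglongrightarrow> 0"
    and m: "mollifier \<epsilon> \<rho>"
  shows "(\<lambda>s. LINT x|lebesgue_on U. \<bar>conv \<rho> (borel_rep \<Omega> (u s)) x\<bar> powr p) \<longlonglongrightarrow> 0"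
proof -
  note \<rho> = mollifierD[OF m]
  note L = borel_rep_Lp(1)[OF \<Omega> u(1)]
  note int = Lp_bounded_supportD(3)[OF L p]
  note [measurable] = test_functions_measurable[OF \<rho>(1)]
  obtain B where B: "B \<ge> 0" "\<And>x. \<bar>\<rho> x\<bar> \<le> B" using test_functions_bounded[OF \<rho>(1)] by blast
  define C where "C = B * (measure lborel \<Omega> + M)"
  have bd: "\<bar>conv \<rho> (borel_rep \<Omega> (u s)) x\<bar> \<le> C" for s x
  proof -
    have "\<bar>conv \<rho> (borel_rep \<Omega> (u s)) x\<bar> \<le> (LINT y|lborel. B * \<bar>borel_rep \<Omega> (u s) y\<bar>)"
      unfolding conv_def using conv_integrable[OF \<rho>(1) int[of s]] int[of s] B
      by (intro abs_integral_le) (auto simp: abs_mult intro!: mult_right_mono)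
    also have "\<dots> = B * (LINT y|lborel. \<bar>borel_rep \<Omega> (u s) y\<bar>)" by simp
    also have "\<dots> \<le> C" unfolding C_def
      using integral_abs_le_powr[OF \<Omega> u(1)[of s] p] u(2)[of s] B(1) by (intro mult_left_mono) auto
    finally show ?thesis .
  qed
  have ptw: "(\<lambda>s. conv \<rho> (borel_rep \<Omega> (u s)) x) \<longlonglongrightarrow> 0" for x
  proof -
    have um: "u s \<in> borel_measurable (lebesgue_on \<Omega>)" for s using u(1)[of s] by (simp add: Lp_def)
    have "conv \<rho> (borel_rep \<Omega> (u s)) x = (LINT y|lebesgue_on \<Omega>. u s y * \<rho> (x - y))" for s
      by (subst borel_rep_integral[OF \<Omega>(1) um]) (simp_all add: conv_def mult.commute)
    then show ?thesis using tested[OF test_functions_reflect[OF \<rho>(1)], of x] by simp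
  qed
  have "(\<lambda>s. LINT x|lebesgue_on U. \<bar>conv \<rho> (borel_rep \<Omega> (u s)) x\<bar> powr p) \<longlonglongrightarrow> (LINT x|lebesgue_on U. 0)"
  proof (rule integral_dominated_convergence[where w="\<lambda>x. C powr p"])
    show "integrable (lebesgue_on U) (\<lambda>x. C powr p)" by (rule integral_lebesgue_on_const(1)[OF U])
    show "(\<lambda>x. \<bar>conv \<rho> (borel_rep \<Omega> (u s)) x\<bar> powr p) \<in> borel_measurable (lebesgue_on U)" for s
      using borel_measurable_lebesgue_on[OF conv_measurable[OF \<rho>(1) int[of s]]] by measurable
    show "AE x in lebesgue_on U. (\<lambda>s. \<bar>conv \<rho> (borel_rep \<Omega> (u s)) x\<bar> powr p) \<longlonglongrightarrow> 0"
    proof (rule AE_I2)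
      fix x
      have "(\<lambda>s. \<bar>conv \<rho> (borel_rep \<Omega> (u s)) x\<bar> powr p) \<longlonglongrightarrow> \<bar>0\<bar> powr p"
        using p by (intro tendsto_powr' tendsto_rabs ptw tendsto_const) auto
      then show "(\<lambda>s. \<bar>conv \<rho> (borel_rep \<Omega> (u s)) x\<bar> powr p) \<longlonglongrightarrow> 0" using p by simp
    qed
    show "AE x in lebesgue_on U. norm (\<bar>conv \<rho> (borel_rep \<Omega> (u s)) x\<bar> powr p) \<le> C powr p" for s
      using bd p by (intro AE_I2) (auto intro!: powr_mono2)
  qed simp
  then show ?thesis by simp
qed

text \<open>
  The Rellich compactness theorem, for the mollified sequence \<open>w s\<close> of \<open>u s\<close>. Given \<open>\<eta>\<close>, fix a
  second mollifier \<open>\<rho>\<close> of small radius \<open>\<epsilon>\<close> and split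
  \<open>w s = (w s - \<rho> * w s) + \<rho> * (w s - u s) + \<rho> * u s\<close>. The first part is of order \<open>\<epsilon>\<close>, uniformly in
  \<open>s\<close>, by the bound on the gradients; the second tends to zero with \<open>w s - u s\<close>; the third by
  \<open>conv_weakly_null\<close>.
\<close>
lemma local_compactness:
  fixes u :: "nat \<Rightarrow> 'n::finite rvec \<Rightarrow> real" and g :: "nat \<Rightarrow> 'n \<Rightarrow> 'n rvec \<Rightarrow> real"
  assumes \<Omega>: "open \<Omega>" "bounded \<Omega>" and p: "1 \<le> p" and U: "open U" "bounded U" and r: "r > 0" "\<And>x. x \<in> U \<Longrightarrow> cball x r \<subseteq> \<Omega>"
    and u: "\<And>s. u s \<in> Lp p \<Omega>" "\<And>s. (LINT x|lebesgue_on \<Omega>. \<bar>u s x\<bar> powr p) \<le> M"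
    and g: "\<And>s j. g s j \<in> Lp p \<Omega>" "\<And>s j. (LINT x|lebesgue_on \<Omega>. \<bar>g s j x\<bar> powr p) \<le> M"
    and wd: "\<And>s j. has_weak_deriv \<Omega> (axis j 1) (u s) (g s j)"
    and tested: "\<And>h. h \<in> test_functions UNIV \<Longrightarrow> (\<lambda>s. LINT x|lebesgue_on \<Omega>. u s x * h x) \<longlonglongrightarrow> 0"
    and m: "\<And>s. mollifier (e s) (\<rho>' s)" "\<And>s. e s \<le> r / 2"
    and ap: "(\<lambda>s. LINT x|lborel. \<bar>conv (\<rho>' s) (borel_rep \<Omega> (u s)) x - borel_rep \<Omega> (u s) x\<bar> powr p) \<longlonglongrightarrow> 0"
  shows "(\<lambda>s. LINT x|lebesgue_on U. \<bar>conv (\<rho>' s) (borel_rep \<Omega> (u s)) x\<bar> powr p) \<longlonglongrightarrow> 0"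
proof -
  define w where "w s = conv (\<rho>' s) (borel_rep \<Omega> (u s))" for s
  note L = borel_rep_Lp[OF \<Omega> u(1)]
  note int = Lp_bounded_supportD(3)[OF L(1) p]
  note gL = borel_rep_Lp[OF \<Omega> g(1)]
  note gint = Lp_bounded_supportD(3)[OF gL(1) p]
  note \<rho>' = mollifierD[OF m(1)]
  have wsm: "smooth_on (w s) UNIV" for s unfolding w_def by (rule smooth_conv[OF \<rho>'(1) int])
  have wL: "Lp_bounded_support p (w s)" for s unfolding w_def by (rule conv_Lp_bound(1)[OF m(1) L(1) p])
  define G where "G s j = conv (\<rho>' s) (borel_rep \<Omega> (g s j))" for s j
  \<comment> \<open>The majorant of the derivative of \<open>w s\<close>.\<close>
  define H where "H s y = (\<Sum>j\<in>UNIV. \<bar>G s j y\<bar>)" for s y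
  have Gc: "continuous_on UNIV (G s j)" for s j unfolding G_def by (rule smooth_continuous[OF smooth_conv[OF \<rho>'(1) gint]])
  have Hc: "continuous_on UNIV (H s)" for s unfolding H_def by (intro continuous_intros Gc)
  have H0: "0 \<le> H s y" for s y unfolding H_def by (intro sum_nonneg) auto
  define M1 where "M1 = real CARD('n) powr p * (real CARD('n) * M)"
  have GL: "Lp_bounded_support p (G s j)" for s j unfolding G_def by (rule conv_Lp_bound(1)[OF m(1) gL(1) p])
  have GM: "(LINT x|lborel. \<bar>G s j x\<bar> powr p) \<le> M" for s j
    using conv_Lp_bound(2)[OF m(1)[of s] gL(1)[of s j] p] g(2)[of s j] by (simp add: gL(2) G_def)
  have M0: "0 \<le> M" using order_trans[OF integral_nonneg_AE u(2)[of 0]] by simp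
  have M10: "0 \<le> M1" using M0 by (simp add: M1_def)
  have HI: "integrable lborel (\<lambda>x. H s x powr p)" and HM: "(LINT x|lborel. H s x powr p) \<le> M1" for s
  proof -
    have j: "integrable lborel (\<lambda>x. real CARD('n) powr p * (\<Sum>j\<in>UNIV. \<bar>G s j x\<bar> powr p))"
      by (intro integrable_mult_right Bochner_Integration.integrable_sum Lp_bounded_supportD(2)[OF GL p])
    have le: "H s x powr p \<le> real CARD('n) powr p * (\<Sum>j\<in>UNIV. \<bar>G s j x\<bar> powr p)" for x
      unfolding H_def using p by (intro powr_sum_le) auto
    have [measurable]: "H s \<in> borel_measurable borel" by (rule borel_measurable_continuous_onI[OF Hc])
    show i: "integrable lborel (\<lambda>x. H s x powr p)"
      by (rule Bochner_Integration.integrable_bound[OF j]) (use le in \<open>auto simp: sum_nonneg\<close>)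
    have "(LINT x|lborel. H s x powr p) \<le> (LINT x|lborel. real CARD('n) powr p * (\<Sum>j\<in>UNIV. \<bar>G s j x\<bar> powr p))"
      by (intro integral_mono i j le)
    also have "\<dots> = real CARD('n) powr p * (\<Sum>j\<in>UNIV. (LINT x|lborel. \<bar>G s j x\<bar> powr p))"
      by (simp add: Bochner_Integration.integral_sum[OF Lp_bounded_supportD(2)[OF GL p]])
    also have "\<dots> \<le> real CARD('n) powr p * (\<Sum>j\<in>(UNIV::'n set). M)" by (intro mult_left_mono sum_mono GM) auto
    finally show "(LINT x|lborel. H s x powr p) \<le> M1" by (simp add: M1_def)
  qed
  have deriv: "\<bar>frechet_derivative (w s) (at y) v\<bar> \<le> norm v * H s y" if "x \<in> U" "dist x y \<le> r / 2" for s x y v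
  proof -
    have "cball y (e s) \<subseteq> cball x r"
    proof
      fix z assume "z \<in> cball y (e s)"
      then have "dist x z \<le> r / 2 + r / 2" using that(2) m(2)[of s] dist_triangle[of x z y] by simp
      then show "z \<in> cball x r" by simp
    qed
    then have "cball y (e s) \<subseteq> \<Omega>" using r(2)[OF that(1)] by blast
    then have fd: "frechet_derivative (w s) (at y) (axis j 1) = G s j y" for j
      unfolding w_def G_def by (rule frechet_conv_weak_deriv[OF \<Omega> p u(1) g(1) wd m(1)])
    have "\<bar>frechet_derivative (w s) (at y) v\<bar> = \<bar>\<Sum>j\<in>UNIV. v $ j * G s j y\<bar>"
      by (subst frechet_axis_expansion[OF wsm]) (simp add: fd)
    also have "\<dots> \<le> (\<Sum>j\<in>UNIV. \<bar>v $ j * G s j y\<bar>)" by (rule sum_abs)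
    also have "\<dots> \<le> (\<Sum>j\<in>UNIV. norm v * \<bar>G s j y\<bar>)"
      by (intro sum_mono) (auto simp: abs_mult intro!: mult_right_mono component_le_norm_cart)
    finally show ?thesis by (simp add: H_def sum_distrib_left)
  qed
  define a where "a s = (LINT x|lborel. \<bar>w s x - borel_rep \<Omega> (u s) x\<bar> powr p)" for s
  have a: "a \<longlonglongrightarrow> 0" using ap by (simp add: a_def[abs_def] w_def)
  show ?thesis
  proof (rule LIMSEQ_I)
    fix \<eta> :: real assume \<eta>: "\<eta> > 0"
    \<comment> \<open>The radius is at most \<open>r / 2\<close> and \<open>\<epsilon>\<^sup>p M1\<close> is at most a fixed fraction of \<open>\<eta>\<close>.\<close>
    define \<epsilon> where "\<epsilon> = min (r / 2) ((\<eta> / 2 / (2 powr p * (M1 + 1))) powr (1 / p))"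
    have \<epsilon>: "\<epsilon> > 0" "\<epsilon> \<le> r / 2" using r(1) \<eta> M10 by (auto simp: \<epsilon>_def)
    have ep: "\<epsilon> powr p \<le> \<eta> / 2 / (2 powr p * (M1 + 1))"
    proof -
      have "\<epsilon> powr p \<le> ((\<eta> / 2 / (2 powr p * (M1 + 1))) powr (1 / p)) powr p"
        using \<epsilon> p by (intro powr_mono2) (auto simp: \<epsilon>_def)
      also have "\<dots> = \<eta> / 2 / (2 powr p * (M1 + 1))" using \<eta> M10 p by (simp add: powr_powr)
      finally show ?thesis .
    qed
    obtain \<rho> :: "'n rvec \<Rightarrow> real" where mo: "mollifier \<epsilon> \<rho>" using mollifier_exists[OF \<epsilon>(1)] by blast
    note \<rho> = mollifierD[OF mo]
    define b where "b s = (LINT x|lebesgue_on U. \<bar>conv \<rho> (borel_rep \<Omega> (u s)) x\<bar> powr p)" for s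
    have b: "b \<longlonglongrightarrow> 0" unfolding b_def[abs_def] by (rule conv_weakly_null[OF \<Omega> p U u tested mo])
    have bound: "(LINT x|lebesgue_on U. \<bar>w s x\<bar> powr p) \<le> 2 powr p * (\<epsilon> powr p * M1) + 2 powr p * 2 powr p * (a s + b s)" for s
    proof -
      let ?u = "borel_rep \<Omega> (u s)"
      note dL = Lp_bounded_support_diff[OF wL[of s] L(1)[of s] p]
      note cdL = conv_Lp_bound[OF mo dL p]
      have c1: "continuous_on UNIV (w s)" by (rule smooth_continuous[OF wsm])
      have c2: "continuous_on UNIV (conv \<rho> (w s))" by (rule smooth_continuous[OF smooth_conv[OF \<rho>(1) Lp_bounded_supportD(3)[OF wL p]]])
      have c3: "continuous_on UNIV (conv \<rho> ?u)" by (rule smooth_continuous[OF smooth_conv[OF \<rho>(1) int]])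
      have c4: "continuous_on UNIV (conv \<rho> (\<lambda>x. w s x - ?u x))" by (rule smooth_continuous[OF smooth_conv[OF \<rho>(1) Lp_bounded_supportD(3)[OF dL p]]])
      have ci: "integrable (lebesgue_on U) (\<lambda>x. \<bar>h x\<bar> powr p)" "h \<in> borel_measurable (lebesgue_on U)" if h: "continuous_on UNIV h" for h :: "'n rvec \<Rightarrow> real"
      proof -
        show "integrable (lebesgue_on U) (\<lambda>x. \<bar>h x\<bar> powr p)"
          by (intro integrable_lebesgue_on_continuous[OF U] continuous_on_powr' continuous_intros h) (use p in auto)
        show "h \<in> borel_measurable (lebesgue_on U)" by (intro borel_measurable_lebesgue_on borel_measurable_continuous_onI h)
      qed
      have c12: "continuous_on UNIV (\<lambda>x. w s x - conv \<rho> (w s) x)" by (intro continuous_intros c1 c2)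
      have e1: "w s x = (w s x - conv \<rho> (w s) x) + conv \<rho> (w s) x" for x by simp
      have e2: "conv \<rho> (w s) x = conv \<rho> (\<lambda>x. w s x - ?u x) x + conv \<rho> ?u x" for x
        using conv_diff[OF \<rho>(1) Lp_bounded_supportD(3)[OF wL[of s] p] int[of s]] by simp
      have "(LINT x|lebesgue_on U. \<bar>w s x\<bar> powr p) \<le> 2 powr p * ((LINT x|lebesgue_on U. \<bar>w s x - conv \<rho> (w s) x\<bar> powr p) + (LINT x|lebesgue_on U. \<bar>conv \<rho> (w s) x\<bar> powr p))"
        by (subst e1) (intro integrable_powr_add(2) ci c12 c2, use p in simp)
      also have "(LINT x|lebesgue_on U. \<bar>w s x - conv \<rho> (w s) x\<bar> powr p) \<le> \<epsilon> powr p * M1"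
      proof -
        have "(LINT x|lebesgue_on U. \<bar>conv \<rho> (w s) x - w s x\<bar> powr p) \<le> \<epsilon> powr p * (LINT x|lborel. H s x powr p)"
          by (rule mollification_error[OF p wsm wL Hc H0 HI mo _ _ U]) (use \<epsilon> deriv in auto)
        also have "\<dots> \<le> \<epsilon> powr p * M1" by (intro mult_left_mono HM) auto
        finally show ?thesis by (simp add: abs_minus_commute)
      qed
      also have "(LINT x|lebesgue_on U. \<bar>conv \<rho> (w s) x\<bar> powr p) \<le> 2 powr p * (a s + b s)"
      proof -
        have "(LINT x|lebesgue_on U. \<bar>conv \<rho> (w s) x\<bar> powr p) \<le> 2 powr p * ((LINT x|lebesgue_on U. \<bar>conv \<rho> (\<lambda>x. w s x - ?u x) x\<bar> powr p) + b s)"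
          unfolding b_def by (subst e2) (intro integrable_powr_add(2) ci c3 c4, use p in simp)
        also have "(LINT x|lebesgue_on U. \<bar>conv \<rho> (\<lambda>x. w s x - ?u x) x\<bar> powr p) \<le> (LINT x|lborel. \<bar>conv \<rho> (\<lambda>x. w s x - ?u x) x\<bar> powr p)"
          by (rule lebesgue_on_le_lborel(2)[OF U(1) Lp_bounded_supportD(2)[OF cdL(1) p]]) simp
        also have "\<dots> \<le> a s" unfolding a_def by (rule cdL(2))
        finally show ?thesis by simp
      qed
      finally show ?thesis by (simp add: distrib_left mult.assoc)
    qed
    have "(\<lambda>s. 2 powr p * 2 powr p * (a s + b s)) \<longlonglongrightarrow> 2 powr p * 2 powr p * (0 + 0)" by (intro tendsto_intros a b)
    then have "eventually (\<lambda>s. 2 powr p * 2 powr p * (a s + b s) < \<eta> / 2) sequentially"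
      by (rule order_tendstoD(2)) (use \<eta> in simp)
    then obtain s0 where s0: "\<And>s. s \<ge> s0 \<Longrightarrow> 2 powr p * 2 powr p * (a s + b s) < \<eta> / 2"
      by (auto simp: eventually_sequentially)
    have half: "2 powr p * (\<epsilon> powr p * M1) \<le> \<eta> / 2"
    proof -
      have "2 powr p * (\<epsilon> powr p * M1) \<le> 2 powr p * (\<eta> / 2 / (2 powr p * (M1 + 1)) * M1)"
        using ep M10 by (intro mult_left_mono mult_right_mono) auto
      also have "\<dots> = \<eta> / 2 * (M1 / (M1 + 1))" by simp
      also have "\<dots> \<le> \<eta> / 2 * 1" using \<eta> M10 by (intro mult_left_mono) auto
      finally show ?thesis by simp
    qed
    show "\<exists>s0. \<forall>s\<ge>s0. norm ((LINT x|lebesgue_on U. \<bar>conv (\<rho>' s) (borel_rep \<Omega> (u s)) x\<bar> powr p) - 0) < \<eta>"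
    proof (intro exI allI impI)
      fix s assume "s \<ge> s0"
      have "0 \<le> (LINT x|lebesgue_on U. \<bar>w s x\<bar> powr p)" by (rule integral_nonneg_AE) simp
      then show "norm ((LINT x|lebesgue_on U. \<bar>conv (\<rho>' s) (borel_rep \<Omega> (u s)) x\<bar> powr p) - 0) < \<eta>"
        using bound[of s] s0[OF \<open>s \<ge> s0\<close>] half by (simp add: w_def)
    qed
  qed
qed

section \<open>Mollified forms\<close>

definition conv_form :: "('n::finite rvec \<Rightarrow> real) \<Rightarrow> 'n rvec set \<Rightarrow> 'n form_field \<Rightarrow> 'n form_field" where
  "conv_form \<rho> \<Omega> \<gamma> x vs = conv \<rho> (borel_rep \<Omega> (\<lambda>y. \<gamma> y vs)) x"

text \<open>
  The value at \<open>vs\<close> is an integral of \<open>\<gamma> y vs\<close> over \<open>y\<close> in \<open>\<Omega>\<close>, where \<open>\<gamma> y\<close> is alternating.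
\<close>
lemma smooth_conv_form:
  fixes \<gamma> :: "'n::finite form_field"
  assumes \<Omega>: "open \<Omega>" "bounded \<Omega>" and p: "1 \<le> p" and \<gamma>: "\<And>y. y \<in> \<Omega> \<Longrightarrow> \<gamma> y \<in> alt_forms m" "\<And>vs. (\<lambda>y. \<gamma> y vs) \<in> Lp p \<Omega>"
    and mo: "mollifier \<epsilon> \<rho>"
  shows "smooth_form m (conv_form \<rho> \<Omega> \<gamma>)"
proof -
  note \<rho> = mollifierD[OF mo]
  note L = borel_rep_Lp(1)[OF \<Omega> \<gamma>(2)]
  note int = Lp_bounded_supportD(3)[OF L p]
  have \<gamma>m: "(\<lambda>y. \<gamma> y vs) \<in> borel_measurable (lebesgue_on \<Omega>)" for vs using \<gamma>(2)[of vs] by (simp add: Lp_def)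
  note [measurable] = test_functions_measurable[OF \<rho>(1)]
  have val: "conv_form \<rho> \<Omega> \<gamma> x vs = (LINT y|lebesgue_on \<Omega>. \<gamma> y vs * \<rho> (x - y))" for x vs
    unfolding conv_form_def by (subst borel_rep_integral[OF \<Omega>(1) \<gamma>m]) (simp_all add: conv_def mult.commute)
  have i: "integrable (lebesgue_on \<Omega>) (\<lambda>y. \<gamma> y vs * \<rho> (x - y))" for x vs
  proof -
    note r = borel_rep[OF \<Omega>(1) \<gamma>m[of vs]]
    note [measurable] = r(1) \<gamma>m[of vs] borel_measurable_lebesgue_on[of "\<lambda>y. \<rho> (x - y)"]
    have eq: "AE y in lebesgue_on \<Omega>. \<gamma> y vs * \<rho> (x - y) = borel_rep \<Omega> (\<lambda>y. \<gamma> y vs) y * \<rho> (x - y)"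
      using r(3) by eventually_elim simp
    have "integrable (lebesgue_on \<Omega>) (\<lambda>y. \<gamma> y vs * \<rho> (x - y)) \<longleftrightarrow> integrable lborel (\<lambda>y. borel_rep \<Omega> (\<lambda>y. \<gamma> y vs) y * \<rho> (x - y))"
      by (rule lebesgue_on_lborel(1)[OF \<Omega>(1) _ _ _ eq]) (use r(2) in simp_all)
    then show ?thesis using conv_integrable[OF \<rho>(1) int[of vs], of x] by (simp add: mult.commute)
  qed
  show ?thesis
    unfolding smooth_form_def
  proof (intro conjI allI)
    show "smooth_on (\<lambda>x. conv_form \<rho> \<Omega> \<gamma> x vs) UNIV" for vs
      unfolding conv_form_def by (rule smooth_conv[OF \<rho>(1) int])
    fix x
    have zero: "conv_form \<rho> \<Omega> \<gamma> x vs = 0" if "\<And>y. y \<in> \<Omega> \<Longrightarrow> \<gamma> y vs = 0" for vs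
      unfolding val by (rule integral_eq_zero_AE) (auto intro!: AE_I2 simp: space_restrict_space that)
    show "conv_form \<rho> \<Omega> \<gamma> x \<in> alt_forms m"
    proof (rule alt_formsI)
      fix vs :: "'n rvec list"
      show "length vs \<noteq> m \<Longrightarrow> conv_form \<rho> \<Omega> \<gamma> x vs = 0" using alt_forms_length[OF \<gamma>(1)] by (intro zero) blast
      show "conv_form \<rho> \<Omega> \<gamma> x vs = 0" if "length vs = m" "i < j" "j < m" "vs ! i = vs ! j" for i j
        using alt_forms_eq[OF \<gamma>(1) that] by (intro zero) blast
      show "linear (\<lambda>v. conv_form \<rho> \<Omega> \<gamma> x (vs[i := v]))" if vs: "length vs = m" "i < m" for i
      proof (rule linearI)
        fix a b :: "'n rvec" and c :: real
        have lin: "linear (\<lambda>v. \<gamma> y (vs[i := v]))" if "y \<in> \<Omega>" for y by (rule alt_forms_linear[OF \<gamma>(1)[OF that] vs])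
        have "conv_form \<rho> \<Omega> \<gamma> x (vs[i := a + b]) = (LINT y|lebesgue_on \<Omega>. \<gamma> y (vs[i := a]) * \<rho> (x - y) + \<gamma> y (vs[i := b]) * \<rho> (x - y))"
          unfolding val using linear_add[OF lin]
          by (intro Bochner_Integration.integral_cong) (auto simp: space_restrict_space distrib_right)
        then show "conv_form \<rho> \<Omega> \<gamma> x (vs[i := a + b]) = conv_form \<rho> \<Omega> \<gamma> x (vs[i := a]) + conv_form \<rho> \<Omega> \<gamma> x (vs[i := b])"
          using i by (simp add: val)
        have "conv_form \<rho> \<Omega> \<gamma> x (vs[i := c *\<^sub>R a]) = (LINT y|lebesgue_on \<Omega>. c * (\<gamma> y (vs[i := a]) * \<rho> (x - y)))"
          unfolding val using linear_cmul[OF lin]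
          by (intro Bochner_Integration.integral_cong) (auto simp: space_restrict_space)
        then show "conv_form \<rho> \<Omega> \<gamma> x (vs[i := c *\<^sub>R a]) = c *\<^sub>R conv_form \<rho> \<Omega> \<gamma> x (vs[i := a])"
          by (simp add: val)
      qed
    qed
  qed
qed

section \<open>Smooth approximation of a weakly null sequence\<close>

lemma ext_comb_powr:
  fixes D :: "'n::{finite,linorder} rvec \<Rightarrow> 'n rvec form" and m :: nat and p :: real
  assumes p: "0 \<le> p"
  defines "C \<equiv> real (CARD('n set) * Suc m) powr p * real (CARD('n) * card (multi_indices m :: 'n list set)) powr p"
  shows "norm (form_vec (Suc m) (ext_comb m D)) powr p \<le> C * (\<Sum>j\<in>UNIV. \<Sum>ks\<in>multi_indices m. \<bar>D (axis j 1) (basis_list ks)\<bar> powr p)"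
proof -
  let ?I = "UNIV \<times> multi_indices m :: ('n \<times> 'n list) set"
  let ?a = "\<lambda>(j, ks). \<bar>D (axis j 1) (basis_list ks)\<bar>"
  have "norm (form_vec (Suc m) (ext_comb m D)) \<le> real (CARD('n set) * Suc m) * (\<Sum>i\<in>?I. ?a i)"
    using ext_comb_bound[of m D] by (simp add: sum.cartesian_product)
  then have "norm (form_vec (Suc m) (ext_comb m D)) powr p \<le> (real (CARD('n set) * Suc m) * (\<Sum>i\<in>?I. ?a i)) powr p"
    using p by (intro powr_mono2) auto
  also have "\<dots> = real (CARD('n set) * Suc m) powr p * (\<Sum>i\<in>?I. ?a i) powr p"
    by (intro powr_mult)
  also have "\<dots> \<le> real (CARD('n set) * Suc m) powr p * (real (card ?I) powr p * (\<Sum>i\<in>?I. ?a i powr p))"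
    using p by (intro mult_left_mono powr_sum_le) auto
  also have "(\<Sum>i\<in>?I. ?a i powr p) = (\<Sum>j\<in>UNIV. \<Sum>ks\<in>multi_indices m. \<bar>D (axis j 1) (basis_list ks)\<bar> powr p)"
    by (subst sum.cartesian_product) (simp add: case_prod_unfold)
  finally show ?thesis unfolding C_def by (simp add: card_cartesian_product mult.assoc)
qed

lemma ext_comb_diff:
  "form_vec (Suc m) (ext_comb m D) - form_vec (Suc m) (ext_comb m E) = form_vec (Suc m) (ext_comb m (\<lambda>v vs. D v vs - E v vs))"
  by (simp add: form_vec_def vec_eq_iff ext_comb_def sum_subtractf[symmetric] right_diff_distrib del: sum.lessThan_Suc)

lemma ext_deriv_measurable:
  fixes \<alpha> :: "'n::{finite,linorder} form_field"
  assumes "open \<Omega>" "\<alpha> \<in> W1p p \<Omega> m"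
  shows "(\<lambda>x. form_vec (Suc m) (ext_deriv \<Omega> m \<alpha> x)) \<in> borel_measurable (lebesgue_on \<Omega>)"
proof (rule borel_measurable_form_vec)
  fix js :: "'n list" assume js: "js \<in> multi_indices (Suc m)"
  have [measurable]: "(\<lambda>x. weak_deriv \<Omega> m (axis j 1) \<alpha> x vs) \<in> borel_measurable (lebesgue_on \<Omega>)" for j vs
    using W1p_weak_deriv(2)[OF assms, of j vs] by (simp add: Lp_def)
  show "(\<lambda>x. ext_deriv \<Omega> m \<alpha> x (basis_list js)) \<in> borel_measurable (lebesgue_on \<Omega>)"
    unfolding ext_deriv_eq ext_comb_basis[OF js] by measurable
qed

lemma ext_deriv_powr_integrable:
  fixes \<alpha> :: "'n::{finite,linorder} form_field" and m :: nat and p :: real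
  assumes \<Omega>: "open \<Omega>" and \<alpha>: "\<alpha> \<in> W1p p \<Omega> m" and p: "1 \<le> p"
  defines "C \<equiv> real (CARD('n set) * Suc m) powr p * real (CARD('n) * card (multi_indices m :: 'n list set)) powr p"
  shows "integrable (lebesgue_on \<Omega>) (\<lambda>x. norm (form_vec (Suc m) (ext_deriv \<Omega> m \<alpha> x)) powr p)"
    "(LINT x|lebesgue_on \<Omega>. norm (form_vec (Suc m) (ext_deriv \<Omega> m \<alpha> x)) powr p) \<le>
      C * (\<Sum>j\<in>UNIV. \<Sum>ks\<in>multi_indices m. (LINT x|lebesgue_on \<Omega>. \<bar>weak_deriv \<Omega> m (axis j 1) \<alpha> x (basis_list ks)\<bar> powr p))"
proof -
  note [measurable] = ext_deriv_measurable[OF \<Omega> \<alpha>]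
  let ?S = "\<lambda>x. C * (\<Sum>j\<in>UNIV. \<Sum>ks\<in>multi_indices m. \<bar>weak_deriv \<Omega> m (axis j 1) \<alpha> x (basis_list ks)\<bar> powr p)"
  have i0: "integrable (lebesgue_on \<Omega>) (\<lambda>x. \<bar>weak_deriv \<Omega> m (axis j 1) \<alpha> x vs\<bar> powr p)" for j vs
    using W1p_weak_deriv(2)[OF \<Omega> \<alpha>, of j vs] by (simp add: Lp_def)
  have i: "integrable (lebesgue_on \<Omega>) ?S" by (intro integrable_mult_right Bochner_Integration.integrable_sum i0)
  have le: "norm (form_vec (Suc m) (ext_deriv \<Omega> m \<alpha> x)) powr p \<le> ?S x" for x
    unfolding ext_deriv_eq C_def using p by (intro order_trans[OF ext_comb_powr]) (auto simp: sum_axis)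
  have S0: "0 \<le> ?S x" for x by (rule order_trans[OF _ le]) simp
  show j: "integrable (lebesgue_on \<Omega>) (\<lambda>x. norm (form_vec (Suc m) (ext_deriv \<Omega> m \<alpha> x)) powr p)"
  proof (rule Bochner_Integration.integrable_bound[OF i])
    show "AE x in lebesgue_on \<Omega>. norm (norm (form_vec (Suc m) (ext_deriv \<Omega> m \<alpha> x)) powr p) \<le> norm (?S x)"
      using le S0 by (intro AE_I2) (simp only: real_norm_def abs_of_nonneg powr_ge_zero)
  qed measurable
  have "(LINT x|lebesgue_on \<Omega>. norm (form_vec (Suc m) (ext_deriv \<Omega> m \<alpha> x)) powr p) \<le> (LINT x|lebesgue_on \<Omega>. ?S x)"
    by (intro integral_mono i j le)
  also have "\<dots> = C * (\<Sum>j\<in>UNIV. \<Sum>ks\<in>multi_indices m. (LINT x|lebesgue_on \<Omega>. \<bar>weak_deriv \<Omega> m (axis j 1) \<alpha> x (basis_list ks)\<bar> powr p))"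
    by (simp add: Bochner_Integration.integral_sum Bochner_Integration.integrable_sum i0)
  finally show "(LINT x|lebesgue_on \<Omega>. norm (form_vec (Suc m) (ext_deriv \<Omega> m \<alpha> x)) powr p) \<le>
      C * (\<Sum>j\<in>UNIV. \<Sum>ks\<in>multi_indices m. (LINT x|lebesgue_on \<Omega>. \<bar>weak_deriv \<Omega> m (axis j 1) \<alpha> x (basis_list ks)\<bar> powr p))" .
qed

lemma Lp_diff:
  assumes "u \<in> Lp p \<Omega>" "w \<in> Lp p \<Omega>" "0 \<le> p"
  shows "(\<lambda>x. u x - w x) \<in> Lp p \<Omega>"
    "(LINT x|lebesgue_on \<Omega>. \<bar>u x - w x\<bar> powr p) \<le> 2 powr p * ((LINT x|lebesgue_on \<Omega>. \<bar>u x\<bar> powr p) + (LINT x|lebesgue_on \<Omega>. \<bar>w x\<bar> powr p))"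
  using assms integrable_powr_add[of u "lebesgue_on \<Omega>" "\<lambda>x. - w x" p] by (auto simp: Lp_def)

text \<open>
  There are finitely many coordinates and partial derivatives, and each is bounded by
  \<open>weak_convergence_bounded\<close>.
\<close>
lemma weak_convergence_Lp_bounded:
  fixes \<Omega> :: "'n::{finite,linorder} rvec set"
  assumes \<Omega>: "open \<Omega>" and p: "1 < p" and w: "weakly_converges_W1p p \<Omega> m \<alpha>s \<alpha>"
  shows "\<exists>M\<ge>0. (\<forall>s. \<forall>ks\<in>multi_indices m. (LINT x|lebesgue_on \<Omega>. \<bar>\<alpha>s s x (basis_list ks)\<bar> powr p) \<le> M) \<and>
    (\<forall>s j. \<forall>ks\<in>multi_indices m. (LINT x|lebesgue_on \<Omega>. \<bar>weak_deriv \<Omega> m (axis j 1) (\<alpha>s s) x (basis_list ks)\<bar> powr p) \<le> M)"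
proof -
  define q where "q = p / (p - 1)"
  have pq: "1 < p" "1 < q" "1 / p + 1 / q = 1" using p by (auto simp: q_def field_simps)
  have \<Omega>l: "\<Omega> \<in> sets lebesgue" using \<Omega> by simp
  have "\<exists>M. \<forall>s. (LINT x|lebesgue_on \<Omega>. \<bar>\<alpha>s s x (basis_list ks)\<bar> powr p) \<le> M" if "ks \<in> multi_indices m" for ks
    using weak_convergence_bounded[OF \<Omega>l pq coordinate_op_value[OF \<Omega> _ that] w] p by simp
  then obtain M1 where M1: "\<And>ks s. ks \<in> multi_indices m \<Longrightarrow> (LINT x|lebesgue_on \<Omega>. \<bar>\<alpha>s s x (basis_list ks)\<bar> powr p) \<le> M1 ks" by metis
  have "\<exists>M. \<forall>s. (LINT x|lebesgue_on \<Omega>. \<bar>weak_deriv \<Omega> m (axis j 1) (\<alpha>s s) x (basis_list ks)\<bar> powr p) \<le> M" if "ks \<in> multi_indices m" for ks j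
    using weak_convergence_bounded[OF \<Omega>l pq coordinate_op_deriv[OF \<Omega> _ that, of p j] w] p by simp
  then obtain M2 where M2: "\<And>ks j s. ks \<in> multi_indices m \<Longrightarrow> (LINT x|lebesgue_on \<Omega>. \<bar>weak_deriv \<Omega> m (axis j 1) (\<alpha>s s) x (basis_list ks)\<bar> powr p) \<le> M2 ks j" by metis
  define M where "M = (\<Sum>ks\<in>multi_indices m. \<bar>M1 ks\<bar>) + (\<Sum>ks\<in>multi_indices m. \<Sum>j\<in>UNIV. \<bar>M2 ks j\<bar>)"
  have s1: "M1 ks \<le> M" if "ks \<in> multi_indices m" for ks
  proof -
    have "\<bar>M1 ks\<bar> \<le> (\<Sum>ks\<in>multi_indices m. \<bar>M1 ks\<bar>)" by (rule member_le_sum) (use that in auto)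
    moreover have "0 \<le> (\<Sum>ks\<in>multi_indices m. \<Sum>j\<in>UNIV. \<bar>M2 ks j\<bar>)" by (intro sum_nonneg) auto
    ultimately show ?thesis unfolding M_def by linarith
  qed
  have s2: "M2 ks j \<le> M" if "ks \<in> multi_indices m" for ks j
  proof -
    have "\<bar>M2 ks j\<bar> \<le> (\<Sum>j\<in>UNIV. \<bar>M2 ks j\<bar>)" by (rule member_le_sum) auto
    also have "\<dots> \<le> (\<Sum>ks\<in>multi_indices m. \<Sum>j\<in>UNIV. \<bar>M2 ks j\<bar>)"
      by (rule member_le_sum[of ks "multi_indices m" "\<lambda>ks. \<Sum>j\<in>UNIV. \<bar>M2 ks j\<bar>"]) (use that in \<open>auto intro: sum_nonneg\<close>)
    finally have "\<bar>M2 ks j\<bar> \<le> (\<Sum>ks\<in>multi_indices m. \<Sum>j\<in>UNIV. \<bar>M2 ks j\<bar>)" .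
    moreover have "0 \<le> (\<Sum>ks\<in>multi_indices m. \<bar>M1 ks\<bar>)" by (intro sum_nonneg) auto
    ultimately show ?thesis unfolding M_def by linarith
  qed
  have "M \<ge> 0" unfolding M_def by (intro add_nonneg_nonneg sum_nonneg) auto
  moreover have "(LINT x|lebesgue_on \<Omega>. \<bar>\<alpha>s s x (basis_list ks)\<bar> powr p) \<le> M" if "ks \<in> multi_indices m" for s ks
    using order_trans[OF M1[OF that] s1[OF that]] .
  moreover have "(LINT x|lebesgue_on \<Omega>. \<bar>weak_deriv \<Omega> m (axis j 1) (\<alpha>s s) x (basis_list ks)\<bar> powr p) \<le> M" if "ks \<in> multi_indices m" for s j ks
    using order_trans[OF M2[OF that] s2[OF that]] .
  ultimately show ?thesis by blast
qed

text \<open>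
  For each \<open>s\<close> there are finitely many functions to approximate, so some mollifier brings all
  errors below \<open>1 / (s + 1)\<close>.
\<close>
lemma mollifier_sequence:
  fixes g :: "nat \<Rightarrow> 'i \<Rightarrow> 'a::euclidean_space \<Rightarrow> real"
  assumes p: "1 \<le> p" and I: "finite I" and g: "\<And>s i. i \<in> I \<Longrightarrow> Lp_bounded_support p (g s i)" and r: "r > 0"
  shows "\<exists>e \<rho>. (\<forall>s. 0 < e s \<and> e s \<le> r \<and> mollifier (e s) (\<rho> s)) \<and>
    (\<forall>i\<in>I. (\<lambda>s. LINT x|lborel. \<bar>conv (\<rho> s) (g s i) x - g s i x\<bar> powr p) \<longlonglongrightarrow> 0)"
proof -
  have "\<exists>e \<rho>. 0 < e \<and> e \<le> r \<and> mollifier e \<rho> \<and> (\<forall>i\<in>I. (LINT x|lborel. \<bar>conv \<rho> (g s i) x - g s i x\<bar> powr p) < inverse (real (Suc s)))" for s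
  proof -
    have "\<forall>i\<in>I. \<exists>\<epsilon>0>0. \<forall>\<epsilon> \<rho>. \<epsilon> < \<epsilon>0 \<longrightarrow> mollifier \<epsilon> \<rho> \<longrightarrow> (LINT x|lborel. \<bar>conv \<rho> (g s i) x - g s i x\<bar> powr p) < inverse (real (Suc s))"
      by (intro ballI conv_Lp_approx g p) auto
    from bchoice[OF this] obtain d where d: "\<forall>i\<in>I. 0 < d i \<and> (\<forall>\<epsilon> \<rho>. \<epsilon> < d i \<longrightarrow> mollifier \<epsilon> \<rho> \<longrightarrow> (LINT x|lborel. \<bar>conv \<rho> (g s i) x - g s i x\<bar> powr p) < inverse (real (Suc s)))" ..
    define e where "e = Min (insert r (d ` I)) / 2"
    have pos: "Min (insert r (d ` I)) > 0" using d r I by (subst Min_gr_iff) auto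
    have e: "e > 0" using pos by (simp add: e_def)
    have "Min (insert r (d ` I)) \<le> r" using I by (intro Min_le) auto
    then have er: "e \<le> r" using pos by (simp add: e_def)
    have ed: "e < d i" if "i \<in> I" for i
    proof -
      have "Min (insert r (d ` I)) \<le> d i" using I that by (intro Min_le) auto
      then show ?thesis using pos by (simp add: e_def)
    qed
    obtain \<rho> :: "'a \<Rightarrow> real" where "mollifier e \<rho>" using mollifier_exists[OF e] by blast
    then show ?thesis using d e er ed by blast
  qed
  then have "\<forall>s. \<exists>p'. 0 < fst p' \<and> fst p' \<le> r \<and> mollifier (fst p') (snd p') \<and> (\<forall>i\<in>I. (LINT x|lborel. \<bar>conv (snd p') (g s i) x - g s i x\<bar> powr p) < inverse (real (Suc s)))"
    by simp
  from choice[OF this] obtain P where P: "\<forall>s. 0 < fst (P s) \<and> fst (P s) \<le> r \<and> mollifier (fst (P s)) (snd (P s)) \<and> (\<forall>i\<in>I. (LINT x|lborel. \<bar>conv (snd (P s)) (g s i) x - g s i x\<bar> powr p) < inverse (real (Suc s)))" ..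
  have "(\<lambda>s. LINT x|lborel. \<bar>conv (snd (P s)) (g s i) x - g s i x\<bar> powr p) \<longlonglongrightarrow> 0" if "i \<in> I" for i
  proof (rule tendsto_sandwich[OF _ _ tendsto_const LIMSEQ_inverse_real_of_nat])
    show "\<forall>\<^sub>F s in sequentially. 0 \<le> (LINT x|lborel. \<bar>conv (snd (P s)) (g s i) x - g s i x\<bar> powr p)"
      by (intro always_eventually allI integral_nonneg_AE) simp
    show "\<forall>\<^sub>F s in sequentially. (LINT x|lborel. \<bar>conv (snd (P s)) (g s i) x - g s i x\<bar> powr p) \<le> inverse (real (Suc s))"
      using P that by (intro always_eventually allI less_imp_le) blast
  qed
  then show ?thesis using P by (intro exI[of _ "\<lambda>s. fst (P s)"] exI[of _ "\<lambda>s. snd (P s)"]) blast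
qed

text \<open>
  Mollify \<open>\<alpha>\<^sub>s - \<alpha>\<close> with radii so small that the errors of all coordinates and all weak derivatives
  tend to zero in \<open>L\<^sup>p\<close>. Then \<open>w s \<rightarrow> 0\<close> by local compactness, and as mollification commutes with
  differentiation in \<open>U\<close>, the classical exterior derivative of \<open>w s\<close> approximates \<open>d\<alpha>\<^sub>s - d\<alpha>\<close>.
\<close>
lemma smooth_approximation:
  fixes \<Omega> U :: "'n::{finite,linorder} rvec set"
  assumes \<Omega>: "open \<Omega>" "bounded \<Omega>" and p: "1 < p" and U: "open U" "bounded U" and r: "r > 0" "\<And>x. x \<in> U \<Longrightarrow> cball x r \<subseteq> \<Omega>"
    and wk: "weakly_converges_W1p p \<Omega> m \<alpha>s \<alpha>"
  shows "\<exists>w. (\<forall>s. smooth_form m (w s)) \<and>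
    (\<lambda>s. LINT x|lebesgue_on U. norm (form_vec m (w s x)) powr p) \<longlonglongrightarrow> 0 \<and>
    (\<lambda>s. LINT x|lebesgue_on U. norm (form_vec (Suc m) (cext m (w s) x) -
      (form_vec (Suc m) (ext_deriv \<Omega> m (\<alpha>s s) x) - form_vec (Suc m) (ext_deriv \<Omega> m \<alpha> x))) powr p) \<longlonglongrightarrow> 0"
proof -
  have p1: "1 \<le> p" using p by simp
  define q where "q = p / (p - 1)"
  have pq: "1 < p" "1 < q" "1 / p + 1 / q = 1" using p by (auto simp: q_def field_simps)
  have \<Omega>l: "\<Omega> \<in> sets lebesgue" using \<Omega> by simp
  have \<alpha>s: "\<alpha>s s \<in> W1p p \<Omega> m" for s using wk by (simp add: weakly_converges_W1p_def)
  have \<alpha>: "\<alpha> \<in> W1p p \<Omega> m" using wk by (simp add: weakly_converges_W1p_def)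
  define \<gamma> where "\<gamma> s x vs = \<alpha>s s x vs - \<alpha> x vs" for s x vs
  define \<beta> where "\<beta> s j x vs = weak_deriv \<Omega> m (axis j 1) (\<alpha>s s) x vs - weak_deriv \<Omega> m (axis j 1) \<alpha> x vs" for s j x vs
  have \<gamma>L: "(\<lambda>x. \<gamma> s x vs) \<in> Lp p \<Omega>" for s vs unfolding \<gamma>_def using p by (intro Lp_diff(1) W1pD(2)[OF \<alpha>s] W1pD(2)[OF \<alpha>]) auto
  have \<beta>L: "(\<lambda>x. \<beta> s j x vs) \<in> Lp p \<Omega>" for s j vs
    unfolding \<beta>_def using p by (intro Lp_diff(1) W1p_weak_deriv(2)[OF \<Omega>(1) \<alpha>s] W1p_weak_deriv(2)[OF \<Omega>(1) \<alpha>]) auto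
  have \<gamma>alt: "\<gamma> s x \<in> alt_forms m" if "x \<in> \<Omega>" for s x
    using alt_forms_diff[OF W1pD(1)[OF \<alpha>s that] W1pD(1)[OF \<alpha> that]] by (simp add: form_diff_def \<gamma>_def[abs_def])
  have wd: "has_weak_deriv \<Omega> (axis j 1) (\<lambda>x. \<gamma> s x vs) (\<lambda>x. \<beta> s j x vs)" for s j vs
    using has_weak_deriv_form_lin[OF \<Omega>(1) W1p_weak_deriv(1)[OF \<Omega>(1) \<alpha>s[of s], of j] W1p_weak_deriv(1)[OF \<Omega>(1) \<alpha>], where a=1 and b="-1"]
    by (simp add: has_weak_deriv_form_def \<gamma>_def \<beta>_def)
  obtain M where M: "M \<ge> 0" "\<And>s ks. ks \<in> multi_indices m \<Longrightarrow> (LINT x|lebesgue_on \<Omega>. \<bar>\<alpha>s s x (basis_list ks)\<bar> powr p) \<le> M"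
    "\<And>s j ks. ks \<in> multi_indices m \<Longrightarrow> (LINT x|lebesgue_on \<Omega>. \<bar>weak_deriv \<Omega> m (axis j 1) (\<alpha>s s) x (basis_list ks)\<bar> powr p) \<le> M"
    using weak_convergence_Lp_bounded[OF \<Omega>(1) p wk] by blast
  \<comment> \<open>The coordinates and the weak derivatives are collected in one finite family, since they need a
    common mollifier.\<close>
  let ?I = "Inl ` (multi_indices m :: 'n list set) \<union> Inr ` (UNIV \<times> (multi_indices m :: 'n list set)) :: ('n list + 'n \<times> 'n list) set"
  define G where "G s i = (case i of Inl ks \<Rightarrow> borel_rep \<Omega> (\<lambda>x. \<gamma> s x (basis_list ks)) | Inr (j, ks) \<Rightarrow> borel_rep \<Omega> (\<lambda>x. \<beta> s j x (basis_list ks)))" for s and i :: "'n list + 'n \<times> 'n list"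
  have GL: "Lp_bounded_support p (G s i)" if "i \<in> ?I" for s i
    unfolding G_def using borel_rep_Lp(1)[OF \<Omega> \<gamma>L] borel_rep_Lp(1)[OF \<Omega> \<beta>L] by (auto split: sum.split)
  have "\<exists>e \<rho>. (\<forall>s. 0 < e s \<and> e s \<le> r / 2 \<and> mollifier (e s) (\<rho> s)) \<and>
      (\<forall>i\<in>?I. (\<lambda>s. LINT x|lborel. \<bar>conv (\<rho> s) (G s i) x - G s i x\<bar> powr p) \<longlonglongrightarrow> 0)"
    by (rule mollifier_sequence[OF p1 _ GL]) (use r(1) in auto)
  then obtain e \<rho> where er: "\<forall>s. 0 < e s \<and> e s \<le> r / 2 \<and> mollifier (e s) (\<rho> s)"
    and conv0': "\<forall>i\<in>?I. (\<lambda>s. LINT x|lborel. \<bar>conv (\<rho> s) (G s i) x - G s i x\<bar> powr p) \<longlonglongrightarrow> 0" by (elim exE conjE)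
  note conv0 = bspec[OF conv0']
  have e: "0 < e s" "e s \<le> r / 2" "mollifier (e s) (\<rho> s)" for s using er by simp_all
  have conv\<gamma>: "(\<lambda>s. LINT x|lborel. \<bar>conv (\<rho> s) (borel_rep \<Omega> (\<lambda>x. \<gamma> s x (basis_list ks))) x - borel_rep \<Omega> (\<lambda>x. \<gamma> s x (basis_list ks)) x\<bar> powr p) \<longlonglongrightarrow> 0"
    if "ks \<in> multi_indices m" for ks
    using conv0[of "Inl ks"] that by (simp add: G_def)
  have conv\<beta>: "(\<lambda>s. LINT x|lborel. \<bar>conv (\<rho> s) (borel_rep \<Omega> (\<lambda>x. \<beta> s j x (basis_list ks))) x - borel_rep \<Omega> (\<lambda>x. \<beta> s j x (basis_list ks)) x\<bar> powr p) \<longlonglongrightarrow> 0"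
    if "ks \<in> multi_indices m" for j ks
    using conv0[of "Inr (j, ks)"] that by (simp add: G_def)
  define w where "w s = conv_form (\<rho> s) \<Omega> (\<gamma> s)" for s
  have ws: "smooth_form m (w s)" for s unfolding w_def by (rule smooth_conv_form[OF \<Omega> p1 \<gamma>alt \<gamma>L e(3)])
  have UO: "U \<subseteq> \<Omega>" using r by (meson centre_in_cball less_imp_le subsetD subsetI)
  have w0: "(\<lambda>s. LINT x|lebesgue_on U. \<bar>w s x (basis_list ks)\<bar> powr p) \<longlonglongrightarrow> 0" if ks: "ks \<in> multi_indices m" for ks
    unfolding w_def conv_form_def
  proof (rule local_compactness[OF \<Omega> p1 U r, where g="\<lambda>s j x. \<beta> s j x (basis_list ks)" and e=e])
    define M' where "M' = 2 powr p * (M + (LINT x|lebesgue_on \<Omega>. \<bar>\<alpha> x (basis_list ks)\<bar> powr p) + (\<Sum>j\<in>UNIV. (LINT x|lebesgue_on \<Omega>. \<bar>weak_deriv \<Omega> m (axis j 1) \<alpha> x (basis_list ks)\<bar> powr p)))"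
    have n0: "0 \<le> (LINT x|lebesgue_on \<Omega>. \<bar>h x\<bar> powr p)" for h :: "'n rvec \<Rightarrow> real" by (rule integral_nonneg_AE) simp
    show "(LINT x|lebesgue_on \<Omega>. \<bar>\<gamma> s x (basis_list ks)\<bar> powr p) \<le> M'" for s
    proof -
      have "(LINT x|lebesgue_on \<Omega>. \<bar>\<gamma> s x (basis_list ks)\<bar> powr p) \<le> 2 powr p * ((LINT x|lebesgue_on \<Omega>. \<bar>\<alpha>s s x (basis_list ks)\<bar> powr p) + (LINT x|lebesgue_on \<Omega>. \<bar>\<alpha> x (basis_list ks)\<bar> powr p))"
        unfolding \<gamma>_def using p by (intro Lp_diff(2) W1pD(2)[OF \<alpha>s] W1pD(2)[OF \<alpha>]) auto
      also have "\<dots> \<le> M'" unfolding M'_def using M(2)[OF ks, of s] by (intro mult_left_mono) (auto intro!: add_mono add_increasing2 sum_nonneg n0)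
      finally show ?thesis .
    qed
    show "(LINT x|lebesgue_on \<Omega>. \<bar>\<beta> s j x (basis_list ks)\<bar> powr p) \<le> M'" for s j
    proof -
      have "(LINT x|lebesgue_on \<Omega>. \<bar>\<beta> s j x (basis_list ks)\<bar> powr p) \<le> 2 powr p * ((LINT x|lebesgue_on \<Omega>. \<bar>weak_deriv \<Omega> m (axis j 1) (\<alpha>s s) x (basis_list ks)\<bar> powr p) + (LINT x|lebesgue_on \<Omega>. \<bar>weak_deriv \<Omega> m (axis j 1) \<alpha> x (basis_list ks)\<bar> powr p))"
        unfolding \<beta>_def using p by (intro Lp_diff(2) W1p_weak_deriv(2)[OF \<Omega>(1) \<alpha>s] W1p_weak_deriv(2)[OF \<Omega>(1) \<alpha>]) auto
      also have "\<dots> \<le> M'"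
      proof -
        have "(LINT x|lebesgue_on \<Omega>. \<bar>weak_deriv \<Omega> m (axis j 1) \<alpha> x (basis_list ks)\<bar> powr p) \<le> (\<Sum>j\<in>UNIV. (LINT x|lebesgue_on \<Omega>. \<bar>weak_deriv \<Omega> m (axis j 1) \<alpha> x (basis_list ks)\<bar> powr p))"
          by (rule member_le_sum[of j UNIV "\<lambda>j. LINT x|lebesgue_on \<Omega>. \<bar>weak_deriv \<Omega> m (axis j 1) \<alpha> x (basis_list ks)\<bar> powr p"]) (auto intro: n0)
        then show ?thesis unfolding M'_def using M(3)[OF ks, of j s] n0[of "\<lambda>x. \<alpha> x (basis_list ks)"] by (intro mult_left_mono) (linarith | simp)+
      qed
      finally show ?thesis .
    qed
    show "(\<lambda>s. LINT x|lebesgue_on \<Omega>. \<gamma> s x (basis_list ks) * h x) \<longlonglongrightarrow> 0" if h: "h \<in> test_functions UNIV" for h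
    proof -
      obtain B where B: "\<And>x. \<bar>h x\<bar> \<le> B" using test_functions_bounded[OF h] by blast
      have hm: "h \<in> borel_measurable (lebesgue_on \<Omega>)" by (rule borel_measurable_lebesgue_on[OF test_functions_measurable[OF h]])
      have hq: "integrable (lebesgue_on \<Omega>) (\<lambda>x. \<bar>h x\<bar> powr q)"
        by (rule integrable_lebesgue_on_bounded[OF \<Omega>, of _ "B powr q"]) (use hm B pq in \<open>auto intro!: powr_mono2\<close>)
      have hp: "integrable (lebesgue_on \<Omega>) (\<lambda>x. h x * u x)" if "u \<in> Lp p \<Omega>" for u
        using holder_inequality(1)[OF pq, of u "lebesgue_on \<Omega>" h] that hm hq by (simp add: Lp_def)
      have "(\<lambda>s. LINT x|lebesgue_on \<Omega>. h x * \<alpha>s s x (basis_list ks)) \<longlonglongrightarrow> (LINT x|lebesgue_on \<Omega>. h x * \<alpha> x (basis_list ks))"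
        by (rule weak_convergence_tested[OF \<Omega>l pq coordinate_op_value[OF \<Omega>(1) p1 ks] wk hm hq])
      then have "(\<lambda>s. (LINT x|lebesgue_on \<Omega>. h x * \<alpha>s s x (basis_list ks)) - (LINT x|lebesgue_on \<Omega>. h x * \<alpha> x (basis_list ks))) \<longlonglongrightarrow> 0"
        by (rule LIM_zero)
      moreover have "(LINT x|lebesgue_on \<Omega>. h x * \<alpha>s s x (basis_list ks)) - (LINT x|lebesgue_on \<Omega>. h x * \<alpha> x (basis_list ks)) = (LINT x|lebesgue_on \<Omega>. \<gamma> s x (basis_list ks) * h x)" for s
        using hp[OF W1pD(2)[OF \<alpha>s]] hp[OF W1pD(2)[OF \<alpha>]] by (simp add: \<gamma>_def algebra_simps)
      ultimately show ?thesis by simp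
    qed
  qed (use \<gamma>L \<beta>L wd e conv\<gamma>[OF ks] in auto)
  have W: "(\<lambda>s. LINT x|lebesgue_on U. norm (form_vec m (w s x)) powr p) \<longlonglongrightarrow> 0"
  proof (rule tendsto_sandwich[OF _ _ tendsto_const])
    show "\<forall>\<^sub>F s in sequentially. 0 \<le> (LINT x|lebesgue_on U. norm (form_vec m (w s x)) powr p)"
      by (intro always_eventually allI integral_nonneg_AE) simp
    let ?b = "\<lambda>s. real (card (multi_indices m :: 'n list set)) powr p * (\<Sum>ks\<in>multi_indices m. (LINT x|lebesgue_on U. \<bar>w s x (basis_list ks)\<bar> powr p))"
    have cont: "continuous_on UNIV (\<lambda>x. w s x vs)" for s vs by (rule smooth_continuous[OF smooth_formD(2)[OF ws]])
    have "(LINT x|lebesgue_on U. norm (form_vec m (w s x)) powr p) \<le> ?b s" for s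
    proof (rule form_norm_powr_integrable(2))
      show "integrable (lebesgue_on U) (\<lambda>x. \<bar>w s x (basis_list ks)\<bar> powr p)" for ks
        by (intro integrable_lebesgue_on_continuous[OF U] continuous_on_powr' continuous_intros cont) (use p in auto)
    qed (use p cont in \<open>auto intro!: borel_measurable_lebesgue_on borel_measurable_continuous_onI\<close>)
    then show "\<forall>\<^sub>F s in sequentially. (LINT x|lebesgue_on U. norm (form_vec m (w s x)) powr p) \<le> ?b s" by simp
    have "?b \<longlonglongrightarrow> real (card (multi_indices m :: 'n list set)) powr p * (\<Sum>ks\<in>(multi_indices m :: 'n list set). 0)"
      by (intro tendsto_intros tendsto_sum w0)
    then show "?b \<longlonglongrightarrow> 0" by simp
  qed
  have T: "(\<lambda>s. LINT x|lebesgue_on U. norm (form_vec (Suc m) (cext m (w s) x) -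
      (form_vec (Suc m) (ext_deriv \<Omega> m (\<alpha>s s) x) - form_vec (Suc m) (ext_deriv \<Omega> m \<alpha> x))) powr p) \<longlonglongrightarrow> 0"
  proof (rule tendsto_sandwich[OF _ _ tendsto_const])
    let ?T = "\<lambda>s x. norm (form_vec (Suc m) (cext m (w s) x) - (form_vec (Suc m) (ext_deriv \<Omega> m (\<alpha>s s) x) - form_vec (Suc m) (ext_deriv \<Omega> m \<alpha> x))) powr p"
    show "\<forall>\<^sub>F s in sequentially. 0 \<le> (LINT x|lebesgue_on U. ?T s x)"
      by (intro always_eventually allI integral_nonneg_AE) simp
    define C where "C = real (CARD('n set) * Suc m) powr p * real (CARD('n) * card (multi_indices m :: 'n list set)) powr p"
    let ?c = "\<lambda>s j ks x. \<bar>conv (\<rho> s) (borel_rep \<Omega> (\<lambda>x. \<beta> s j x (basis_list ks))) x - borel_rep \<Omega> (\<lambda>x. \<beta> s j x (basis_list ks)) x\<bar> powr p"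
    let ?b = "\<lambda>s. C * (\<Sum>j\<in>UNIV. \<Sum>ks\<in>multi_indices m. (LINT x|lborel. ?c s j ks x))"
    have "(LINT x|lebesgue_on U. ?T s x) \<le> ?b s" for s
    proof -
      have cL: "integrable lborel (?c s j ks)" for j ks
        by (rule Lp_bounded_supportD(2)[OF Lp_bounded_support_diff[OF conv_Lp_bound(1)[OF e(3) borel_rep_Lp(1)[OF \<Omega> \<beta>L] p1] borel_rep_Lp(1)[OF \<Omega> \<beta>L] p1] p1])
      have cU: "integrable (lebesgue_on U) (?c s j ks)" "(LINT x|lebesgue_on U. ?c s j ks x) \<le> (LINT x|lborel. ?c s j ks x)" for j ks
        by (rule lebesgue_on_le_lborel[OF U(1) cL]; simp)+
      have ae1: "AE x in lebesgue_on \<Omega>. \<forall>j. \<forall>ks\<in>multi_indices m. \<beta> s j x (basis_list ks) = borel_rep \<Omega> (\<lambda>x. \<beta> s j x (basis_list ks)) x"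
      proof -
        have "AE x in lebesgue_on \<Omega>. \<beta> s j x (basis_list ks) = borel_rep \<Omega> (\<lambda>x. \<beta> s j x (basis_list ks)) x" for j ks
          using borel_rep(3)[OF \<Omega>(1), of "\<lambda>x. \<beta> s j x (basis_list ks)"] \<beta>L[of s j "basis_list ks"] by (simp add: Lp_def)
        then have "AE x in lebesgue_on \<Omega>. \<forall>ks\<in>multi_indices m. \<beta> s j x (basis_list ks) = borel_rep \<Omega> (\<lambda>x. \<beta> s j x (basis_list ks)) x" for j
          by (intro AE_finite_allI) auto
        then have "AE x in lebesgue_on \<Omega>. \<forall>j\<in>UNIV. \<forall>ks\<in>multi_indices m. \<beta> s j x (basis_list ks) = borel_rep \<Omega> (\<lambda>x. \<beta> s j x (basis_list ks)) x"
          by (rule AE_finite_allI[OF finite])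
        then show ?thesis by simp
      qed
      have "AE x in lebesgue. x \<in> \<Omega> \<longrightarrow> (\<forall>j. \<forall>ks\<in>multi_indices m. \<beta> s j x (basis_list ks) = borel_rep \<Omega> (\<lambda>x. \<beta> s j x (basis_list ks)) x)"
        using ae1 \<Omega>l by (subst (asm) AE_restrict_space_iff) auto
      then have ae2: "AE x in lebesgue_on U. \<forall>j. \<forall>ks\<in>multi_indices m. \<beta> s j x (basis_list ks) = borel_rep \<Omega> (\<lambda>x. \<beta> s j x (basis_list ks)) x"
        using U by (subst AE_restrict_space_iff) (auto elim!: eventually_mono intro: subsetD[OF UO])
      have aeU: "AE x in lebesgue_on U. x \<in> U" using AE_space[of "lebesgue_on U"] by (simp add: space_restrict_space)
      have ae: "AE x in lebesgue_on U. ?T s x \<le> C * (\<Sum>j\<in>UNIV. \<Sum>ks\<in>multi_indices m. ?c s j ks x)"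
        using ae2 aeU
      proof eventually_elim
        case (elim x)
        have cb: "cball x (e s) \<subseteq> \<Omega>"
        proof -
          have "e s \<le> r" using e(2)[of s] r(1) by simp
          then have "cball x (e s) \<subseteq> cball x r" by (rule subset_cball)
          then show ?thesis using r(2)[OF elim(2)] by blast
        qed
        have "form_vec (Suc m) (ext_deriv \<Omega> m (\<alpha>s s) x) - form_vec (Suc m) (ext_deriv \<Omega> m \<alpha> x) = form_vec (Suc m) (ext_comb m (\<lambda>v vs. \<Sum>j\<in>UNIV. v $ j * \<beta> s j x vs))"
          unfolding ext_deriv_eq ext_comb_diff by (simp add: \<beta>_def sum_subtractf[symmetric] right_diff_distrib)
        then have "form_vec (Suc m) (cext m (w s) x) - (form_vec (Suc m) (ext_deriv \<Omega> m (\<alpha>s s) x) - form_vec (Suc m) (ext_deriv \<Omega> m \<alpha> x)) =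
          form_vec (Suc m) (ext_comb m (\<lambda>v vs. frechet_derivative (\<lambda>y. w s y vs) (at x) v - (\<Sum>j\<in>UNIV. v $ j * \<beta> s j x vs)))"
          unfolding cext_def by (simp add: ext_comb_diff)
        then have "?T s x \<le> C * (\<Sum>j\<in>UNIV. \<Sum>ks\<in>multi_indices m. \<bar>frechet_derivative (\<lambda>y. w s y (basis_list ks)) (at x) (axis j 1) - (\<Sum>i\<in>UNIV. axis j 1 $ i * \<beta> s i x (basis_list ks))\<bar> powr p)"
          unfolding C_def using p by (simp only:) (intro ext_comb_powr, simp)
        also have "\<dots> = C * (\<Sum>j\<in>UNIV. \<Sum>ks\<in>multi_indices m. ?c s j ks x)"
        proof -
          have "frechet_derivative (\<lambda>y. w s y (basis_list ks)) (at x) (axis j 1) = conv (\<rho> s) (borel_rep \<Omega> (\<lambda>x. \<beta> s j x (basis_list ks))) x" for j ks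
            unfolding w_def conv_form_def by (rule frechet_conv_weak_deriv[OF \<Omega> p1 \<gamma>L \<beta>L wd e(3) cb])
          then show ?thesis using elim(1) by (simp add: sum_axis)
        qed
        finally show ?case .
      qed
      have iS: "integrable (lebesgue_on U) (\<lambda>x. C * (\<Sum>j\<in>UNIV. \<Sum>ks\<in>multi_indices m. ?c s j ks x))"
        by (intro integrable_mult_right Bochner_Integration.integrable_sum cU)
      have "(LINT x|lebesgue_on U. ?T s x) \<le> (LINT x|lebesgue_on U. C * (\<Sum>j\<in>UNIV. \<Sum>ks\<in>multi_indices m. ?c s j ks x))"
        by (rule integral_mono_AE'[OF iS ae]) (auto intro!: AE_I2 mult_nonneg_nonneg sum_nonneg simp: C_def)
      also have "\<dots> = C * (\<Sum>j\<in>UNIV. \<Sum>ks\<in>multi_indices m. (LINT x|lebesgue_on U. ?c s j ks x))"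
        by (simp add: Bochner_Integration.integral_sum Bochner_Integration.integrable_sum cU(1))
      also have "\<dots> \<le> ?b s" unfolding C_def by (intro mult_left_mono sum_mono cU(2)) auto
      finally show ?thesis .
    qed
    then show "\<forall>\<^sub>F s in sequentially. (LINT x|lebesgue_on U. ?T s x) \<le> ?b s" by simp
    have "?b \<longlonglongrightarrow> C * (\<Sum>j\<in>(UNIV::'n set). \<Sum>ks\<in>(multi_indices m :: 'n list set). 0)"
      by (intro tendsto_intros tendsto_sum conv\<beta>)
    then show "?b \<longlonglongrightarrow> 0" by simp
  qed
  show ?thesis using ws W T by blast
qed

section \<open>Piecewise constant approximation\<close>

lemma lebesgue_on_subset_integral:
  fixes g :: "'a::euclidean_space \<Rightarrow> real"
  assumes \<Omega>: "open \<Omega>" and U: "open U" "U \<subseteq> \<Omega>" and g: "integrable (lebesgue_on \<Omega>) g"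
  shows "integrable (lebesgue_on U) g" "integrable (lebesgue_on \<Omega>) (\<lambda>x. indicator U x * g x)"
    "(LINT x|lebesgue_on U. g x) = (LINT x|lebesgue_on \<Omega>. indicator U x * g x)"
proof -
  have Us: "U \<in> sets (lebesgue_on \<Omega>)" using \<Omega> U by (auto simp: sets_restrict_space_iff)
  show i: "integrable (lebesgue_on \<Omega>) (\<lambda>x. indicator U x * g x)"
    using integrable_mult_indicator[OF Us g] by simp
  have gl: "integrable lebesgue (\<lambda>x. indicator \<Omega> x * g x)" using g \<Omega> by (subst (asm) integrable_restrict_space) auto
  have e: "indicator U x * (indicator \<Omega> x * g x) = indicator U x * g x" for x using U(2) by (auto simp: indicator_def)
  have gu: "integrable lebesgue (\<lambda>x. indicator U x * g x)"
    using integrable_mult_indicator[OF _ gl, of U] U by (simp add: e del: of_bool_eq_iff)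
  show "integrable (lebesgue_on U) g" using gu U by (subst integrable_restrict_space) auto
  have "(LINT x|lebesgue_on \<Omega>. indicator U x * g x) = (LINT x|lebesgue. indicator \<Omega> x * (indicator U x * g x))"
    using \<Omega> by (subst integral_restrict_space) auto
  also have "\<dots> = (LINT x|lebesgue. indicator U x * g x)"
    by (rule Bochner_Integration.integral_cong) (use U(2) in \<open>auto simp: indicator_def\<close>)
  also have "\<dots> = (LINT x|lebesgue_on U. g x)" using U by (subst integral_restrict_space) auto
  finally show "(LINT x|lebesgue_on U. g x) = (LINT x|lebesgue_on \<Omega>. indicator U x * g x)" by simp
qed

lemma sum_disjoint_integral:
  fixes g :: "'a::euclidean_space \<Rightarrow> real" and n :: nat
  assumes \<Omega>: "open \<Omega>" and U: "\<And>i. i < n \<Longrightarrow> open (U i)" "\<And>i. i < n \<Longrightarrow> U i \<subseteq> \<Omega>"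
    and disj: "\<And>i j. i < n \<Longrightarrow> j < n \<Longrightarrow> i \<noteq> j \<Longrightarrow> U i \<inter> U j = {}" and g: "integrable (lebesgue_on \<Omega>) g"
  shows "(\<Sum>i<n. (LINT x|lebesgue_on (U i). g x)) = (LINT x|lebesgue_on \<Omega>. indicator (\<Union>i<n. U i) x * g x)"
proof -
  have "(\<Sum>i<n. (LINT x|lebesgue_on (U i). g x)) = (\<Sum>i<n. (LINT x|lebesgue_on \<Omega>. indicator (U i) x * g x))"
    using lebesgue_on_subset_integral(3)[OF \<Omega> U g] by (intro sum.cong) auto
  also have "\<dots> = (LINT x|lebesgue_on \<Omega>. (\<Sum>i<n. indicator (U i) x * g x))"
    using lebesgue_on_subset_integral(2)[OF \<Omega> U g] by (intro Bochner_Integration.integral_sum[symmetric]) auto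
  also have "\<dots> = (LINT x|lebesgue_on \<Omega>. indicator (\<Union>i<n. U i) x * g x)"
  proof (rule Bochner_Integration.integral_cong[OF refl])
    fix x
    have d: "disjoint_family_on U {..<n}" using disj by (auto simp: disjoint_family_on_def)
    show "(\<Sum>i<n. indicator (U i) x * g x) = indicator (\<Union>i<n. U i) x * g x"
      by (simp only: sum_distrib_right[symmetric] indicator_UN_disjoint[OF finite_lessThan d])
  qed
  finally show ?thesis .
qed

lemma indicator_powr_tail:
  fixes F :: "'a::euclidean_space \<Rightarrow> 'b::euclidean_space"
  assumes \<Omega>: "open \<Omega>" "bounded \<Omega>" and [measurable]: "F \<in> borel_measurable (lebesgue_on \<Omega>)"
    and F: "integrable (lebesgue_on \<Omega>) (\<lambda>x. norm (F x) powr p)" and \<tau>: "\<tau> > 0"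
  shows "\<exists>R>0. (LINT x|lebesgue_on \<Omega>. indicator {x. norm (F x) > R} x * (1 + norm (F x) powr p)) < \<tau>"
proof -
  let ?g = "\<lambda>x. 1 + norm (F x) powr p"
  have g: "integrable (lebesgue_on \<Omega>) ?g" by (intro Bochner_Integration.integrable_add integral_lebesgue_on_const(1)[OF \<Omega>] F)
  have "(\<lambda>R. LINT x|lebesgue_on \<Omega>. indicator {x. norm (F x) > real R} x * ?g x) \<longlonglongrightarrow> (LINT x|lebesgue_on \<Omega>. 0)"
  proof (rule integral_dominated_convergence[where w="?g"])
    show "AE x in lebesgue_on \<Omega>. (\<lambda>R. indicator {x. norm (F x) > real R} x * ?g x) \<longlonglongrightarrow> 0"
    proof (intro AE_I2 tendsto_eventually)
      fix x
      show "\<forall>\<^sub>F R in sequentially. indicator {x. norm (F x) > real R} x * ?g x = 0"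
        using eventually_ge_at_top[of "nat \<lceil>norm (F x)\<rceil>"]
      proof eventually_elim
        case (elim R)
        then have "\<not> real R < norm (F x)" by linarith
        then show ?case by simp
      qed
    qed
    show "(\<lambda>x. indicator {x. norm (F x) > real R} x * ?g x) \<in> borel_measurable (lebesgue_on \<Omega>)" for R by measurable
    show "AE x in lebesgue_on \<Omega>. norm (indicator {x. norm (F x) > real R} x * ?g x) \<le> ?g x" for R
      by (intro AE_I2) (auto simp: indicator_def)
  qed (use g in auto)
  then have "eventually (\<lambda>R. (LINT x|lebesgue_on \<Omega>. indicator {x. norm (F x) > real R} x * ?g x) < \<tau>) sequentially"
    by (rule order_tendstoD(2)) (use \<tau> in simp)
  then have "eventually (\<lambda>R. real R > 0 \<and> (LINT x|lebesgue_on \<Omega>. indicator {x. norm (F x) > real R} x * ?g x) < \<tau>) sequentially"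
    using eventually_gt_at_top[of 0] by eventually_elim simp
  then obtain R :: nat where "real R > 0 \<and> (LINT x|lebesgue_on \<Omega>. indicator {x. norm (F x) > real R} x * ?g x) < \<tau>"
    by (metis (no_types, lifting) eventually_happens sequentially_bot)
  then show ?thesis by blast
qed

text \<open>
  Cover the ball of radius \<open>R\<close> by finitely many balls of radius \<open>d / 2\<close> and make their preimages
  disjoint.
\<close>
lemma finite_small_cells:
  fixes F :: "'a \<Rightarrow> 'b::euclidean_space"
  assumes F: "F \<in> borel_measurable M" and d: "d > 0"
  shows "\<exists>n. \<exists>E :: nat \<Rightarrow> 'a set. (\<forall>i<n. E i \<in> sets M) \<and> (\<forall>i<n. \<forall>j<n. i \<noteq> j \<longrightarrow> E i \<inter> E j = {}) \<and>
    (\<Union>i<n. E i) = {x \<in> space M. norm (F x) \<le> R} \<and> (\<forall>i<n. \<forall>x\<in>E i. \<forall>y\<in>E i. norm (F x - F y) \<le> d)"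
proof -
  have "compact (cball (0::'b) R)" by simp
  then obtain C where C: "finite C" "cball (0::'b) R \<subseteq> (\<Union>c\<in>C. ball c (d / 2))"
    using compactE_image[of "cball 0 R" "cball (0::'b) R" "\<lambda>c. ball c (d / 2)"] d
    by (smt (verit) UN_iff centre_in_ball half_gt_zero open_ball subsetI)
  obtain cs where cs: "set cs = C" using C(1) finite_list by blast
  define B where "B i = F -` ball (cs ! i) (d / 2) \<inter> space M" for i
  \<comment> \<open>Each point belongs to the first ball that contains its value.\<close>
  define E where "E i = (B i - (\<Union>j<i. B j)) \<inter> {x \<in> space M. norm (F x) \<le> R}" for i
  have Bm: "B i \<in> sets M" for i unfolding B_def by (rule measurable_sets[OF F]) simp
  have Sm: "{x \<in> space M. norm (F x) \<le> R} \<in> sets M" using F by measurable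
  show ?thesis
  proof (intro exI[of _ "length cs"] exI[of _ E] conjI allI impI ballI)
    show "E i \<in> sets M" for i unfolding E_def using Bm Sm by (intro sets.Int sets.Diff sets.finite_UN) auto
    show "E i \<inter> E j = {}" if "i \<noteq> j" for i j
      using that by (cases "i < j") (auto simp: E_def)
    show "(\<Union>i<length cs. E i) = {x \<in> space M. norm (F x) \<le> R}"
    proof (intro equalityI subsetI)
      fix x assume x: "x \<in> {x \<in> space M. norm (F x) \<le> R}"
      then have "F x \<in> cball 0 R" by simp
      then obtain c where "c \<in> C" "F x \<in> ball c (d / 2)" using C(2) by blast
      then obtain i where i: "i < length cs" "x \<in> B i" using x cs by (auto simp: B_def in_set_conv_nth)
      define k where "k = (LEAST i. x \<in> B i)"
      have "x \<in> B k" "k \<le> i" unfolding k_def using i(2) by (auto intro: LeastI Least_le)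
      moreover have "x \<notin> B j" if "j < k" for j using that not_less_Least unfolding k_def by blast
      ultimately have "x \<in> E k" "k < length cs" using x i(1) by (auto simp: E_def)
      then show "x \<in> (\<Union>i<length cs. E i)" by blast
    qed (auto simp: E_def)
    fix i x y assume "x \<in> E i" "y \<in> E i"
    then have "dist (cs ! i) (F x) < d / 2" "dist (cs ! i) (F y) < d / 2" by (auto simp: E_def B_def)
    then show "norm (F x - F y) \<le> d" using dist_triangle_half_l[of "F x" "cs ! i" d "F y"] by (simp add: dist_commute dist_norm)
  qed
qed

text \<open>
  The neighbourhoods of radius \<open>1 / (k + 1)\<close> of the compact sets decrease to these sets, so every
  one of the requirements holds for all large \<open>k\<close>.
\<close>
lemma small_neighbourhoods:
  fixes K :: "nat \<Rightarrow> 'a::euclidean_space set" and n :: nat and g :: "'a \<Rightarrow> real"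
  assumes \<Omega>: "open \<Omega>" and K: "\<And>i. i < n \<Longrightarrow> compact (K i)" "\<And>i. i < n \<Longrightarrow> K i \<subseteq> \<Omega>"
    and disj: "\<And>i j. i < n \<Longrightarrow> j < n \<Longrightarrow> i \<noteq> j \<Longrightarrow> K i \<inter> K j = {}"
    and g: "integrable (lebesgue_on \<Omega>) g" "\<And>x. 0 \<le> g x" and \<tau>: "\<tau> > 0"
  shows "\<exists>r>0. \<exists>U. (\<forall>i<n. open (U i) \<and> K i \<subseteq> U i \<and> U i \<subseteq> \<Omega> \<and> (\<forall>x\<in>U i. cball x r \<subseteq> \<Omega>) \<and>
      (LINT x|lebesgue_on \<Omega>. indicator (U i - K i) x * g x) < \<tau>) \<and>
    (\<forall>i<n. \<forall>j<n. i \<noteq> j \<longrightarrow> U i \<inter> U j = {})"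
proof -
  define V where "V i k = (\<Union>x\<in>K i. ball x (inverse (real (Suc k))))" for i k
  have Vo: "open (V i k)" for i k unfolding V_def by blast
  have KV: "K i \<subseteq> V i k" for i k by (auto simp: V_def intro!: bexI)
  have "compact (\<Union>i<n. K i)" using K(1) by (intro compact_UN) auto
  then obtain e where e: "e > 0" "(\<Union>x\<in>(\<Union>i<n. K i). cball x e) \<subseteq> \<Omega>"
    using compact_subset_open_imp_cball_epsilon_subset[OF _ \<Omega>, of "\<Union>i<n. K i"] K(2) by blast
  have small: "eventually (\<lambda>k. inverse (real (Suc k)) < b) sequentially" if "b > 0" for b
    using order_tendstoD(2)[OF LIMSEQ_inverse_real_of_nat that] .
  have ev1: "eventually (\<lambda>k. \<forall>i\<in>{..<n}. \<forall>x\<in>V i k. cball x (e / 2) \<subseteq> \<Omega>) sequentially"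
  proof (rule eventually_mono[OF small[of "e / 2"]])
    fix k assume k: "inverse (real (Suc k)) < e / 2"
    show "\<forall>i\<in>{..<n}. \<forall>x\<in>V i k. cball x (e / 2) \<subseteq> \<Omega>"
    proof (intro ballI subsetI)
      fix i x y assume i: "i \<in> {..<n}" and x: "x \<in> V i k" and y: "y \<in> cball x (e / 2)"
      then obtain z where z: "z \<in> K i" "dist z x < inverse (real (Suc k))" by (auto simp: V_def)
      have "dist z y \<le> e" using z(2) y k dist_triangle[of z y x] by (simp add: dist_commute)
      then have "y \<in> (\<Union>x\<in>(\<Union>i<n. K i). cball x e)" using z(1) i by auto
      then show "y \<in> \<Omega>" using e(2) by blast
    qed
  qed (use e in simp)
  have ev2: "eventually (\<lambda>k. \<forall>ij\<in>{ij \<in> {..<n} \<times> {..<n}. fst ij \<noteq> snd ij}. V (fst ij) k \<inter> V (snd ij) k = {}) sequentially"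
  proof (subst eventually_ball_finite_distrib, safe)
    fix i j assume ij: "i < n" "j < n" "fst (i, j) \<noteq> snd (i, j)"
    obtain d where d: "d > 0" "\<forall>x\<in>K i. \<forall>y\<in>K j. d \<le> dist x y"
      using separate_compact_closed[OF K(1)[OF ij(1)] compact_imp_closed[OF K(1)[OF ij(2)]]] disj[OF ij(1,2)] ij(3) by auto
    show "\<forall>\<^sub>F k in sequentially. V (fst (i, j)) k \<inter> V (snd (i, j)) k = {}"
    proof (rule eventually_mono[OF small[of "d / 2"]])
      fix k assume k: "inverse (real (Suc k)) < d / 2"
      show "V (fst (i, j)) k \<inter> V (snd (i, j)) k = {}"
      proof (rule ccontr)
        assume "V (fst (i, j)) k \<inter> V (snd (i, j)) k \<noteq> {}"
        then obtain z x y where z: "x \<in> K i" "y \<in> K j" "dist x z < inverse (real (Suc k))" "dist y z < inverse (real (Suc k))"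
          by (auto simp: V_def)
        then have "dist x y < d" using k dist_triangle[of x y z] by (simp add: dist_commute)
        then show False using d(2) z(1,2) by force
      qed
    qed (use d in simp)
  qed auto
  have ev3: "eventually (\<lambda>k. \<forall>i\<in>{..<n}. (LINT x|lebesgue_on \<Omega>. indicator (V i k - K i) x * g x) < \<tau>) sequentially"
  proof (subst eventually_ball_finite_distrib, safe)
    fix i assume i: "i < n"
    have "(\<lambda>k. LINT x|lebesgue_on \<Omega>. indicator (V i k - K i) x * g x) \<longlonglongrightarrow> (LINT x|lebesgue_on \<Omega>. 0)"
    proof (rule integral_dominated_convergence[where w=g])
      show "AE x in lebesgue_on \<Omega>. (\<lambda>k. indicator (V i k - K i) x * g x) \<longlonglongrightarrow> 0"
      proof (intro AE_I2 tendsto_eventually)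
        fix x
        show "\<forall>\<^sub>F k in sequentially. indicator (V i k - K i) x * g x = 0"
        proof (cases "x \<in> K i")
          case False
          obtain d where d: "d > 0" "\<forall>y\<in>{x}. \<forall>z\<in>K i. d \<le> dist y z"
            using separate_compact_closed[OF compact_sing compact_imp_closed[OF K(1)[OF i]], of x] False by auto
          show ?thesis
          proof (rule eventually_mono[OF small[OF d(1)]])
            fix k assume "inverse (real (Suc k)) < d"
            then have "x \<notin> V i k" using d(2) by (force simp: V_def dist_commute)
            then show "indicator (V i k - K i) x * g x = 0" by simp
          qed
        qed simp
      qed
      have "V i k - K i \<in> sets lebesgue" for k using Vo compact_imp_closed[OF K(1)[OF i]] by (intro sets.Diff) auto
      then have "(V i k - K i) \<inter> \<Omega> \<in> sets (lebesgue_on \<Omega>)" for k using \<Omega> by (auto simp: sets_restrict_space)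
      then have "(\<lambda>x. indicator ((V i k - K i) \<inter> \<Omega>) x * g x) \<in> borel_measurable (lebesgue_on \<Omega>)" for k
        using g by (intro borel_measurable_times borel_measurable_indicator) auto
      then show "(\<lambda>x. indicator (V i k - K i) x * g x) \<in> borel_measurable (lebesgue_on \<Omega>)" for k
        by (rule measurable_cong[THEN iffD1, rotated]) (auto simp: space_restrict_space indicator_def)
      show "AE x in lebesgue_on \<Omega>. norm (indicator (V i k - K i) x * g x) \<le> g x" for k
        using g(2) by (intro AE_I2) (auto simp: indicator_def)
    qed (use g in auto)
    then show "\<forall>\<^sub>F k in sequentially. (LINT x|lebesgue_on \<Omega>. indicator (V i k - K i) x * g x) < \<tau>"
      by (rule order_tendstoD(2)) (use \<tau> in simp)
  qed
  from eventually_happens[OF eventually_conj[OF ev1 eventually_conj[OF ev2 ev3]]]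
  obtain k where k: "\<forall>i\<in>{..<n}. \<forall>x\<in>V i k. cball x (e / 2) \<subseteq> \<Omega>"
    "\<forall>ij\<in>{ij \<in> {..<n} \<times> {..<n}. fst ij \<noteq> snd ij}. V (fst ij) k \<inter> V (snd ij) k = {}"
    "\<forall>i\<in>{..<n}. (LINT x|lebesgue_on \<Omega>. indicator (V i k - K i) x * g x) < \<tau>" by auto
  have sub: "V i k \<subseteq> \<Omega>" if "i < n" for i
    using k(1) that e(1) by (meson centre_in_cball half_gt_zero lessThan_iff less_imp_le subset_iff)
  show ?thesis
    by (rule exI[of _ "e / 2"], intro conjI exI[of _ "\<lambda>i. V i k"]) (use e k Vo KV sub in auto)
qed

lemma norm_diff_powr_le:
  fixes a b :: "'b::real_normed_vector"
  assumes "0 \<le> p" shows "norm (a - b) powr p \<le> 2 powr p * (norm a powr p + norm b powr p)"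
proof -
  have "norm (a - b) powr p \<le> \<bar>norm a + norm b\<bar> powr p"
    using assms norm_triangle_ineq4[of a b] by (intro powr_mono2) auto
  also have "\<dots> \<le> 2 powr p * (norm a powr p + norm b powr p)" using powr_add_le[OF assms, of "norm a" "norm b"] by simp
  finally show ?thesis .
qed

text \<open>
  Discard the set where \<open>|F| > R\<close>, divide the rest into finitely many cells on which \<open>F\<close> varies by
  at most \<open>d\<close>, and exhaust the cells by disjoint compact sets \<open>K i\<close>. The sets \<open>U i\<close> are
  neighbourhoods of \<open>K i\<close> so small that \<open>1 + |F|\<^sup>p\<close> has small integral over \<open>U i - K i\<close>. The radius
  \<open>r\<close> leaves room for mollification inside \<open>\<Omega>\<close>.
\<close>
lemma piecewise_constant_approximation:
  fixes F :: "'a::euclidean_space \<Rightarrow> 'b::euclidean_space"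
  assumes \<Omega>: "open \<Omega>" "bounded \<Omega>" and p: "1 \<le> p" and Fm: "F \<in> borel_measurable (lebesgue_on \<Omega>)"
    and Fi: "integrable (lebesgue_on \<Omega>) (\<lambda>x. norm (F x) powr p)" and \<tau>: "\<tau> > 0"
  shows "\<exists>n :: nat. \<exists>z U K r. r > 0 \<and>
    (\<forall>i<n. z i \<in> \<Omega> \<and> compact (K i) \<and> K i \<subseteq> U i \<and> open (U i) \<and> U i \<subseteq> \<Omega> \<and> (\<forall>x\<in>U i. cball x r \<subseteq> \<Omega>)) \<and>
    (\<forall>i<n. \<forall>j<n. i \<noteq> j \<longrightarrow> U i \<inter> U j = {}) \<and>
    (\<Sum>i<n. (LINT x|lebesgue_on (U i). norm (F x - F (z i)) powr p)) \<le> \<tau> \<and>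
    (\<Sum>i<n. (1 + norm (F (z i)) powr p) * measure lebesgue (U i - K i)) \<le> \<tau> \<and>
    (LINT x|lebesgue_on \<Omega>. indicator (\<Omega> - (\<Union>i<n. U i)) x * (1 + norm (F x) powr p)) \<le> \<tau>"
proof (cases "\<Omega> = {}")
  case True
  then show ?thesis using \<tau> by (intro exI[of _ 0] exI[of _ "\<lambda>i. undefined"] exI[of _ "\<lambda>i. {}"] exI[of _ 1]) simp
next
  case False
  then obtain x0 where x0: "x0 \<in> \<Omega>" by blast
  note [measurable] = Fm
  let ?g = "\<lambda>x. 1 + norm (F x) powr p"
  have g: "integrable (lebesgue_on \<Omega>) ?g" by (intro Bochner_Integration.integrable_add integral_lebesgue_on_const(1)[OF \<Omega>] Fi)
  have g0: "0 \<le> ?g x" for x by simp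
  obtain R where R: "R > 0" "(LINT x|lebesgue_on \<Omega>. indicator {x. norm (F x) > R} x * ?g x) < \<tau> / 2"
    using indicator_powr_tail[OF \<Omega> Fm Fi, of "\<tau> / 2"] \<tau> by auto
  define \<mu> where "\<mu> = measure lebesgue \<Omega>"
  have \<mu>: "\<mu> \<ge> 0" by (simp add: \<mu>_def)
  define d where "d = (\<tau> / 2 / (\<mu> + 1)) powr (1 / p)"
  have d: "d > 0" "d powr p = \<tau> / 2 / (\<mu> + 1)" using \<tau> \<mu> p by (auto simp: d_def powr_powr)
  from finite_small_cells[OF Fm d(1), of R]
  obtain n and E :: "nat \<Rightarrow> 'a set" where EE: "(\<forall>i<n. E i \<in> sets (lebesgue_on \<Omega>)) \<and> (\<forall>i<n. \<forall>j<n. i \<noteq> j \<longrightarrow> E i \<inter> E j = {}) \<and>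
    (\<Union>i<n. E i) = {x \<in> space (lebesgue_on \<Omega>). norm (F x) \<le> R} \<and> (\<forall>i<n. \<forall>x\<in>E i. \<forall>y\<in>E i. norm (F x - F y) \<le> d)"
    by (elim exE) (rule that)
  have E: "\<And>i. i < n \<Longrightarrow> E i \<in> sets (lebesgue_on \<Omega>)" "\<And>i j. i < n \<Longrightarrow> j < n \<Longrightarrow> i \<noteq> j \<Longrightarrow> E i \<inter> E j = {}"
    "(\<Union>i<n. E i) = {x \<in> space (lebesgue_on \<Omega>). norm (F x) \<le> R}" "\<And>i x y. i < n \<Longrightarrow> x \<in> E i \<Longrightarrow> y \<in> E i \<Longrightarrow> norm (F x - F y) \<le> d"
    using EE by simp_all
  have E\<Omega>: "E i \<subseteq> \<Omega>" "E i \<in> sets lebesgue" if "i < n" for i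
    using E(1)[OF that] \<Omega> by (auto simp: sets_restrict_space intro!: sets.Int)
  have ER: "norm (F x) \<le> R" if "i < n" "x \<in> E i" for i x using E(3) that by blast
  define D where "D = 1 + R powr p"
  have D: "D \<ge> 1" by (simp add: D_def)
  define e where "e = \<tau> / (2 * (real n + 1) * D)"
  have e: "e > 0" using \<tau> D by (simp add: e_def)
  have "\<exists>K. compact K \<and> K \<subseteq> E i \<and> measure lebesgue (E i - K) < e" if i: "i < n" for i
  proof -
    from sets_lebesgue_inner_closed[OF E\<Omega>(2)[OF i] e] obtain K where K: "closed K" "K \<subseteq> E i" "E i - K \<in> lmeasurable" "emeasure lebesgue (E i - K) < ennreal e" by metis
    have "measure lebesgue (E i - K) < e"
      using K(3,4) e by (simp add: emeasure_eq_measure2 ennreal_less_iff)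
    moreover have "bounded K" using K(2) E\<Omega>(1)[OF i] \<Omega>(2) bounded_subset by blast
    ultimately show ?thesis using K by (auto simp: compact_eq_bounded_closed)
  qed
  then obtain K where K: "\<And>i. i < n \<Longrightarrow> compact (K i)" "\<And>i. i < n \<Longrightarrow> K i \<subseteq> E i" "\<And>i. i < n \<Longrightarrow> measure lebesgue (E i - K i) < e" by metis
  have K\<Omega>: "K i \<subseteq> \<Omega>" if "i < n" for i using K(2)[OF that] E\<Omega>(1)[OF that] by blast
  have Kd: "K i \<inter> K j = {}" if "i < n" "j < n" "i \<noteq> j" for i j using E(2)[OF that] K(2) that by blast
  \<comment> \<open>The number of cells and the bound \<open>R\<close> are fixed before the neighbourhoods are chosen, so \<open>\<kappa>\<close> may
    depend on them.\<close>
  define \<kappa> where "\<kappa> = \<tau> / (2 * (real n + 1) * D * 2 powr p)"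
  have \<kappa>: "\<kappa> > 0" using \<tau> D by (simp add: \<kappa>_def)
  have "\<exists>r>0. \<exists>U. (\<forall>i<n. open (U i) \<and> K i \<subseteq> U i \<and> U i \<subseteq> \<Omega> \<and> (\<forall>x\<in>U i. cball x r \<subseteq> \<Omega>) \<and>
      (LINT x|lebesgue_on \<Omega>. indicator (U i - K i) x * ?g x) < \<kappa>) \<and>
    (\<forall>i<n. \<forall>j<n. i \<noteq> j \<longrightarrow> U i \<inter> U j = {})"
    by (rule small_neighbourhoods[where K=K and n=n, OF \<Omega>(1) _ _ _ g g0 \<kappa>]) (use K(1) K\<Omega> Kd in auto)
  then obtain r U0 where r: "r > 0" and UU: "(\<forall>i<n. open (U0 i) \<and> K i \<subseteq> U0 i \<and> U0 i \<subseteq> \<Omega> \<and> (\<forall>x\<in>U0 i. cball x r \<subseteq> \<Omega>) \<and>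
      (LINT x|lebesgue_on \<Omega>. indicator (U0 i - K i) x * ?g x) < \<kappa>) \<and>
    (\<forall>i<n. \<forall>j<n. i \<noteq> j \<longrightarrow> U0 i \<inter> U0 j = {})"
    by (elim exE conjE) (rule that, assumption, rule conjI)
  have U0: "\<And>i. i < n \<Longrightarrow> open (U0 i)" "\<And>i. i < n \<Longrightarrow> K i \<subseteq> U0 i" "\<And>i. i < n \<Longrightarrow> U0 i \<subseteq> \<Omega>"
    "\<And>i x. i < n \<Longrightarrow> x \<in> U0 i \<Longrightarrow> cball x r \<subseteq> \<Omega>" "\<And>i. i < n \<Longrightarrow> (LINT x|lebesgue_on \<Omega>. indicator (U0 i - K i) x * ?g x) < \<kappa>"
    "\<And>i j. i < n \<Longrightarrow> j < n \<Longrightarrow> i \<noteq> j \<Longrightarrow> U0 i \<inter> U0 j = {}"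
    using UU by simp_all
  \<comment> \<open>Empty cells have no point at which to evaluate \<open>F\<close>, so they get an empty neighbourhood.\<close>
  define U where "U i = (if E i = {} then {} else U0 i)" for i
  define z where "z i = (if E i = {} then x0 else SOME x. x \<in> E i)" for i
  have zE: "z i \<in> E i" if "E i \<noteq> {}" for i using that some_in_eq[of "E i"] by (simp add: z_def)
  have U: "open (U i)" "K i \<subseteq> U i" "U i \<subseteq> \<Omega>" "\<forall>x\<in>U i. cball x r \<subseteq> \<Omega>" if "i < n" for i
    using U0[OF that] U0(4)[OF that] K(2)[OF that] by (auto simp: U_def)
  have Ud: "U i \<inter> U j = {}" if "i < n" "j < n" "i \<noteq> j" for i j using U0(6)[OF that] by (auto simp: U_def)
  have z\<Omega>: "z i \<in> \<Omega>" if "i < n" for i using zE[of i] E\<Omega>(1)[OF that] x0 by (cases "E i = {}") (auto simp: z_def)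
  have UK: "U i - K i \<in> sets lebesgue" "U i - K i \<subseteq> \<Omega>" if "i < n" for i
    using U[OF that] compact_imp_closed[OF K(1)[OF that]] by (auto intro!: sets.Diff)
  have EK: "E i - K i \<in> sets lebesgue" "E i - K i \<subseteq> \<Omega>" if "i < n" for i
    using E\<Omega>[OF that] compact_imp_closed[OF K(1)[OF that]] by (auto intro!: sets.Diff)
  have Kl: "K i \<in> sets lebesgue" if "i < n" for i using compact_imp_closed[OF K(1)[OF that]] by simp
  have indi: "integrable (lebesgue_on \<Omega>) (\<lambda>x. indicator A x * ?g x)" if "A \<in> sets lebesgue" "A \<subseteq> \<Omega>" for A
    using integrable_mult_indicator[OF _ g, of A] that \<Omega> by (simp add: sets_restrict_space_iff)
  have Ug: "(LINT x|lebesgue_on \<Omega>. indicator (U i - K i) x * ?g x) \<le> \<kappa>" if "i < n" for i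
    using U0(5)[OF that] \<kappa> by (cases "E i = {}") (auto simp: U_def)
  have nk: "real n * (2 powr p * D * \<kappa>) \<le> \<tau> / 2"
  proof -
    have "2 powr p * D * \<kappa> = \<tau> / (2 * (real n + 1))" using D by (simp add: \<kappa>_def)
    then have "real n * (2 powr p * D * \<kappa>) = real n * (\<tau> / (2 * (real n + 1)))" by (simp only:)
    also have "\<dots> \<le> \<tau> / 2" using \<tau> by (simp add: field_simps)
    finally show ?thesis .
  qed
  have Q1: "(\<Sum>i<n. (LINT x|lebesgue_on (U i). norm (F x - F (z i)) powr p)) \<le> \<tau>"
  proof -
    have "(LINT x|lebesgue_on (U i). norm (F x - F (z i)) powr p) \<le> (LINT x|lebesgue_on \<Omega>. indicator (K i) x * d powr p) + 2 powr p * D * \<kappa>" if i: "i < n" for i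
    proof (cases "E i = {}")
      case True
      then have "U i = {}" by (simp add: U_def)
      moreover have "0 \<le> (LINT x|lebesgue_on \<Omega>. indicator (K i) x * d powr p)" by (rule integral_nonneg_AE) simp
      ultimately show ?thesis using \<kappa> D by (simp add: integral_restrict_space)
    next
      case False
      note z = zE[OF False]
      have pt: "norm (F x - F (z i)) powr p \<le> 2 powr p * (D * ?g x)" for x
      proof -
        have "norm (F x - F (z i)) powr p \<le> 2 powr p * (norm (F x) powr p + norm (F (z i)) powr p)" using p by (intro norm_diff_powr_le) simp
        also have "\<dots> \<le> 2 powr p * (norm (F x) powr p + R powr p)"
          using ER[OF i z] p by (intro mult_left_mono add_left_mono powr_mono2) auto
        also have "\<dots> \<le> 2 powr p * (D * ?g x)" by (intro mult_left_mono) (auto simp: D_def algebra_simps)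
        finally show ?thesis .
      qed
      have hi: "integrable (lebesgue_on \<Omega>) (\<lambda>x. norm (F x - F (z i)) powr p)"
      proof (rule Bochner_Integration.integrable_bound[of _ "\<lambda>x. 2 powr p * (D * ?g x)"])
        show "integrable (lebesgue_on \<Omega>) (\<lambda>x. 2 powr p * (D * ?g x))" by (intro integrable_mult_right g)
        show "AE x in lebesgue_on \<Omega>. norm (norm (F x - F (z i)) powr p) \<le> norm (2 powr p * (D * ?g x))"
          using pt D by (intro AE_I2) (simp add: abs_mult)
      qed measurable
      have "(LINT x|lebesgue_on (U i). norm (F x - F (z i)) powr p) = (LINT x|lebesgue_on \<Omega>. indicator (U i) x * norm (F x - F (z i)) powr p)"
        by (rule lebesgue_on_subset_integral(3)[OF \<Omega>(1) U(1,3)[OF i] hi])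
      also have "\<dots> \<le> (LINT x|lebesgue_on \<Omega>. indicator (K i) x * d powr p + 2 powr p * D * (indicator (U i - K i) x * ?g x))"
      proof (rule integral_mono)
        show "integrable (lebesgue_on \<Omega>) (\<lambda>x. indicator (U i) x * norm (F x - F (z i)) powr p)"
          by (rule lebesgue_on_subset_integral(2)[OF \<Omega>(1) U(1,3)[OF i] hi])
        show "integrable (lebesgue_on \<Omega>) (\<lambda>x. indicator (K i) x * d powr p + 2 powr p * D * (indicator (U i - K i) x * ?g x))"
          by (intro Bochner_Integration.integrable_add integrable_mult_right indi UK[OF i] integral_lebesgue_on_const_indicator(1)[OF \<Omega> Kl[OF i] K\<Omega>[OF i]])
        fix x
        have "norm (F x - F (z i)) powr p \<le> d powr p" if "x \<in> K i"
          using E(4)[OF i _ z, of x] K(2)[OF i] that p by (intro powr_mono2) auto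
        then show "indicator (U i) x * norm (F x - F (z i)) powr p \<le> indicator (K i) x * d powr p + 2 powr p * D * (indicator (U i - K i) x * ?g x)"
          using pt[of x] U(2)[OF i] by (auto simp: indicator_def mult.assoc)
      qed
      also have "\<dots> = (LINT x|lebesgue_on \<Omega>. indicator (K i) x * d powr p) + 2 powr p * D * (LINT x|lebesgue_on \<Omega>. indicator (U i - K i) x * ?g x)"
        by (subst Bochner_Integration.integral_add[OF integral_lebesgue_on_const_indicator(1)[OF \<Omega> Kl[OF i] K\<Omega>[OF i]] integrable_mult_right[OF indi[OF UK[OF i]]]])
          (simp only: integral_mult_right_zero)
      also have "\<dots> \<le> (LINT x|lebesgue_on \<Omega>. indicator (K i) x * d powr p) + 2 powr p * D * \<kappa>"
        using Ug[OF i] D by (intro add_left_mono mult_left_mono) auto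
      finally show ?thesis .
    qed
    then have "(\<Sum>i<n. (LINT x|lebesgue_on (U i). norm (F x - F (z i)) powr p)) \<le> (\<Sum>i<n. (LINT x|lebesgue_on \<Omega>. indicator (K i) x * d powr p) + 2 powr p * D * \<kappa>)"
      by (intro sum_mono) simp
    also have "\<dots> = (\<Sum>i<n. (LINT x|lebesgue_on \<Omega>. indicator (K i) x * d powr p)) + real n * (2 powr p * D * \<kappa>)"
      by (simp add: sum.distrib)
    also have "(\<Sum>i<n. (LINT x|lebesgue_on \<Omega>. indicator (K i) x * d powr p)) = (LINT x|lebesgue_on \<Omega>. (\<Sum>i<n. indicator (K i) x * d powr p))"
      by (intro Bochner_Integration.integral_sum[symmetric] integral_lebesgue_on_const_indicator(1)[OF \<Omega> Kl K\<Omega>]) auto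
    also have "\<dots> \<le> (LINT x|lebesgue_on \<Omega>. d powr p)"
    proof (rule integral_mono)
      show "integrable (lebesgue_on \<Omega>) (\<lambda>x. \<Sum>i<n. indicator (K i) x * d powr p)"
        by (intro Bochner_Integration.integrable_sum integral_lebesgue_on_const_indicator(1)[OF \<Omega> Kl K\<Omega>]) auto
      show "integrable (lebesgue_on \<Omega>) (\<lambda>x. d powr p)" by (rule integral_lebesgue_on_const(1)[OF \<Omega>])
      have "disjoint_family_on K {..<n}" using Kd by (auto simp: disjoint_family_on_def)
      then show "(\<Sum>i<n. indicator (K i) x * d powr p) \<le> d powr p" for x
        by (simp add: sum_distrib_right[symmetric] indicator_UN_disjoint[symmetric] mult_left_le_one_le del: of_bool_eq_iff)
    qed
    also have "\<dots> = \<mu> * d powr p" by (simp only: integral_lebesgue_on_const(2)[OF \<Omega>] \<mu>_def)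
    also have "\<mu> * d powr p \<le> \<tau> / 2" unfolding d(2) using \<mu> \<tau> by (simp add: field_simps)
    finally show ?thesis using nk by simp
  qed
  have Q2: "(\<Sum>i<n. (1 + norm (F (z i)) powr p) * measure lebesgue (U i - K i)) \<le> \<tau>"
  proof -
    have "(1 + norm (F (z i)) powr p) * measure lebesgue (U i - K i) \<le> 2 powr p * D * \<kappa>" if i: "i < n" for i
    proof (cases "E i = {}")
      case True
      then show ?thesis using \<kappa> D by (simp add: U_def)
    next
      case False
      have "measure lebesgue (U i - K i) = (LINT x|lebesgue_on \<Omega>. indicator (U i - K i) x * 1)"
        by (subst integral_lebesgue_on_const_indicator(2)[OF \<Omega> UK[OF i]]) simp
      also have "\<dots> \<le> (LINT x|lebesgue_on \<Omega>. indicator (U i - K i) x * ?g x)"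
        by (intro integral_mono integral_lebesgue_on_const_indicator(1)[OF \<Omega> UK[OF i]] indi UK[OF i] mult_left_mono) auto
      also have "\<dots> \<le> \<kappa>" by (rule Ug[OF i])
      finally have 1: "measure lebesgue (U i - K i) \<le> \<kappa>" .
      have 2: "1 + norm (F (z i)) powr p \<le> D" unfolding D_def using ER[OF i zE[OF False]] p by (intro add_left_mono powr_mono2) auto
      have "(1 + norm (F (z i)) powr p) * measure lebesgue (U i - K i) \<le> D * \<kappa>" using 1 2 D by (intro mult_mono) auto
      also have "\<dots> \<le> 2 powr p * (D * \<kappa>)" using D \<kappa> p ge_one_powr_ge_zero[of 2 p] mult_right_mono[of 1 "2 powr p" "D * \<kappa>"] by simp
      finally show ?thesis by (simp add: mult.assoc)
    qed
    then have "(\<Sum>i<n. (1 + norm (F (z i)) powr p) * measure lebesgue (U i - K i)) \<le> (\<Sum>i<n. 2 powr p * D * \<kappa>)"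
      by (intro sum_mono) simp
    then show ?thesis using nk \<tau> by simp
  qed
  have Q3: "(LINT x|lebesgue_on \<Omega>. indicator (\<Omega> - (\<Union>i<n. U i)) x * ?g x) \<le> \<tau>"
  proof -
    have Vo: "open (\<Union>i<n. U i)" using U(1) by blast
    have Rm: "{x. norm (F x) > R} \<inter> \<Omega> \<in> sets (lebesgue_on \<Omega>)"
    proof -
      have "{x \<in> space (lebesgue_on \<Omega>). norm (F x) > R} \<in> sets (lebesgue_on \<Omega>)" by measurable
      then show ?thesis by (simp add: space_restrict_space Int_def conj_commute)
    qed
    have "integrable (lebesgue_on \<Omega>) (\<lambda>x. indicator ({x. norm (F x) > R} \<inter> \<Omega>) x * ?g x)"
      using integrable_mult_indicator[OF Rm g] by simp
    then have Ri: "integrable (lebesgue_on \<Omega>) (\<lambda>x. indicator {x. norm (F x) > R} x * ?g x)"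
      by (rule Bochner_Integration.integrable_cong[THEN iffD1, rotated 2]) (auto simp: space_restrict_space indicator_def)
    have Si: "integrable (lebesgue_on \<Omega>) (\<lambda>x. \<Sum>i<n. indicator (E i - K i) x * D)"
      by (intro Bochner_Integration.integrable_sum integral_lebesgue_on_const_indicator(1)[OF \<Omega>] EK) auto
    have "(LINT x|lebesgue_on \<Omega>. indicator (\<Omega> - (\<Union>i<n. U i)) x * ?g x) \<le>
        (LINT x|lebesgue_on \<Omega>. indicator {x. norm (F x) > R} x * ?g x + (\<Sum>i<n. indicator (E i - K i) x * D))"
    proof (rule integral_mono)
      show "integrable (lebesgue_on \<Omega>) (\<lambda>x. indicator (\<Omega> - (\<Union>i<n. U i)) x * ?g x)"
        using \<Omega>(1) Vo by (intro indi) (auto intro!: sets.Diff)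
      show "integrable (lebesgue_on \<Omega>) (\<lambda>x. indicator {x. norm (F x) > R} x * ?g x + (\<Sum>i<n. indicator (E i - K i) x * D))"
        by (intro Bochner_Integration.integrable_add Ri Si)
      fix x assume "x \<in> space (lebesgue_on \<Omega>)"
      then have x: "x \<in> \<Omega>" by (simp add: space_restrict_space)
      have s0: "0 \<le> (\<Sum>i<n. indicator (E i - K i) x * D)" using D by (intro sum_nonneg) auto
      show "indicator (\<Omega> - (\<Union>i<n. U i)) x * ?g x \<le> indicator {x. norm (F x) > R} x * ?g x + (\<Sum>i<n. indicator (E i - K i) x * D)"
      proof (cases "x \<in> (\<Union>i<n. U i) \<or> norm (F x) > R")
        case True
        then show ?thesis using s0 g0[of x] by (auto simp: indicator_def)
      next
        case F': False
        then have "x \<in> (\<Union>i<n. E i)" using E(3) x by (simp add: space_restrict_space)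
        then obtain i where i: "i < n" "x \<in> E i" by blast
        then have "x \<in> E i - K i" using F' U(2)[OF i(1)] by blast
        then have "D = indicator (E i - K i) x * D" by simp
        also have "\<dots> \<le> (\<Sum>i<n. indicator (E i - K i) x * D)" using i(1) D by (intro member_le_sum[of i "{..<n}" "\<lambda>i. indicator (E i - K i) x * D"]) auto
        finally have "D \<le> (\<Sum>i<n. indicator (E i - K i) x * D)" .
        moreover have "?g x \<le> D" unfolding D_def using F' p by (intro add_left_mono powr_mono2) auto
        ultimately show ?thesis using g0[of x] s0 by (auto simp: indicator_def)
      qed
    qed
    also have "\<dots> = (LINT x|lebesgue_on \<Omega>. indicator {x. norm (F x) > R} x * ?g x) + (\<Sum>i<n. measure lebesgue (E i - K i) * D)"
    proof -
      have "(LINT x|lebesgue_on \<Omega>. (\<Sum>i<n. indicator (E i - K i) x * D)) = (\<Sum>i<n. (LINT x|lebesgue_on \<Omega>. indicator (E i - K i) x * D))"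
        by (intro Bochner_Integration.integral_sum integral_lebesgue_on_const_indicator(1)[OF \<Omega>] EK) auto
      also have "\<dots> = (\<Sum>i<n. measure lebesgue (E i - K i) * D)"
        by (intro sum.cong refl integral_lebesgue_on_const_indicator(2)[OF \<Omega>] EK) auto
      finally show ?thesis using Bochner_Integration.integral_add[OF Ri Si] by simp
    qed
    also have "\<dots> \<le> \<tau> / 2 + (\<Sum>i<n. e * D)"
      using R(2) K(3) D by (intro add_mono sum_mono mult_right_mono) (auto intro: less_imp_le)
    also have "(\<Sum>i<n. e * D) = real n * (\<tau> / (2 * (real n + 1)))" using D by (simp add: e_def)
    also have "\<dots> \<le> \<tau> / 2" using \<tau> by (simp add: field_simps)
    finally show ?thesis by simp
  qed
  show ?thesis
    by (intro exI[of _ n] exI[of _ z] exI[of _ U] exI[of _ K] exI[of _ r] conjI Q1 Q2 Q3 r allI impI) (use z\<Omega> K(1) U Ud in auto)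
qed

section \<open>Lower semicontinuity\<close>

lemma integral_subset_le:
  fixes g :: "'a::euclidean_space \<Rightarrow> real"
  assumes "open \<Omega>" "open U" "U \<subseteq> \<Omega>" "integrable (lebesgue_on \<Omega>) g" "\<And>x. 0 \<le> g x"
  shows "(LINT x|lebesgue_on U. g x) \<le> (LINT x|lebesgue_on \<Omega>. g x)"
proof -
  have "(LINT x|lebesgue_on U. g x) = (LINT x|lebesgue_on \<Omega>. indicator U x * g x)"
    by (rule lebesgue_on_subset_integral(3)[OF assms(1-4)])
  also have "\<dots> \<le> (LINT x|lebesgue_on \<Omega>. g x)"
    using assms by (intro integral_mono lebesgue_on_subset_integral(2)) (auto simp: indicator_def)
  finally show ?thesis .
qed

context quasiconvex_growth
begin

text \<open>The growth conditions dominate \<open>|f|\<close> by a multiple of \<open>1 + |.|\<^sup>p\<close>.\<close>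
lemma integrable_f_powr:
  assumes \<Omega>: "open \<Omega>" "bounded \<Omega>" and F: "\<And>x. x \<in> \<Omega> \<Longrightarrow> F x \<in> alt_forms (Suc m)"
    "(\<lambda>x. form_vec (Suc m) (F x)) \<in> borel_measurable (lebesgue_on \<Omega>)" "integrable (lebesgue_on \<Omega>) (\<lambda>x. nrm (F x) powr p)"
  shows "integrable (lebesgue_on \<Omega>) (\<lambda>x. f (F x))"
proof (rule Bochner_Integration.integrable_bound[of _ "\<lambda>x. c1 + c2 * (nrm (F x) powr p + 1)"])
  show "integrable (lebesgue_on \<Omega>) (\<lambda>x. c1 + c2 * (nrm (F x) powr p + 1))"
    by (intro Bochner_Integration.integrable_add integrable_mult_right integral_lebesgue_on_const(1)[OF \<Omega>] F(3))
  show "(\<lambda>x. f (F x)) \<in> borel_measurable (lebesgue_on \<Omega>)" by (rule measurable_f_form[OF qc F(1,2)])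
  have "norm (f (F x)) \<le> norm (c1 + c2 * (nrm (F x) powr p + 1))" if "x \<in> \<Omega>" for x
  proof -
    have "0 \<le> c2 * (nrm (F x) powr p + 1)" using c by simp
    then have "\<bar>f (F x)\<bar> \<le> c1 + c2 * (nrm (F x) powr p + 1)"
      using lower[OF F(1)[OF that]] upper[OF F(1)[OF that]] c by linarith
    then show ?thesis by simp
  qed
  then show "AE x in lebesgue_on \<Omega>. norm (f (F x)) \<le> norm (c1 + c2 * (nrm (F x) powr p + 1))"
    by (intro AE_I2) (simp add: space_restrict_space)
qed

text \<open>
  Lower semicontinuity on one cell with all error terms. Here \<open>X\<close> stands for \<open>d\<alpha>\<close>, \<open>Y\<close> for \<open>d\<alpha>\<^sub>s\<close>,
  \<open>\<xi>\<close> for the approximate value of \<open>X\<close> on \<open>U\<close>, and \<open>dw\<close> for an approximation of \<open>Y - X\<close>. The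
  comparison runs from \<open>f X\<close> to \<open>f \<xi>\<close> and from \<open>f (\<xi> + dw)\<close> to \<open>f Y\<close> by quantitative continuity,
  and between \<open>f \<xi>\<close> and \<open>f (\<xi> + dw)\<close> by slicing. Among the coefficients, \<open>CL\<close> alone depends on \<open>U\<close>
  and \<open>K\<close>, and it multiplies a quantity that tends to zero with \<open>w\<close>.
\<close>
lemma local_estimate:
  fixes U K :: "'n rvec set" and l :: nat
  assumes U: "open U" "bounded U" and K: "compact K" "K \<subseteq> U" and l: "l > 0" and \<delta>: "\<delta> > 0" and C\<delta>: "C\<delta> \<ge> 0"
    and quasi: "\<forall>\<xi>\<in>alt_forms (Suc m). \<forall>\<eta>\<in>alt_forms (Suc m).
      f \<xi> \<le> f \<eta> + \<delta> * (1 + nrm \<xi> powr p) + C\<delta> * norm (form_vec (Suc m) \<xi> - form_vec (Suc m) \<eta>) powr p"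
  defines "C1 \<equiv> c1 + c2 * (1 + 3 powr p)" and "P \<equiv> 2 powr p"
  shows "\<exists>CL\<ge>0. \<forall>\<xi>\<in>alt_forms (Suc m). \<forall>w X Y. smooth_form m w \<longrightarrow>
    (\<forall>x\<in>U. X x \<in> alt_forms (Suc m)) \<longrightarrow> (\<forall>x\<in>U. Y x \<in> alt_forms (Suc m)) \<longrightarrow>
    (\<lambda>x. form_vec (Suc m) (X x)) \<in> borel_measurable (lebesgue_on U) \<longrightarrow>
    (\<lambda>x. form_vec (Suc m) (Y x)) \<in> borel_measurable (lebesgue_on U) \<longrightarrow>
    integrable (lebesgue_on U) (\<lambda>x. nrm (X x) powr p) \<longrightarrow> integrable (lebesgue_on U) (\<lambda>x. nrm (Y x) powr p) \<longrightarrow>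
    (LINT x|lebesgue_on U. f (X x)) \<le> (LINT x|lebesgue_on U. f (Y x))
      + \<delta> * (2 * measure lebesgue U + (LINT x|lebesgue_on U. nrm (X x) powr p) + P * (LINT x|lebesgue_on U. nrm (Y x) powr p))
      + (C\<delta> + (C\<delta> + \<delta> * P) * P) * (LINT x|lebesgue_on U. norm (form_vec (Suc m) (X x) - form_vec (Suc m) \<xi>) powr p)
      + C1 * ((1 + nrm \<xi> powr p) * measure lebesgue (U - K))
      + ((C\<delta> + \<delta> * P) * P + C1 / l * P) * (LINT x|lebesgue_on U. norm (form_vec (Suc m) (cext m w x) - (form_vec (Suc m) (Y x) - form_vec (Suc m) (X x))) powr p)
      + C1 / l * P * P * ((LINT x|lebesgue_on U. nrm (Y x) powr p) + (LINT x|lebesgue_on U. nrm (X x) powr p))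
      + CL * (LINT x|lebesgue_on U. norm (form_vec m (w x)) powr p)"
proof -
  obtain CL where CL: "CL \<ge> 0" and slice: "\<And>\<xi> w. \<xi> \<in> alt_forms (Suc m) \<Longrightarrow> smooth_form m w \<Longrightarrow>
    f \<xi> * measure lebesgue U \<le> (LINT x|lebesgue_on U. f (form_add \<xi> (cext m w x)))
      + C1 * (1 + nrm \<xi> powr p) * measure lebesgue (U - K)
      + C1 / l * (LINT x|lebesgue_on U. nrm (cext m w x) powr p)
      + CL * (LINT x|lebesgue_on U. norm (form_vec m (w x)) powr p)"
    using slicing_estimate[OF U K l] unfolding C1_def by blast
  note quasi = quasi[rule_format]
  have P: "P \<ge> 1" unfolding P_def using p by (intro ge_one_powr_ge_zero) auto
  have p0: "0 \<le> p" using p by simp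
  have C1: "C1 \<ge> 0" unfolding C1_def using c by simp
  show ?thesis
  proof (intro exI[of _ CL] conjI CL ballI allI impI)
    fix \<xi> :: "'n rvec form" and w X Y :: "'n form_field"
    assume \<xi>: "\<xi> \<in> alt_forms (Suc m)" and w: "smooth_form m w"
      and X: "\<forall>x\<in>U. X x \<in> alt_forms (Suc m)" and Y: "\<forall>x\<in>U. Y x \<in> alt_forms (Suc m)"
      and [measurable]: "(\<lambda>x. form_vec (Suc m) (X x)) \<in> borel_measurable (lebesgue_on U)" "(\<lambda>x. form_vec (Suc m) (Y x)) \<in> borel_measurable (lebesgue_on U)"
      and Xi: "integrable (lebesgue_on U) (\<lambda>x. nrm (X x) powr p)" and Yi: "integrable (lebesgue_on U) (\<lambda>x. nrm (Y x) powr p)"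
    define vX where "vX x = form_vec (Suc m) (X x)" for x
    define vY where "vY x = form_vec (Suc m) (Y x)" for x
    define v\<xi> where "v\<xi> = form_vec (Suc m) \<xi>"
    define vw where "vw x = form_vec (Suc m) (cext m w x)" for x
    have [measurable]: "vX \<in> borel_measurable (lebesgue_on U)" "vY \<in> borel_measurable (lebesgue_on U)" "vw \<in> borel_measurable (lebesgue_on U)"
      unfolding vX_def[abs_def] vY_def[abs_def] vw_def[abs_def]
      using borel_measurable_lebesgue_on[OF borel_measurable_continuous_onI[OF continuous_cext(1)[OF w]]] by measurable
    have Xi: "integrable (lebesgue_on U) (\<lambda>x. norm (vX x) powr p)" and Yi: "integrable (lebesgue_on U) (\<lambda>x. norm (vY x) powr p)"
      using Xi Yi by (simp_all add: vX_def vY_def)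
    have wi: "integrable (lebesgue_on U) (\<lambda>x. norm (vw x) powr p)" unfolding vw_def using p
      by (intro integrable_lebesgue_on_continuous[OF U] continuous_on_powr' continuous_intros continuous_cext(1)[OF w]) auto
    have diffi: "integrable (lebesgue_on U) (\<lambda>x. norm (a x - b x) powr p)"
      if [measurable]: "a \<in> borel_measurable (lebesgue_on U)" "b \<in> borel_measurable (lebesgue_on U)"
        and "integrable (lebesgue_on U) (\<lambda>x. norm (a x) powr p)" "integrable (lebesgue_on U) (\<lambda>x. norm (b x) powr p)" for a b :: "'n rvec \<Rightarrow> (real, 'n set) vec"
    proof (rule Bochner_Integration.integrable_bound[of _ "\<lambda>x. 2 powr p * (norm (a x) powr p + norm (b x) powr p)"])
      show "integrable (lebesgue_on U) (\<lambda>x. 2 powr p * (norm (a x) powr p + norm (b x) powr p))" using that by simp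
      show "AE x in lebesgue_on U. norm (norm (a x - b x) powr p) \<le> norm (2 powr p * (norm (a x) powr p + norm (b x) powr p))"
        using norm_diff_powr_le[OF p0] by (intro AE_I2) (simp add: abs_mult)
    qed measurable
    have qi: "integrable (lebesgue_on U) (\<lambda>x. norm (vX x - v\<xi>) powr p)"
      by (rule diffi) (use Xi integral_lebesgue_on_const(1)[OF U] in auto)
    have yxi: "integrable (lebesgue_on U) (\<lambda>x. norm (vY x - vX x) powr p)" by (rule diffi) (use Xi Yi in auto)
    have ti: "integrable (lebesgue_on U) (\<lambda>x. norm (vw x - (vY x - vX x)) powr p)"
      by (rule diffi) (use wi yxi in auto)
    define \<mu> a b q t W where "\<mu> = measure lebesgue U" and "a = (LINT x|lebesgue_on U. norm (vX x) powr p)" and "b = (LINT x|lebesgue_on U. norm (vY x) powr p)"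
      and "q = (LINT x|lebesgue_on U. norm (vX x - v\<xi>) powr p)" and "t = (LINT x|lebesgue_on U. norm (vw x - (vY x - vX x)) powr p)"
      and "W = (LINT x|lebesgue_on U. norm (form_vec m (w x)) powr p)"
    define k where "k = (1 + nrm \<xi> powr p) * measure lebesgue (U - K)"
    define C' where "C' = C\<delta> + \<delta> * P"
    have C': "C' \<ge> 0" using C\<delta> \<delta> P by (simp add: C'_def)
    note ci = integral_lebesgue_on_const[OF U]
    have fX: "integrable (lebesgue_on U) (\<lambda>x. f (X x))" using X Xi by (intro integrable_f_powr U) (auto simp: vX_def)
    have fY: "integrable (lebesgue_on U) (\<lambda>x. f (Y x))" using Y Yi by (intro integrable_f_powr U) (auto simp: vY_def)
    have alt: "form_add \<xi> (cext m w x) \<in> alt_forms (Suc m)" for x by (intro alt_forms_add \<xi> cext_alt w)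
    have 1: "(LINT x|lebesgue_on U. f (X x)) \<le> f \<xi> * \<mu> + \<delta> * (\<mu> + a) + C\<delta> * q"
    proof -
      have "(LINT x|lebesgue_on U. f (X x)) \<le> (LINT x|lebesgue_on U. (f \<xi> + \<delta>) + \<delta> * norm (vX x) powr p + C\<delta> * norm (vX x - v\<xi>) powr p)"
      proof (rule integral_mono[OF fX])
        show "integrable (lebesgue_on U) (\<lambda>x. (f \<xi> + \<delta>) + \<delta> * norm (vX x) powr p + C\<delta> * norm (vX x - v\<xi>) powr p)"
          by (intro Bochner_Integration.integrable_add integrable_mult_right ci(1) Xi qi)
        fix x assume "x \<in> space (lebesgue_on U)"
        then have "x \<in> U" by (simp add: space_restrict_space)
        then show "f (X x) \<le> (f \<xi> + \<delta>) + \<delta> * norm (vX x) powr p + C\<delta> * norm (vX x - v\<xi>) powr p"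
          using quasi[of "X x" \<xi>] X \<xi> by (simp add: vX_def v\<xi>_def algebra_simps)
      qed
      also have "\<dots> = \<mu> * (f \<xi> + \<delta>) + \<delta> * a + C\<delta> * q"
      proof -
        note i1 = Bochner_Integration.integrable_add[OF ci(1)[of "f \<xi> + \<delta>"] integrable_mult_right[OF Xi, of \<delta>]]
        show ?thesis
          by (simp only: Bochner_Integration.integral_add[OF i1 integrable_mult_right[OF qi]] Bochner_Integration.integral_add[OF ci(1) integrable_mult_right[OF Xi]]
              integral_mult_right_zero ci(2) \<mu>_def a_def q_def)
      qed
      finally show ?thesis by (simp add: algebra_simps)
    qed
    have 2: "(LINT x|lebesgue_on U. f (form_add \<xi> (cext m w x))) \<le> (LINT x|lebesgue_on U. f (Y x)) + \<delta> * (\<mu> + P * b) + C' * P * (q + t)"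
    proof -
      have "(LINT x|lebesgue_on U. f (form_add \<xi> (cext m w x))) \<le>
        (LINT x|lebesgue_on U. f (Y x) + \<delta> + \<delta> * P * norm (vY x) powr p + C' * P * norm (vX x - v\<xi>) powr p + C' * P * norm (vw x - (vY x - vX x)) powr p)"
      proof (rule integral_mono[OF integrable_f_smooth[OF U \<xi> w]])
        show "integrable (lebesgue_on U) (\<lambda>x. f (Y x) + \<delta> + \<delta> * P * norm (vY x) powr p + C' * P * norm (vX x - v\<xi>) powr p + C' * P * norm (vw x - (vY x - vX x)) powr p)"
          by (intro Bochner_Integration.integrable_add integrable_mult_right ci(1) fY Yi qi ti)
        fix x assume "x \<in> space (lebesgue_on U)"
        then have x: "x \<in> U" by (simp add: space_restrict_space)
        let ?\<xi>' = "form_add \<xi> (cext m w x)"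
        define D where "D = norm ((v\<xi> + vw x) - vY x) powr p"
        have v': "form_vec (Suc m) ?\<xi>' = v\<xi> + vw x" by (simp add: form_vec_add v\<xi>_def vw_def)
        have "f ?\<xi>' \<le> f (Y x) + \<delta> * (1 + norm (v\<xi> + vw x) powr p) + C\<delta> * D"
          using quasi[OF alt, of "Y x" x] Y x by (simp add: v' vY_def D_def)
        also have "norm (v\<xi> + vw x) powr p \<le> P * (norm (vY x) powr p + D)"
        proof -
          have "norm (v\<xi> + vw x) powr p = norm (vY x - (vY x - (v\<xi> + vw x))) powr p" by simp
          also have "\<dots> \<le> P * (norm (vY x) powr p + norm (vY x - (v\<xi> + vw x)) powr p)" unfolding P_def by (rule norm_diff_powr_le[OF p0])
          finally show ?thesis by (simp add: D_def norm_minus_commute)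
        qed
        finally have "f ?\<xi>' \<le> f (Y x) + \<delta> * (1 + P * (norm (vY x) powr p + D)) + C\<delta> * D" using \<delta> by simp
        also have "\<dots> = f (Y x) + \<delta> + \<delta> * P * norm (vY x) powr p + C' * D" by (simp add: C'_def algebra_simps)
        also have "D \<le> P * (norm (vX x - v\<xi>) powr p + norm (vw x - (vY x - vX x)) powr p)"
        proof -
          have "D = norm ((vw x - (vY x - vX x)) - (vX x - v\<xi>)) powr p" unfolding D_def by (simp add: algebra_simps)
          also have "\<dots> \<le> P * (norm (vw x - (vY x - vX x)) powr p + norm (vX x - v\<xi>) powr p)" unfolding P_def by (rule norm_diff_powr_le[OF p0])
          finally show ?thesis by (simp add: add.commute)
        qed
        finally have "f ?\<xi>' \<le> f (Y x) + \<delta> + \<delta> * P * norm (vY x) powr p + C' * (P * (norm (vX x - v\<xi>) powr p + norm (vw x - (vY x - vX x)) powr p))"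
          using C' by (simp add: mult_left_mono)
        then show "f ?\<xi>' \<le> f (Y x) + \<delta> + \<delta> * P * norm (vY x) powr p + C' * P * norm (vX x - v\<xi>) powr p + C' * P * norm (vw x - (vY x - vX x)) powr p"
          by (simp add: algebra_simps)
      qed
      also have "\<dots> = (LINT x|lebesgue_on U. f (Y x)) + \<mu> * \<delta> + \<delta> * P * b + C' * P * q + C' * P * t"
      proof -
        note i1 = Bochner_Integration.integrable_add[OF fY ci(1)[of \<delta>]]
        note i2 = Bochner_Integration.integrable_add[OF i1 integrable_mult_right[OF Yi, of "\<delta> * P"]]
        note i3 = Bochner_Integration.integrable_add[OF i2 integrable_mult_right[OF qi, of "C' * P"]]
        show ?thesis
          by (simp only: Bochner_Integration.integral_add[OF i3 integrable_mult_right[OF ti]] Bochner_Integration.integral_add[OF i2 integrable_mult_right[OF qi]]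
              Bochner_Integration.integral_add[OF i1 integrable_mult_right[OF Yi]] Bochner_Integration.integral_add[OF fY ci(1)]
              integral_mult_right_zero ci(2) \<mu>_def b_def q_def t_def)
      qed
      finally show ?thesis by (simp add: algebra_simps)
    qed
    have 3: "(LINT x|lebesgue_on U. norm (vw x) powr p) \<le> P * t + P * P * (b + a)"
    proof -
      have "(LINT x|lebesgue_on U. norm (vw x) powr p) \<le> (LINT x|lebesgue_on U. P * norm (vw x - (vY x - vX x)) powr p + P * P * (norm (vY x) powr p + norm (vX x) powr p))"
      proof (rule integral_mono[OF wi])
        show "integrable (lebesgue_on U) (\<lambda>x. P * norm (vw x - (vY x - vX x)) powr p + P * P * (norm (vY x) powr p + norm (vX x) powr p))"
          by (intro Bochner_Integration.integrable_add integrable_mult_right ti Xi Yi)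
        fix x
        have "norm (vw x) powr p = norm ((vw x - (vY x - vX x)) - (vX x - vY x)) powr p" by simp
        also have "\<dots> \<le> P * (norm (vw x - (vY x - vX x)) powr p + norm (vX x - vY x) powr p)" unfolding P_def by (rule norm_diff_powr_le[OF p0])
        also have "\<dots> \<le> P * (norm (vw x - (vY x - vX x)) powr p + P * (norm (vX x) powr p + norm (vY x) powr p))"
          using P norm_diff_powr_le[OF p0, of "vX x" "vY x"] by (intro mult_left_mono add_left_mono) (auto simp: P_def)
        finally show "norm (vw x) powr p \<le> P * norm (vw x - (vY x - vX x)) powr p + P * P * (norm (vY x) powr p + norm (vX x) powr p)"
          by (simp add: algebra_simps)
      qed
      also have "\<dots> = P * t + P * P * (b + a)"
        by (simp only: Bochner_Integration.integral_add[OF integrable_mult_right[OF ti] integrable_mult_right[OF Bochner_Integration.integrable_add[OF Yi Xi]]]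
            Bochner_Integration.integral_add[OF Yi Xi] integral_mult_right_zero a_def b_def t_def)
      finally show ?thesis .
    qed
    have 4: "f \<xi> * \<mu> \<le> (LINT x|lebesgue_on U. f (form_add \<xi> (cext m w x))) + C1 * k + C1 / l * (LINT x|lebesgue_on U. norm (vw x) powr p) + CL * W"
      using slice[OF \<xi> w] by (simp add: \<mu>_def k_def vw_def W_def mult.assoc)
    have 5: "C1 / l * (LINT x|lebesgue_on U. norm (vw x) powr p) \<le> C1 / l * (P * t + P * P * (b + a))"
      using 3 C1 by (intro mult_left_mono) auto
    have "(LINT x|lebesgue_on U. f (X x)) \<le> (LINT x|lebesgue_on U. f (Y x)) + \<delta> * (\<mu> + P * b) + C' * P * (q + t) + C1 * k + C1 / l * (P * t + P * P * (b + a)) + CL * W + \<delta> * (\<mu> + a) + C\<delta> * q"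
      using 1 2 4 5 by linarith
    also have "\<dots> = (LINT x|lebesgue_on U. f (Y x)) + \<delta> * (2 * \<mu> + a + P * b) + (C\<delta> + C' * P) * q + C1 * k + (C' * P + C1 / l * P) * t + C1 / l * P * P * (b + a) + CL * W"
      by (simp add: algebra_simps add_divide_distrib)
    finally show "(LINT x|lebesgue_on U. f (X x)) \<le> (LINT x|lebesgue_on U. f (Y x))
      + \<delta> * (2 * measure lebesgue U + (LINT x|lebesgue_on U. nrm (X x) powr p) + P * (LINT x|lebesgue_on U. nrm (Y x) powr p))
      + (C\<delta> + (C\<delta> + \<delta> * P) * P) * (LINT x|lebesgue_on U. norm (form_vec (Suc m) (X x) - form_vec (Suc m) \<xi>) powr p)
      + C1 * ((1 + nrm \<xi> powr p) * measure lebesgue (U - K))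
      + ((C\<delta> + \<delta> * P) * P + C1 / l * P) * (LINT x|lebesgue_on U. norm (form_vec (Suc m) (cext m w x) - (form_vec (Suc m) (Y x) - form_vec (Suc m) (X x))) powr p)
      + C1 / l * P * P * ((LINT x|lebesgue_on U. nrm (Y x) powr p) + (LINT x|lebesgue_on U. nrm (X x) powr p))
      + CL * (LINT x|lebesgue_on U. norm (form_vec m (w x)) powr p)"
      unfolding \<mu>_def a_def b_def q_def k_def t_def W_def C'_def vX_def vY_def v\<xi>_def vw_def .
  qed
qed

text \<open>
  Summation of the local estimates. The constants allow a choice of parameters one after the other:
  \<open>\<delta>\<close> makes the terms with \<open>\<delta>\<close> small, as all integrals of \<open>|d\<alpha>\<^sub>s|\<^sup>p\<close> are bounded; this fixes \<open>C\<delta>\<close>,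
  and \<open>\<tau>\<close> makes the errors of the piecewise constant approximation small against it; then \<open>l\<close>
  handles the transition layers. What remains tends to zero as \<open>s \<rightarrow> \<infinity>\<close>.
\<close>
lemma eventually_integral_le:
  fixes \<Omega> :: "'n rvec set"
  assumes \<Omega>: "open \<Omega>" "bounded \<Omega>" and p1: "1 < p" and wk: "weakly_converges_W1p p \<Omega> m \<alpha>s \<alpha>" and \<epsilon>: "\<epsilon> > 0"
  shows "\<forall>\<^sub>F s in sequentially. (LINT x|lebesgue_on \<Omega>. f (ext_deriv \<Omega> m \<alpha> x)) \<le> (LINT x|lebesgue_on \<Omega>. f (ext_deriv \<Omega> m (\<alpha>s s) x)) + \<epsilon>"
proof -
  have \<alpha>s: "\<alpha>s s \<in> W1p p \<Omega> m" for s using wk by (simp add: weakly_converges_W1p_def)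
  have \<alpha>: "\<alpha> \<in> W1p p \<Omega> m" using wk by (simp add: weakly_converges_W1p_def)
  define X where "X = ext_deriv \<Omega> m \<alpha>"
  define Y where "Y s = ext_deriv \<Omega> m (\<alpha>s s)" for s
  have Xalt: "X x \<in> alt_forms (Suc m)" if "x \<in> \<Omega>" for x
    unfolding X_def by (rule ext_deriv_alt[OF W1p_weak_deriv(1)[OF \<Omega>(1) \<alpha>] that])
  have Yalt: "Y s x \<in> alt_forms (Suc m)" if "x \<in> \<Omega>" for s x
    unfolding Y_def by (rule ext_deriv_alt[OF W1p_weak_deriv(1)[OF \<Omega>(1) \<alpha>s] that])
  have Xm: "(\<lambda>x. form_vec (Suc m) (X x)) \<in> borel_measurable (lebesgue_on \<Omega>)" unfolding X_def by (rule ext_deriv_measurable[OF \<Omega>(1) \<alpha>])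
  have Ym: "(\<lambda>x. form_vec (Suc m) (Y s x)) \<in> borel_measurable (lebesgue_on \<Omega>)" for s unfolding Y_def by (rule ext_deriv_measurable[OF \<Omega>(1) \<alpha>s])
  have Xi: "integrable (lebesgue_on \<Omega>) (\<lambda>x. nrm (X x) powr p)" unfolding X_def by (rule ext_deriv_powr_integrable(1)[OF \<Omega>(1) \<alpha> p])
  have Yi: "integrable (lebesgue_on \<Omega>) (\<lambda>x. nrm (Y s x) powr p)" for s unfolding Y_def by (rule ext_deriv_powr_integrable(1)[OF \<Omega>(1) \<alpha>s p])
  have fX: "integrable (lebesgue_on \<Omega>) (\<lambda>x. f (X x))" by (rule integrable_f_powr[OF \<Omega> Xalt Xm Xi])
  have fY: "integrable (lebesgue_on \<Omega>) (\<lambda>x. f (Y s x))" for s by (rule integrable_f_powr[OF \<Omega> Yalt Ym Yi])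
  obtain M0 where M0: "M0 \<ge> 0" "\<And>s j ks. ks \<in> multi_indices m \<Longrightarrow> (LINT x|lebesgue_on \<Omega>. \<bar>weak_deriv \<Omega> m (axis j 1) (\<alpha>s s) x (basis_list ks)\<bar> powr p) \<le> M0"
    using weak_convergence_Lp_bounded[OF \<Omega>(1) p1 wk] by blast
  define CC where "CC = real (CARD('n set) * Suc m) powr p * real (CARD('n) * card (multi_indices m :: 'n list set)) powr p"
  define M where "M = CC * (\<Sum>j\<in>(UNIV::'n set). \<Sum>ks\<in>(multi_indices m :: 'n list set). M0) + (LINT x|lebesgue_on \<Omega>. nrm (X x) powr p) + measure lebesgue \<Omega>"
  have parts: "0 \<le> CC * (\<Sum>j\<in>(UNIV::'n set). \<Sum>ks\<in>(multi_indices m :: 'n list set). M0)" "0 \<le> (LINT x|lebesgue_on \<Omega>. nrm (X x) powr p)" "0 \<le> measure lebesgue \<Omega>"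
    unfolding CC_def using M0(1) by (auto intro!: mult_nonneg_nonneg sum_nonneg integral_nonneg_AE)
  have YM: "(LINT x|lebesgue_on \<Omega>. nrm (Y s x) powr p) \<le> M" for s
  proof -
    have "(LINT x|lebesgue_on \<Omega>. nrm (Y s x) powr p) \<le> CC * (\<Sum>j\<in>UNIV. \<Sum>ks\<in>multi_indices m. (LINT x|lebesgue_on \<Omega>. \<bar>weak_deriv \<Omega> m (axis j 1) (\<alpha>s s) x (basis_list ks)\<bar> powr p))"
      unfolding Y_def CC_def by (rule ext_deriv_powr_integrable(2)[OF \<Omega>(1) \<alpha>s p])
    also have "\<dots> \<le> CC * (\<Sum>j\<in>(UNIV::'n set). \<Sum>ks\<in>(multi_indices m :: 'n list set). M0)"
      unfolding CC_def by (intro mult_left_mono sum_mono M0(2)) auto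
    finally show ?thesis using parts unfolding M_def by linarith
  qed
  have XM: "(LINT x|lebesgue_on \<Omega>. nrm (X x) powr p) \<le> M" and \<mu>M: "measure lebesgue \<Omega> \<le> M" and M: "0 \<le> M"
    using parts unfolding M_def by linarith+
  define P where "P = 2 powr p"
  have P: "P \<ge> 1" unfolding P_def using p by (intro ge_one_powr_ge_zero) auto
  define C1 where "C1 = c1 + c2 * (1 + 3 powr p)"
  have C1: "C1 \<ge> 0" unfolding C1_def using c by simp
  \<comment> \<open>The parameters are fixed in the order \<open>\<delta>\<close>, \<open>\<tau>\<close>, \<open>l\<close>, and finally \<open>s\<close>; each one absorbs a quarter of \<open>\<epsilon>\<close>.\<close>
  define \<delta> where "\<delta> = \<epsilon> / (4 * (3 * M + P * M + 1))"
  have PM: "0 \<le> P * M" using P M by simp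
  have \<delta>: "\<delta> > 0" using \<epsilon> M PM by (simp add: \<delta>_def)
  have \<delta>4: "\<delta> * (3 * M + P * M) \<le> \<epsilon> / 4"
  proof -
    have "\<delta> * (3 * M + P * M) \<le> \<delta> * (3 * M + P * M + 1)" using \<delta> by (intro mult_left_mono) auto
    also have "\<dots> = \<epsilon> / 4" using M PM by (simp add: \<delta>_def field_simps)
    finally show ?thesis .
  qed
  obtain C\<delta> where C\<delta>: "C\<delta> \<ge> 0" and quasi: "\<forall>\<xi>\<in>alt_forms (Suc m). \<forall>\<eta>\<in>alt_forms (Suc m).
      f \<xi> \<le> f \<eta> + \<delta> * (1 + nrm \<xi> powr p) + C\<delta> * norm (form_vec (Suc m) \<xi> - form_vec (Suc m) \<eta>) powr p"
    using quasiconvex_estimate[OF \<delta>] by blast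
  define A1 where "A1 = C\<delta> + (C\<delta> + \<delta> * P) * P"
  define B where "B = (C\<delta> + \<delta> * P) * P"
  have A1: "A1 \<ge> 0" and B: "B \<ge> 0" using C\<delta> \<delta> P by (simp_all add: A1_def B_def)
  define \<tau> where "\<tau> = \<epsilon> / (4 * (c1 + c2 + A1 + C1 + 1))"
  have \<tau>: "\<tau> > 0" using \<epsilon> c A1 C1 by (simp add: \<tau>_def)
  have \<tau>4: "(c1 + c2 + A1 + C1) * \<tau> \<le> \<epsilon> / 4"
  proof -
    have "(c1 + c2 + A1 + C1) * \<tau> \<le> (c1 + c2 + A1 + C1 + 1) * \<tau>" using \<tau> by (intro mult_right_mono) auto
    also have "\<dots> = \<epsilon> / 4"
    proof -
      have cancel: "x * (\<epsilon> / (4 * x)) = \<epsilon> / 4" if "x > 0" for x using that by simp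
      show ?thesis unfolding \<tau>_def by (rule cancel) (use c A1 C1 in linarith)
    qed
    finally show ?thesis .
  qed
  from piecewise_constant_approximation[OF \<Omega> p Xm Xi \<tau>]
  obtain n :: nat and z U K r where r: "r > 0"
    and pc: "\<forall>i<n. z i \<in> \<Omega> \<and> compact (K i) \<and> K i \<subseteq> U i \<and> open (U i) \<and> U i \<subseteq> \<Omega> \<and> (\<forall>x\<in>U i. cball x r \<subseteq> \<Omega>)"
    and disj': "\<forall>i<n. \<forall>j<n. i \<noteq> j \<longrightarrow> U i \<inter> U j = {}"
    and Q1: "(\<Sum>i<n. (LINT x|lebesgue_on (U i). norm (form_vec (Suc m) (X x) - form_vec (Suc m) (X (z i))) powr p)) \<le> \<tau>"
    and Q2: "(\<Sum>i<n. (1 + norm (form_vec (Suc m) (X (z i))) powr p) * measure lebesgue (U i - K i)) \<le> \<tau>"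
    and Q3: "(LINT x|lebesgue_on \<Omega>. indicator (\<Omega> - (\<Union>i<n. U i)) x * (1 + norm (form_vec (Suc m) (X x)) powr p)) \<le> \<tau>"
    by (elim exE conjE) (rule that)
  have z: "z i \<in> \<Omega>" and K: "compact (K i)" "K i \<subseteq> U i" and U: "open (U i)" "U i \<subseteq> \<Omega>" if "i < n" for i
    using pc that by simp_all
  have disj: "U i \<inter> U j = {}" if "i < n" "j < n" "i \<noteq> j" for i j using disj' that by blast
  have Ub: "bounded (U i)" if "i < n" for i using bounded_subset[OF \<Omega>(2) U(2)[OF that]] .
  define V where "V = (\<Union>i<n. U i)"
  have V: "open V" "V \<subseteq> \<Omega>" unfolding V_def using U by blast+
  have Vb: "bounded V" by (rule bounded_subset[OF \<Omega>(2) V(2)])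
  have UV: "U i \<subseteq> V" if "i < n" for i using that by (auto simp: V_def)
  have Vr: "cball x r \<subseteq> \<Omega>" if "x \<in> V" for x using pc that unfolding V_def by blast
  obtain w where w: "\<And>s. smooth_form m (w s)"
    and W0: "(\<lambda>s. LINT x|lebesgue_on V. norm (form_vec m (w s x)) powr p) \<longlonglongrightarrow> 0"
    and T0: "(\<lambda>s. LINT x|lebesgue_on V. norm (form_vec (Suc m) (cext m (w s) x) - (form_vec (Suc m) (Y s x) - form_vec (Suc m) (X x))) powr p) \<longlonglongrightarrow> 0"
    using smooth_approximation[OF \<Omega> p1 V(1) Vb r Vr wk] unfolding X_def Y_def by blast
  define W where "W s = (LINT x|lebesgue_on V. norm (form_vec m (w s x)) powr p)" for s
  define tf where "tf s x = norm (form_vec (Suc m) (cext m (w s) x) - (form_vec (Suc m) (Y s x) - form_vec (Suc m) (X x))) powr p" for s x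
  define T where "T s = (LINT x|lebesgue_on V. tf s x)" for s
  define l where "l = nat \<lceil>4 * (C1 * (P + P * P * (2 * M))) / \<epsilon>\<rceil> + 1"
  have l: "l > 0" by (simp add: l_def)
  have l4: "C1 / l * (P + P * P * (2 * M)) \<le> \<epsilon> / 4"
  proof -
    have "4 * (C1 * (P + P * P * (2 * M))) / \<epsilon> \<le> real l" unfolding l_def by linarith
    then show ?thesis using \<epsilon> l by (simp add: field_simps)
  qed
  have C1l: "0 \<le> C1 / l" using C1 by simp
  have ti: "integrable (lebesgue_on V) (tf s)" for s
  proof -
    note mV = lebesgue_on_subset_integral(1)[OF \<Omega>(1) V]
    have [measurable]: "(\<lambda>x. form_vec (Suc m) (cext m (w s) x)) \<in> borel_measurable (lebesgue_on V)"
      "(\<lambda>x. form_vec (Suc m) (X x)) \<in> borel_measurable (lebesgue_on V)" "(\<lambda>x. form_vec (Suc m) (Y s x)) \<in> borel_measurable (lebesgue_on V)"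
      using borel_measurable_lebesgue_on[OF borel_measurable_continuous_onI[OF continuous_cext(1)[OF w]]]
        measurable_restrict_mono[OF Xm V(2)] measurable_restrict_mono[OF Ym V(2)] by auto
    have wi: "integrable (lebesgue_on V) (\<lambda>x. nrm (cext m (w s) x) powr p)" using p
      by (intro integrable_lebesgue_on_continuous[OF V(1) Vb] continuous_on_powr' continuous_intros continuous_cext(1)[OF w]) auto
    show ?thesis unfolding tf_def
    proof (rule Bochner_Integration.integrable_bound[of _ "\<lambda>x. P * (nrm (cext m (w s) x) powr p + P * (nrm (Y s x) powr p + nrm (X x) powr p))"])
      show "integrable (lebesgue_on V) (\<lambda>x. P * (nrm (cext m (w s) x) powr p + P * (nrm (Y s x) powr p + nrm (X x) powr p)))"
        by (intro integrable_mult_right Bochner_Integration.integrable_add wi mV Xi Yi)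
      have "norm (form_vec (Suc m) (cext m (w s) x) - (form_vec (Suc m) (Y s x) - form_vec (Suc m) (X x))) powr p \<le> P * (nrm (cext m (w s) x) powr p + P * (nrm (Y s x) powr p + nrm (X x) powr p))" for x
      proof -
        have "norm (form_vec (Suc m) (cext m (w s) x) - (form_vec (Suc m) (Y s x) - form_vec (Suc m) (X x))) powr p \<le> P * (nrm (cext m (w s) x) powr p + norm (form_vec (Suc m) (Y s x) - form_vec (Suc m) (X x)) powr p)"
          unfolding P_def using p by (intro norm_diff_powr_le) simp
        also have "\<dots> \<le> P * (nrm (cext m (w s) x) powr p + P * (nrm (Y s x) powr p + nrm (X x) powr p))"
          using P p norm_diff_powr_le[of p "form_vec (Suc m) (Y s x)" "form_vec (Suc m) (X x)"] by (intro mult_left_mono add_left_mono) (auto simp: P_def)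
        finally show ?thesis .
      qed
      then show "AE x in lebesgue_on V. norm (norm (form_vec (Suc m) (cext m (w s) x) - (form_vec (Suc m) (Y s x) - form_vec (Suc m) (X x))) powr p) \<le> norm (P * (nrm (cext m (w s) x) powr p + P * (nrm (Y s x) powr p + nrm (X x) powr p)))"
        using P by (intro AE_I2) (simp add: abs_mult)
    qed measurable
  qed
  define a where "a i = (LINT x|lebesgue_on (U i). nrm (X x) powr p)" for i
  define b where "b i s = (LINT x|lebesgue_on (U i). nrm (Y s x) powr p)" for i s
  define q where "q i = (LINT x|lebesgue_on (U i). norm (form_vec (Suc m) (X x) - form_vec (Suc m) (X (z i))) powr p)" for i
  define k where "k i = (1 + nrm (X (z i)) powr p) * measure lebesgue (U i - K i)" for i
  define t where "t i s = (LINT x|lebesgue_on (U i). tf s x)" for i s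
  have "\<exists>CL\<ge>0. \<forall>s. (LINT x|lebesgue_on (U i). f (X x)) \<le> (LINT x|lebesgue_on (U i). f (Y s x)) + \<delta> * (2 * measure lebesgue (U i) + a i + P * b i s)
      + A1 * q i + C1 * k i + (B + C1 / l * P) * t i s + C1 / l * P * P * (b i s + a i) + CL * W s" if i: "i < n" for i
  proof -
    note loc = local_estimate[OF U(1)[OF i] Ub[OF i] K[OF i] l \<delta> C\<delta> quasi, folded C1_def P_def, folded A1_def, folded B_def]
    obtain CL where CL: "CL \<ge> 0" and est: "\<forall>\<xi>\<in>alt_forms (Suc m). \<forall>w X Y. smooth_form m w \<longrightarrow>
      (\<forall>x\<in>U i. X x \<in> alt_forms (Suc m)) \<longrightarrow> (\<forall>x\<in>U i. Y x \<in> alt_forms (Suc m)) \<longrightarrow>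
      (\<lambda>x. form_vec (Suc m) (X x)) \<in> borel_measurable (lebesgue_on (U i)) \<longrightarrow>
      (\<lambda>x. form_vec (Suc m) (Y x)) \<in> borel_measurable (lebesgue_on (U i)) \<longrightarrow>
      integrable (lebesgue_on (U i)) (\<lambda>x. nrm (X x) powr p) \<longrightarrow> integrable (lebesgue_on (U i)) (\<lambda>x. nrm (Y x) powr p) \<longrightarrow>
      (LINT x|lebesgue_on (U i). f (X x)) \<le> (LINT x|lebesgue_on (U i). f (Y x))
        + \<delta> * (2 * measure lebesgue (U i) + (LINT x|lebesgue_on (U i). nrm (X x) powr p) + P * (LINT x|lebesgue_on (U i). nrm (Y x) powr p))
        + A1 * (LINT x|lebesgue_on (U i). norm (form_vec (Suc m) (X x) - form_vec (Suc m) \<xi>) powr p)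
        + C1 * ((1 + nrm \<xi> powr p) * measure lebesgue (U i - K i))
        + (B + C1 / l * P) * (LINT x|lebesgue_on (U i). norm (form_vec (Suc m) (cext m w x) - (form_vec (Suc m) (Y x) - form_vec (Suc m) (X x))) powr p)
        + C1 / l * P * P * ((LINT x|lebesgue_on (U i). nrm (Y x) powr p) + (LINT x|lebesgue_on (U i). nrm (X x) powr p))
        + CL * (LINT x|lebesgue_on (U i). norm (form_vec m (w x)) powr p)"
      using loc by (elim exE conjE) (rule that)
    have "(LINT x|lebesgue_on (U i). f (X x)) \<le> (LINT x|lebesgue_on (U i). f (Y s x)) + \<delta> * (2 * measure lebesgue (U i) + a i + P * b i s)
      + A1 * q i + C1 * k i + (B + C1 / l * P) * t i s + C1 / l * P * P * (b i s + a i) + CL * W s" for s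
    proof -
      have "(LINT x|lebesgue_on (U i). norm (form_vec m (w s x)) powr p) \<le> W s"
        unfolding W_def
      proof (rule integral_subset_le[OF V(1) U(1)[OF i] UV[OF i]])
        show "integrable (lebesgue_on V) (\<lambda>x. norm (form_vec m (w s x)) powr p)" using p
          by (intro integrable_lebesgue_on_continuous[OF V(1) Vb] continuous_on_powr' continuous_intros continuous_cext(2)[OF w]) auto
      qed simp
      then have "CL * (LINT x|lebesgue_on (U i). norm (form_vec m (w s x)) powr p) \<le> CL * W s" using CL by (rule mult_left_mono)
      moreover have "\<forall>x\<in>U i. X x \<in> alt_forms (Suc m)" "\<forall>x\<in>U i. Y s x \<in> alt_forms (Suc m)"
        using Xalt Yalt U(2)[OF i] by blast+
      note est[rule_format, OF Xalt[OF z[OF i]] w[of s] this[rule_format] measurable_restrict_mono[OF Xm U(2)[OF i]] measurable_restrict_mono[OF Ym U(2)[OF i]]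
          lebesgue_on_subset_integral(1)[OF \<Omega>(1) U[OF i] Xi] lebesgue_on_subset_integral(1)[OF \<Omega>(1) U[OF i] Yi]]
      ultimately show ?thesis
        unfolding a_def b_def q_def k_def t_def tf_def by linarith
    qed
    with CL show ?thesis by (intro exI[of _ CL] conjI allI)
  qed
  then obtain CL where CL: "\<And>i. i < n \<Longrightarrow> CL i \<ge> 0" and est: "\<And>i s. i < n \<Longrightarrow> (LINT x|lebesgue_on (U i). f (X x)) \<le> (LINT x|lebesgue_on (U i). f (Y s x)) + \<delta> * (2 * measure lebesgue (U i) + a i + P * b i s)
      + A1 * q i + C1 * k i + (B + C1 / l * P) * t i s + C1 / l * P * P * (b i s + a i) + CL i * W s" by metis
  define CW where "CW = (\<Sum>i<n. CL i)"
  define S where "S g = (\<Sum>i<n. (LINT x|lebesgue_on (U i). g x))" for g :: "'n rvec \<Rightarrow> real"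
  have S: "S g = (LINT x|lebesgue_on \<Omega>. indicator V x * g x)" if "integrable (lebesgue_on \<Omega>) g" for g
    unfolding S_def V_def by (rule sum_disjoint_integral[OF \<Omega>(1) U disj that])
  have Sle: "S g \<le> (LINT x|lebesgue_on \<Omega>. g x)" if "integrable (lebesgue_on \<Omega>) g" "\<And>x. 0 \<le> g x" for g
    unfolding S[OF that(1)] using that by (intro integral_mono lebesgue_on_subset_integral(2)[OF \<Omega>(1) V]) (auto simp: indicator_def)
  have Sa: "(\<Sum>i<n. a i) \<le> M" unfolding a_def using order_trans[OF Sle[OF Xi] XM] by (simp add: S_def)
  have Sb: "(\<Sum>i<n. b i s) \<le> M" for s unfolding b_def using order_trans[OF Sle[OF Yi] YM] by (simp add: S_def)
  have S\<mu>: "(\<Sum>i<n. measure lebesgue (U i)) \<le> M"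
  proof -
    have "(\<Sum>i<n. measure lebesgue (U i)) = S (\<lambda>x. 1)"
      unfolding S_def using integral_lebesgue_on_const(2)[OF U(1) Ub, of _ 1] by (intro sum.cong) auto
    also have "\<dots> \<le> (LINT x|lebesgue_on \<Omega>. 1)" by (rule Sle[OF integral_lebesgue_on_const(1)[OF \<Omega>]]) simp
    also have "\<dots> \<le> M" using \<mu>M integral_lebesgue_on_const(2)[OF \<Omega>, of 1] by simp
    finally show ?thesis .
  qed
  have St: "(\<Sum>i<n. t i s) = T s" for s
  proof -
    have "(\<Sum>i<n. t i s) = (LINT x|lebesgue_on V. indicator (\<Union>i<n. U i) x * tf s x)"
      unfolding t_def by (rule sum_disjoint_integral[OF V(1) U(1) UV disj ti])
    also have "\<dots> = T s" unfolding T_def V_def[symmetric]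
      by (rule Bochner_Integration.integral_cong) (auto simp: space_restrict_space)
    finally show ?thesis .
  qed
  have rest: "integrable (lebesgue_on \<Omega>) (\<lambda>x. indicator (\<Omega> - V) x * g x)" if "integrable (lebesgue_on \<Omega>) g" for g :: "'n rvec \<Rightarrow> real"
    using integrable_mult_indicator[OF _ that, of "\<Omega> - V"] \<Omega>(1) V(1) by (simp add: sets_restrict_space_iff sets.Diff)
  have split: "(LINT x|lebesgue_on \<Omega>. g x) = S g + (LINT x|lebesgue_on \<Omega>. indicator (\<Omega> - V) x * g x)" if "integrable (lebesgue_on \<Omega>) g" for g
  proof -
    have "(LINT x|lebesgue_on \<Omega>. g x) = (LINT x|lebesgue_on \<Omega>. indicator V x * g x + indicator (\<Omega> - V) x * g x)"
      by (rule Bochner_Integration.integral_cong) (auto simp: space_restrict_space indicator_def)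
    then show ?thesis using lebesgue_on_subset_integral(2)[OF \<Omega>(1) V that] rest[OF that] S[OF that] by simp
  qed
  have g1: "integrable (lebesgue_on \<Omega>) (\<lambda>x. 1 + nrm (X x) powr p)"
    by (intro Bochner_Integration.integrable_add integral_lebesgue_on_const(1)[OF \<Omega>] Xi)
  note Q3' = Q3[folded V_def]
  have upX: "(LINT x|lebesgue_on \<Omega>. f (X x)) \<le> S (\<lambda>x. f (X x)) + c2 * \<tau>"
  proof -
    have "(LINT x|lebesgue_on \<Omega>. indicator (\<Omega> - V) x * f (X x)) \<le> (LINT x|lebesgue_on \<Omega>. c2 * (indicator (\<Omega> - V) x * (1 + nrm (X x) powr p)))"
    proof (rule integral_mono[OF rest[OF fX] integrable_mult_right[OF rest[OF g1]]])
      fix x assume "x \<in> space (lebesgue_on \<Omega>)"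
      then have "x \<in> \<Omega>" by (simp add: space_restrict_space)
      then show "indicator (\<Omega> - V) x * f (X x) \<le> c2 * (indicator (\<Omega> - V) x * (1 + nrm (X x) powr p))"
        using upper[OF Xalt] by (auto simp: indicator_def add.commute)
    qed
    also have "\<dots> \<le> c2 * \<tau>" using Q3' c by (simp add: mult_left_mono)
    finally show ?thesis using split[OF fX] by linarith
  qed
  have loY: "S (\<lambda>x. f (Y s x)) \<le> (LINT x|lebesgue_on \<Omega>. f (Y s x)) + c1 * \<tau>" for s
  proof -
    have "(LINT x|lebesgue_on \<Omega>. - c1 * (indicator (\<Omega> - V) x * (1 + nrm (X x) powr p))) \<le> (LINT x|lebesgue_on \<Omega>. indicator (\<Omega> - V) x * f (Y s x))"
    proof (rule integral_mono[OF integrable_mult_right[OF rest[OF g1]] rest[OF fY]])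
      fix x assume "x \<in> space (lebesgue_on \<Omega>)"
      then have x: "x \<in> \<Omega>" by (simp add: space_restrict_space)
      have "- c1 * (1 + nrm (X x) powr p) \<le> - c1" using c by (simp add: mult_le_cancel_left1 algebra_simps)
      also have "\<dots> \<le> f (Y s x)" by (rule lower[OF Yalt[OF x]])
      finally show "- c1 * (indicator (\<Omega> - V) x * (1 + nrm (X x) powr p)) \<le> indicator (\<Omega> - V) x * f (Y s x)"
        by (auto simp: indicator_def)
    qed
    moreover have "c1 * (LINT x|lebesgue_on \<Omega>. indicator (\<Omega> - V) x * (1 + nrm (X x) powr p)) \<le> c1 * \<tau>" using Q3' c by (intro mult_left_mono)
    ultimately show ?thesis using split[OF fY[of s]] by simp
  qed
  have main: "S (\<lambda>x. f (X x)) \<le> S (\<lambda>x. f (Y s x)) + \<delta> * (3 * M + P * M) + A1 * \<tau> + C1 * \<tau> + (B + C1 / l * P) * T s + C1 / l * P * P * (2 * M) + CW * W s" for s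
  proof -
    have "S (\<lambda>x. f (X x)) \<le> (\<Sum>i<n. (LINT x|lebesgue_on (U i). f (Y s x)) + \<delta> * (2 * measure lebesgue (U i) + a i + P * b i s)
      + A1 * q i + C1 * k i + (B + C1 / l * P) * t i s + C1 / l * P * P * (b i s + a i) + CL i * W s)"
      unfolding S_def by (intro sum_mono est) auto
    also have "\<dots> = S (\<lambda>x. f (Y s x)) + \<delta> * (2 * (\<Sum>i<n. measure lebesgue (U i)) + (\<Sum>i<n. a i) + P * (\<Sum>i<n. b i s))
      + A1 * (\<Sum>i<n. q i) + C1 * (\<Sum>i<n. k i) + (B + C1 / l * P) * (\<Sum>i<n. t i s) + C1 / l * P * P * ((\<Sum>i<n. b i s) + (\<Sum>i<n. a i)) + CW * W s"
      unfolding S_def CW_def by (simp only: sum.distrib flip: sum_distrib_left sum_distrib_right)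
    also have "\<dots> \<le> S (\<lambda>x. f (Y s x)) + \<delta> * (2 * M + M + P * M) + A1 * \<tau> + C1 * \<tau> + (B + C1 / l * P) * T s + C1 / l * P * P * (M + M) + CW * W s"
      unfolding St using Sa Sb[of s] S\<mu> Q1 Q2 \<delta> P A1 C1 C1l
      by (intro add_mono mult_left_mono order_refl mult_nonneg_nonneg) (auto simp: q_def k_def)
    finally show ?thesis by (simp add: algebra_simps)
  qed
  have "(\<lambda>s. B * T s + CW * W s) \<longlonglongrightarrow> B * 0 + CW * 0"
    using T0 W0 unfolding T_def[symmetric] W_def[symmetric] tf_def[symmetric] by (intro tendsto_intros)
  then have "\<forall>\<^sub>F s in sequentially. B * T s + CW * W s < \<epsilon> / 4" by (rule order_tendstoD(2)) (use \<epsilon> in simp)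
  moreover have "\<forall>\<^sub>F s in sequentially. T s < 1"
    by (rule order_tendstoD(2)[of T 0]) (use T0 in \<open>simp_all add: T_def[abs_def] tf_def[abs_def]\<close>)
  ultimately show ?thesis
  proof eventually_elim
    case (elim s)
    have "C1 / l * P * T s \<le> C1 / l * P * 1" using elim(2) C1 P by (intro mult_left_mono) auto
    moreover have "C1 / l * (P + P * P * (2 * M)) = C1 / l * P * 1 + C1 / l * P * P * (2 * M)" by (simp add: algebra_simps)
    moreover have "(B + C1 / l * P) * T s = B * T s + C1 / l * P * T s" by (simp add: algebra_simps)
    moreover have "(c1 + c2 + A1 + C1) * \<tau> = c1 * \<tau> + c2 * \<tau> + A1 * \<tau> + C1 * \<tau>" by (simp add: algebra_simps)
    ultimately have "(LINT x|lebesgue_on \<Omega>. f (X x)) \<le> (LINT x|lebesgue_on \<Omega>. f (Y s x)) + \<epsilon>"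
      using main[of s] upX loY[of s] \<delta>4 \<tau>4 l4 elim(1) by linarith
    then show ?case by (simp add: X_def Y_def)
  qed
qed

end

theorem theorem3p5:
  fixes k :: nat and p c1 c2 :: real
    and \<Omega> :: "'n::{finite,linorder} rvec set"
    and f :: "'n rvec form \<Rightarrow> real"
    and \<alpha>s :: "nat \<Rightarrow> 'n form_field"
    and \<alpha> :: "'n form_field"
  assumes "1 \<le> k" and "k \<le> CARD('n)"
    and "1 < p"
    and "bounded \<Omega>" and "smooth_open_set \<Omega>"
    and "ext_quasiconvex k f"
    and "c1 > 0" and "c2 > 0"
    and "\<And>\<xi>. \<xi> \<in> alt_forms k \<Longrightarrow> c1 * (form_norm k \<xi> powr p - 1) \<le> f \<xi>"
    and "\<And>\<xi>. \<xi> \<in> alt_forms k \<Longrightarrow> f \<xi> \<le> c2 * (form_norm k \<xi> powr p + 1)"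
    and "weakly_converges_W1p p \<Omega> (k - 1) \<alpha>s \<alpha>"
  shows "liminf (\<lambda>s. ereal (LINT x|lebesgue_on \<Omega>. f (ext_deriv \<Omega> (k - 1) (\<alpha>s s) x)))
           \<ge> ereal (LINT x|lebesgue_on \<Omega>. f (ext_deriv \<Omega> (k - 1) \<alpha> x))"
proof -
  obtain m where k: "k = Suc m" using assms(1) by (cases k) auto
  interpret quasiconvex_growth f m p c1 c2
  proof
    show "- c1 \<le> f \<xi>" if "\<xi> \<in> alt_forms (Suc m)" for \<xi>
    proof -
      have "c1 * (0 - 1) \<le> c1 * (form_norm k \<xi> powr p - 1)" using assms(7) by (intro mult_left_mono) auto
      then show ?thesis using assms(9)[of \<xi>] that k by simp
    qed
    show "f \<xi> \<le> c2 * (norm (form_vec (Suc m) \<xi>) powr p + 1)" if "\<xi> \<in> alt_forms (Suc m)" for \<xi>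
      using assms(10)[of \<xi>] that k by (simp add: form_norm_eq)
  qed (use assms k in auto)
  have \<Omega>: "open \<Omega>" using assms(5) by (simp add: smooth_open_set_def)
  define I where "I = (LINT x|lebesgue_on \<Omega>. f (ext_deriv \<Omega> m \<alpha> x))"
  define J where "J s = (LINT x|lebesgue_on \<Omega>. f (ext_deriv \<Omega> m (\<alpha>s s) x))" for s
  have ev: "\<forall>\<^sub>F s in sequentially. I \<le> J s + \<epsilon>" if "\<epsilon> > 0" for \<epsilon>
    unfolding I_def J_def by (rule eventually_integral_le[OF \<Omega> assms(4) assms(3) _ that]) (use assms(11) k in simp)
  have "ereal I \<le> liminf (\<lambda>s. ereal (J s))"
    unfolding le_Liminf_iff
  proof (intro allI impI)
    fix y assume y: "y < ereal I"
    show "\<forall>\<^sub>F s in sequentially. y < ereal (J s)"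
    proof (cases y)
      case (real r)
      then have "(I - r) / 2 > 0" using y by simp
      from ev[OF this] show ?thesis
        by eventually_elim (use real y in \<open>auto simp: field_simps\<close>)
    qed (use y in auto)
  qed
  then show ?thesis by (simp add: I_def J_def k)
qed

end
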